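(* Let $A$ be a differential graded algebra over a commutative ring such that the cohomology ring $H^*A$ is graded-commutative and coherent. The following conditions are equivalent for a finitely presented graded $H^*A$-module $X$: (1) $X$ is realisable. (2) $X_{\mathfrak p}$ is realisable for all graded prime ideals $\mathfrak p$ of $H^*A$. (3) $X_{\mathfrak m}$ is realisable for all graded maximal ideals $\mathfrak m$ of $H^*A$.
   Context: Graded means $\mathbb Z$-graded; modules are right modules. A dg algebra $A$ over a commutative ring $k$ is a graded $k$-algebra with a $k$-linear differential of degree $+1$, $d^2=0$, satisfying the Leibniz rule; $\mathcal D(A)$ is the derived category of (right) dg $A$-modules and $H^*$ is cohomology. A graded $H^*A$-module $X$ is realisable if there is $M\in\mathcal D(A)$ such that $X$ is isomorphic to a direct summand of the graded $H^*A$-module $H^*M$. A graded ring $R$ is graded-commutative if $rs=(-1)^{|r||s|}sr$ for homogeneous $r,s$. It is coherent if finitely generated graded submodules of finitely presented graded $R$-modules are finitely presented. A prime ideal of a graded-commutative ring $R$ is a proper ideal $\mathfrak p$ such that $ab\in\mathfrak p$ implies $a\in\mathfrak p$ or $b\in\mathfrak p$; a graded ideal is one generated by homogeneous elements; a graded maximal ideal is a maximal element among proper graded ideals (it is prime). For a graded prime $\mathfrak p$ let $S$ be the set of homogeneous elements of $R\setminus\mathfrak p$ and $S_{ev}\subseteq S$ the elements of even degree. Then $R_{\mathfrak p}=S^{-1}R=R[S_{ev}^{-1}]$ and $X_{\mathfrak p}=X\otimes_R R_{\mathfrak p}$, whose elements are fractions $\frac{x}{s}$ with $x\in X$, $s\in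 S_{ev}$, with the usual equivalence relation and degree $|x|-|s|$. In (2) and (3), $X_{\mathfrak p}$ and $X_{\mathfrak m}$ are regarded as graded $H^*A$-modules. *)

theory Defs
  imports "HOL-Algebra.QuotRing" "HOL-Algebra.Module" "HOL-Library.Equipollence"
begin

section \<open>Graded rings and graded modules\<close>

text \<open>
  All objects are internally graded: \<open>gr G i\<close> is the set of homogeneous elements of degree \<open>i\<close>
  of the underlying (total) abelian group.

  The field \<open>smult\<close> of the library record carries the scalars of an algebra over a commutative
  ring, and also the action of a graded ring on a \<^emph>\<open>right\<close> module. In the latter
  case \<open>r \<odot> x\<close> is written \<open>x \<cdot> r\<close>, and it satisfies the axioms of a right module. The fields
  \<open>mult\<close> and \<open>one\<close> are irrelevant for modules.
\<close>

record ('s, 'a) graded = "('s, 'a) module" +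
  gr :: "int \<Rightarrow> 'a set"

record ('s, 'a) dg = "('s, 'a) graded" +
  diff :: "'a \<Rightarrow> 'a"

abbreviation (input) ract :: "('r, 'm, 'z) module_scheme \<Rightarrow> 'm \<Rightarrow> 'r \<Rightarrow> 'm"  (infixl "\<cdot>\<index>" 70)
  where "x \<cdot>\<^bsub>M\<^esub> r \<equiv> r \<odot>\<^bsub>M\<^esub> x"

locale graded_group = abelian_group G for G :: "('s, 'a, 'z) graded_scheme" (structure) +
  assumes gr_subgroup: "additive_subgroup (gr G i) G"
    and gr_direct_sum: "x \<in> carrier G \<Longrightarrow>
      \<exists>!f. (\<forall>i. f i \<in> gr G i) \<and> finite {i. f i \<noteq> \<zero>} \<and> x = (\<Oplus>i\<in>{i. f i \<noteq> \<zero>}. f i)"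

locale graded_ring = ring R + graded_group R for R :: "('s, 'a, 'z) graded_scheme" (structure) +
  assumes gr_one: "\<one> \<in> gr R 0"
    and gr_mult: "\<lbrakk>a \<in> gr R i; b \<in> gr R j\<rbrakk> \<Longrightarrow> a \<otimes> b \<in> gr R (i + j)"

locale graded_module = R?: graded_ring R + M?: graded_group M
  for R :: "('k, 'r, 'y) graded_scheme" (structure)
    and M :: "('r, 'm, 'z) graded_scheme" (structure) +
  assumes ract_closed: "\<lbrakk>x \<in> carrier M; r \<in> carrier R\<rbrakk> \<Longrightarrow> x \<cdot>\<^bsub>M\<^esub> r \<in> carrier M"
    and ract_add_left: "\<lbrakk>x \<in> carrier M; y \<in> carrier M; r \<in> carrier R\<rbrakk> \<Longrightarrow>
      (x \<oplus>\<^bsub>M\<^esub> y) \<cdot>\<^bsub>M\<^esub> r = (x \<cdot>\<^bsub>M\<^esub> r) \<oplus>\<^bsub>M\<^esub> (y \<cdot>\<^bsub>M\<^esub> r)"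
    and ract_add_right: "\<lbrakk>x \<in> carrier M; r \<in> carrier R; s \<in> carrier R\<rbrakk> \<Longrightarrow>
      x \<cdot>\<^bsub>M\<^esub> (r \<oplus>\<^bsub>R\<^esub> s) = (x \<cdot>\<^bsub>M\<^esub> r) \<oplus>\<^bsub>M\<^esub> (x \<cdot>\<^bsub>M\<^esub> s)"
    and ract_mult: "\<lbrakk>x \<in> carrier M; r \<in> carrier R; s \<in> carrier R\<rbrakk> \<Longrightarrow>
      x \<cdot>\<^bsub>M\<^esub> (r \<otimes>\<^bsub>R\<^esub> s) = (x \<cdot>\<^bsub>M\<^esub> r) \<cdot>\<^bsub>M\<^esub> s"
    and ract_one: "x \<in> carrier M \<Longrightarrow> x \<cdot>\<^bsub>M\<^esub> \<one>\<^bsub>R\<^esub> = x"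
    and gr_ract: "\<lbrakk>x \<in> gr M i; r \<in> gr R j\<rbrakk> \<Longrightarrow> x \<cdot>\<^bsub>M\<^esub> r \<in> gr M (i + j)"

definition homogeneous :: "('s, 'a, 'z) graded_scheme \<Rightarrow> 'a set"
  where "homogeneous G = (\<Union>i. gr G i)"

definition koszul :: "('a, 'z) ring_scheme \<Rightarrow> int \<Rightarrow> 'a \<Rightarrow> 'a"
  \<comment> \<open>\<open>(-1)\<^sup>n x\<close>\<close>
  where "koszul G n x = (if even n then x else \<ominus>\<^bsub>G\<^esub> x)"

definition graded_commutative :: "('s, 'a, 'z) graded_scheme \<Rightarrow> bool"
  where "graded_commutative R \<longleftrightarrow>
    (\<forall>i j. \<forall>r\<in>gr R i. \<forall>s\<in>gr R j. r \<otimes>\<^bsub>R\<^esub> s = koszul R (i * j) (s \<otimes>\<^bsub>R\<^esub> r))"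

definition graded_hom ::
    "('k, 'r, 'y) graded_scheme \<Rightarrow> ('r, 'm, 'z) graded_scheme \<Rightarrow> ('r, 'n, 'w) graded_scheme
      \<Rightarrow> ('m \<Rightarrow> 'n) set"
  where "graded_hom R M N = {\<phi> \<in> carrier M \<rightarrow> carrier N.
    (\<forall>x\<in>carrier M. \<forall>y\<in>carrier M. \<phi> (x \<oplus>\<^bsub>M\<^esub> y) = \<phi> x \<oplus>\<^bsub>N\<^esub> \<phi> y) \<and>
    (\<forall>x\<in>carrier M. \<forall>r\<in>carrier R. \<phi> (x \<cdot>\<^bsub>M\<^esub> r) = \<phi> x \<cdot>\<^bsub>N\<^esub> r) \<and>
    (\<forall>i. \<forall>x\<in>gr M i. \<phi> x \<in> gr N i)}"

definition graded_iso ::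
    "('k, 'r, 'y) graded_scheme \<Rightarrow> ('r, 'm, 'z) graded_scheme \<Rightarrow> ('r, 'n, 'w) graded_scheme \<Rightarrow> bool"
  where "graded_iso R M N \<longleftrightarrow> (\<exists>\<phi>\<in>graded_hom R M N. bij_betw \<phi> (carrier M) (carrier N))"

definition restr :: "('r, 'm) graded \<Rightarrow> 'm set \<Rightarrow> ('r, 'm) graded"
  where "restr M U = M\<lparr>carrier := U, gr := (\<lambda>i. gr M i \<inter> U)\<rparr>"

definition graded_submodule :: "('k, 'r, 'y) graded_scheme \<Rightarrow> ('r, 'm) graded \<Rightarrow> 'm set \<Rightarrow> bool"
  where "graded_submodule R M U \<longleftrightarrow> U \<subseteq> carrier M \<and> graded_module R (restr M U)"

definition direct_summand :: "('k, 'r, 'y) graded_scheme \<Rightarrow> ('r, 'm) graded \<Rightarrow> 'm set \<Rightarrow> bool"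
  where "direct_summand R M U \<longleftrightarrow> graded_submodule R M U \<and>
    (\<exists>V. graded_submodule R M V \<and> U \<inter> V = {\<zero>\<^bsub>M\<^esub>} \<and> U <+>\<^bsub>M\<^esub> V = carrier M)"


section \<open>Finiteness conditions\<close>

definition submodule_gen ::
    "('k, 'r, 'y) graded_scheme \<Rightarrow> ('r, 'm, 'z) graded_scheme \<Rightarrow> 'm set \<Rightarrow> 'm set"
  where "submodule_gen R M S = \<Inter>{N. additive_subgroup N M \<and>
    (\<forall>x\<in>N. \<forall>r\<in>carrier R. x \<cdot>\<^bsub>M\<^esub> r \<in> N) \<and> S \<subseteq> N}"

definition fin_gen :: "('k, 'r, 'y) graded_scheme \<Rightarrow> ('r, 'm, 'z) graded_scheme \<Rightarrow> 'm set \<Rightarrow> bool"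
  \<comment> \<open>the submodule \<open>N\<close> of \<open>M\<close> is finitely generated; for graded \<open>N\<close> it makes no difference
      whether the generators are required to be homogeneous\<close>
  where "fin_gen R M N \<longleftrightarrow> (\<exists>S. finite S \<and> S \<subseteq> N \<and> submodule_gen R M S = N)"

definition free_graded :: "('k, 'r, 'y) graded_scheme \<Rightarrow> int list \<Rightarrow> ('r, nat \<Rightarrow> 'r) graded"
  \<comment> \<open>the free graded right module whose \<open>k\<close>-th basis element has degree \<open>ds ! k\<close>\<close>
  where "free_graded R ds =
    \<lparr>carrier = {..<length ds} \<rightarrow>\<^sub>E carrier R,
     mult = undefined, one = undefined,
     zero = (\<lambda>k\<in>{..<length ds}. \<zero>\<^bsub>R\<^esub>),
     add = (\<lambda>f g. \<lambda>k\<in>{..<length ds}. f k \<oplus>\<^bsub>R\<^esub> g k),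
     smult = (\<lambda>r f. \<lambda>k\<in>{..<length ds}. f k \<otimes>\<^bsub>R\<^esub> r),
     gr = (\<lambda>j. \<Pi>\<^sub>E k\<in>{..<length ds}. gr R (j - ds ! k))\<rparr>"

definition finitely_presented ::
    "('k, 'r, 'y) graded_scheme \<Rightarrow> ('r, 'm, 'z) graded_scheme \<Rightarrow> bool"
  where "finitely_presented R X \<longleftrightarrow> graded_module R X \<and>
    (\<exists>ds. \<exists>\<phi>\<in>graded_hom R (free_graded R ds) X.
      \<phi> ` carrier (free_graded R ds) = carrier X \<and>
      fin_gen R (free_graded R ds) {f \<in> carrier (free_graded R ds). \<phi> f = \<zero>\<^bsub>X\<^esub>})"

text \<open>
  Every finitely presented graded \<open>R\<close>-module is isomorphic to a quotient of some
  \<open>free_graded R ds\<close>, whose elements (cosets) have type \<open>(nat \<Rightarrow> 'r) set\<close>; so it suffices to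
  let \<open>P\<close> range over modules with elements of this type.
\<close>

definition coherent :: "('k, 'r, 'y) graded_scheme \<Rightarrow> bool"
  where "coherent R \<longleftrightarrow>
    (\<forall>(P :: ('r, (nat \<Rightarrow> 'r) set) graded) N.
      finitely_presented R P \<longrightarrow> graded_submodule R P N \<longrightarrow> fin_gen R P N \<longrightarrow>
      finitely_presented R (restr P N))"


section \<open>Graded prime ideals and localisation\<close>

definition graded_ideal :: "('s, 'a, 'z) graded_scheme \<Rightarrow> 'a set \<Rightarrow> bool"
  where "graded_ideal R I \<longleftrightarrow> (\<exists>T \<subseteq> homogeneous R. I = Idl\<^bsub>R\<^esub> T)"

definition graded_prime :: "('s, 'a, 'z) graded_scheme \<Rightarrow> 'a set \<Rightarrow> bool"
  where "graded_prime R p \<longleftrightarrow> graded_ideal R p \<and> p \<noteq> carrier R \<and>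
    (\<forall>a\<in>carrier R. \<forall>b\<in>carrier R. a \<otimes>\<^bsub>R\<^esub> b \<in> p \<longrightarrow> a \<in> p \<or> b \<in> p)"

definition graded_maximal :: "('s, 'a, 'z) graded_scheme \<Rightarrow> 'a set \<Rightarrow> bool"
  where "graded_maximal R m \<longleftrightarrow> graded_ideal R m \<and> m \<noteq> carrier R \<and>
    (\<forall>J. graded_ideal R J \<and> J \<noteq> carrier R \<and> m \<subseteq> J \<longrightarrow> J = m)"

definition even_denoms :: "('s, 'a, 'z) graded_scheme \<Rightarrow> 'a set \<Rightarrow> 'a set"
  where "even_denoms R p = (\<Union>i\<in>{i. even i}. gr R i) - p"

definition fraction :: "('r, 'x, 'z) graded_scheme \<Rightarrow> 'r set \<Rightarrow> 'x \<Rightarrow> 'r \<Rightarrow> ('x \<times> 'r) set"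
  where "fraction X S x s =
    {(y, t) \<in> carrier X \<times> S. \<exists>u\<in>S. (x \<cdot>\<^bsub>X\<^esub> t) \<cdot>\<^bsub>X\<^esub> u = (y \<cdot>\<^bsub>X\<^esub> s) \<cdot>\<^bsub>X\<^esub> u}"

text \<open>
  The module of fractions \<open>X\<^sub>p\<close>, as a graded module over \<open>R\<close> itself. Its operations are
  \<open>x/s + y/t = (x\<cdot>t + y\<cdot>s)/(st)\<close> and \<open>(x/s)\<cdot>r = (x\<cdot>r)/s\<close>, the unions running over all
  representatives; recall that elements of even degree are central.
\<close>

definition localisation ::
    "('k, 'r, 'y) graded_scheme \<Rightarrow> 'r set \<Rightarrow> ('r, 'x, 'z) graded_scheme \<Rightarrow> ('r, ('x \<times> 'r) set) graded"
  where "localisation R p X = (let S = even_denoms R p in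
    \<lparr>carrier = {fraction X S x s | x s. x \<in> carrier X \<and> s \<in> S},
     mult = undefined, one = undefined,
     zero = fraction X S \<zero>\<^bsub>X\<^esub> \<one>\<^bsub>R\<^esub>,
     add = (\<lambda>\<xi> \<eta>. \<Union>(x, s)\<in>\<xi>. \<Union>(y, t)\<in>\<eta>.
              fraction X S ((x \<cdot>\<^bsub>X\<^esub> t) \<oplus>\<^bsub>X\<^esub> (y \<cdot>\<^bsub>X\<^esub> s)) (s \<otimes>\<^bsub>R\<^esub> t)),
     smult = (\<lambda>r \<xi>. \<Union>(x, s)\<in>\<xi>. fraction X S (x \<cdot>\<^bsub>X\<^esub> r) s),
     gr = (\<lambda>j. {fraction X S x s | x s i l. x \<in> gr X i \<and> s \<in> S \<inter> gr R l \<and> j = i - l})\<rparr>)"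


section \<open>Differential graded algebras and modules\<close>

locale dg_algebra = K?: module K A + A?: graded_ring A
  for K :: "('k, 'y) ring_scheme" (structure) and A :: "('k, 'a, 'z) dg_scheme" (structure) +
  assumes smult_mult_left: "\<lbrakk>c \<in> carrier K; a \<in> carrier A; b \<in> carrier A\<rbrakk> \<Longrightarrow>
      c \<odot>\<^bsub>A\<^esub> (a \<otimes>\<^bsub>A\<^esub> b) = (c \<odot>\<^bsub>A\<^esub> a) \<otimes>\<^bsub>A\<^esub> b"
    and smult_mult_right: "\<lbrakk>c \<in> carrier K; a \<in> carrier A; b \<in> carrier A\<rbrakk> \<Longrightarrow>
      c \<odot>\<^bsub>A\<^esub> (a \<otimes>\<^bsub>A\<^esub> b) = a \<otimes>\<^bsub>A\<^esub> (c \<odot>\<^bsub>A\<^esub> b)"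
    and gr_smult: "\<lbrakk>c \<in> carrier K; a \<in> gr A i\<rbrakk> \<Longrightarrow> c \<odot>\<^bsub>A\<^esub> a \<in> gr A i"
    and diff_closed: "a \<in> carrier A \<Longrightarrow> diff A a \<in> carrier A"
    and diff_add: "\<lbrakk>a \<in> carrier A; b \<in> carrier A\<rbrakk> \<Longrightarrow>
      diff A (a \<oplus>\<^bsub>A\<^esub> b) = diff A a \<oplus>\<^bsub>A\<^esub> diff A b"
    and diff_smult: "\<lbrakk>c \<in> carrier K; a \<in> carrier A\<rbrakk> \<Longrightarrow>
      diff A (c \<odot>\<^bsub>A\<^esub> a) = c \<odot>\<^bsub>A\<^esub> diff A a"
    and diff_degree: "a \<in> gr A i \<Longrightarrow> diff A a \<in> gr A (i + 1)"
    and diff_diff: "a \<in> carrier A \<Longrightarrow> diff A (diff A a) = \<zero>\<^bsub>A\<^esub>"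
    and leibniz: "\<lbrakk>a \<in> gr A i; b \<in> carrier A\<rbrakk> \<Longrightarrow>
      diff A (a \<otimes>\<^bsub>A\<^esub> b) = (diff A a \<otimes>\<^bsub>A\<^esub> b) \<oplus>\<^bsub>A\<^esub> koszul A i (a \<otimes>\<^bsub>A\<^esub> diff A b)"

text \<open>
  Right dg modules. The scalars of the ground ring act through \<open>A\<close>, so linearity of the
  differential over the ground ring is a consequence of the Leibniz rule.
\<close>

locale dg_module = graded_module A M
  for A :: "('k, 'a, 'y) dg_scheme" (structure) and M :: "('a, 'm, 'z) dg_scheme" (structure) +
  assumes mdiff_closed: "x \<in> carrier M \<Longrightarrow> diff M x \<in> carrier M"
    and mdiff_add: "\<lbrakk>x \<in> carrier M; y \<in> carrier M\<rbrakk> \<Longrightarrow>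
      diff M (x \<oplus>\<^bsub>M\<^esub> y) = diff M x \<oplus>\<^bsub>M\<^esub> diff M y"
    and mdiff_degree: "x \<in> gr M i \<Longrightarrow> diff M x \<in> gr M (i + 1)"
    and mdiff_diff: "x \<in> carrier M \<Longrightarrow> diff M (diff M x) = \<zero>\<^bsub>M\<^esub>"
    and mleibniz: "\<lbrakk>x \<in> gr M i; a \<in> carrier A\<rbrakk> \<Longrightarrow>
      diff M (x \<cdot>\<^bsub>M\<^esub> a) = (diff M x \<cdot>\<^bsub>M\<^esub> a) \<oplus>\<^bsub>M\<^esub> koszul M i (x \<cdot>\<^bsub>M\<^esub> diff A a)"

definition cycles :: "('s, 'm, 'z) dg_scheme \<Rightarrow> 'm set"
  where "cycles M = {x \<in> carrier M. diff M x = \<zero>\<^bsub>M\<^esub>}"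

definition boundaries :: "('s, 'm, 'z) dg_scheme \<Rightarrow> 'm set"
  where "boundaries M = diff M ` carrier M"

text \<open>
  Cycles modulo boundaries, as the library's quotient structure, equipped with the induced
  grading and a given action. For a dg algebra this is the quotient ring; for a dg module only
  the quotient group underlying it matters.
\<close>

definition cohomology_with ::
    "('t \<Rightarrow> 'm set \<Rightarrow> 'm set) \<Rightarrow> ('s, 'm) dg \<Rightarrow> ('t, 'm set) graded"
  where "cohomology_with act M = (let Q = M\<lparr>carrier := cycles M\<rparr> Quot boundaries M in
    \<lparr>carrier = carrier Q, mult = mult Q, one = one Q, zero = zero Q, add = add Q,
     smult = act,
     gr = (\<lambda>i. {boundaries M +>\<^bsub>M\<^esub> z | z. z \<in> cycles M \<inter> gr M i})\<rparr>)"

definition cohomology_ring :: "('k, 'a) dg \<Rightarrow> ('k, 'a set) graded"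
  where "cohomology_ring A =
    cohomology_with (\<lambda>c \<xi>. \<Union>z\<in>\<xi>. boundaries A +>\<^bsub>A\<^esub> (c \<odot>\<^bsub>A\<^esub> z)) A"

definition cohomology_module :: "('a, 'm) dg \<Rightarrow> ('a set, 'm set) graded"
  where "cohomology_module M =
    cohomology_with (\<lambda>\<alpha> \<xi>. \<Union>z\<in>\<xi>. \<Union>a\<in>\<alpha>. boundaries M +>\<^bsub>M\<^esub> (z \<cdot>\<^bsub>M\<^esub> a)) M"

text \<open>
  The objects of the derived category of \<open>A\<close> are the dg \<open>A\<close>-modules, so \<open>M\<close> ranges over these.
  As HOL cannot quantify over types inside a formula, the type \<open>'m\<close> from which \<open>M\<close> takes its
  elements is a parameter. As soon as \<open>'m\<close> is infinite and has at least the cardinality of both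
  \<open>A\<close> and \<open>X\<close>, the predicate no longer depends on \<open>'m\<close>: if \<open>X\<close> is a summand of the cohomology of
  any \<open>M\<close>, it is one of the cohomology of a dg submodule of \<open>M\<close> generated by cycles
  representing the elements of \<open>X\<close> and by elements bounding the relations among these cycles.
  For finitely presented \<open>X\<close> over the cohomology ring, and for the localisations of such \<open>X\<close>, the
  size condition on \<open>X\<close> follows from the one on \<open>A\<close>.
\<close>

definition realisable :: "'m itself \<Rightarrow> ('k, 'a) dg \<Rightarrow> ('a set, 'x) graded \<Rightarrow> bool"
  where "realisable TYPE('m) A X \<longleftrightarrow>
    (\<exists>(M :: ('a, 'm) dg) U. dg_module A M \<and>
      direct_summand (cohomology_ring A) (cohomology_module M) U \<and>
      graded_iso (cohomology_ring A) X (restr (cohomology_module M) U))"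

end

theory Submission
  imports Defs
begin

text \<open>
  Write \<open>R = H\<^sup>*A\<close>. A graded module \<open>X\<close> is realisable iff for some dg module \<open>M\<close> there are maps
  \<open>X \<rightarrow> H\<^sup>*M \<rightarrow> X\<close> with composite the identity.

  Realisability passes to \<open>X\<^sub>p\<close>: let \<open>S\<close> be the set of even homogeneous elements outside \<open>p\<close>, and
  attach to \<open>M\<close> cones of left multiplications \<open>A \<rightarrow> A[n]\<close> by cycles representing elements of \<open>S\<close>,
  along all possible maps into \<open>M\<close>. Such cones have \<open>S\<close>-torsion cohomology, so the cohomology changes
  by \<open>S\<close>-torsion only, while classes of \<open>H\<^sup>*M\<close> become divisible by \<open>S\<close> and \<open>S\<close>-torsion classes of
  \<open>H\<^sup>*M\<close> die. After two such steps \<open>M \<rightarrow> M' \<rightarrow> M''\<close> there are maps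
  \<open>X\<^sub>p \<rightarrow> H\<^sup>*M'' \<rightarrow> X\<^sub>p\<close>.

  Conversely, coherence gives an exact sequence \<open>F\<^sub>2 \<rightarrow> F\<^sub>1 \<rightarrow> F\<^sub>0 \<rightarrow> X \<rightarrow> 0\<close> of finitely generated free
  modules such that the kernel of \<open>F\<^sub>2 \<rightarrow> F\<^sub>1\<close> is finitely generated. Realising \<open>F\<^sub>1 \<rightarrow> F\<^sub>0\<close> by free dg
  modules, its cone \<open>C\<close> has an exact sequence \<open>0 \<rightarrow> X \<rightarrow> H\<^sup>*C \<rightarrow> ker (F\<^sub>1 \<rightarrow> F\<^sub>0) \<rightarrow> 0\<close> (up to a shift), and
  \<open>X\<close> is realisable as soon as \<open>X \<rightarrow> H\<^sup>*C\<close> has a linear retraction. If \<open>M\<close> realises \<open>X\<^sub>m\<close>, the map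
  \<open>F\<^sub>0 \<rightarrow> X \<rightarrow> X\<^sub>m \<rightarrow> H\<^sup>*M\<close> extends to \<open>C \<rightarrow> M\<close>, so that \<open>X \<rightarrow> X\<^sub>m\<close> extends to \<open>H\<^sup>*C \<rightarrow> X\<^sub>m\<close>. By finite
  presentation some \<open>s \<notin> m\<close> clears the denominators; these \<open>s\<close>, one for each graded maximal ideal
  \<open>m\<close>, generate the unit ideal, which yields the retraction.
\<close>

section \<open>Additive maps and graded groups\<close>

text \<open>The type of the elements of \<open>M\<close> is fixed, so an infinite iteration of cell
  attachments would have to be squeezed into it. Two rounds suffice because modules are compared
  only up to \<open>S\<close>-torsion: the first round makes classes divisible, the second removes
  the ambiguity of the quotients, and no term has to be \<open>S\<close>-local. Each round stays
  within the cardinality of the type. An element of \<open>S\<close> is central in cohomology, but a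
  cycle representing it commutes with other cycles only up to a boundary. Right multiplication by it
  is not a map of right dg modules; this is why cones of left multiplications on \<open>A\<close>
  are used, and why their torsion has to be computed with representatives. In the other direction,
  the connecting map out of the cohomology of the cone shifts degrees and clearing denominators
  multiplies by elements of nonzero degree. Retractions are therefore sought among ungraded linear
  maps, and the part of degree zero is taken at the end. Finite generation of the kernel of
  \<open>F2 -> F1\<close> lets one denominator serve all relations.\<close>

definition add_hom :: "('a, 'y) ring_scheme \<Rightarrow> ('b, 'z) ring_scheme \<Rightarrow> ('a \<Rightarrow> 'b) \<Rightarrow> bool"
  where "add_hom G H \<phi> \<longleftrightarrow> \<phi> \<in> carrier G \<rightarrow> carrier H \<and>
    (\<forall>x\<in>carrier G. \<forall>y\<in>carrier G. \<phi> (x \<oplus>\<^bsub>G\<^esub> y) = \<phi> x \<oplus>\<^bsub>H\<^esub> \<phi> y)"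

lemma add_hom_closed: "\<lbrakk>add_hom G H \<phi>; x \<in> carrier G\<rbrakk> \<Longrightarrow> \<phi> x \<in> carrier H"
  by (auto simp: add_hom_def)

lemma add_hom_add:
  "\<lbrakk>add_hom G H \<phi>; x \<in> carrier G; y \<in> carrier G\<rbrakk> \<Longrightarrow> \<phi> (x \<oplus>\<^bsub>G\<^esub> y) = \<phi> x \<oplus>\<^bsub>H\<^esub> \<phi> y"
  by (auto simp: add_hom_def)

lemma add_hom_zero:
  assumes "add_hom G H \<phi>" "abelian_group G" "abelian_group H"
  shows "\<phi> \<zero>\<^bsub>G\<^esub> = \<zero>\<^bsub>H\<^esub>"
proof -
  interpret G: abelian_group G by fact
  interpret H: abelian_group H by fact
  have "\<phi> \<zero>\<^bsub>G\<^esub> \<oplus>\<^bsub>H\<^esub> \<phi> \<zero>\<^bsub>G\<^esub> = \<phi> \<zero>\<^bsub>G\<^esub>"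
    using add_hom_add[OF assms(1), of "\<zero>\<^bsub>G\<^esub>" "\<zero>\<^bsub>G\<^esub>"] by simp
  then show ?thesis
    using add_hom_closed[OF assms(1), of "\<zero>\<^bsub>G\<^esub>"] by simp
qed

lemma add_hom_neg:
  assumes "add_hom G H \<phi>" "abelian_group G" "abelian_group H" "x \<in> carrier G"
  shows "\<phi> (\<ominus>\<^bsub>G\<^esub> x) = \<ominus>\<^bsub>H\<^esub> \<phi> x"
proof -
  interpret G: abelian_group G by fact
  interpret H: abelian_group H by fact
  have "\<phi> (\<ominus>\<^bsub>G\<^esub> x) \<oplus>\<^bsub>H\<^esub> \<phi> x = \<zero>\<^bsub>H\<^esub>"
    using add_hom_add[OF assms(1), of "\<ominus>\<^bsub>G\<^esub> x" x] assms add_hom_zero[OF assms(1-3)]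
    by (simp add: G.l_neg)
  then show ?thesis
    using assms add_hom_closed[OF assms(1)] by (simp add: H.minus_equality)
qed

lemma add_hom_minus:
  assumes "add_hom G H \<phi>" "abelian_group G" "abelian_group H" "x \<in> carrier G" "y \<in> carrier G"
  shows "\<phi> (x \<ominus>\<^bsub>G\<^esub> y) = \<phi> x \<ominus>\<^bsub>H\<^esub> \<phi> y"
proof -
  interpret G: abelian_group G by fact
  interpret H: abelian_group H by fact
  show ?thesis
    using assms add_hom_add[OF assms(1), of x "\<ominus>\<^bsub>G\<^esub> y"] add_hom_neg[OF assms(1-3)]
    by (simp add: a_minus_def)
qed

lemma add_hom_finsum:
  assumes "add_hom G H \<phi>" "abelian_group G" "abelian_group H" "f \<in> I \<rightarrow> carrier G"
  shows "\<phi> (finsum G f I) = finsum H (\<lambda>i. \<phi> (f i)) I"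
proof -
  interpret G: abelian_group G by fact
  interpret H: abelian_group H by fact
  show ?thesis
    using assms(4)
  proof (induction I rule: infinite_finite_induct)
    case (infinite I)
    then show ?case by (simp add: add_hom_zero[OF assms(1-3)])
  next
    case empty
    then show ?case by (simp add: add_hom_zero[OF assms(1-3)])
  next
    case (insert i I)
    then have "f i \<in> carrier G" "f \<in> I \<rightarrow> carrier G" by auto
    moreover have "(\<lambda>i. \<phi> (f i)) \<in> I \<rightarrow> carrier H" "\<phi> (f i) \<in> carrier H"
      using calculation add_hom_closed[OF assms(1)] by auto
    ultimately show ?case
      using insert by (simp add: add_hom_add[OF assms(1)])
  qed
qed

lemma add_hom_comp:
  "\<lbrakk>add_hom G H \<phi>; add_hom H L \<psi>\<rbrakk> \<Longrightarrow> add_hom G L (\<lambda>x. \<psi> (\<phi> x))"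
  by (auto simp: add_hom_def Pi_iff)

lemma (in abelian_group) minus_add_cancel:
  assumes "x \<in> carrier G" "y \<in> carrier G"
  shows "(x \<ominus> y) \<oplus> y = x" "(x \<oplus> y) \<ominus> y = x"
  using assms by (simp_all add: a_minus_def a_assoc l_neg r_neg)

lemma (in abelian_group) add_minus_cancel_left:
  "\<lbrakk>x \<in> carrier G; y \<in> carrier G\<rbrakk> \<Longrightarrow> (x \<oplus> y) \<ominus> x = y"
  using minus_add_cancel(2)[of y x] by (simp add: a_comm)

lemma (in abelian_group) minus_eq_zero_iff:
  assumes "x \<in> carrier G" "y \<in> carrier G"
  shows "x \<ominus> y = \<zero> \<longleftrightarrow> x = y"
  using minus_add_cancel(1)[OF assms] assms by (metis a_minus_def l_zero r_neg)

lemma (in abelian_group) add_eq_iff_minus: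
  assumes "x \<in> carrier G" "y \<in> carrier G" "z \<in> carrier G"
  shows "x \<oplus> y = z \<longleftrightarrow> x = z \<ominus> y"
  using minus_add_cancel[OF assms(1,2)] minus_add_cancel[OF assms(3,2)] by metis

lemma (in abelian_group) minus_trans:
  assumes "x \<in> carrier G" "y \<in> carrier G" "z \<in> carrier G"
  shows "(x \<ominus> y) \<oplus> (y \<ominus> z) = x \<ominus> z"
  using assms by (simp add: a_minus_def a_assoc r_neg1)

lemma (in abelian_group) neg_zero: "\<ominus> \<zero> = \<zero>"
  by (rule minus_equality) auto

lemma (in abelian_group) minus_zero_right: "x \<in> carrier G \<Longrightarrow> x \<ominus> \<zero> = x"
  by (simp add: a_minus_def neg_zero)

lemma (in abelian_group) add_eq_add_imp_minus_eq:
  assumes "u \<oplus> v = u' \<oplus> v'" "u \<in> carrier G" "v \<in> carrier G" "u' \<in> carrier G" "v' \<in> carrier G"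
  shows "u \<ominus> u' = v' \<ominus> v"
proof -
  have "((v' \<ominus> v) \<oplus> u') \<oplus> v = ((v' \<ominus> v) \<oplus> v) \<oplus> u'"
    using assms minus_closed by (simp only: a_assoc a_comm[of u' v])
  also have "\<dots> = u \<oplus> v" using assms minus_add_cancel(1)[of v' v] by (simp add: a_comm)
  finally have "(v' \<ominus> v) \<oplus> u' = u"
    by (rule add.right_cancel[THEN iffD1, rotated -1]) (use assms in auto)
  then show ?thesis using add_eq_iff_minus[of "v' \<ominus> v" u' u] assms by simp
qed

lemma (in abelian_group) finsum_support:
  assumes "finite F" "{i. f i \<noteq> \<zero>} \<subseteq> F" "\<And>i. f i \<in> carrier G"
  shows "(\<Oplus>i\<in>F. f i) = (\<Oplus>i\<in>{i. f i \<noteq> \<zero>}. f i)"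
  by (rule add.finprod_mono_neutral_cong_left[symmetric]) (use assms in auto)

section \<open>Homogeneous components\<close>

definition gcomp :: "('s, 'a, 'z) graded_scheme \<Rightarrow> 'a \<Rightarrow> int \<Rightarrow> 'a"
  where "gcomp G x = (THE f. (\<forall>i. f i \<in> gr G i) \<and> finite {i. f i \<noteq> \<zero>\<^bsub>G\<^esub>} \<and>
    x = (\<Oplus>\<^bsub>G\<^esub>i\<in>{i. f i \<noteq> \<zero>\<^bsub>G\<^esub>}. f i))"

context graded_group
begin

lemma gr_sub: "gr G i \<subseteq> carrier G"
  using additive_subgroup.a_subset[OF gr_subgroup] .

lemma gr_carrier: "x \<in> gr G i \<Longrightarrow> x \<in> carrier G"
  using gr_sub by blast

lemma gr_zero: "\<zero> \<in> gr G i"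
  using additive_subgroup.zero_closed[OF gr_subgroup] .

lemma gr_add: "\<lbrakk>x \<in> gr G i; y \<in> gr G i\<rbrakk> \<Longrightarrow> x \<oplus> y \<in> gr G i"
  using additive_subgroup.a_closed[OF gr_subgroup] .

lemma gr_neg: "x \<in> gr G i \<Longrightarrow> \<ominus> x \<in> gr G i"
  using additive_subgroup.a_inv_closed[OF gr_subgroup] .

lemma gr_minus: "\<lbrakk>x \<in> gr G i; y \<in> gr G i\<rbrakk> \<Longrightarrow> x \<ominus> y \<in> gr G i"
  by (simp add: a_minus_def gr_add gr_neg)

lemma gcomp_props:
  assumes "x \<in> carrier G"
  shows "gcomp G x i \<in> gr G i" "finite {i. gcomp G x i \<noteq> \<zero>}"
    "(\<Oplus>i\<in>{i. gcomp G x i \<noteq> \<zero>}. gcomp G x i) = x"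
proof -
  note * = theI'[OF gr_direct_sum[OF assms], folded gcomp_def]
  show "gcomp G x i \<in> gr G i" by (rule *[THEN conjunct1, rule_format])
  show "finite {i. gcomp G x i \<noteq> \<zero>}" by (rule *[THEN conjunct2, THEN conjunct1])
  show "(\<Oplus>i\<in>{i. gcomp G x i \<noteq> \<zero>}. gcomp G x i) = x"
    by (rule *[THEN conjunct2, THEN conjunct2, symmetric])
qed

lemma gcomp_closed: "x \<in> carrier G \<Longrightarrow> gcomp G x i \<in> carrier G"
  using gcomp_props(1) gr_carrier by blast

lemma gcomp_sum:
  assumes "x \<in> carrier G" "finite F" "{i. gcomp G x i \<noteq> \<zero>} \<subseteq> F"
  shows "(\<Oplus>i\<in>F. gcomp G x i) = x"
  using finsum_support[OF assms(2,3)] gcomp_props(3)[OF assms(1)] gcomp_closed[OF assms(1)] by auto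

text \<open>Any finite set containing the support may be summed over; thus the components of a sum
  can be found on the union of two supports.\<close>

lemma gcomp_unique:
  assumes "\<And>i. f i \<in> gr G i" "finite F" "{i. f i \<noteq> \<zero>} \<subseteq> F" "x = (\<Oplus>i\<in>F. f i)"
  shows "gcomp G x = f"
proof -
  have c: "\<And>i. f i \<in> carrier G" using assms(1) gr_carrier by blast
  then have x: "x \<in> carrier G" using assms(4) by (auto intro: finsum_closed)
  have "(\<forall>i. f i \<in> gr G i) \<and> finite {i. f i \<noteq> \<zero>} \<and> x = (\<Oplus>i\<in>{i. f i \<noteq> \<zero>}. f i)"
    using assms(1) finite_subset[OF assms(3,2)] assms(4)[unfolded finsum_support[OF assms(2,3) c]]
    by (intro conjI allI)
  note the1_equality[OF gr_direct_sum[OF x], folded gcomp_def, OF this]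
  then show ?thesis .
qed

lemma gcomp_homogeneous:
  assumes "x \<in> gr G k"
  shows "gcomp G x i = (if i = k then x else \<zero>)"
proof -
  have "gcomp G x = (\<lambda>i. if i = k then x else \<zero>)"
    by (rule gcomp_unique[of _ "{k}"]) (use assms gr_zero gr_carrier in auto)
  then show ?thesis by simp
qed

lemma gcomp_add:
  assumes "x \<in> carrier G" "y \<in> carrier G"
  shows "gcomp G (x \<oplus> y) i = gcomp G x i \<oplus> gcomp G y i"
proof -
  let ?F = "{i. gcomp G x i \<noteq> \<zero>} \<union> {i. gcomp G y i \<noteq> \<zero>}"
  have fin: "finite ?F" using gcomp_props(2) assms by auto
  have "gcomp G (x \<oplus> y) = (\<lambda>i. gcomp G x i \<oplus> gcomp G y i)"
  proof (rule gcomp_unique[of _ ?F])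
    show "x \<oplus> y = (\<Oplus>i\<in>?F. gcomp G x i \<oplus> gcomp G y i)"
      using gcomp_sum[OF assms(1) fin] gcomp_sum[OF assms(2) fin]
      by (subst finsum_addf) (auto simp: assms gcomp_closed)
  qed (use assms gcomp_props gr_add fin in auto)
  then show ?thesis by simp
qed

lemma gcomp_zero: "gcomp G \<zero> i = \<zero>"
  using gcomp_homogeneous[OF gr_zero[of i]] by simp

text \<open>The reduction of an additive statement to homogeneous elements, for which alone the
  signs in the Leibniz rule and in graded commutativity make sense.\<close>

lemma graded_induct [consumes 1, case_names homogeneous add]:
  assumes "x \<in> carrier G"
    and "\<And>i x. x \<in> gr G i \<Longrightarrow> P x"
    and "\<And>x y. \<lbrakk>x \<in> carrier G; y \<in> carrier G; P x; P y\<rbrakk> \<Longrightarrow> P (x \<oplus> y)"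
  shows "P x"
proof -
  have "P (\<Oplus>i\<in>F. gcomp G x i)" if "finite F" for F
    using that
  proof (induction F rule: finite_induct)
    case empty
    then show ?case using assms(2)[OF gr_zero] by simp
  next
    case (insert i F)
    then show ?case
      using assms(2)[OF gcomp_props(1)[OF assms(1)]] gcomp_closed[OF assms(1)]
      by (simp add: assms(3) finsum_closed Pi_iff)
  qed
  then show ?thesis using gcomp_props[OF assms(1)] by metis
qed

lemma gr_disjoint: "\<lbrakk>x \<in> gr G i; x \<in> gr G j; i \<noteq> j\<rbrakk> \<Longrightarrow> x = \<zero>"
  using gcomp_homogeneous[of x i i] gcomp_homogeneous[of x j i] by simp

lemma eqI_gcomp:
  assumes "x \<in> carrier G" "y \<in> carrier G" "\<And>i. gcomp G x i = gcomp G y i"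
  shows "x = y"
proof -
  have eq: "gcomp G x = gcomp G y" by (rule ext) (rule assms(3))
  show ?thesis
    by (rule trans[OF gcomp_props(3)[OF assms(1), symmetric], unfolded eq, OF gcomp_props(3)[OF assms(2)]])
qed

end

text \<open>Covers at once the differential (\<open>k = 1\<close>), the action of a ring element of
  degree \<open>k\<close> and graded homomorphisms (\<open>k = 0\<close>). By additivity it is
  enough to look at homogeneous elements.\<close>

lemma gcomp_shift:
  assumes G: "graded_group G" and H: "graded_group H" and "add_hom G H \<phi>"
    and "\<And>i x. x \<in> gr G i \<Longrightarrow> \<phi> x \<in> gr H (i + k)" and "x \<in> carrier G"
  shows "gcomp H (\<phi> x) (i + k) = \<phi> (gcomp G x i)"
proof -
  interpret G: graded_group G by fact
  interpret H: graded_group H by fact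
  note z = add_hom_zero[OF assms(3) G.abelian_group_axioms H.abelian_group_axioms]
  show ?thesis
    using assms(5)
  proof (induction x rule: G.graded_induct)
    case (homogeneous j x)
    then show ?case
      using G.gcomp_homogeneous[of x j i] H.gcomp_homogeneous[OF assms(4)[of x j], of "i + k"] z by auto
  next
    case (add x y)
    then show ?case
      by (simp add: add_hom_add[OF assms(3)] H.gcomp_add G.gcomp_add G.gcomp_closed
          add_hom_closed[OF assms(3)])
  qed
qed

text \<open>The map \<open>c\<close> provides a decomposition of each element. Uniqueness follows by
  applying the additive map \<open>\<lambda>x. c x i\<close> to an arbitrary decomposition, which
  picks out its term of degree \<open>i\<close>.\<close>

lemma graded_groupI:
  fixes G (structure)
  assumes "abelian_group G"
    and sub: "\<And>i. additive_subgroup (gr G i) G"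
    and c1: "\<And>x i. x \<in> carrier G \<Longrightarrow> c x i \<in> gr G i"
    and c2: "\<And>x. x \<in> carrier G \<Longrightarrow> finite {i. c x i \<noteq> \<zero>}"
    and c3: "\<And>x. x \<in> carrier G \<Longrightarrow> (\<Oplus>i\<in>{i. c x i \<noteq> \<zero>}. c x i) = x"
    and c4: "\<And>x y i. \<lbrakk>x \<in> carrier G; y \<in> carrier G\<rbrakk> \<Longrightarrow> c (x \<oplus> y) i = c x i \<oplus> c y i"
    and c5: "\<And>x i j. x \<in> gr G j \<Longrightarrow> c x i = (if i = j then x else \<zero>)"
  shows "graded_group G"
proof -
  interpret abelian_group G by fact
  have gc: "x \<in> carrier G" if "x \<in> gr G i" for x i
    using additive_subgroup.a_subset[OF sub] that by blast
  show ?thesis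
  proof (intro graded_group.intro graded_group_axioms.intro)
    show "abelian_group G" by fact
    show "additive_subgroup (gr G i) G" for i by (rule sub)
    fix x assume x: "x \<in> carrier G"
    show "\<exists>!f. (\<forall>i. f i \<in> gr G i) \<and> finite {i. f i \<noteq> \<zero>} \<and> x = (\<Oplus>i\<in>{i. f i \<noteq> \<zero>}. f i)"
    proof (rule ex1I[of _ "c x"])
      show "(\<forall>i. c x i \<in> gr G i) \<and> finite {i. c x i \<noteq> \<zero>} \<and> x = (\<Oplus>i\<in>{i. c x i \<noteq> \<zero>}. c x i)"
        using c1 c2 c3 x by auto
    next
      fix f assume f: "(\<forall>i. f i \<in> gr G i) \<and> finite {i. f i \<noteq> \<zero>} \<and> x = (\<Oplus>i\<in>{i. f i \<noteq> \<zero>}. f i)"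
      have hom: "add_hom G G (\<lambda>x. c x i)" for i
        using c1 gc c4 by (auto simp: add_hom_def)
      have fc: "f i \<in> carrier G" for i using f gc by blast
      show "f = c x"
      proof
        fix i
        have "c x i = (\<Oplus>j\<in>{i. f i \<noteq> \<zero>}. c (f j) i)"
          using add_hom_finsum[OF hom assms(1) assms(1), of f "{i. f i \<noteq> \<zero>}" i] fc f by auto
        also have "\<dots> = (\<Oplus>j\<in>{i. f i \<noteq> \<zero>}. if i = j then f j else \<zero>)"
          by (rule finsum_cong') (use f c5 fc in auto)
        also have "\<dots> = f i"
        proof (cases "f i = \<zero>")
          case True
          then have "(\<Oplus>j\<in>{i. f i \<noteq> \<zero>}. if i = j then f j else \<zero>) = (\<Oplus>j\<in>{i. f i \<noteq> \<zero>}. \<zero>)"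
            by (intro finsum_cong') auto
          then show ?thesis using True by simp
        next
          case False
          then show ?thesis using f fc by (subst finsum_singleton) auto
        qed
        finally show "f i = c x i" ..
      qed
    qed
  qed
qed

section \<open>Graded modules and module homomorphisms\<close>

definition mod_hom ::
    "('k, 'r, 'y) graded_scheme \<Rightarrow> ('r, 'm, 'z) graded_scheme \<Rightarrow> ('r, 'n, 'w) graded_scheme
      \<Rightarrow> ('m \<Rightarrow> 'n) \<Rightarrow> bool"
  where "mod_hom R M N \<phi> \<longleftrightarrow> add_hom M N \<phi> \<and>
    (\<forall>x\<in>carrier M. \<forall>r\<in>carrier R. \<phi> (x \<cdot>\<^bsub>M\<^esub> r) = \<phi> x \<cdot>\<^bsub>N\<^esub> r)"

lemma mod_homI:
  assumes "\<And>x. x \<in> carrier M \<Longrightarrow> \<phi> x \<in> carrier N"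
    and "\<And>x y. \<lbrakk>x \<in> carrier M; y \<in> carrier M\<rbrakk> \<Longrightarrow> \<phi> (x \<oplus>\<^bsub>M\<^esub> y) = \<phi> x \<oplus>\<^bsub>N\<^esub> \<phi> y"
    and "\<And>x r. \<lbrakk>x \<in> carrier M; r \<in> carrier R\<rbrakk> \<Longrightarrow> \<phi> (x \<cdot>\<^bsub>M\<^esub> r) = \<phi> x \<cdot>\<^bsub>N\<^esub> r"
  shows "mod_hom R M N \<phi>"
  using assms by (auto simp: mod_hom_def add_hom_def)

lemma mod_hom_add_hom: "mod_hom R M N \<phi> \<Longrightarrow> add_hom M N \<phi>"
  by (simp add: mod_hom_def)

lemma mod_hom_ract:
  "\<lbrakk>mod_hom R M N \<phi>; x \<in> carrier M; r \<in> carrier R\<rbrakk> \<Longrightarrow> \<phi> (x \<cdot>\<^bsub>M\<^esub> r) = \<phi> x \<cdot>\<^bsub>N\<^esub> r"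
  by (simp add: mod_hom_def)

lemmas mod_hom_closed = add_hom_closed[OF mod_hom_add_hom]
  and mod_hom_add = add_hom_add[OF mod_hom_add_hom]

lemma mod_hom_comp:
  "\<lbrakk>mod_hom R M N \<phi>; mod_hom R N L \<psi>\<rbrakk> \<Longrightarrow> mod_hom R M L (\<lambda>x. \<psi> (\<phi> x))"
  by (auto simp: mod_hom_def add_hom_def Pi_iff)

lemma graded_hom_iff:
  "\<phi> \<in> graded_hom R M N \<longleftrightarrow> mod_hom R M N \<phi> \<and> (\<forall>i. \<forall>x\<in>gr M i. \<phi> x \<in> gr N i)"
  by (auto simp: graded_hom_def mod_hom_def add_hom_def)

lemma graded_hom_mod_hom: "\<phi> \<in> graded_hom R M N \<Longrightarrow> mod_hom R M N \<phi>"
  by (simp add: graded_hom_iff)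

lemma graded_hom_gr: "\<lbrakk>\<phi> \<in> graded_hom R M N; x \<in> gr M i\<rbrakk> \<Longrightarrow> \<phi> x \<in> gr N i"
  by (simp add: graded_hom_iff)

lemma graded_hom_comp:
  "\<lbrakk>\<phi> \<in> graded_hom R M N; \<psi> \<in> graded_hom R N L\<rbrakk> \<Longrightarrow> (\<lambda>x. \<psi> (\<phi> x)) \<in> graded_hom R M L"
  by (auto simp: graded_hom_iff intro: mod_hom_comp)

context graded_module
begin

lemma add_hom_ract: "r \<in> carrier R \<Longrightarrow> add_hom M M (\<lambda>x. x \<cdot>\<^bsub>M\<^esub> r)"
  by (simp add: add_hom_def ract_closed ract_add_left)

lemma add_hom_ract_right: "x \<in> carrier M \<Longrightarrow> add_hom R M (\<lambda>r. x \<cdot>\<^bsub>M\<^esub> r)"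
  by (simp add: add_hom_def ract_closed ract_add_right)

lemmas ract_zero_left =
    add_hom_zero[OF add_hom_ract M.abelian_group_axioms M.abelian_group_axioms]
  and ract_neg_left =
    add_hom_neg[OF add_hom_ract M.abelian_group_axioms M.abelian_group_axioms]
  and ract_minus_left =
    add_hom_minus[OF add_hom_ract M.abelian_group_axioms M.abelian_group_axioms]
  and ract_finsum_left =
    add_hom_finsum[OF add_hom_ract M.abelian_group_axioms M.abelian_group_axioms]
  and ract_zero_right =
    add_hom_zero[OF add_hom_ract_right R.abelian_group_axioms M.abelian_group_axioms]
  and ract_minus_right =
    add_hom_minus[OF add_hom_ract_right R.abelian_group_axioms M.abelian_group_axioms]

lemma gcomp_ract:
  assumes "x \<in> carrier M" "r \<in> gr R k"
  shows "gcomp M (x \<cdot>\<^bsub>M\<^esub> r) (i + k) = gcomp M x i \<cdot>\<^bsub>M\<^esub> r"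
  using gcomp_shift[OF M.graded_group_axioms M.graded_group_axioms add_hom_ract _ assms(1)]
    assms(2) R.gr_carrier gr_ract by blast

lemma is_graded_module: "graded_module R M"
  by (rule graded_module_axioms)

end

lemma gcomp_graded_hom:
  assumes "graded_module R M" "graded_module R N" "\<phi> \<in> graded_hom R M N" "x \<in> carrier M"
  shows "gcomp N (\<phi> x) i = \<phi> (gcomp M x i)"
  using gcomp_shift[of M N \<phi> 0 x i] assms
  by (simp add: graded_hom_iff mod_hom_def graded_module_def)

lemma mod_hom_zero:
  assumes "mod_hom R M N \<phi>" "graded_module R M" "graded_module R N"
  shows "\<phi> \<zero>\<^bsub>M\<^esub> = \<zero>\<^bsub>N\<^esub>"
  using assms add_hom_zero[of M N \<phi>] by (simp add: mod_hom_def graded_module_def graded_group_def)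

lemma mod_hom_minus:
  assumes "mod_hom R M N \<phi>" "graded_module R M" "graded_module R N" "x \<in> carrier M" "y \<in> carrier M"
  shows "\<phi> (x \<ominus>\<^bsub>M\<^esub> y) = \<phi> x \<ominus>\<^bsub>N\<^esub> \<phi> y"
  using assms add_hom_minus[of M N \<phi>] by (simp add: mod_hom_def graded_module_def graded_group_def)

lemma mod_hom_neg:
  assumes "mod_hom R M N \<phi>" "graded_module R M" "graded_module R N" "x \<in> carrier M"
  shows "\<phi> (\<ominus>\<^bsub>M\<^esub> x) = \<ominus>\<^bsub>N\<^esub> \<phi> x"
  using assms add_hom_neg[of M N \<phi>] by (simp add: mod_hom_def graded_module_def graded_group_def)

lemma mod_hom_finsum:
  assumes "mod_hom R M N \<phi>" "graded_module R M" "graded_module R N" "f \<in> I \<rightarrow> carrier M"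
  shows "\<phi> (finsum M f I) = finsum N (\<lambda>i. \<phi> (f i)) I"
  using assms add_hom_finsum[of M N \<phi>] by (simp add: mod_hom_def graded_module_def graded_group_def)

text \<open>The witness is the degree zero part of \<open>q\<close>.\<close>

lemma graded_retraction:
  assumes X: "graded_module R X" and Y: "graded_module R Y"
    and i: "i \<in> graded_hom R X Y" and q: "mod_hom R Y X q"
    and qi: "\<And>x. x \<in> carrier X \<Longrightarrow> q (i x) = x"
  shows "\<exists>p\<in>graded_hom R Y X. \<forall>x\<in>carrier X. p (i x) = x"
proof -
  interpret X: graded_module R X by fact
  interpret Y: graded_module R Y by fact
  define T where "T y k = gcomp X (q (gcomp Y y k)) k" for y k
  define p where "p y = (\<Oplus>\<^bsub>X\<^esub>k\<in>{k. gcomp Y y k \<noteq> \<zero>\<^bsub>Y\<^esub>}. T y k)" for y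
  note qc = mod_hom_closed[OF q] and q0 = mod_hom_zero[OF q Y X]
  have Tgr: "T y k \<in> gr X k" if "y \<in> carrier Y" for y k
    unfolding T_def by (intro X.M.gcomp_props(1) qc Y.M.gcomp_closed that)
  then have Tc: "T y k \<in> carrier X" if "y \<in> carrier Y" for y k
    using that X.M.gr_carrier by blast
  have pc: "p y \<in> carrier X" if "y \<in> carrier Y" for y
    unfolding p_def using that Tc by (auto intro: X.M.finsum_closed)
  have pcomp: "gcomp X (p y) = T y" if y: "y \<in> carrier Y" for y
  proof (rule X.M.gcomp_unique[of _ "{k. gcomp Y y k \<noteq> \<zero>\<^bsub>Y\<^esub>}"])
    show "T y k \<in> gr X k" for k by (rule Tgr[OF y])
    show "{k. T y k \<noteq> \<zero>\<^bsub>X\<^esub>} \<subseteq> {k. gcomp Y y k \<noteq> \<zero>\<^bsub>Y\<^esub>}"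
      by (auto simp: T_def q0 X.M.gcomp_zero)
  qed (simp_all add: p_def Y.M.gcomp_props(2)[OF y])
  have padd: "p (x \<oplus>\<^bsub>Y\<^esub> y) = p x \<oplus>\<^bsub>X\<^esub> p y" if "x \<in> carrier Y" "y \<in> carrier Y" for x y
  proof (rule X.M.eqI_gcomp)
    fix k show "gcomp X (p (x \<oplus>\<^bsub>Y\<^esub> y)) k = gcomp X (p x \<oplus>\<^bsub>X\<^esub> p y) k"
      using that by (simp add: pcomp X.M.gcomp_add pc T_def Y.M.gcomp_add Y.M.gcomp_closed
          mod_hom_add[OF q] qc)
  qed (use that pc in auto)
  \<comment> \<open>\<open>q\<close> need not respect degrees, but it is linear, so \<open>r\<close>
    can be pulled out of both component maps at the cost of a shift by \<open>j\<close>.\<close>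
  have pract1: "p (y \<cdot>\<^bsub>Y\<^esub> r) = p y \<cdot>\<^bsub>X\<^esub> r" if y: "y \<in> carrier Y" and r: "r \<in> gr R j" for y r j
  proof (rule X.M.eqI_gcomp)
    have rc: "r \<in> carrier R" using r X.R.gr_carrier by blast
    show "p (y \<cdot>\<^bsub>Y\<^esub> r) \<in> carrier X" "p y \<cdot>\<^bsub>X\<^esub> r \<in> carrier X"
      using y rc by (auto intro: pc Y.ract_closed X.ract_closed)
    fix k
    have "gcomp X (p (y \<cdot>\<^bsub>Y\<^esub> r)) ((k - j) + j) = gcomp X (p y \<cdot>\<^bsub>X\<^esub> r) ((k - j) + j)"
      using Y.gcomp_ract[OF y r, of "k - j"]
        X.gcomp_ract[OF qc[OF Y.M.gcomp_closed[OF y]] r, of "k - j" "k - j"]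
      unfolding X.gcomp_ract[OF pc[OF y] r] using y rc
      by (simp add: pcomp Y.ract_closed T_def mod_hom_ract[OF q] Y.M.gcomp_closed)
    then show "gcomp X (p (y \<cdot>\<^bsub>Y\<^esub> r)) k = gcomp X (p y \<cdot>\<^bsub>X\<^esub> r) k" by simp
  qed
  have pract: "p (y \<cdot>\<^bsub>Y\<^esub> r) = p y \<cdot>\<^bsub>X\<^esub> r" if y: "y \<in> carrier Y" and r: "r \<in> carrier R" for y r
    using r
  proof (induction r rule: X.R.graded_induct)
    case (homogeneous j r)
    then show ?case using pract1[OF y] by blast
  next
    case (add r s)
    then show ?case using y by (simp add: Y.ract_add_right X.ract_add_right padd Y.ract_closed pc)
  qed
  have "p \<in> graded_hom R Y X"
    unfolding graded_hom_iff
  proof (intro conjI allI ballI)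
    show "mod_hom R Y X p" by (rule mod_homI) (use pc padd pract in auto)
    fix k y assume y: "y \<in> gr Y k"
    have "p y = T y k"
    proof (cases "y = \<zero>\<^bsub>Y\<^esub>")
      case True
      then show ?thesis by (simp add: p_def T_def Y.M.gcomp_zero q0 X.M.gcomp_zero)
    next
      case False
      then have "{l. gcomp Y y l \<noteq> \<zero>\<^bsub>Y\<^esub>} = {k}" by (auto simp: Y.M.gcomp_homogeneous[OF y])
      then show ?thesis
        unfolding p_def using Tc[OF Y.M.gr_carrier[OF y]] by (simp add: X.M.finsum_insert)
    qed
    then show "p y \<in> gr X k" using Tgr[OF Y.M.gr_carrier[OF y]] by simp
  qed
  moreover have "p (i x) = x" if x: "x \<in> carrier X" for x
  proof (rule X.M.eqI_gcomp)
    have ix: "i x \<in> carrier Y" using mod_hom_closed[OF graded_hom_mod_hom[OF i] x] .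
    then show "p (i x) \<in> carrier X" by (rule pc)
    fix k
    show "gcomp X (p (i x)) k = gcomp X x k"
      using X.M.gcomp_homogeneous[OF X.M.gcomp_props(1)[OF x]]
      by (simp add: pcomp[OF ix] T_def gcomp_graded_hom[OF X Y i x] qi X.M.gcomp_closed[OF x])
  qed (rule x)
  ultimately show ?thesis by blast
qed

subsection \<open>Submodules and summands\<close>

lemma restr_simps [simp]:
  "carrier (restr M U) = U" "\<zero>\<^bsub>restr M U\<^esub> = \<zero>\<^bsub>M\<^esub>"
  "x \<oplus>\<^bsub>restr M U\<^esub> y = x \<oplus>\<^bsub>M\<^esub> y" "x \<cdot>\<^bsub>restr M U\<^esub> r = x \<cdot>\<^bsub>M\<^esub> r" "gr (restr M U) i = gr M i \<inter> U"
  by (simp_all add: restr_def)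

text \<open>Closure under homogeneous components lets the decomposition in \<open>M\<close> serve as
  the decomposition in \<open>U\<close>.\<close>

lemma graded_submoduleI:
  assumes M: "graded_module R M" and U: "U \<subseteq> carrier M" "\<zero>\<^bsub>M\<^esub> \<in> U"
    and add: "\<And>x y. \<lbrakk>x \<in> U; y \<in> U\<rbrakk> \<Longrightarrow> x \<oplus>\<^bsub>M\<^esub> y \<in> U"
    and neg: "\<And>x. x \<in> U \<Longrightarrow> \<ominus>\<^bsub>M\<^esub> x \<in> U"
    and act: "\<And>x r. \<lbrakk>x \<in> U; r \<in> carrier R\<rbrakk> \<Longrightarrow> x \<cdot>\<^bsub>M\<^esub> r \<in> U"
    and comp: "\<And>x i. x \<in> U \<Longrightarrow> gcomp M x i \<in> U"
  shows "graded_submodule R M U"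
proof -
  interpret M: graded_module R M by fact
  let ?N = "restr M U"
  have Uc: "x \<in> carrier M" if "x \<in> U" for x using that U by blast
  have ab: "abelian_group ?N"
    by (rule abelian_groupI)
      (auto simp: add U Uc M.M.a_assoc intro: M.M.a_comm neg M.M.l_neg dest: Uc)
  interpret N: abelian_group ?N by (rule ab)
  have incl: "add_hom ?N M (\<lambda>x. x)" by (simp add: add_hom_def Uc)
  have fs: "finsum ?N f F = finsum M f F" if "f \<in> F \<rightarrow> U" for f and F :: "int set"
    using add_hom_finsum[OF incl ab M.M.abelian_group_axioms, of f F] that by simp
  have neg': "\<ominus>\<^bsub>?N\<^esub> x = \<ominus>\<^bsub>M\<^esub> x" if "x \<in> U" for x
    using add_hom_neg[OF incl ab M.M.abelian_group_axioms, of x] that by simp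
  have "graded_group ?N"
  proof (rule graded_groupI[where c = "gcomp M"])
    show "additive_subgroup (gr ?N i) ?N" for i
    proof (rule additive_subgroup.intro, rule N.add.subgroupI)
      show "gr ?N i \<noteq> {}" using M.M.gr_zero U by auto
    next
      fix a assume "a \<in> gr ?N i"
      then show "\<ominus>\<^bsub>?N\<^esub> a \<in> gr ?N i" using neg' neg M.M.gr_neg by auto
    qed (auto simp: add M.M.gr_add)
    fix x assume x: "x \<in> carrier ?N"
    then show "(\<Oplus>\<^bsub>?N\<^esub>i\<in>{i. gcomp M x i \<noteq> \<zero>\<^bsub>?N\<^esub>}. gcomp M x i) = x"
      using M.M.gcomp_props(3)[of x] Uc comp by (subst fs) auto
  qed (use ab Uc comp M.M.gcomp_props M.M.gcomp_add M.M.gcomp_homogeneous in auto)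
  moreover have "graded_module_axioms R ?N"
    by unfold_locales
      (use Uc act M.ract_add_left M.ract_add_right M.ract_mult M.ract_one M.gr_ract M.R.gr_carrier in auto)
  ultimately show ?thesis
    unfolding graded_submodule_def graded_module_def using U M.R.graded_ring_axioms by auto
qed

lemma graded_submoduleD:
  assumes M: "graded_module R M" and S: "graded_submodule R M U"
  shows "U \<subseteq> carrier M" "\<zero>\<^bsub>M\<^esub> \<in> U"
    and "\<And>x y. \<lbrakk>x \<in> U; y \<in> U\<rbrakk> \<Longrightarrow> x \<oplus>\<^bsub>M\<^esub> y \<in> U"
    and "\<And>x. x \<in> U \<Longrightarrow> \<ominus>\<^bsub>M\<^esub> x \<in> U"
    and "\<And>x r. \<lbrakk>x \<in> U; r \<in> carrier R\<rbrakk> \<Longrightarrow> x \<cdot>\<^bsub>M\<^esub> r \<in> U"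
    and "\<And>x i. x \<in> U \<Longrightarrow> gcomp M x i \<in> U"
proof -
  interpret M: graded_module R M by fact
  show sub: "U \<subseteq> carrier M" using S by (simp add: graded_submodule_def)
  interpret N: graded_module R "restr M U" using S by (simp add: graded_submodule_def)
  have incl: "add_hom (restr M U) M (\<lambda>x. x)" using sub by (auto simp: add_hom_def)
  show "\<zero>\<^bsub>M\<^esub> \<in> U" using N.M.zero_closed by simp
  show "x \<oplus>\<^bsub>M\<^esub> y \<in> U" if "x \<in> U" "y \<in> U" for x y using N.M.a_closed[of x y] that by simp
  show "\<ominus>\<^bsub>M\<^esub> x \<in> U" if "x \<in> U" for x
    using N.M.a_inv_closed[of x] that
      add_hom_neg[OF incl N.M.abelian_group_axioms M.M.abelian_group_axioms, of x] by simp
  show "x \<cdot>\<^bsub>M\<^esub> r \<in> U" if "x \<in> U" "r \<in> carrier R" for x r using N.ract_closed[of x r] that by simp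
  show "gcomp M x i \<in> U" if "x \<in> U" for x i
    using gcomp_shift[OF N.M.graded_group_axioms M.M.graded_group_axioms incl, of 0 x i] that
      N.M.gcomp_closed[of x i] by simp
qed

text \<open>The composite \<open>e\<close> of \<open>q\<close> and \<open>i\<close> is an idempotent
  graded endomorphism of \<open>H\<close>, so \<open>H\<close> is the direct sum of its fixed
  points, onto which \<open>i\<close> maps \<open>X\<close>, and of its kernel.\<close>

lemma summand_of_split:
  fixes H :: "('r, 'm) graded"
  assumes H: "graded_module R H" and i: "i \<in> graded_hom R X H" and q: "q \<in> graded_hom R H X"
    and qi: "\<And>x. x \<in> carrier X \<Longrightarrow> q (i x) = x" and Xgr: "\<And>k. gr X k \<subseteq> carrier X"
  shows "\<exists>U. direct_summand R H U \<and> graded_iso R X (restr H U)"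
proof -
  interpret H: graded_module R H by fact
  define e where "e y = i (q y)" for y
  have e: "e \<in> graded_hom R H H" unfolding e_def using graded_hom_comp[OF q i] .
  note eh = graded_hom_mod_hom[OF e]
  have ic: "i x \<in> carrier H" if "x \<in> carrier X" for x
    using mod_hom_closed[OF graded_hom_mod_hom[OF i] that] .
  have qc: "q y \<in> carrier X" if "y \<in> carrier H" for y
    using mod_hom_closed[OF graded_hom_mod_hom[OF q] that] .
  have ee: "e (e y) = e y" if "y \<in> carrier H" for y using that qi qc by (simp add: e_def)
  note e0 = mod_hom_zero[OF eh H H] and ec = mod_hom_closed[OF eh]
  define U where "U = {y \<in> carrier H. e y = y}"
  define V where "V = {y \<in> carrier H. e y = \<zero>\<^bsub>H\<^esub>}"
  have 1: "graded_submodule R H U"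
    by (rule graded_submoduleI[OF H])
      (auto simp: U_def e0 mod_hom_add[OF eh] mod_hom_neg[OF eh H H] mod_hom_ract[OF eh]
        H.ract_closed gcomp_graded_hom[OF H H e, symmetric] H.M.gcomp_closed)
  have 2: "graded_submodule R H V"
    by (rule graded_submoduleI[OF H])
      (auto simp: V_def e0 mod_hom_add[OF eh] mod_hom_neg[OF eh H H] mod_hom_ract[OF eh] H.M.gcomp_zero
        H.ract_closed gcomp_graded_hom[OF H H e, symmetric] H.M.gcomp_closed H.ract_zero_left)
  have 3: "U \<inter> V = {\<zero>\<^bsub>H\<^esub>}" by (auto simp: U_def V_def e0)
  have 4: "U <+>\<^bsub>H\<^esub> V = carrier H"
  proof
    show "U <+>\<^bsub>H\<^esub> V \<subseteq> carrier H" by (auto simp: set_add_def' U_def V_def)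
    show "carrier H \<subseteq> U <+>\<^bsub>H\<^esub> V"
    proof
      fix y assume y: "y \<in> carrier H"
      have "y \<ominus>\<^bsub>H\<^esub> e y \<in> V"
        using y by (simp add: V_def mod_hom_minus[OF eh H H] ec ee H.M.minus_eq_zero_iff)
      moreover have "e y \<in> U" using y by (simp add: U_def ec ee)
      moreover have "y = e y \<oplus>\<^bsub>H\<^esub> (y \<ominus>\<^bsub>H\<^esub> e y)"
        using H.M.minus_add_cancel(1)[OF y ec[OF y]] y by (simp add: H.M.a_comm ec)
      ultimately show "y \<in> U <+>\<^bsub>H\<^esub> V" unfolding set_add_def' by blast
    qed
  qed
  have "i \<in> graded_hom R X (restr H U)"
  proof -
    have "i x \<in> U" if "x \<in> carrier X" for x using ic[OF that] qi[OF that] by (simp add: U_def e_def)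
    then show ?thesis using i Xgr unfolding graded_hom_def restr_simps by blast
  qed
  moreover have "bij_betw i (carrier X) U"
    by (rule bij_betw_byWitness[where f' = q]) (auto simp: U_def e_def qi ic qc)
  ultimately show ?thesis
    using 1 2 3 4 by (auto simp: direct_summand_def graded_iso_def)
qed

text \<open>\<open>X\<close> is only asked to be closed under its operations: linearity of the
  inverse isomorphism is derived from that of \<open>i\<close> by injectivity. In this form the
  lemma applies directly to localisations. The projection is merely linear; degrees are restored by
  \<open>graded_retraction\<close>.\<close>

lemma split_of_summand:
  fixes H :: "('r, 'm) graded"
  assumes H: "graded_module R H" and U: "direct_summand R H U" and iso: "graded_iso R X (restr H U)"
    and Xadd: "\<And>x y. \<lbrakk>x \<in> carrier X; y \<in> carrier X\<rbrakk> \<Longrightarrow> x \<oplus>\<^bsub>X\<^esub> y \<in> carrier X"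
    and Xact: "\<And>x r. \<lbrakk>x \<in> carrier X; r \<in> carrier R\<rbrakk> \<Longrightarrow> x \<cdot>\<^bsub>X\<^esub> r \<in> carrier X"
  shows "\<exists>i q. i \<in> graded_hom R X H \<and> mod_hom R H X q \<and> (\<forall>x\<in>carrier X. q (i x) = x)"
proof -
  interpret H: graded_module R H by fact
  obtain V where Us: "graded_submodule R H U" and Vs: "graded_submodule R H V"
    and UV: "U \<inter> V = {\<zero>\<^bsub>H\<^esub>}" and sum: "U <+>\<^bsub>H\<^esub> V = carrier H"
    using U by (auto simp: direct_summand_def)
  note Ud = graded_submoduleD[OF H Us] and Vd = graded_submoduleD[OF H Vs]
  obtain i where i: "i \<in> graded_hom R X (restr H U)" and bij: "bij_betw i (carrier X) U"
    using iso by (auto simp: graded_iso_def)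
  have iH: "i \<in> graded_hom R X H" using i Ud(1) by (auto simp: graded_hom_def)
  have uniq: "u = u'" if "u \<in> U" "v \<in> V" "u' \<in> U" "v' \<in> V" "u \<oplus>\<^bsub>H\<^esub> v = u' \<oplus>\<^bsub>H\<^esub> v'" for u u' v v'
  proof -
    have c: "u \<in> carrier H" "v \<in> carrier H" "u' \<in> carrier H" "v' \<in> carrier H"
      using that Ud(1) Vd(1) by auto
    have "u \<ominus>\<^bsub>H\<^esub> u' = v' \<ominus>\<^bsub>H\<^esub> v"
      using H.M.add_eq_add_imp_minus_eq[OF that(5)] c by blast
    moreover have "u \<ominus>\<^bsub>H\<^esub> u' \<in> U" "v' \<ominus>\<^bsub>H\<^esub> v \<in> V"
      using that Ud(3,4) Vd(3,4) by (auto simp: a_minus_def)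
    ultimately have "u \<ominus>\<^bsub>H\<^esub> u' \<in> U \<inter> V" by simp
    then show ?thesis using UV c by (simp add: H.M.minus_eq_zero_iff)
  qed
  define pr where "pr y = (SOME u. u \<in> U \<and> (\<exists>v\<in>V. y = u \<oplus>\<^bsub>H\<^esub> v))" for y
  have pr: "pr y \<in> U \<and> (\<exists>v\<in>V. y = pr y \<oplus>\<^bsub>H\<^esub> v)" if "y \<in> carrier H" for y
  proof -
    have "y \<in> U <+>\<^bsub>H\<^esub> V" using that sum by simp
    then have "\<exists>u. u \<in> U \<and> (\<exists>v\<in>V. y = u \<oplus>\<^bsub>H\<^esub> v)" unfolding set_add_def' by blast
    then show ?thesis unfolding pr_def by (rule someI_ex)
  qed
  have prI: "pr (u \<oplus>\<^bsub>H\<^esub> v) = u" if "u \<in> U" "v \<in> V" for u v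
  proof -
    have "u \<oplus>\<^bsub>H\<^esub> v \<in> carrier H" using that Ud(1) Vd(1) by auto
    from pr[OF this] obtain v' where "pr (u \<oplus>\<^bsub>H\<^esub> v) \<in> U" "v' \<in> V" "u \<oplus>\<^bsub>H\<^esub> v = pr (u \<oplus>\<^bsub>H\<^esub> v) \<oplus>\<^bsub>H\<^esub> v'"
      by blast
    from uniq[OF this(1,2) that this(3)[symmetric]] show ?thesis .
  qed
  have pr_add: "pr (x \<oplus>\<^bsub>H\<^esub> y) = pr x \<oplus>\<^bsub>H\<^esub> pr y" if x: "x \<in> carrier H" and y: "y \<in> carrier H" for x y
  proof -
    obtain v w where v: "v \<in> V" "x = pr x \<oplus>\<^bsub>H\<^esub> v" and w: "w \<in> V" "y = pr y \<oplus>\<^bsub>H\<^esub> w"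
      using pr x y by blast
    have c: "pr x \<in> U" "pr y \<in> U" "pr x \<in> carrier H" "pr y \<in> carrier H" "v \<in> carrier H" "w \<in> carrier H"
      using pr[OF x, THEN conjunct1] pr[OF y, THEN conjunct1] v(1) w(1) Ud(1) Vd(1) by auto
    have "x \<oplus>\<^bsub>H\<^esub> y = (pr x \<oplus>\<^bsub>H\<^esub> v) \<oplus>\<^bsub>H\<^esub> (pr y \<oplus>\<^bsub>H\<^esub> w)"
      by (rule arg_cong2[OF v(2) w(2)])
    also have "\<dots> = (pr x \<oplus>\<^bsub>H\<^esub> pr y) \<oplus>\<^bsub>H\<^esub> (v \<oplus>\<^bsub>H\<^esub> w)"
      using c by (simp add: H.M.a_ac)
    finally show ?thesis using prI[OF Ud(3)[OF c(1,2)] Vd(3)[OF v(1) w(1)]] by (rule_tac trans[OF arg_cong[of _ _ pr]])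
  qed
  have pr_act: "pr (x \<cdot>\<^bsub>H\<^esub> r) = pr x \<cdot>\<^bsub>H\<^esub> r" if x: "x \<in> carrier H" and r: "r \<in> carrier R" for x r
  proof -
    obtain v where v: "v \<in> V" "x = pr x \<oplus>\<^bsub>H\<^esub> v" using pr x by blast
    have c: "pr x \<in> U" "pr x \<in> carrier H" "v \<in> carrier H" 
      using pr[OF x, THEN conjunct1] v(1) Ud(1) Vd(1) by auto
    have "x \<cdot>\<^bsub>H\<^esub> r = (pr x \<oplus>\<^bsub>H\<^esub> v) \<cdot>\<^bsub>H\<^esub> r" by (rule arg_cong[OF v(2)])
    also have "\<dots> = (pr x \<cdot>\<^bsub>H\<^esub> r) \<oplus>\<^bsub>H\<^esub> (v \<cdot>\<^bsub>H\<^esub> r)" using c r by (simp add: H.ract_add_left)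
    finally show ?thesis using prI[OF Ud(5)[OF c(1) r] Vd(5)[OF v(1) r]] by (rule_tac trans[OF arg_cong[of _ _ pr]])
  qed
  define j where "j = inv_into (carrier X) i"
  have j: "j u \<in> carrier X" "i (j u) = u" if "u \<in> U" for u
    using bij that by (auto simp: j_def bij_betw_def inv_into_into f_inv_into_f)
  have ji: "j (i x) = x" if "x \<in> carrier X" for x
    using bij that by (auto simp: j_def bij_betw_def)
  have iU: "i x \<in> U" if "x \<in> carrier X" for x using bij that by (auto simp: bij_betw_def)
  note ih = graded_hom_mod_hom[OF iH]
  have "mod_hom R H X (\<lambda>y. j (pr y))"
  proof (rule mod_homI)
    show "j (pr y) \<in> carrier X" if "y \<in> carrier H" for y using j pr[OF that, THEN conjunct1] by blast
    fix x assume x: "x \<in> carrier H"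
    show "j (pr (x \<oplus>\<^bsub>H\<^esub> y)) = j (pr x) \<oplus>\<^bsub>X\<^esub> j (pr y)" if y: "y \<in> carrier H" for y
    proof -
      have "i (j (pr x) \<oplus>\<^bsub>X\<^esub> j (pr y)) = pr (x \<oplus>\<^bsub>H\<^esub> y)"
        using j pr[OF x, THEN conjunct1] pr[OF y, THEN conjunct1] by (simp add: mod_hom_add[OF ih] pr_add x y)
      then show ?thesis using ji[of "j (pr x) \<oplus>\<^bsub>X\<^esub> j (pr y)"] Xadd j(1)[OF pr[OF x, THEN conjunct1]]
          j(1)[OF pr[OF y, THEN conjunct1]] by simp
    qed
    show "j (pr (x \<cdot>\<^bsub>H\<^esub> r)) = j (pr x) \<cdot>\<^bsub>X\<^esub> r" if r: "r \<in> carrier R" for r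
    proof -
      have "i (j (pr x) \<cdot>\<^bsub>X\<^esub> r) = pr (x \<cdot>\<^bsub>H\<^esub> r)"
        using j pr[OF x, THEN conjunct1] r by (simp add: mod_hom_ract[OF ih] pr_act x)
      then show ?thesis using ji[of "j (pr x) \<cdot>\<^bsub>X\<^esub> r"] Xact j(1)[OF pr[OF x, THEN conjunct1]] r by simp
    qed
  qed
  moreover have "j (pr (i x)) = x" if x: "x \<in> carrier X" for x
    using prI[OF iU[OF x] Vd(2)] iU[OF x] Ud(1) ji[OF x] by auto
  ultimately show ?thesis using iH by blast
qed

section \<open>Cohomology\<close>

lemma additive_subgroup_finsum:
  assumes "abelian_group G" "additive_subgroup N G" "f \<in> F \<rightarrow> N"
  shows "finsum G f F \<in> N"
proof -
  interpret G: abelian_group G by fact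
  have N: "N \<subseteq> carrier G" using additive_subgroup.a_subset[OF assms(2)] .
  show ?thesis
    using assms(3)
  proof (induction F rule: infinite_finite_induct)
    case (insert i F)
    then have "f i \<in> N" "finsum G f F \<in> N" "f \<in> F \<rightarrow> carrier G" "f i \<in> carrier G" using N by auto
    then show ?case using insert additive_subgroup.a_closed[OF assms(2)] by simp
  qed (simp_all add: additive_subgroup.zero_closed[OF assms(2)])
qed

text \<open>Complexes of graded groups without any multiplication, so that cohomology is built once
  for both dg algebras and dg modules.\<close>

locale dg_group = graded_group M for M :: "('s, 'm) dg" (structure) +
  assumes d_closed: "x \<in> carrier M \<Longrightarrow> diff M x \<in> carrier M"
    and d_add: "\<lbrakk>x \<in> carrier M; y \<in> carrier M\<rbrakk> \<Longrightarrow> diff M (x \<oplus> y) = diff M x \<oplus> diff M y"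
    and d_degree: "x \<in> gr M i \<Longrightarrow> diff M x \<in> gr M (i + 1)"
    and d_d: "x \<in> carrier M \<Longrightarrow> diff M (diff M x) = \<zero>"

definition cls :: "('s, 'm) dg \<Rightarrow> 'm \<Rightarrow> 'm set"
  where "cls M z = boundaries M +>\<^bsub>M\<^esub> z"

lemma cohomology_with_simps:
  "carrier (cohomology_with act M) = cls M ` cycles M"
  "\<zero>\<^bsub>cohomology_with act M\<^esub> = boundaries M"
  "\<xi> \<oplus>\<^bsub>cohomology_with act M\<^esub> \<eta> = \<xi> <+>\<^bsub>M\<^esub> \<eta>"
  "\<xi> \<cdot>\<^bsub>cohomology_with act M\<^esub> r = act r \<xi>"
  "gr (cohomology_with act M) i = cls M ` (cycles M \<inter> gr M i)"
  by (auto simp: cohomology_with_def Let_def FactRing_def cls_def A_RCOSETS_def' a_r_coset_def' set_add_def')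

lemma cohomology_with_mult:
  "\<xi> \<otimes>\<^bsub>cohomology_with act M\<^esub> \<eta> = (\<Union>a\<in>\<xi>. \<Union>b\<in>\<eta>. cls M (a \<otimes>\<^bsub>M\<^esub> b))"
  "\<one>\<^bsub>cohomology_with act M\<^esub> = cls M \<one>\<^bsub>M\<^esub>"
  by (simp_all add: cohomology_with_def Let_def FactRing_def cls_def a_r_coset_def' rcoset_mult_def)

context dg_group
begin

lemma add_hom_diff: "add_hom M M (diff M)"
  by (simp add: add_hom_def d_closed d_add)

lemmas d_zero = add_hom_zero[OF add_hom_diff abelian_group_axioms abelian_group_axioms]
  and d_neg = add_hom_neg[OF add_hom_diff abelian_group_axioms abelian_group_axioms]
  and d_minus = add_hom_minus[OF add_hom_diff abelian_group_axioms abelian_group_axioms]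
  and d_finsum = add_hom_finsum[OF add_hom_diff abelian_group_axioms abelian_group_axioms]

lemma gcomp_diff: "x \<in> carrier M \<Longrightarrow> gcomp M (diff M x) (i + 1) = diff M (gcomp M x i)"
  using gcomp_shift[OF graded_group_axioms graded_group_axioms add_hom_diff d_degree] by blast

lemma cyclesI: "\<lbrakk>x \<in> carrier M; diff M x = \<zero>\<rbrakk> \<Longrightarrow> x \<in> cycles M"
  by (simp add: cycles_def)

lemma cyclesD: "x \<in> cycles M \<Longrightarrow> x \<in> carrier M" "x \<in> cycles M \<Longrightarrow> diff M x = \<zero>"
  by (simp_all add: cycles_def)

lemma cycles_subgroup: "additive_subgroup (cycles M) M"
  by (rule additive_subgroup.intro, rule add.subgroupI)
    (auto simp: cycles_def d_add d_neg d_zero)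

lemma boundaries_subgroup: "additive_subgroup (boundaries M) M"
proof (rule additive_subgroup.intro, rule add.subgroupI)
  show "boundaries M \<subseteq> carrier M" "boundaries M \<noteq> {}"
    using d_closed by (auto simp: boundaries_def)
  fix x y assume x: "x \<in> boundaries M" and "y \<in> boundaries M"
  then obtain u v where "u \<in> carrier M" "x = diff M u" "v \<in> carrier M" "y = diff M v"
    by (auto simp: boundaries_def)
  then show "\<ominus> x \<in> boundaries M" "x \<oplus> y \<in> boundaries M"
    by (auto simp: boundaries_def d_add[symmetric] d_neg[symmetric])
qed

lemma boundariesI: "x \<in> carrier M \<Longrightarrow> diff M x \<in> boundaries M"
  by (simp add: boundaries_def)

lemma boundariesE: "y \<in> boundaries M \<Longrightarrow> (\<And>x. \<lbrakk>x \<in> carrier M; y = diff M x\<rbrakk> \<Longrightarrow> P) \<Longrightarrow> P"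
  by (auto simp: boundaries_def)

lemma boundaries_cycles: "boundaries M \<subseteq> cycles M"
  by (auto simp: boundaries_def cycles_def d_closed d_d)

lemma boundaries_carrier: "boundaries M \<subseteq> carrier M"
  using additive_subgroup.a_subset[OF boundaries_subgroup] .

lemma gcomp_cycles: "x \<in> cycles M \<Longrightarrow> gcomp M x i \<in> cycles M"
  using gcomp_diff[of x i] by (simp add: cycles_def gcomp_closed gcomp_zero)

lemma gcomp_boundaries: "x \<in> boundaries M \<Longrightarrow> gcomp M x i \<in> boundaries M"
proof (elim boundariesE)
  fix y assume "y \<in> carrier M" "x = diff M y"
  then show "gcomp M x i \<in> boundaries M"
    using gcomp_diff[of y "i - 1"] by (simp add: boundariesI gcomp_closed)
qed

text \<open>Take the component of degree \<open>i - 1\<close> of any preimage. Attaching cells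
  requires homogeneous data, and this supplies it wherever a cycle is known to be a
  boundary.\<close>

lemma boundary_homogeneous:
  assumes "x \<in> boundaries M" "x \<in> gr M i"
  obtains y where "y \<in> gr M (i - 1)" "x = diff M y"
proof -
  obtain y where y: "y \<in> carrier M" "x = diff M y" using assms(1) by (rule boundariesE)
  have "x = gcomp M x i" using assms(2) by (simp add: gcomp_homogeneous)
  also have "\<dots> = diff M (gcomp M y (i - 1))" using gcomp_diff[OF y(1), of "i - 1"] y(2) by simp
  finally show thesis using that gcomp_props(1)[OF y(1)] by blast
qed

interpretation B: abelian_subgroup "boundaries M" M
  by (rule abelian_subgroupI3[OF boundaries_subgroup abelian_group_axioms])

lemma cls_eq_iff:
  assumes "x \<in> carrier M" "y \<in> carrier M"
  shows "cls M x = cls M y \<longleftrightarrow> x \<ominus> y \<in> boundaries M"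
  using B.a_rcos_module[OF assms(2,1)] B.a_rcos_self[OF assms(1)]
    a_repr_independence[OF _ assms(2) B.a_subgroup, of x]
  unfolding a_minus_def cls_def by metis

lemma cls_self: "x \<in> carrier M \<Longrightarrow> x \<in> cls M x"
  unfolding cls_def by (rule B.a_rcos_self)

lemma cls_rep: "\<lbrakk>x \<in> cls M y; y \<in> carrier M\<rbrakk> \<Longrightarrow> x \<in> carrier M \<and> cls M x = cls M y"
  unfolding cls_def using B.a_elemrcos_carrier[of y x] a_repr_independence[OF _ _ B.a_subgroup, of x y] by simp

lemma cls_add: "\<lbrakk>x \<in> carrier M; y \<in> carrier M\<rbrakk> \<Longrightarrow> cls M x <+>\<^bsub>M\<^esub> cls M y = cls M (x \<oplus> y)"
  unfolding cls_def by (rule B.a_rcos_sum)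

lemma cls_zero: "cls M \<zero> = boundaries M"
  unfolding cls_def by (simp add: boundaries_carrier)

lemma cls_zero_iff: "x \<in> carrier M \<Longrightarrow> cls M x = boundaries M \<longleftrightarrow> x \<in> boundaries M"
  using cls_eq_iff[of x \<zero>] by (simp add: cls_zero minus_zero_right)

lemma cls_rep_cycle: "\<lbrakk>x \<in> cls M y; y \<in> cycles M\<rbrakk> \<Longrightarrow> x \<in> cycles M"
proof -
  assume xy: "x \<in> cls M y" and y: "y \<in> cycles M"
  then have x: "x \<in> carrier M" "cls M x = cls M y" using cls_rep[OF xy cyclesD(1)[OF y]] by blast+
  then have "x \<ominus> y \<in> cycles M" using cls_eq_iff boundaries_cycles y cyclesD by blast
  then have "(x \<ominus> y) \<oplus> y \<in> cycles M" using y additive_subgroup.a_closed[OF cycles_subgroup] by blast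
  then show ?thesis using minus_add_cancel(1)[OF x(1) cyclesD(1)[OF y]] by simp
qed

lemma coh_abelian_group: "abelian_group (cohomology_with act M)"
proof -
  note cc = cyclesD(1) additive_subgroup.a_closed[OF cycles_subgroup]
    additive_subgroup.a_inv_closed[OF cycles_subgroup] additive_subgroup.zero_closed[OF cycles_subgroup]
  show ?thesis
  proof (rule abelian_groupI)
    fix x assume "x \<in> carrier (cohomology_with act M)"
    then obtain u where u: "u \<in> cycles M" "x = cls M u" by (auto simp: cohomology_with_simps)
    then have "cls M (\<ominus> u) \<oplus>\<^bsub>cohomology_with act M\<^esub> x = \<zero>\<^bsub>cohomology_with act M\<^esub>"
      using cc by (simp add: cohomology_with_simps cls_add l_neg cls_zero)
    then show "\<exists>y\<in>carrier (cohomology_with act M).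
        y \<oplus>\<^bsub>cohomology_with act M\<^esub> x = \<zero>\<^bsub>cohomology_with act M\<^esub>"
      using u cc by (auto simp: cohomology_with_simps)
    show "\<zero>\<^bsub>cohomology_with act M\<^esub> \<oplus>\<^bsub>cohomology_with act M\<^esub> x = x"
      using u cc by (simp add: cohomology_with_simps cls_add cls_zero[symmetric])
  next
    show "\<zero>\<^bsub>cohomology_with act M\<^esub> \<in> carrier (cohomology_with act M)"
      using cc cls_zero by (auto simp: cohomology_with_simps)
  qed (use cc in \<open>auto simp: cohomology_with_simps cls_add a_ac\<close>)
qed

lemma coh_finsum:
  assumes "f \<in> F \<rightarrow> cycles M"
  shows "finsum (cohomology_with act M) (\<lambda>i. cls M (f i)) F = cls M (finsum M f F)"
  using assms
proof (induction F rule: infinite_finite_induct)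
  interpret H: abelian_group "cohomology_with act M" by (rule coh_abelian_group)
  {
    case (infinite F)
    then show ?case by (simp add: cls_zero cohomology_with_simps)
  next
    case empty
    then show ?case by (simp add: cls_zero cohomology_with_simps)
  next
    case (insert i F)
    then have fi: "f i \<in> cycles M" "f \<in> F \<rightarrow> cycles M" by auto
    then have fc: "f i \<in> carrier M" "f \<in> F \<rightarrow> carrier M" using cyclesD by auto
    have "(\<lambda>i. cls M (f i)) \<in> F \<rightarrow> carrier (cohomology_with act M)"
      "cls M (f i) \<in> carrier (cohomology_with act M)"
      using fi by (auto simp: cohomology_with_simps)
    then show ?case
      using insert fi fc by (simp add: cohomology_with_simps cls_add finsum_closed)
  }
qed

text \<open>The components of a class are the classes of the components of a representing cycle. The
  representative does not matter because boundaries are closed under taking components.\<close>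

lemma coh_graded_group: "graded_group (cohomology_with act M)"
proof -
  let ?H = "cohomology_with act M"
  interpret H: abelian_group ?H by (rule coh_abelian_group)
  define c where "c \<xi> i = cls M (gcomp M (SOME z. z \<in> cycles M \<and> \<xi> = cls M z) i)" for \<xi> i
  note cc = cyclesD(1) additive_subgroup.a_closed[OF cycles_subgroup]
    additive_subgroup.zero_closed[OF cycles_subgroup]
  have neg: "\<ominus> z \<in> cycles M" if "z \<in> cycles M" for z
    using that by (simp add: cycles_def d_neg)
  have c: "c (cls M z) i = cls M (gcomp M z i)" if z: "z \<in> cycles M" for z i
  proof -
    define w where "w = (SOME w. w \<in> cycles M \<and> cls M z = cls M w)"
    have w: "w \<in> cycles M \<and> cls M z = cls M w" unfolding w_def by (rule someI[of _ z]) (use z in auto)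
    then have "w \<ominus> z \<in> boundaries M" using cls_eq_iff[of w z] z cc by auto
    then have "gcomp M (w \<ominus> z) i \<in> boundaries M" by (rule gcomp_boundaries)
    moreover have "gcomp M w i = gcomp M (w \<ominus> z) i \<oplus> gcomp M z i"
      using gcomp_add[of "w \<ominus> z" z i] minus_add_cancel(1)[of w z] w z cc by simp
    ultimately have "cls M (gcomp M w i) = cls M (gcomp M z i)"
      using w z cc by (simp add: cls_eq_iff gcomp_closed minus_add_cancel(2))
    then show ?thesis unfolding c_def w_def .
  qed
  show ?thesis
  proof (rule graded_groupI[where c = c])
    show "abelian_group ?H" by (rule H.abelian_group_axioms)
    show "additive_subgroup (gr ?H i) ?H" for i
    proof (rule additive_subgroup.intro, rule H.add.subgroupI)
      show "gr ?H i \<subseteq> carrier ?H" by (auto simp: cohomology_with_simps)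
      show "gr ?H i \<noteq> {}" using cc gr_zero by (auto simp: cohomology_with_simps)
      fix x assume "x \<in> gr ?H i"
      then obtain u where u: "u \<in> cycles M" "u \<in> gr M i" "x = cls M u"
        by (auto simp: cohomology_with_simps)
      have "cls M (\<ominus> u) \<oplus>\<^bsub>?H\<^esub> x = \<zero>\<^bsub>?H\<^esub>"
        using u cc neg by (simp add: cohomology_with_simps cls_add l_neg cls_zero)
      then have "\<ominus>\<^bsub>?H\<^esub> x = cls M (\<ominus> u)"
        using u neg by (intro H.minus_equality) (auto simp: cohomology_with_simps)
      then show "\<ominus>\<^bsub>?H\<^esub> x \<in> gr ?H i" using u neg gr_neg by (auto simp: cohomology_with_simps)
      fix y assume "y \<in> gr ?H i"
      then obtain v where v: "v \<in> cycles M" "v \<in> gr M i" "y = cls M v"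
        by (auto simp: cohomology_with_simps)
      then show "x \<oplus>\<^bsub>?H\<^esub> y \<in> gr ?H i"
        using u v cc gr_add by (auto simp: cohomology_with_simps cls_add)
    qed
    fix x i assume "x \<in> carrier ?H"
    then obtain u where u: "u \<in> cycles M" "x = cls M u" by (auto simp: cohomology_with_simps)
    show "c x i \<in> gr ?H i"
      using u c cc gcomp_props gcomp_cycles by (auto simp: cohomology_with_simps)
    have sub: "{i. c x i \<noteq> \<zero>\<^bsub>?H\<^esub>} \<subseteq> {i. gcomp M u i \<noteq> \<zero>}"
      using c[OF u(1)] u(2) by (auto simp: cohomology_with_simps cls_zero)
    then show "finite {i. c x i \<noteq> \<zero>\<^bsub>?H\<^esub>}" using gcomp_props(2) u cc finite_subset by blast
    have "finsum ?H (c x) {i. c x i \<noteq> \<zero>\<^bsub>?H\<^esub>} = finsum ?H (c x) {i. gcomp M u i \<noteq> \<zero>}"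
      by (rule H.finsum_support[symmetric])
        (use sub u c cc gcomp_props gcomp_cycles in \<open>auto simp: cohomology_with_simps\<close>)
    also have "\<dots> = finsum ?H (\<lambda>i. cls M (gcomp M u i)) {i. gcomp M u i \<noteq> \<zero>}"
      using u c by (intro arg_cong2[where f = "finsum ?H"]) auto
    also have "\<dots> = cls M (finsum M (gcomp M u) {i. gcomp M u i \<noteq> \<zero>})"
      by (rule coh_finsum) (use gcomp_cycles u in auto)
    also have "\<dots> = x" using gcomp_props(3)[OF cc(1)[OF u(1)]] u(2) by simp
    finally show "finsum ?H (c x) {i. c x i \<noteq> \<zero>\<^bsub>?H\<^esub>} = x" .
    fix y assume "y \<in> carrier ?H"
    then obtain v where v: "v \<in> cycles M" "y = cls M v" by (auto simp: cohomology_with_simps)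
    show "c (x \<oplus>\<^bsub>?H\<^esub> y) i = c x i \<oplus>\<^bsub>?H\<^esub> c y i"
      using u v cc by (simp add: cohomology_with_simps cls_add c gcomp_add gcomp_closed)
  next
    fix x i j assume "x \<in> gr ?H j"
    then obtain u where u: "u \<in> cycles M" "u \<in> gr M j" "x = cls M u"
      by (auto simp: cohomology_with_simps)
    then show "c x i = (if i = j then x else \<zero>\<^bsub>?H\<^esub>)"
      by (simp add: c gcomp_homogeneous cohomology_with_simps cls_zero)
  qed
qed

end

section \<open>Signs, and the cohomology of dg algebras and dg modules\<close>

lemma dg_algebra_group: "dg_algebra K A \<Longrightarrow> dg_group A"
  by (simp add: dg_algebra_def dg_algebra_axioms_def dg_group_def dg_group_axioms_def graded_ring_def)

lemma dg_module_group: "dg_module A M \<Longrightarrow> dg_group M"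
  by (simp add: dg_module_def dg_module_axioms_def dg_group_def dg_group_axioms_def graded_module_def)

lemma koszul_zero: "abelian_group G \<Longrightarrow> koszul G n \<zero>\<^bsub>G\<^esub> = \<zero>\<^bsub>G\<^esub>"
  by (metis abelian_group.minus_equality abelian_groupE(2,5) koszul_def)

lemma koszul_closed: "\<lbrakk>abelian_group G; x \<in> carrier G\<rbrakk> \<Longrightarrow> koszul G n x \<in> carrier G"
  by (simp add: koszul_def abelian_group.a_inv_closed)

lemma koszul_koszul:
  "\<lbrakk>abelian_group G; x \<in> carrier G\<rbrakk> \<Longrightarrow> koszul G m (koszul G n x) = koszul G (m + n) x"
  by (auto simp: koszul_def abelian_group.minus_minus)

lemma add_hom_koszul: "abelian_group G \<Longrightarrow> add_hom G G (koszul G n)"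
  by (auto simp: add_hom_def koszul_def abelian_group.a_inv_closed abelian_group.minus_add
      abelian_groupE(1))

lemma koszul_hom:
  "\<lbrakk>add_hom G H \<phi>; abelian_group G; abelian_group H; x \<in> carrier G\<rbrakk> \<Longrightarrow> \<phi> (koszul G n x) = koszul H n (\<phi> x)"
  by (simp add: koszul_def add_hom_neg)

lemma koszul_in_subgroup:
  "\<lbrakk>additive_subgroup N G; abelian_group G; x \<in> N\<rbrakk> \<Longrightarrow> koszul G n x \<in> N"
  by (simp add: koszul_def additive_subgroup.a_inv_closed)

lemma koszul_even: "even n \<Longrightarrow> koszul G n x = x"
  by (simp add: koszul_def)

text \<open>What is kept of a dg algebra: the graded ring and its differential, from which dg
  modules and their cohomology are defined.\<close>

locale dg_ring = A?: graded_ring A + dg_group A for A :: "('k, 'a) dg" (structure) +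
  assumes d_leibniz: "\<lbrakk>a \<in> gr A i; b \<in> carrier A\<rbrakk> \<Longrightarrow>
      diff A (a \<otimes> b) = (diff A a \<otimes> b) \<oplus> koszul A i (a \<otimes> diff A b)"

lemma dg_algebra_ring: "dg_algebra K A \<Longrightarrow> dg_ring A"
  by (intro dg_ring.intro dg_ring_axioms.intro dg_algebra_group)
    (auto simp: dg_algebra_def dg_algebra_axioms_def)

context dg_ring
begin

text \<open>With a cycle on the right, the term of the Leibniz rule that carries the sign vanishes;
  the resulting formula is additive in \<open>a\<close> and extends to inhomogeneous
  elements.\<close>

lemma d_mult_cycle: "\<lbrakk>a \<in> carrier A; z \<in> cycles A\<rbrakk> \<Longrightarrow> diff A (a \<otimes> z) = diff A a \<otimes> z"
proof (induction a rule: graded_induct)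
  case (homogeneous i x)
  then show ?case
    using d_leibniz[of x i z] gr_carrier[of x i] cyclesD[of z] d_closed
    by (simp add: koszul_zero abelian_group_axioms)
next
  case (add x y)
  then show ?case using cyclesD[of z] by (simp add: l_distr d_add d_closed)
qed

lemma mult_cycles: "\<lbrakk>a \<in> cycles A; b \<in> cycles A\<rbrakk> \<Longrightarrow> a \<otimes> b \<in> cycles A"
  using cyclesD by (intro cyclesI) (auto simp: d_mult_cycle)

text \<open>With the cycle on the left, the Leibniz rule has a sign depending on its degree. Each
  component of \<open>z\<close> is again a cycle, and the components are treated one by one.\<close>

lemma cycle_mult_boundary:
  assumes "z \<in> cycles A" "b \<in> carrier A"
  shows "z \<otimes> diff A b \<in> boundaries A"
proof -
  have *: "x \<otimes> diff A b \<in> boundaries A" if x: "x \<in> cycles A" "x \<in> gr A i" for x i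
  proof -
    have "diff A (x \<otimes> b) = koszul A i (x \<otimes> diff A b)"
      using d_leibniz[OF x(2) assms(2)] x assms cyclesD d_closed
      by (simp add: koszul_closed abelian_group_axioms)
    then have "koszul A i (diff A (x \<otimes> b)) = x \<otimes> diff A b"
      using x assms cyclesD d_closed
      by (auto simp: koszul_def minus_minus split: if_splits)
    then show ?thesis
      using koszul_in_subgroup[OF boundaries_subgroup abelian_group_axioms boundariesI] x assms cyclesD
      by (metis m_closed)
  qed
  have zc: "z \<in> carrier A" using assms cyclesD by auto
  have hom: "add_hom A A (\<lambda>x. x \<otimes> diff A b)" using assms by (simp add: add_hom_def l_distr d_closed)
  have "z \<otimes> diff A b = (\<Oplus>i\<in>{i. gcomp A z i \<noteq> \<zero>}. gcomp A z i \<otimes> diff A b)"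
    using add_hom_finsum[OF hom abelian_group_axioms abelian_group_axioms,
        of "gcomp A z" "{i. gcomp A z i \<noteq> \<zero>}"] gcomp_props(3)[OF zc] gcomp_closed[OF zc] by auto
  also have "\<dots> \<in> boundaries A"
    by (rule additive_subgroup_finsum[OF abelian_group_axioms boundaries_subgroup])
      (use * gcomp_cycles gcomp_props zc assms in blast)
  finally show ?thesis .
qed

text \<open>One factor is changed at a time: the first difference is a boundary by
  \<open>d_mult_cycle\<close>, the second by \<open>cycle_mult_boundary\<close>.\<close>

lemma cls_mult_wd:
  assumes "a \<in> cycles A" "b \<in> cycles A" "a' \<in> cls A a" "b' \<in> cls A b"
  shows "cls A (a' \<otimes> b') = cls A (a \<otimes> b)"
proof -
  have c: "a' \<in> cycles A" "b' \<in> cycles A" "a \<in> carrier A" "b \<in> carrier A" "a' \<in> carrier A" "b' \<in> carrier A"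
    using assms cls_rep_cycle cyclesD by auto
  obtain u where u: "u \<in> carrier A" "a' \<ominus> a = diff A u"
    using assms c cls_rep[of a' a] cls_eq_iff[of a' a] by (auto elim!: boundariesE)
  obtain v where v: "v \<in> carrier A" "b' \<ominus> b = diff A v"
    using assms c cls_rep[of b' b] cls_eq_iff[of b' b] by (auto elim!: boundariesE)
  have "(a' \<otimes> b') \<ominus> (a \<otimes> b) = ((a' \<otimes> b') \<ominus> (a \<otimes> b')) \<oplus> ((a \<otimes> b') \<ominus> (a \<otimes> b))"
    using c by (simp add: minus_trans)
  also have "\<dots> = (a' \<ominus> a) \<otimes> b' \<oplus> a \<otimes> (b' \<ominus> b)"
    using c by (simp add: a_minus_def l_distr r_distr l_minus r_minus)
  also have "\<dots> = diff A (u \<otimes> b') \<oplus> a \<otimes> diff A v"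
    using u v c d_mult_cycle by simp
  also have "\<dots> \<in> boundaries A"
    using additive_subgroup.a_closed[OF boundaries_subgroup boundariesI cycle_mult_boundary] u v c assms
    by simp
  finally show ?thesis using c by (simp add: cls_eq_iff)
qed

lemma coh_ring_simps:
  "carrier (cohomology_ring A) = cls A ` cycles A"
  "\<zero>\<^bsub>cohomology_ring A\<^esub> = cls A \<zero>"
  "\<one>\<^bsub>cohomology_ring A\<^esub> = cls A \<one>"
  "gr (cohomology_ring A) i = cls A ` (cycles A \<inter> gr A i)"
  by (simp_all add: cohomology_ring_def cohomology_with_simps cohomology_with_mult cls_zero)

lemma coh_ring_add:
  "\<lbrakk>a \<in> cycles A; b \<in> cycles A\<rbrakk> \<Longrightarrow> cls A a \<oplus>\<^bsub>cohomology_ring A\<^esub> cls A b = cls A (a \<oplus> b)"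
  using cyclesD(1) by (simp add: cohomology_ring_def cohomology_with_simps cls_add)

lemma coh_ring_mult:
  assumes "a \<in> cycles A" "b \<in> cycles A"
  shows "cls A a \<otimes>\<^bsub>cohomology_ring A\<^esub> cls A b = cls A (a \<otimes> b)"
proof -
  have "cls A a \<otimes>\<^bsub>cohomology_ring A\<^esub> cls A b = (\<Union>a'\<in>cls A a. \<Union>b'\<in>cls A b. cls A (a \<otimes> b))"
    unfolding cohomology_ring_def cohomology_with_mult using cls_mult_wd[OF assms] by simp
  moreover have "cls A a \<noteq> {}" "cls A b \<noteq> {}"
    using cls_self[OF cyclesD(1)[OF assms(1)]] cls_self[OF cyclesD(1)[OF assms(2)]] by blast+
  ultimately show ?thesis by simp
qed

lemma one_cycle: "\<one> \<in> cycles A"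
proof (rule cyclesI)
  have "diff A \<one> \<oplus> diff A \<one> = diff A \<one>"
    using d_leibniz[OF gr_one, of \<one>] d_closed[of \<one>] by (simp add: koszul_def)
  then show "diff A \<one> = \<zero>" using d_closed[of \<one>] by simp
qed simp

lemma coh_graded_ring: "graded_ring (cohomology_ring A)"
proof -
  let ?R = "cohomology_ring A"
  note cc = cyclesD(1) additive_subgroup.a_closed[OF cycles_subgroup] mult_cycles one_cycle
  have gg: "graded_group ?R" unfolding cohomology_ring_def by (rule coh_graded_group)
  have "abelian_group ?R" using gg by (simp add: graded_group_def)
  moreover have "Group.monoid ?R"
    by (rule Group.monoidI) (use cc in \<open>auto simp: coh_ring_simps coh_ring_mult m_assoc\<close>)
  ultimately have "ring ?R"
    by (rule ringI) (use cc in \<open>auto simp: coh_ring_simps coh_ring_mult coh_ring_add l_distr r_distr\<close>)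
  moreover have "graded_ring_axioms ?R"
    by unfold_locales (use cc gr_one gr_mult in \<open>auto simp: coh_ring_simps coh_ring_mult\<close>)
  ultimately show ?thesis using gg by (simp add: graded_ring_def)
qed

end

locale dgm = A: dg_ring A + M: dg_module A M
  for A :: "('k, 'a) dg" and M :: "('a, 'm) dg"

sublocale dgm \<subseteq> M: dg_group M
  using dg_module_group[OF M.dg_module_axioms] .

context dgm
begin

lemma d_ract_cycle:
  "\<lbrakk>x \<in> carrier M; a \<in> cycles A\<rbrakk> \<Longrightarrow> diff M (x \<cdot>\<^bsub>M\<^esub> a) = diff M x \<cdot>\<^bsub>M\<^esub> a"
proof (induction x rule: M.graded_induct)
  case (homogeneous i x)
  then show ?case
    using M.mleibniz[of x i a] M.gr_carrier[of x i] A.cyclesD[of a] M.d_closed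
    by (simp add: koszul_zero M.M.abelian_group_axioms M.ract_zero_right M.ract_closed)
next
  case (add x y)
  then show ?case using A.cyclesD[of a] by (simp add: M.ract_add_left M.d_add M.d_closed M.ract_closed)
qed

lemma ract_cycles: "\<lbrakk>x \<in> cycles M; a \<in> cycles A\<rbrakk> \<Longrightarrow> x \<cdot>\<^bsub>M\<^esub> a \<in> cycles M"
  using M.cyclesD A.cyclesD
  by (intro M.cyclesI) (auto simp: d_ract_cycle M.ract_closed M.ract_zero_left)

lemma koszul_ract:
  "\<lbrakk>x \<in> carrier M; a \<in> carrier A\<rbrakk> \<Longrightarrow> x \<cdot>\<^bsub>M\<^esub> koszul A n a = koszul M n (x \<cdot>\<^bsub>M\<^esub> a)"
  by (simp add: koszul_hom[OF M.add_hom_ract_right A.A.abelian_group_axioms M.M.abelian_group_axioms])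

lemma cycle_ract_boundary:
  assumes "z \<in> cycles M" "b \<in> carrier A"
  shows "z \<cdot>\<^bsub>M\<^esub> diff A b \<in> boundaries M"
proof -
  have *: "x \<cdot>\<^bsub>M\<^esub> diff A b \<in> boundaries M" if x: "x \<in> cycles M" "x \<in> gr M i" for x i
  proof -
    have xc: "x \<in> carrier M" "x \<cdot>\<^bsub>M\<^esub> diff A b \<in> carrier M" "x \<cdot>\<^bsub>M\<^esub> b \<in> carrier M"
      using x assms M.cyclesD A.d_closed M.ract_closed by auto
    have "diff M (x \<cdot>\<^bsub>M\<^esub> b) = koszul M i (x \<cdot>\<^bsub>M\<^esub> diff A b)"
      using M.mleibniz[OF x(2) assms(2)] x assms M.cyclesD xc
      by (simp add: koszul_closed M.M.abelian_group_axioms M.ract_zero_left)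
    then have "koszul M i (diff M (x \<cdot>\<^bsub>M\<^esub> b)) = x \<cdot>\<^bsub>M\<^esub> diff A b"
      using xc by (simp add: koszul_koszul M.M.abelian_group_axioms koszul_even)
    then show ?thesis
      using koszul_in_subgroup[OF M.boundaries_subgroup M.M.abelian_group_axioms M.boundariesI[OF xc(3)], of i]
      by simp
  qed
  have zc: "z \<in> carrier M" using assms M.cyclesD by auto
  have "z \<cdot>\<^bsub>M\<^esub> diff A b = (\<Oplus>\<^bsub>M\<^esub>i\<in>{i. gcomp M z i \<noteq> \<zero>\<^bsub>M\<^esub>}. gcomp M z i \<cdot>\<^bsub>M\<^esub> diff A b)"
    using M.ract_finsum_left[OF A.d_closed[OF assms(2)], of "gcomp M z" "{i. gcomp M z i \<noteq> \<zero>\<^bsub>M\<^esub>}"]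
      M.M.gcomp_props(3)[OF zc] M.M.gcomp_closed[OF zc] by auto
  also have "\<dots> \<in> boundaries M"
    by (rule additive_subgroup_finsum[OF M.M.abelian_group_axioms M.boundaries_subgroup])
      (use * M.gcomp_cycles M.M.gcomp_props zc assms in blast)
  finally show ?thesis .
qed

lemma cls_ract_wd:
  assumes "x \<in> cycles M" "a \<in> cycles A" "x' \<in> cls M x" "a' \<in> cls A a"
  shows "cls M (x' \<cdot>\<^bsub>M\<^esub> a') = cls M (x \<cdot>\<^bsub>M\<^esub> a)"
proof -
  have c: "x' \<in> cycles M" "a' \<in> cycles A" "x \<in> carrier M" "a \<in> carrier A" "x' \<in> carrier M" "a' \<in> carrier A"
    using assms M.cls_rep_cycle A.cls_rep_cycle M.cyclesD A.cyclesD by auto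
  obtain u where u: "u \<in> carrier M" "x' \<ominus>\<^bsub>M\<^esub> x = diff M u"
    using assms c M.cls_rep[of x' x] M.cls_eq_iff[of x' x] by (auto elim!: M.boundariesE)
  obtain v where v: "v \<in> carrier A" "a' \<ominus>\<^bsub>A\<^esub> a = diff A v"
    using assms c A.cls_rep[of a' a] A.cls_eq_iff[of a' a] by (auto elim!: A.boundariesE)
  have cl: "x' \<cdot>\<^bsub>M\<^esub> a' \<in> carrier M" "x \<cdot>\<^bsub>M\<^esub> a \<in> carrier M" "x \<cdot>\<^bsub>M\<^esub> a' \<in> carrier M"
    using c M.ract_closed by auto
  have "(x' \<cdot>\<^bsub>M\<^esub> a') \<ominus>\<^bsub>M\<^esub> (x \<cdot>\<^bsub>M\<^esub> a)
      = ((x' \<cdot>\<^bsub>M\<^esub> a') \<ominus>\<^bsub>M\<^esub> (x \<cdot>\<^bsub>M\<^esub> a')) \<oplus>\<^bsub>M\<^esub> ((x \<cdot>\<^bsub>M\<^esub> a') \<ominus>\<^bsub>M\<^esub> (x \<cdot>\<^bsub>M\<^esub> a))"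
    using cl by (simp add: M.M.minus_trans)
  also have "\<dots> = ((x' \<ominus>\<^bsub>M\<^esub> x) \<cdot>\<^bsub>M\<^esub> a') \<oplus>\<^bsub>M\<^esub> (x \<cdot>\<^bsub>M\<^esub> (a' \<ominus>\<^bsub>A\<^esub> a))"
    using c by (simp add: M.ract_minus_left M.ract_minus_right)
  also have "\<dots> = diff M (u \<cdot>\<^bsub>M\<^esub> a') \<oplus>\<^bsub>M\<^esub> (x \<cdot>\<^bsub>M\<^esub> diff A v)"
    using u v c d_ract_cycle by simp
  also have "\<dots> \<in> boundaries M"
    using additive_subgroup.a_closed[OF M.boundaries_subgroup M.boundariesI cycle_ract_boundary] u v c assms
    by (simp add: M.ract_closed)
  finally show ?thesis using cl by (simp add: M.cls_eq_iff)
qed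

lemma coh_simps:
  "carrier (cohomology_module M) = cls M ` cycles M"
  "\<zero>\<^bsub>cohomology_module M\<^esub> = cls M \<zero>\<^bsub>M\<^esub>"
  "gr (cohomology_module M) i = cls M ` (cycles M \<inter> gr M i)"
  by (simp_all add: cohomology_module_def cohomology_with_simps M.cls_zero)

lemma coh_add:
  "\<lbrakk>x \<in> cycles M; y \<in> cycles M\<rbrakk> \<Longrightarrow> cls M x \<oplus>\<^bsub>cohomology_module M\<^esub> cls M y = cls M (x \<oplus>\<^bsub>M\<^esub> y)"
  using M.cyclesD(1) by (simp add: cohomology_module_def cohomology_with_simps M.cls_add)

lemma coh_ract:
  assumes "x \<in> cycles M" "a \<in> cycles A"
  shows "cls M x \<cdot>\<^bsub>cohomology_module M\<^esub> cls A a = cls M (x \<cdot>\<^bsub>M\<^esub> a)"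
proof -
  have "cls M x \<cdot>\<^bsub>cohomology_module M\<^esub> cls A a = (\<Union>x'\<in>cls M x. \<Union>a'\<in>cls A a. cls M (x \<cdot>\<^bsub>M\<^esub> a))"
    unfolding cohomology_module_def cohomology_with_simps cls_def[of M, symmetric]
    using cls_ract_wd[OF assms] by simp
  moreover have "cls M x \<noteq> {}" "cls A a \<noteq> {}"
    using M.cls_self[OF M.cyclesD(1)[OF assms(1)]] A.cls_self[OF A.cyclesD(1)[OF assms(2)]] by blast+
  ultimately show ?thesis by simp
qed

lemma coh_graded_module: "graded_module (cohomology_ring A) (cohomology_module M)"
proof -
  let ?R = "cohomology_ring A" and ?H = "cohomology_module M"
  note cc = M.cyclesD(1) additive_subgroup.a_closed[OF M.cycles_subgroup] ract_cycles
    A.cyclesD(1) additive_subgroup.a_closed[OF A.cycles_subgroup] A.mult_cycles A.one_cycle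
  have gg: "graded_group ?H" unfolding cohomology_module_def by (rule M.coh_graded_group)
  moreover have "graded_module_axioms ?R ?H"
    by unfold_locales
      (use cc in \<open>auto simp: coh_simps coh_ract coh_add A.coh_ring_simps A.coh_ring_mult A.coh_ring_add
        M.ract_add_left M.ract_add_right M.ract_mult M.ract_one M.gr_ract\<close>)
  ultimately show ?thesis using A.coh_graded_ring by (simp add: graded_module_def)
qed

end

section \<open>Homomorphisms of dg modules and realisability\<close>

definition dg_hom :: "('k, 'a) dg \<Rightarrow> ('a, 'm) dg \<Rightarrow> ('a, 'n) dg \<Rightarrow> ('m \<Rightarrow> 'n) \<Rightarrow> bool"
  where "dg_hom A M N f \<longleftrightarrow> f \<in> graded_hom A M N \<and> (\<forall>x\<in>carrier M. f (diff M x) = diff N (f x))"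

text \<open>An arbitrary element of the class is mapped. For a dg homomorphism and a class of cycles
  the choice is harmless by \<open>hmap_cls\<close>.\<close>

definition hmap :: "('a, 'n) dg \<Rightarrow> ('m \<Rightarrow> 'n) \<Rightarrow> 'm set \<Rightarrow> 'n set"
  where "hmap N f \<xi> = cls N (f (SOME z. z \<in> \<xi>))"

lemma dg_hom_mod_hom: "dg_hom A M N f \<Longrightarrow> mod_hom A M N f"
  by (simp add: dg_hom_def graded_hom_iff)

lemma dg_hom_diff: "\<lbrakk>dg_hom A M N f; x \<in> carrier M\<rbrakk> \<Longrightarrow> f (diff M x) = diff N (f x)"
  by (simp add: dg_hom_def)

lemma dg_hom_gr: "\<lbrakk>dg_hom A M N f; x \<in> gr M i\<rbrakk> \<Longrightarrow> f x \<in> gr N i"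
  by (simp add: dg_hom_def graded_hom_iff)

lemma dg_hom_comp:
  assumes "dg_hom A M N f" "dg_hom A N L g"
  shows "dg_hom A M L (\<lambda>x. g (f x))"
  using assms mod_hom_closed[OF dg_hom_mod_hom[OF assms(1)]]
  by (auto simp: dg_hom_def intro: graded_hom_comp)

lemma dgmI: "\<lbrakk>dg_ring A; dg_module A M\<rbrakk> \<Longrightarrow> dgm A M"
  by (simp add: dgm_def)

context
  fixes A :: "('k, 'a) dg" and M :: "('a, 'm) dg" and N :: "('a, 'n) dg" and f :: "'m \<Rightarrow> 'n"
  assumes M: "dgm A M" and N: "dgm A N" and f: "dg_hom A M N f"
begin

interpretation M: dgm A M by (rule M)
interpretation N: dgm A N by (rule N)

lemma dg_hom_cycles: "z \<in> cycles M \<Longrightarrow> f z \<in> cycles N"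
  using M.M.cyclesD dg_hom_diff[OF f] mod_hom_closed[OF dg_hom_mod_hom[OF f]]
    mod_hom_zero[OF dg_hom_mod_hom[OF f] M.M.is_graded_module N.M.is_graded_module]
  by (metis N.M.cyclesI)

lemma dg_hom_boundaries: "z \<in> boundaries M \<Longrightarrow> f z \<in> boundaries N"
  using dg_hom_diff[OF f] mod_hom_closed[OF dg_hom_mod_hom[OF f]]
  by (auto simp: boundaries_def)

lemma hmap_cls:
  assumes z: "z \<in> cycles M"
  shows "hmap N f (cls M z) = cls N (f z)"
proof -
  define w where "w = (SOME w. w \<in> cls M z)"
  have w: "w \<in> cls M z"
    unfolding w_def by (rule someI[of _ z]) (rule M.M.cls_self[OF M.M.cyclesD(1)[OF z]])
  have c: "w \<in> carrier M" "z \<in> carrier M" "cls M w = cls M z"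
    using M.M.cls_rep[OF w M.M.cyclesD(1)[OF z]] M.M.cyclesD(1)[OF z] by auto
  have "f (w \<ominus>\<^bsub>M\<^esub> z) \<in> boundaries N" using c M.M.cls_eq_iff[OF c(1,2)] dg_hom_boundaries by blast
  then have "cls N (f w) = cls N (f z)"
    using c mod_hom_closed[OF dg_hom_mod_hom[OF f]]
    by (simp add: N.M.cls_eq_iff mod_hom_minus[OF dg_hom_mod_hom[OF f] M.M.is_graded_module N.M.is_graded_module])
  then show ?thesis by (simp add: hmap_def w_def)
qed

lemma hmap_graded_hom:
  "hmap N f \<in> graded_hom (cohomology_ring A) (cohomology_module M) (cohomology_module N)"
  unfolding graded_hom_iff
proof (intro conjI allI ballI)
  note fh = dg_hom_mod_hom[OF f]
  note cc = M.M.cyclesD(1) N.M.cyclesD(1) M.A.cyclesD(1)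
    additive_subgroup.a_closed[OF M.M.cycles_subgroup] M.ract_cycles
  show "mod_hom (cohomology_ring A) (cohomology_module M) (cohomology_module N) (hmap N f)"
  proof (rule mod_homI)
    fix x assume "x \<in> carrier (cohomology_module M)"
    then obtain u where u: "u \<in> cycles M" "x = cls M u" by (auto simp: M.coh_simps)
    show "hmap N f x \<in> carrier (cohomology_module N)"
      using u by (auto simp: N.coh_simps hmap_cls dg_hom_cycles)
    show "hmap N f (x \<oplus>\<^bsub>cohomology_module M\<^esub> y) = hmap N f x \<oplus>\<^bsub>cohomology_module N\<^esub> hmap N f y"
      if y: "y \<in> carrier (cohomology_module M)" for y
    proof -
      obtain v where "v \<in> cycles M" "y = cls M v" using y by (auto simp: M.coh_simps)
      then show ?thesis
        using u cc by (simp add: M.coh_add N.coh_add hmap_cls dg_hom_cycles mod_hom_add[OF fh])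
    qed
    show "hmap N f (x \<cdot>\<^bsub>cohomology_module M\<^esub> r) = hmap N f x \<cdot>\<^bsub>cohomology_module N\<^esub> r"
      if r: "r \<in> carrier (cohomology_ring A)" for r
    proof -
      obtain a where "a \<in> cycles A" "r = cls A a" using r by (auto simp: M.A.coh_ring_simps)
      then show ?thesis
        using u cc by (simp add: M.coh_ract N.coh_ract hmap_cls dg_hom_cycles mod_hom_ract[OF fh])
    qed
  qed
  fix i x assume "x \<in> gr (cohomology_module M) i"
  then obtain u where "u \<in> cycles M" "u \<in> gr M i" "x = cls M u" by (auto simp: M.coh_simps)
  then show "hmap N f x \<in> gr (cohomology_module N) i"
    by (auto simp: N.coh_simps hmap_cls dg_hom_cycles dg_hom_gr[OF f])
qed

end

text \<open>Attaching cells leads to ever larger product types, whereas \<open>realisable\<close>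
  prescribes the type of the elements of \<open>M\<close>. The structure is moved along a map that
  is injective on the carrier.\<close>

definition transport :: "('m \<Rightarrow> 'n) \<Rightarrow> ('a, 'm) dg \<Rightarrow> ('a, 'n) dg"
  where "transport f M =
    \<lparr>carrier = f ` carrier M, mult = undefined, one = undefined, zero = f \<zero>\<^bsub>M\<^esub>,
     add = (\<lambda>x y. f (inv_into (carrier M) f x \<oplus>\<^bsub>M\<^esub> inv_into (carrier M) f y)),
     smult = (\<lambda>r x. f (inv_into (carrier M) f x \<cdot>\<^bsub>M\<^esub> r)),
     gr = (\<lambda>i. f ` gr M i),
     diff = (\<lambda>x. f (diff M (inv_into (carrier M) f x)))\<rparr>"

text \<open>Serves two changes of the element type: the one in \<open>transport\<close>, and the
  passage from functions to singletons in \<open>coherent_free\<close>.\<close>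

lemma graded_module_iso:
  assumes M: "graded_module R M"
    and bij: "inj_on f (carrier M)" "carrier N = f ` carrier M"
    and zero: "\<zero>\<^bsub>N\<^esub> = f \<zero>\<^bsub>M\<^esub>"
    and add: "\<And>x y. \<lbrakk>x \<in> carrier M; y \<in> carrier M\<rbrakk> \<Longrightarrow> f x \<oplus>\<^bsub>N\<^esub> f y = f (x \<oplus>\<^bsub>M\<^esub> y)"
    and act: "\<And>x r. \<lbrakk>x \<in> carrier M; r \<in> carrier R\<rbrakk> \<Longrightarrow> f x \<cdot>\<^bsub>N\<^esub> r = f (x \<cdot>\<^bsub>M\<^esub> r)"
    and grN: "\<And>i. gr N i = f ` gr M i"
  shows "graded_module R N"
proof -
  interpret M: graded_module R M by fact
  have ab: "abelian_group N"
  proof (rule abelian_groupI)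
    fix x assume "x \<in> carrier N"
    then obtain u where u: "u \<in> carrier M" "x = f u" using bij by auto
    show "\<exists>y\<in>carrier N. y \<oplus>\<^bsub>N\<^esub> x = \<zero>\<^bsub>N\<^esub>"
      by (rule bexI[of _ "f (\<ominus>\<^bsub>M\<^esub> u)"]) (use u in \<open>simp_all add: add zero bij M.M.l_neg\<close>)
  qed (use bij in \<open>auto simp: add zero M.M.a_assoc intro!: arg_cong[of _ _ f] M.M.a_comm\<close>)
  interpret N: abelian_group N by (rule ab)
  have fh: "add_hom M N f" by (simp add: add_hom_def bij add)
  define g where "g = inv_into (carrier M) f"
  have g: "g (f x) = x" if "x \<in> carrier M" for x using that bij by (simp add: g_def)
  note fneg = add_hom_neg[OF fh M.M.abelian_group_axioms ab]
  have fz: "f x = f \<zero>\<^bsub>M\<^esub> \<longleftrightarrow> x = \<zero>\<^bsub>M\<^esub>" if "x \<in> carrier M" for x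
    using that bij by (simp add: inj_on_eq_iff)
  have "graded_group N"
  proof (rule graded_groupI[where c = "\<lambda>x i. f (gcomp M (g x) i)"])
    show "additive_subgroup (gr N i) N" for i
    proof (rule additive_subgroup.intro, rule N.add.subgroupI)
      show "gr N i \<noteq> {}" using M.M.gr_zero by (auto simp: grN)
    qed (use M.M.gr_carrier M.M.gr_add M.M.gr_neg fneg[symmetric] in \<open>auto simp: grN bij add\<close>)
    fix x assume "x \<in> carrier N"
    then obtain u where u: "u \<in> carrier M" "x = f u" using bij by auto
    note gc = M.M.gcomp_closed[OF u(1)]
    show "finite {i. f (gcomp M (g x) i) \<noteq> \<zero>\<^bsub>N\<^esub>}"
      using M.M.gcomp_props(2)[OF u(1)] by (simp add: u g zero fz gc)
    have "(\<Oplus>\<^bsub>N\<^esub>i\<in>{i. gcomp M u i \<noteq> \<zero>\<^bsub>M\<^esub>}. f (gcomp M u i)) = f u"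
      using add_hom_finsum[OF fh M.M.abelian_group_axioms ab, of "gcomp M u" "{i. gcomp M u i \<noteq> \<zero>\<^bsub>M\<^esub>}"]
        gc M.M.gcomp_props(3)[OF u(1)] by simp
    then show "(\<Oplus>\<^bsub>N\<^esub>i\<in>{i. f (gcomp M (g x) i) \<noteq> \<zero>\<^bsub>N\<^esub>}. f (gcomp M (g x) i)) = x"
      by (simp add: u g zero fz gc)
  qed (use ab M.M.gcomp_props M.M.gcomp_closed M.M.gcomp_homogeneous M.M.gr_carrier
      in \<open>auto simp: bij grN g add M.M.gcomp_add zero\<close>)
  moreover have "graded_module_axioms R N"
    by unfold_locales
      (use M.M.gr_carrier M.ract_closed M.gr_ract M.R.gr_carrier in \<open>auto simp: bij act add grN M.ract_add_left
        M.ract_add_right M.ract_mult M.ract_one\<close>)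
  ultimately show ?thesis using M.R.graded_ring_axioms by (simp add: graded_module_def)
qed

lemma dg_moduleI:
  assumes A: "dg_ring A" and M: "graded_module A M"
    and 1: "\<And>x. x \<in> carrier M \<Longrightarrow> diff M x \<in> carrier M"
    and 2: "\<And>x y. \<lbrakk>x \<in> carrier M; y \<in> carrier M\<rbrakk> \<Longrightarrow> diff M (x \<oplus>\<^bsub>M\<^esub> y) = diff M x \<oplus>\<^bsub>M\<^esub> diff M y"
    and 3: "\<And>x i. x \<in> gr M i \<Longrightarrow> diff M x \<in> gr M (i + 1)"
    and 4: "\<And>x. x \<in> carrier M \<Longrightarrow> diff M (diff M x) = \<zero>\<^bsub>M\<^esub>"
    and 5: "\<And>x i a. \<lbrakk>x \<in> gr M i; a \<in> carrier A\<rbrakk> \<Longrightarrow>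
      diff M (x \<cdot>\<^bsub>M\<^esub> a) = (diff M x \<cdot>\<^bsub>M\<^esub> a) \<oplus>\<^bsub>M\<^esub> koszul M i (x \<cdot>\<^bsub>M\<^esub> diff A a)"
  shows "dgm A M"
  using assms by (simp add: dgm_def dg_module_def dg_module_axioms_def)

lemma transport_dgm:
  assumes "dgm A M" and inj: "inj_on f (carrier M)"
  shows "dgm A (transport f M)" "dg_hom A M (transport f M) f"
    "dg_hom A (transport f M) M (inv_into (carrier M) f)"
proof -
  interpret M: dgm A M by fact
  let ?T = "transport f M" and ?g = "inv_into (carrier M) f"
  have g: "?g (f x) = x" if "x \<in> carrier M" for x using that inj by simp
  have T: "carrier ?T = f ` carrier M" "\<zero>\<^bsub>?T\<^esub> = f \<zero>\<^bsub>M\<^esub>" "gr ?T i = f ` gr M i" for i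
    by (simp_all add: transport_def)
  have add: "f x \<oplus>\<^bsub>?T\<^esub> f y = f (x \<oplus>\<^bsub>M\<^esub> y)" if "x \<in> carrier M" "y \<in> carrier M" for x y
    using that by (simp add: transport_def g)
  have act: "f x \<cdot>\<^bsub>?T\<^esub> r = f (x \<cdot>\<^bsub>M\<^esub> r)" if "x \<in> carrier M" for x r
    using that by (simp add: transport_def g)
  have di: "diff ?T (f x) = f (diff M x)" if "x \<in> carrier M" for x
    using that by (simp add: transport_def g)
  have gm: "graded_module A ?T"
    by (rule graded_module_iso[OF M.M.is_graded_module inj]) (simp_all add: T add act)
  interpret T: graded_module A ?T by (rule gm)
  have fh: "add_hom M ?T f" by (simp add: add_hom_def T add)
  note kz = koszul_hom[OF fh M.M.M.abelian_group_axioms T.M.abelian_group_axioms, symmetric]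
  have mc: "x \<in> gr M i \<Longrightarrow> x \<in> carrier M" for x i using M.M.M.gr_carrier .
  show "dgm A ?T"
  proof (rule dg_moduleI[OF M.A.dg_ring_axioms gm])
    fix x i a assume "x \<in> gr ?T i" and a: "a \<in> carrier A"
    then obtain u where u: "u \<in> gr M i" "x = f u" "u \<in> carrier M" using mc by (auto simp: T)
    then show "diff ?T (x \<cdot>\<^bsub>?T\<^esub> a) = (diff ?T x \<cdot>\<^bsub>?T\<^esub> a) \<oplus>\<^bsub>?T\<^esub> koszul ?T i (x \<cdot>\<^bsub>?T\<^esub> diff A a)"
      using a by (simp add: act di M.M.ract_closed M.A.d_closed M.M.d_closed kz add M.M.mleibniz
          koszul_closed M.M.M.abelian_group_axioms)
  next
    fix x i assume "x \<in> gr ?T i"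
    then show "diff ?T x \<in> gr ?T (i + 1)" using mc M.M.d_degree by (auto simp: T di)
  qed (auto simp: T di add M.M.d_closed M.M.d_add M.M.d_d)
  show "dg_hom A M ?T f"
    by (auto simp: dg_hom_def graded_hom_iff T add act di intro!: mod_homI)
  show "dg_hom A ?T M ?g"
    by (auto simp: dg_hom_def graded_hom_iff T add act di g mc M.M.ract_closed M.M.d_closed intro!: mod_homI)
qed

text \<open>The module is moved into the prescribed type. Its cohomology changes by the isomorphism
  that the injection induces, and \<open>i\<close> and \<open>q\<close> are composed with this
  isomorphism and its inverse.\<close>

lemma realisableI:
  fixes M :: "('a, 'n) dg"
  assumes M: "dgm A M" and small: "carrier M \<lesssim> (UNIV :: 'm set)"
    and i: "i \<in> graded_hom (cohomology_ring A) X (cohomology_module M)"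
    and q: "q \<in> graded_hom (cohomology_ring A) (cohomology_module M) X"
    and qi: "\<And>x. x \<in> carrier X \<Longrightarrow> q (i x) = x" and Xgr: "\<And>k. gr X k \<subseteq> carrier X"
  shows "realisable TYPE('m) A X"
proof -
  obtain f :: "'n \<Rightarrow> 'm" where inj: "inj_on f (carrier M)" using small by (auto simp: lepoll_def)
  let ?T = "transport f M" and ?g = "inv_into (carrier M) f"
  note tr = transport_dgm[OF M inj]
  interpret M: dgm A M by fact
  interpret T: dgm A ?T by (rule tr)
  have "\<exists>U. direct_summand (cohomology_ring A) (cohomology_module ?T) U \<and>
      graded_iso (cohomology_ring A) X (restr (cohomology_module ?T) U)"
  proof (rule summand_of_split[OF T.coh_graded_module])
    show "(\<lambda>x. hmap ?T f (i x)) \<in> graded_hom (cohomology_ring A) X (cohomology_module ?T)"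
      by (rule graded_hom_comp[OF i hmap_graded_hom[OF M tr(1,2)]])
    show "(\<lambda>y. q (hmap M ?g y)) \<in> graded_hom (cohomology_ring A) (cohomology_module ?T) X"
      by (rule graded_hom_comp[OF hmap_graded_hom[OF tr(1) M tr(3)] q])
    fix x assume x: "x \<in> carrier X"
    then have "i x \<in> carrier (cohomology_module M)"
      using mod_hom_closed[OF graded_hom_mod_hom[OF i]] by blast
    then obtain z where z: "z \<in> cycles M" "i x = cls M z" by (auto simp: M.coh_simps)
    then show "q (hmap M ?g (hmap ?T f (i x))) = x"
      using qi[OF x] M.M.cyclesD(1) inj
      by (simp add: hmap_cls[OF M tr(1,2)] hmap_cls[OF tr(1) M tr(3)] dg_hom_cycles[OF M tr(1,2)])
  qed (rule Xgr)
  then show ?thesis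
    unfolding realisable_def using T.M.dg_module_axioms by blast
qed

lemma realisableD:
  assumes A: "dg_ring A" and X: "realisable TYPE('m) A X"
    and Xadd: "\<And>x y. \<lbrakk>x \<in> carrier X; y \<in> carrier X\<rbrakk> \<Longrightarrow> x \<oplus>\<^bsub>X\<^esub> y \<in> carrier X"
    and Xact: "\<And>x r. \<lbrakk>x \<in> carrier X; r \<in> carrier (cohomology_ring A)\<rbrakk> \<Longrightarrow> x \<cdot>\<^bsub>X\<^esub> r \<in> carrier X"
  shows "\<exists>(M :: ('a, 'm) dg) i q. dgm A M \<and>
    i \<in> graded_hom (cohomology_ring A) X (cohomology_module M) \<and>
    mod_hom (cohomology_ring A) (cohomology_module M) X q \<and> (\<forall>x\<in>carrier X. q (i x) = x)"
proof -
  obtain M :: "('a, 'm) dg" and U where M: "dg_module A M"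
    and U: "direct_summand (cohomology_ring A) (cohomology_module M) U"
    and iso: "graded_iso (cohomology_ring A) X (restr (cohomology_module M) U)"
    using X unfolding realisable_def by blast
  interpret dgm A M using A M by (rule dgmI)
  show ?thesis
    using split_of_summand[OF coh_graded_module U iso Xadd Xact] dgm_axioms by blast
qed

section \<open>Attaching cells\<close>

text \<open>The direct sum of copies of \<open>A\<close> indexed by \<open>J\<close>, encoded by
  functions on the whole index type that vanish off \<open>J\<close>, so that equality of elements
  is equality of functions.\<close>

definition fsupp :: "('a, 'z) ring_scheme \<Rightarrow> 'j set \<Rightarrow> ('j \<Rightarrow> 'a) set"
  where "fsupp A J = {a. (\<forall>j. a j \<in> carrier A) \<and> (\<forall>j. j \<notin> J \<longrightarrow> a j = \<zero>\<^bsub>A\<^esub>) \<and> finite {j. a j \<noteq> \<zero>\<^bsub>A\<^esub>}}"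

text \<open>The linear map out of the free module on \<open>J\<close> sending the basis element
  \<open>j\<close> to \<open>y j\<close>. The sum runs over the support of \<open>a\<close>, since
  \<open>J\<close> may be infinite and \<open>finsum\<close> over an infinite set is zero by
  convention.\<close>

definition wsum ::
    "('k, 'a, 'y) graded_scheme \<Rightarrow> ('a, 'm, 'z) graded_scheme \<Rightarrow> ('j \<Rightarrow> 'm) \<Rightarrow> ('j \<Rightarrow> 'a) \<Rightarrow> 'm"
  where "wsum A M y a = (\<Oplus>\<^bsub>M\<^esub>j\<in>{j. a j \<noteq> \<zero>\<^bsub>A\<^esub>}. y j \<cdot>\<^bsub>M\<^esub> a j)"

definition single :: "('a, 'z) ring_scheme \<Rightarrow> 'j \<Rightarrow> 'a \<Rightarrow> 'j \<Rightarrow> 'a"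
  where "single A j b = (\<lambda>i. if i = j then b else \<zero>\<^bsub>A\<^esub>)"

lemma fsupp_closed: "a \<in> fsupp A J \<Longrightarrow> a j \<in> carrier A"
  by (simp add: fsupp_def)

lemma fsupp_finite: "a \<in> fsupp A J \<Longrightarrow> finite {j. a j \<noteq> \<zero>\<^bsub>A\<^esub>}"
  by (simp add: fsupp_def)

lemma fsupp_subset: "a \<in> fsupp A J \<Longrightarrow> {j. a j \<noteq> \<zero>\<^bsub>A\<^esub>} \<subseteq> J"
  by (auto simp: fsupp_def)

context abelian_group
begin

lemma fsupp_zero: "(\<lambda>j. \<zero>) \<in> fsupp G J"
  by (simp add: fsupp_def)

lemma fsupp_add: "\<lbrakk>a \<in> fsupp G J; b \<in> fsupp G J\<rbrakk> \<Longrightarrow> (\<lambda>j. a j \<oplus> b j) \<in> fsupp G J"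
  unfolding fsupp_def
  by (auto intro: rev_finite_subset[of "{j. a j \<noteq> \<zero>} \<union> {j. b j \<noteq> \<zero>}"])

lemma fsupp_map:
  assumes "a \<in> fsupp G J" "\<And>j x. x \<in> carrier G \<Longrightarrow> h j x \<in> carrier G" "\<And>j. h j \<zero> = \<zero>"
  shows "(\<lambda>j. h j (a j)) \<in> fsupp G J"
  using assms unfolding fsupp_def
  by (auto intro: rev_finite_subset[of "{j. a j \<noteq> \<zero>}"])

lemma fsupp_neg: "a \<in> fsupp G J \<Longrightarrow> (\<lambda>j. \<ominus> a j) \<in> fsupp G J"
  by (rule fsupp_map) (auto simp: neg_zero)

lemma single_fsupp: "\<lbrakk>j \<in> J; b \<in> carrier G\<rbrakk> \<Longrightarrow> single G j b \<in> fsupp G J"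
  by (auto simp: fsupp_def single_def)

end

context graded_module
begin

lemma wsum_eq:
  assumes a: "a \<in> fsupp R J" and y: "\<And>j. j \<in> J \<Longrightarrow> y j \<in> carrier M"
    and F: "finite F" "{j. a j \<noteq> \<zero>} \<subseteq> F" "F \<subseteq> J"
  shows "wsum R M y a = (\<Oplus>\<^bsub>M\<^esub>j\<in>F. y j \<cdot>\<^bsub>M\<^esub> a j)"
  unfolding wsum_def
proof (rule M.add.finprod_mono_neutral_cong_left)
  show "y j \<cdot>\<^bsub>M\<^esub> a j = \<zero>\<^bsub>M\<^esub>" if "j \<in> F - {j. a j \<noteq> \<zero>}" for j
    using that F y by (auto simp: ract_zero_right)
qed (use F a y in \<open>auto simp: ract_closed fsupp_closed\<close>)

lemma wsum_closed:
  assumes a: "a \<in> fsupp R J" and y: "\<And>j. j \<in> J \<Longrightarrow> y j \<in> carrier M"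
  shows "wsum R M y a \<in> carrier M"
  unfolding wsum_def using fsupp_subset[OF a] fsupp_closed[OF a] y
  by (auto intro!: M.finsum_closed ract_closed)

lemma wsum_add:
  assumes a: "a \<in> fsupp R J" and b: "b \<in> fsupp R J" and y: "\<And>j. j \<in> J \<Longrightarrow> y j \<in> carrier M"
  shows "wsum R M y (\<lambda>j. a j \<oplus> b j) = wsum R M y a \<oplus>\<^bsub>M\<^esub> wsum R M y b"
proof -
  let ?F = "{j. a j \<noteq> \<zero>} \<union> {j. b j \<noteq> \<zero>}"
  have F: "finite ?F" "?F \<subseteq> J" using fsupp_finite fsupp_subset a b by (fast, fast)
  have "wsum R M y (\<lambda>j. a j \<oplus> b j) = (\<Oplus>\<^bsub>M\<^esub>j\<in>?F. y j \<cdot>\<^bsub>M\<^esub> (a j \<oplus> b j))"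
    by (rule wsum_eq[OF R.fsupp_add[OF a b] y]) (use F in auto)
  also have "\<dots> = (\<Oplus>\<^bsub>M\<^esub>j\<in>?F. (y j \<cdot>\<^bsub>M\<^esub> a j) \<oplus>\<^bsub>M\<^esub> (y j \<cdot>\<^bsub>M\<^esub> b j))"
    by (rule M.finsum_cong')
      (use F y fsupp_closed[OF a] fsupp_closed[OF b] in \<open>auto simp: ract_add_right ract_closed subset_iff\<close>)
  also have "\<dots> = wsum R M y a \<oplus>\<^bsub>M\<^esub> wsum R M y b"
    using F y fsupp_closed[OF a] fsupp_closed[OF b]
    by (subst wsum_eq[OF a y F(1) _ F(2)], simp, blast,
        subst wsum_eq[OF b y F(1) _ F(2)], simp, blast, subst M.finsum_addf)
      (auto simp: ract_closed subset_iff)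
  finally show ?thesis .
qed

lemma wsum_hom:
  assumes N: "graded_module R N" and \<phi>: "mod_hom R M N \<phi>"
    and a: "a \<in> fsupp R J" and y: "\<And>j. j \<in> J \<Longrightarrow> y j \<in> carrier M"
  shows "\<phi> (wsum R M y a) = wsum R N (\<lambda>j. \<phi> (y j)) a"
proof -
  interpret N: graded_module R N by fact
  have yc: "j \<in> {j. a j \<noteq> \<zero>} \<Longrightarrow> y j \<in> carrier M" for j using fsupp_subset[OF a] y by auto
  then show ?thesis
    unfolding wsum_def
    by (subst mod_hom_finsum[OF \<phi> graded_module_axioms N])
      (use fsupp_closed[OF a] in \<open>auto simp: ract_closed mod_hom_ract[OF \<phi>] mod_hom_closed[OF \<phi>]
        N.ract_closed intro!: N.M.finsum_cong'\<close>)
qed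

lemma wsum_ract:
  assumes a: "a \<in> fsupp R J" and y: "\<And>j. j \<in> J \<Longrightarrow> y j \<in> carrier M" and r: "r \<in> carrier R"
  shows "wsum R M y (\<lambda>j. a j \<otimes> r) = wsum R M y a \<cdot>\<^bsub>M\<^esub> r"
proof -
  have S: "finite {j. a j \<noteq> \<zero>}" "{j. a j \<noteq> \<zero>} \<subseteq> J" using fsupp_finite[OF a] fsupp_subset[OF a] .
  have "wsum R M y (\<lambda>j. a j \<otimes> r) = (\<Oplus>\<^bsub>M\<^esub>j\<in>{j. a j \<noteq> \<zero>}. y j \<cdot>\<^bsub>M\<^esub> (a j \<otimes> r))"
    by (rule wsum_eq[OF R.fsupp_map[OF a, of "\<lambda>j x. x \<otimes> r"] y]) (use S r in auto)
  also have "\<dots> = (\<Oplus>\<^bsub>M\<^esub>j\<in>{j. a j \<noteq> \<zero>}. (y j \<cdot>\<^bsub>M\<^esub> a j) \<cdot>\<^bsub>M\<^esub> r)"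
    by (rule M.finsum_cong')
      (use S y r fsupp_closed[OF a] in \<open>auto simp: ract_mult ract_closed subset_iff\<close>)
  also have "\<dots> = wsum R M y a \<cdot>\<^bsub>M\<^esub> r"
    unfolding wsum_def
    by (rule ract_finsum_left[OF r, symmetric])
      (use S y fsupp_closed[OF a] in \<open>auto simp: ract_closed subset_iff\<close>)
  finally show ?thesis .
qed

lemma wsum_gr:
  assumes a: "a \<in> fsupp R J" and y: "\<And>j. j \<in> J \<Longrightarrow> y j \<in> gr M (\<delta> j)"
    and g: "\<And>j. j \<in> J \<Longrightarrow> a j \<in> gr R (k - \<delta> j)"
  shows "wsum R M y a \<in> gr M k"
  unfolding wsum_def
proof (rule additive_subgroup_finsum[OF M.abelian_group_axioms M.gr_subgroup], rule funcsetI)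
  fix j assume "j \<in> {j. a j \<noteq> \<zero>}"
  then have "j \<in> J" using fsupp_subset[OF a] by auto
  then show "y j \<cdot>\<^bsub>M\<^esub> a j \<in> gr M k" using gr_ract[OF y g, of j j] by simp
qed

lemma wsum_zero: "wsum R M y (\<lambda>j. \<zero>) = \<zero>\<^bsub>M\<^esub>"
  by (simp add: wsum_def)

lemma wsum_single:
  assumes "y j \<in> carrier M" "b \<in> carrier R"
  shows "wsum R M y (single R j b) = y j \<cdot>\<^bsub>M\<^esub> b"
proof -
  have "wsum R M y (single R j b) = (\<Oplus>\<^bsub>M\<^esub>i\<in>{j}. y i \<cdot>\<^bsub>M\<^esub> single R j b i)"
    by (rule wsum_eq[of _ "{j}"]) (use assms R.single_fsupp[of j "{j}" b] in \<open>auto simp: single_def\<close>)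
  then show ?thesis using assms by (simp add: single_def ract_closed)
qed

end

definition attach ::
    "('k, 'a) dg \<Rightarrow> ('a, 'n) dg \<Rightarrow> 'j set \<Rightarrow> ('j \<Rightarrow> int) \<Rightarrow> ('j \<Rightarrow> 'n) \<Rightarrow> ('a, 'n \<times> ('j \<Rightarrow> 'a)) dg"
  \<comment> \<open>the cone of the map from a free dg module given by the cycles \<open>t j\<close>: a cell of degree \<open>\<delta> j\<close>
      with boundary \<open>t j\<close> is attached to \<open>N\<close> for each \<open>j \<in> J\<close>\<close>
  where "attach A N J \<delta> t =
    \<lparr>carrier = carrier N \<times> fsupp A J, mult = undefined, one = undefined,
     zero = (\<zero>\<^bsub>N\<^esub>, \<lambda>j. \<zero>\<^bsub>A\<^esub>),
     add = (\<lambda>(n, a) (m, b). (n \<oplus>\<^bsub>N\<^esub> m, \<lambda>j. a j \<oplus>\<^bsub>A\<^esub> b j)),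
     smult = (\<lambda>r (n, a). (n \<cdot>\<^bsub>N\<^esub> r, \<lambda>j. a j \<otimes>\<^bsub>A\<^esub> r)),
     gr = (\<lambda>k. gr N k \<times> {a \<in> fsupp A J. \<forall>j\<in>J. a j \<in> gr A (k - \<delta> j)}),
     diff = (\<lambda>(n, a). (diff N n \<oplus>\<^bsub>N\<^esub> wsum A N t a, \<lambda>j. koszul A (\<delta> j) (diff A (a j))))\<rparr>"

lemma attach_simps:
  "carrier (attach A N J \<delta> t) = carrier N \<times> fsupp A J"
  "\<zero>\<^bsub>attach A N J \<delta> t\<^esub> = (\<zero>\<^bsub>N\<^esub>, \<lambda>j. \<zero>\<^bsub>A\<^esub>)"
  "(n, a) \<oplus>\<^bsub>attach A N J \<delta> t\<^esub> (m, b) = (n \<oplus>\<^bsub>N\<^esub> m, \<lambda>j. a j \<oplus>\<^bsub>A\<^esub> b j)"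
  "(n, a) \<cdot>\<^bsub>attach A N J \<delta> t\<^esub> r = (n \<cdot>\<^bsub>N\<^esub> r, \<lambda>j. a j \<otimes>\<^bsub>A\<^esub> r)"
  "gr (attach A N J \<delta> t) k = gr N k \<times> {a \<in> fsupp A J. \<forall>j\<in>J. a j \<in> gr A (k - \<delta> j)}"
  "diff (attach A N J \<delta> t) (n, a) =
    (diff N n \<oplus>\<^bsub>N\<^esub> wsum A N t a, \<lambda>j. koszul A (\<delta> j) (diff A (a j)))"
  by (simp_all add: attach_def)

context dg_ring
begin

lemma add_hom_koszul_diff: "add_hom A A (\<lambda>x. koszul A n (diff A x))"
  using add_hom_comp[OF add_hom_diff add_hom_koszul[OF A.abelian_group_axioms]] .

lemma fsupp_kd: "a \<in> fsupp A J \<Longrightarrow> (\<lambda>j. koszul A (\<delta> j) (diff A (a j))) \<in> fsupp A J"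
  by (rule A.fsupp_map) (auto simp: koszul_closed A.abelian_group_axioms d_closed d_zero koszul_zero)

lemma fsupp_ract: "\<lbrakk>a \<in> fsupp A J; r \<in> carrier A\<rbrakk> \<Longrightarrow> (\<lambda>j. a j \<otimes> r) \<in> fsupp A J"
  by (rule A.fsupp_map) auto

end

context dgm
begin

text \<open>The Leibniz rule applied termwise. The sign is that of the degree of \<open>y j\<close>;
  this explains the sign of \<open>\<delta> j\<close> in the differential of a module with cells
  attached.\<close>

lemma wsum_diff:
  assumes a: "a \<in> fsupp A J" and y: "\<And>j. j \<in> J \<Longrightarrow> y j \<in> gr M (\<delta> j)"
  shows "diff M (wsum A M y a) =
    wsum A M (\<lambda>j. diff M (y j)) a \<oplus>\<^bsub>M\<^esub> wsum A M y (\<lambda>j. koszul A (\<delta> j) (diff A (a j)))"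
proof -
  let ?F = "{j. a j \<noteq> \<zero>\<^bsub>A\<^esub>}"
  have F: "finite ?F" "?F \<subseteq> J" using fsupp_finite[OF a] fsupp_subset[OF a] .
  have yc: "y j \<in> carrier M" "diff M (y j) \<in> carrier M" if "j \<in> J" for j
    using y[OF that] M.M.gr_carrier M.d_closed by auto
  note ac = fsupp_closed[OF a] and kc = fsupp_closed[OF A.fsupp_kd[OF a, of \<delta>]]
  have "diff M (wsum A M y a) = (\<Oplus>\<^bsub>M\<^esub>j\<in>?F. diff M (y j \<cdot>\<^bsub>M\<^esub> a j))"
    unfolding wsum_def by (rule M.d_finsum) (use F yc ac in \<open>auto simp: M.ract_closed subset_iff\<close>)
  also have "\<dots> = (\<Oplus>\<^bsub>M\<^esub>j\<in>?F. (diff M (y j) \<cdot>\<^bsub>M\<^esub> a j) \<oplus>\<^bsub>M\<^esub> (y j \<cdot>\<^bsub>M\<^esub> koszul A (\<delta> j) (diff A (a j))))"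
    using F yc ac kc
    by (intro M.M.finsum_cong')
      (auto simp: M.mleibniz[OF y] koszul_ract A.d_closed subset_iff M.ract_closed koszul_closed
        M.M.abelian_group_axioms)
  also have "\<dots> = (\<Oplus>\<^bsub>M\<^esub>j\<in>?F. diff M (y j) \<cdot>\<^bsub>M\<^esub> a j) \<oplus>\<^bsub>M\<^esub>
      (\<Oplus>\<^bsub>M\<^esub>j\<in>?F. y j \<cdot>\<^bsub>M\<^esub> koszul A (\<delta> j) (diff A (a j)))"
    using F yc ac kc by (intro M.M.finsum_addf) (auto simp: M.ract_closed subset_iff)
  also have "(\<Oplus>\<^bsub>M\<^esub>j\<in>?F. y j \<cdot>\<^bsub>M\<^esub> koszul A (\<delta> j) (diff A (a j)))
      = wsum A M y (\<lambda>j. koszul A (\<delta> j) (diff A (a j)))"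
    by (rule M.wsum_eq[OF A.fsupp_kd[OF a], symmetric])
      (use F yc in \<open>auto simp: A.d_zero koszul_zero A.A.abelian_group_axioms\<close>)
  finally show ?thesis by (simp add: wsum_def)
qed

end

text \<open>The attaching cycles have degree \<open>\<delta> j + 1\<close> because they are to
  become boundaries of cells of degree \<open>\<delta> j\<close>.\<close>

locale cells = dgm A N for A :: "('k, 'a) dg" and N :: "('a, 'n) dg" +
  fixes J :: "'j set" and \<delta> :: "'j \<Rightarrow> int" and t :: "'j \<Rightarrow> 'n"
  assumes t_gr: "j \<in> J \<Longrightarrow> t j \<in> gr N (\<delta> j + 1)"
    and t_cycle: "j \<in> J \<Longrightarrow> t j \<in> cycles N"
begin

abbreviation "T \<equiv> attach A N J \<delta> t"

lemma t_closed: "j \<in> J \<Longrightarrow> t j \<in> carrier N"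
  using t_gr M.M.gr_carrier by blast

lemma T_abelian_group: "abelian_group T"
proof (rule abelian_groupI)
  fix x assume "x \<in> carrier T"
  then obtain n a where x: "x = (n, a)" "n \<in> carrier N" "a \<in> fsupp A J" by (auto simp: attach_simps)
  show "\<exists>y\<in>carrier T. y \<oplus>\<^bsub>T\<^esub> x = \<zero>\<^bsub>T\<^esub>"
    by (rule bexI[of _ "(\<ominus>\<^bsub>N\<^esub> n, \<lambda>j. \<ominus>\<^bsub>A\<^esub> a j)"])
      (use x fsupp_closed[OF x(3)] in \<open>auto simp: attach_simps A.A.fsupp_neg M.M.l_neg A.A.l_neg\<close>)
qed (auto simp: attach_simps A.A.fsupp_zero A.A.fsupp_add M.M.a_ac A.A.a_ac fsupp_closed)

lemma T_fst: "add_hom T N fst"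
  by (auto simp: add_hom_def attach_simps)

lemma T_snd: "add_hom T A (\<lambda>x. snd x j)"
  by (auto simp: add_hom_def attach_simps fsupp_closed)

lemma gcomp_fsupp: "a \<in> fsupp A J \<Longrightarrow> (\<lambda>j. gcomp A (a j) (k - \<delta> j)) \<in> fsupp A J"
  by (rule A.A.fsupp_map[where h = "\<lambda>j x. gcomp A x (k - \<delta> j)"]) (auto simp: A.A.gcomp_closed A.A.gcomp_zero)

lemma T_graded_group: "graded_group T"
proof -
  interpret T: abelian_group T by (rule T_abelian_group)
  define c where "c x k = (gcomp N (fst x) k, \<lambda>j. gcomp A (snd x j) (k - \<delta> j))" for x k
  show ?thesis
  proof (rule graded_groupI[where c = c])
    show "abelian_group T" by (rule T_abelian_group)
    show "additive_subgroup (gr T i) T" for i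
    proof (rule additive_subgroup.intro, rule T.add.subgroupI)
      show "gr T i \<noteq> {}" using M.M.gr_zero A.A.gr_zero A.A.fsupp_zero by (auto simp: attach_simps)
      show "gr T i \<subseteq> carrier T" using M.M.gr_carrier by (auto simp: attach_simps)
      fix x assume "x \<in> gr T i"
      then obtain n a where x: "x = (n, a)" "n \<in> gr N i" "a \<in> fsupp A J" "\<forall>j\<in>J. a j \<in> gr A (i - \<delta> j)"
        by (auto simp: attach_simps)
      have nc: "n \<in> carrier N" using x M.M.gr_carrier by blast
      have "(\<ominus>\<^bsub>N\<^esub> n, \<lambda>j. \<ominus>\<^bsub>A\<^esub> a j) \<oplus>\<^bsub>T\<^esub> x = \<zero>\<^bsub>T\<^esub>"
        using x nc fsupp_closed[OF x(3)] by (simp add: attach_simps M.M.l_neg A.A.l_neg)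
      then have "\<ominus>\<^bsub>T\<^esub> x = (\<ominus>\<^bsub>N\<^esub> n, \<lambda>j. \<ominus>\<^bsub>A\<^esub> a j)"
        using x nc by (intro T.minus_equality) (auto simp: attach_simps A.A.fsupp_neg)
      then show "\<ominus>\<^bsub>T\<^esub> x \<in> gr T i"
        using x by (auto simp: attach_simps A.A.fsupp_neg M.M.gr_neg A.A.gr_neg)
      fix y assume "y \<in> gr T i"
      then show "x \<oplus>\<^bsub>T\<^esub> y \<in> gr T i"
        using x by (auto simp: attach_simps A.A.fsupp_add M.M.gr_add A.A.gr_add)
    qed
    fix x k assume "x \<in> carrier T"
    then obtain n a where x: "x = (n, a)" "n \<in> carrier N" "a \<in> fsupp A J" by (auto simp: attach_simps)
    note ac = fsupp_closed[OF x(3)]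
    have cgr: "c x k \<in> gr T k" for k
      using x M.M.gcomp_props A.A.gcomp_props ac gcomp_fsupp by (auto simp: c_def attach_simps)
    then show "c x k \<in> gr T k" .
    have cc: "c x k \<in> carrier T" for k
      using x M.M.gcomp_closed gcomp_fsupp by (auto simp: c_def attach_simps)
    \<comment> \<open>The degrees in which \<open>x\<close> can have a nonzero component: those of
      \<open>n\<close> and, for the finitely many nonzero coordinates, those of \<open>a j\<close>
      raised by the degree of the cell \<open>j\<close>.\<close>
    define F where "F = {k. gcomp N n k \<noteq> \<zero>\<^bsub>N\<^esub>} \<union>
      (\<Union>j\<in>{j. a j \<noteq> \<zero>\<^bsub>A\<^esub>}. (\<lambda>i. i + \<delta> j) ` {i. gcomp A (a j) i \<noteq> \<zero>\<^bsub>A\<^esub>})"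
    have F: "finite F"
      unfolding F_def using M.M.gcomp_props(2)[OF x(2)] A.A.gcomp_props(2)[OF ac] fsupp_finite[OF x(3)]
      by blast
    have aF: "k \<in> F" if "gcomp A (a j) (k - \<delta> j) \<noteq> \<zero>\<^bsub>A\<^esub>" for j k
    proof -
      have "a j \<noteq> \<zero>\<^bsub>A\<^esub>" using that A.A.gcomp_zero by auto
      moreover have "k = (k - \<delta> j) + \<delta> j" by simp
      ultimately show ?thesis unfolding F_def using that by blast
    qed
    have sub: "{k. c x k \<noteq> \<zero>\<^bsub>T\<^esub>} \<subseteq> F"
    proof
      fix k assume "k \<in> {k. c x k \<noteq> \<zero>\<^bsub>T\<^esub>}"
      then have "gcomp N n k \<noteq> \<zero>\<^bsub>N\<^esub> \<or> (\<exists>j. gcomp A (a j) (k - \<delta> j) \<noteq> \<zero>\<^bsub>A\<^esub>)"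
        using x by (auto simp: c_def attach_simps)
      then show "k \<in> F" using aF by (auto simp: F_def)
    qed
    then show "finite {k. c x k \<noteq> \<zero>\<^bsub>T\<^esub>}" using F finite_subset by blast
    have "finsum T (c x) {k. c x k \<noteq> \<zero>\<^bsub>T\<^esub>} = finsum T (c x) F"
      by (rule T.finsum_support[symmetric]) (use F sub cc in auto)
    also have "\<dots> = x"
    proof (rule prod_eqI)
      have "fst (finsum T (c x) F) = finsum N (\<lambda>k. fst (c x k)) F"
        by (rule add_hom_finsum[OF T_fst T_abelian_group M.M.abelian_group_axioms]) (use cc in auto)
      also have "\<dots> = n" unfolding c_def using x M.M.gcomp_sum[OF x(2) F] by (simp add: F_def)
      finally show "fst (finsum T (c x) F) = fst x" using x by simp
      show "snd (finsum T (c x) F) = snd x"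
      proof
        fix j
        have "snd (finsum T (c x) F) j = finsum A (\<lambda>k. snd (c x k) j) F"
          by (rule add_hom_finsum[OF T_snd T_abelian_group A.A.abelian_group_axioms]) (use cc in auto)
        also have "\<dots> = finsum A (\<lambda>k. gcomp A (a j) (k - \<delta> j)) F" using x by (simp add: c_def)
        also have "\<dots> = finsum A (gcomp A (a j)) ((\<lambda>k. k - \<delta> j) ` F)"
          by (rule A.A.finsum_reindex[symmetric]) (use ac in \<open>auto simp: A.A.gcomp_closed inj_on_def\<close>)
        also have "\<dots> = a j"
        proof (rule A.A.gcomp_sum[OF ac])
          show "finite ((\<lambda>k. k - \<delta> j) ` F)" using F by simp
          show "{i. gcomp A (a j) i \<noteq> \<zero>\<^bsub>A\<^esub>} \<subseteq> (\<lambda>k. k - \<delta> j) ` F"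
          proof
            fix i assume "i \<in> {i. gcomp A (a j) i \<noteq> \<zero>\<^bsub>A\<^esub>}"
            then have "i + \<delta> j \<in> F" using aF[of j "i + \<delta> j"] by simp
            then show "i \<in> (\<lambda>k. k - \<delta> j) ` F" by (rule rev_image_eqI) simp
          qed
        qed
        finally show "snd (finsum T (c x) F) j = snd x j" using x by simp
      qed
    qed
    finally show "finsum T (c x) {k. c x k \<noteq> \<zero>\<^bsub>T\<^esub>} = x" .
    fix y assume "y \<in> carrier T"
    then show "c (x \<oplus>\<^bsub>T\<^esub> y) k = c x k \<oplus>\<^bsub>T\<^esub> c y k"
      using x ac by (auto simp: c_def attach_simps M.M.gcomp_add A.A.gcomp_add fsupp_closed)
  next
    fix x k i assume "x \<in> gr T i"
    then obtain n a where x: "x = (n, a)" "n \<in> gr N i" "a \<in> fsupp A J" "\<forall>j\<in>J. a j \<in> gr A (i - \<delta> j)"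
      by (auto simp: attach_simps)
    have "gcomp A (a j) (k - \<delta> j) = (if k = i then a j else \<zero>\<^bsub>A\<^esub>)" for j
    proof (cases "j \<in> J")
      case True
      then show ?thesis using x A.A.gcomp_homogeneous[of "a j" "i - \<delta> j" "k - \<delta> j"] by auto
    next
      case False
      then have "a j = \<zero>\<^bsub>A\<^esub>" using x by (simp add: fsupp_def)
      then show ?thesis by (simp add: A.A.gcomp_zero)
    qed
    then show "c x k = (if k = i then x else \<zero>\<^bsub>T\<^esub>)"
      using x M.M.gcomp_homogeneous by (auto simp: c_def attach_simps)
  qed
qed

lemma T_graded_module: "graded_module A T"
proof -
  have "graded_module_axioms A T"
  proof
    fix x i r l assume "x \<in> gr T i" and r: "r \<in> gr A l"
    then obtain n a where x: "x = (n, a)" "n \<in> gr N i" "a \<in> fsupp A J" "\<forall>j\<in>J. a j \<in> gr A (i - \<delta> j)"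
      by (auto simp: attach_simps)
    have "a j \<otimes>\<^bsub>A\<^esub> r \<in> gr A (i + l - \<delta> j)" if "j \<in> J" for j
      using A.A.gr_mult[of "a j" "i - \<delta> j" r l] x(4) r that by (simp add: algebra_simps)
    then show "x \<cdot>\<^bsub>T\<^esub> r \<in> gr T (i + l)"
      using x r A.fsupp_ract[OF x(3)] A.A.gr_carrier M.gr_ract by (simp add: attach_simps)
  qed (auto simp: attach_simps A.fsupp_ract M.ract_closed M.ract_add_left M.ract_add_right M.ract_mult
      M.ract_one fsupp_closed A.A.l_distr A.A.r_distr A.A.m_assoc)
  then show ?thesis using T_graded_group A.A.graded_ring_axioms by (simp add: graded_module_def)
qed

lemma T_koszul: "(n, a) \<in> carrier T \<Longrightarrow> koszul T i (n, a) = (koszul N i n, \<lambda>j. koszul A i (a j))"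
proof -
  assume x: "(n, a) \<in> carrier T"
  interpret T: abelian_group T by (rule T_abelian_group)
  have "(\<ominus>\<^bsub>N\<^esub> n, \<lambda>j. \<ominus>\<^bsub>A\<^esub> a j) \<oplus>\<^bsub>T\<^esub> (n, a) = \<zero>\<^bsub>T\<^esub>"
    using x by (auto simp: attach_simps M.M.l_neg A.A.l_neg fsupp_closed)
  then have "\<ominus>\<^bsub>T\<^esub> (n, a) = (\<ominus>\<^bsub>N\<^esub> n, \<lambda>j. \<ominus>\<^bsub>A\<^esub> a j)"
    using x by (intro T.minus_equality) (auto simp: attach_simps A.A.fsupp_neg)
  then show ?thesis by (simp add: koszul_def)
qed

lemma T_dgm: "dgm A T"
proof (rule dg_moduleI[OF A.dg_ring_axioms T_graded_module])
  fix x assume "x \<in> carrier T"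
  then obtain n a where x: "x = (n, a)" "n \<in> carrier N" "a \<in> fsupp A J" by (auto simp: attach_simps)
  note ac = fsupp_closed[OF x(3)]
  show "diff T x \<in> carrier T"
    using x by (auto simp: attach_simps A.fsupp_kd M.d_closed M.wsum_closed t_closed)
  \<comment> \<open>As \<open>t j\<close> has degree \<open>\<delta> j + 1\<close>, the sign is
    opposite to the one in the differential of the coordinate \<open>j\<close>; the two
    contributions to the square of the differential cancel.\<close>
  have "diff N (wsum A N t a) = wsum A N (\<lambda>j. diff N (t j)) a \<oplus>\<^bsub>N\<^esub>
      wsum A N t (\<lambda>j. koszul A (\<delta> j + 1) (diff A (a j)))"
    by (rule wsum_diff[OF x(3) t_gr])
  also have "wsum A N (\<lambda>j. diff N (t j)) a = \<zero>\<^bsub>N\<^esub>"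
    unfolding wsum_def
    by (rule M.M.add.finprod_one_eqI)
      (use fsupp_subset[OF x(3)] t_cycle M.cyclesD ac in \<open>auto simp: M.ract_zero_left subset_iff\<close>)
  also have "\<zero>\<^bsub>N\<^esub> \<oplus>\<^bsub>N\<^esub> wsum A N t (\<lambda>j. koszul A (\<delta> j + 1) (diff A (a j)))
      = wsum A N t (\<lambda>j. koszul A (\<delta> j + 1) (diff A (a j)))"
    by (rule M.M.l_zero) (use M.wsum_closed[OF A.fsupp_kd[OF x(3)] t_closed] in simp)
  finally have 1: "diff N (wsum A N t a) = wsum A N t (\<lambda>j. koszul A (\<delta> j + 1) (diff A (a j)))" .
  have 2: "wsum A N t (\<lambda>j. koszul A (\<delta> j + 1) (diff A (a j))) \<oplus>\<^bsub>N\<^esub>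
      wsum A N t (\<lambda>j. koszul A (\<delta> j) (diff A (a j))) = \<zero>\<^bsub>N\<^esub>"
  proof -
    have "koszul A (\<delta> j + 1) (diff A (a j)) \<oplus>\<^bsub>A\<^esub> koszul A (\<delta> j) (diff A (a j)) = \<zero>\<^bsub>A\<^esub>" for j
      using A.d_closed[OF ac[of j]] by (simp add: koszul_def A.A.l_neg A.A.r_neg)
    then show ?thesis
      using M.wsum_add[OF A.fsupp_kd[OF x(3), of "\<lambda>j. \<delta> j + 1"] A.fsupp_kd[OF x(3), of \<delta>] t_closed]
      by (simp add: M.wsum_zero)
  qed
  have 3: "koszul A (\<delta> j) (diff A (koszul A (\<delta> j) (diff A (a j)))) = \<zero>\<^bsub>A\<^esub>" for j
    using koszul_hom[OF A.add_hom_diff A.A.abelian_group_axioms A.A.abelian_group_axioms A.d_closed[OF ac]]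
    by (simp add: A.d_d[OF ac] koszul_zero A.A.abelian_group_axioms)
  have wc: "wsum A N t a \<in> carrier N" by (rule M.wsum_closed[OF x(3) t_closed])
  show "diff T (diff T x) = \<zero>\<^bsub>T\<^esub>"
    using x wc M.d_closed[OF x(2)] 2 M.wsum_closed[OF A.fsupp_kd[OF x(3), of "\<lambda>j. \<delta> j + 1"] t_closed]
    by (simp add: attach_simps M.d_add M.d_d 1 3 M.M.l_zero M.d_closed)
  fix y assume "y \<in> carrier T"
  then obtain m b where y: "y = (m, b)" "m \<in> carrier N" "b \<in> fsupp A J" by (auto simp: attach_simps)
  show "diff T (x \<oplus>\<^bsub>T\<^esub> y) = diff T x \<oplus>\<^bsub>T\<^esub> diff T y"
    using x y M.wsum_closed[OF x(3) t_closed] M.wsum_closed[OF y(3) t_closed]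
      add_hom_add[OF A.add_hom_koszul_diff ac fsupp_closed[OF y(3)]]
    by (simp add: attach_simps M.d_add M.wsum_add[OF x(3) y(3) t_closed] M.d_closed M.M.a_ac)
next
  fix x i assume "x \<in> gr T i"
  then obtain n a where x: "x = (n, a)" "n \<in> gr N i" "a \<in> fsupp A J" "\<forall>j\<in>J. a j \<in> gr A (i - \<delta> j)"
    by (auto simp: attach_simps)
  have "wsum A N t a \<in> gr N (i + 1)"
    by (rule M.wsum_gr[OF x(3) t_gr]) (use x in auto)
  moreover have "koszul A (\<delta> j) (diff A (a j)) \<in> gr A (i + 1 - \<delta> j)" if "j \<in> J" for j
    by (rule koszul_in_subgroup[OF A.A.gr_subgroup A.A.abelian_group_axioms])
      (use x that A.d_degree[of "a j" "i - \<delta> j"] in \<open>auto simp: algebra_simps\<close>)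
  ultimately show "diff T x \<in> gr T (i + 1)"
    using x M.d_degree A.fsupp_kd by (simp add: attach_simps M.M.gr_add)
next
  fix x i r assume "x \<in> gr T i" and r: "r \<in> carrier A"
  then obtain n a where x: "x = (n, a)" "n \<in> gr N i" "a \<in> fsupp A J" "\<forall>j\<in>J. a j \<in> gr A (i - \<delta> j)"
    by (auto simp: attach_simps)
  have nc: "n \<in> carrier N" using x M.M.gr_carrier by blast
  note ac = fsupp_closed[OF x(3)]
  have dr: "diff A r \<in> carrier A" using r A.d_closed by blast
  have agr: "a j \<in> gr A (i - \<delta> j)" for j
    using x A.A.gr_zero by (cases "j \<in> J") (auto simp: fsupp_def)
  have wc: "wsum A N t a \<in> carrier N" by (rule M.wsum_closed[OF x(3) t_closed])
  \<comment> \<open>\<open>a j\<close> has degree \<open>i - \<delta> j\<close>, so its Leibniz sign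
    times the sign of \<open>\<delta> j\<close> is the sign of \<open>i\<close>, as the Leibniz rule
    in \<open>T\<close> demands.\<close>
  have "koszul A (\<delta> j) (diff A (a j \<otimes>\<^bsub>A\<^esub> r)) =
      (koszul A (\<delta> j) (diff A (a j)) \<otimes>\<^bsub>A\<^esub> r) \<oplus>\<^bsub>A\<^esub> koszul A i (a j \<otimes>\<^bsub>A\<^esub> diff A r)" for j
    using A.d_leibniz[OF agr r] ac[of j] r dr A.d_closed[OF ac[of j]]
    by (auto simp: koszul_def A.A.l_minus A.A.minus_add A.A.minus_minus)
  moreover have "(n \<cdot>\<^bsub>N\<^esub> diff A r, \<lambda>j. a j \<otimes>\<^bsub>A\<^esub> diff A r) \<in> carrier T"
    using nc dr x by (auto simp: attach_simps M.ract_closed A.fsupp_ract)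
  ultimately show "diff T (x \<cdot>\<^bsub>T\<^esub> r) = (diff T x \<cdot>\<^bsub>T\<^esub> r) \<oplus>\<^bsub>T\<^esub> koszul T i (x \<cdot>\<^bsub>T\<^esub> diff A r)"
    using x nc r dr wc M.mleibniz[OF x(2) r]
    by (simp add: attach_simps T_koszul M.wsum_ract[OF x(3) t_closed r] M.ract_add_left M.d_closed
        M.ract_closed M.M.a_ac koszul_closed M.M.abelian_group_axioms)
qed

lemma attach_incl: "dg_hom A N T (\<lambda>n. (n, \<lambda>j. \<zero>\<^bsub>A\<^esub>))"
  by (auto simp: dg_hom_def graded_hom_iff attach_simps A.A.fsupp_zero M.wsum_zero M.d_closed A.d_zero
      koszul_zero A.A.abelian_group_axioms A.A.gr_zero intro!: mod_homI)

text \<open>The universal property of the cone: a map out of \<open>T\<close> is a map on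
  \<open>N\<close> together with elements bounding the images of the attaching cycles. Linearity
  forces the formula, and \<open>wsum_diff\<close> compares the differentials.\<close>

lemma attach_lift:
  assumes L: "dgm A L" and g: "dg_hom A N L g"
    and y: "\<And>j. j \<in> J \<Longrightarrow> y j \<in> gr L (\<delta> j)" and dy: "\<And>j. j \<in> J \<Longrightarrow> diff L (y j) = g (t j)"
  shows "dg_hom A T L (\<lambda>x. g (fst x) \<oplus>\<^bsub>L\<^esub> wsum A L y (snd x))"
proof -
  interpret L: dgm A L by fact
  note gh = dg_hom_mod_hom[OF g]
  have yc: "y j \<in> carrier L" if "j \<in> J" for j using y[OF that] L.M.M.gr_carrier by blast
  note wc = L.M.wsum_closed[OF _ yc]
  show ?thesis
    unfolding dg_hom_def graded_hom_iff
  proof (intro conjI allI ballI)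
    show "mod_hom A T L (\<lambda>x. g (fst x) \<oplus>\<^bsub>L\<^esub> wsum A L y (snd x))"
      by (rule mod_homI)
        (auto simp: attach_simps mod_hom_closed[OF gh] mod_hom_add[OF gh] mod_hom_ract[OF gh] wc
          L.M.wsum_add[OF _ _ yc] L.M.wsum_ract[OF _ yc] L.M.M.a_ac L.M.ract_add_left)
    fix i x assume "x \<in> gr T i"
    then obtain n a where x: "x = (n, a)" "n \<in> gr N i" "a \<in> fsupp A J" "\<forall>j\<in>J. a j \<in> gr A (i - \<delta> j)"
      by (auto simp: attach_simps)
    then show "g (fst x) \<oplus>\<^bsub>L\<^esub> wsum A L y (snd x) \<in> gr L i"
      using L.M.M.gr_add dg_hom_gr[OF g x(2)] L.M.wsum_gr[OF x(3) y] by auto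
  next
    fix x assume "x \<in> carrier T"
    then obtain n a where x: "x = (n, a)" "n \<in> carrier N" "a \<in> fsupp A J" by (auto simp: attach_simps)
    have tw: "wsum A N t a \<in> carrier N" by (rule M.wsum_closed[OF x(3) t_closed])
    have "wsum A L (\<lambda>j. diff L (y j)) a = wsum A L (\<lambda>j. g (t j)) a"
      unfolding wsum_def
      by (rule L.M.M.finsum_cong') (use fsupp_subset[OF x(3)] fsupp_closed[OF x(3)] dy t_closed
          mod_hom_closed[OF gh] in \<open>auto simp: subset_iff L.M.ract_closed\<close>)
    also have "\<dots> = g (wsum A N t a)"
      by (rule M.wsum_hom[OF L.M.is_graded_module gh x(3) t_closed, symmetric])
    finally have "diff L (wsum A L y a) = g (wsum A N t a) \<oplus>\<^bsub>L\<^esub>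
        wsum A L y (\<lambda>j. koszul A (\<delta> j) (diff A (a j)))"
      using L.wsum_diff[OF x(3) y] by simp
    then show "g (fst (diff T x)) \<oplus>\<^bsub>L\<^esub> wsum A L y (snd (diff T x)) =
        diff L (g (fst x) \<oplus>\<^bsub>L\<^esub> wsum A L y (snd x))"
      using x tw M.d_closed[OF x(2)] wc[OF A.fsupp_kd[OF x(3)]] wc[OF x(3)] mod_hom_closed[OF gh] dg_hom_diff[OF g x(2)]
      by (simp add: attach_simps mod_hom_add[OF gh] L.M.d_add L.M.M.a_assoc L.M.d_closed)
  qed
qed

end

section \<open>Cardinality of modules with cells attached\<close>

lemma Fpow_lepoll:
  assumes "infinite (UNIV :: 'm set)" "(S :: 'a set) \<lesssim> (UNIV :: 'm set)"
  shows "Fpow (S :: 'a set) \<lesssim> (UNIV :: 'm set)"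
proof -
  let ?U = "UNIV :: 'm set"
  have sq: "?U \<times> ?U \<lesssim> ?U"
    using card_of_Times_same_infinite[OF assms(1)] by (simp add: eqpoll_iff_card_of_ordIso eqpoll_imp_lepoll)
  have len: "{xs. length xs = n \<and> set xs \<subseteq> S} \<lesssim> ?U" for n
  proof (induction n)
    case 0
    have "finite {xs. length xs = 0 \<and> set xs \<subseteq> S}" by (rule finite_subset[of _ "{[]}"]) auto
    then show ?case by (rule finite_lepoll_infinite[OF assms(1)])
  next
    case (Suc n)
    have "{xs. length xs = Suc n \<and> set xs \<subseteq> S} \<lesssim> S \<times> {xs. length xs = n \<and> set xs \<subseteq> S}"
      unfolding lepoll_def
    proof (rule exI, rule conjI)
      show "inj_on (\<lambda>xs. (hd xs, tl xs)) {xs. length xs = Suc n \<and> set xs \<subseteq> S}"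
      proof (rule inj_onI)
        fix xs ys :: "'a list"
        assume "xs \<in> {xs. length xs = Suc n \<and> set xs \<subseteq> S}" "ys \<in> {xs. length xs = Suc n \<and> set xs \<subseteq> S}"
          "(hd xs, tl xs) = (hd ys, tl ys)"
        then show "xs = ys" by (cases xs; cases ys) simp_all
      qed
      show "(\<lambda>xs. (hd xs, tl xs)) ` {xs. length xs = Suc n \<and> set xs \<subseteq> S}
          \<subseteq> S \<times> {xs. length xs = n \<and> set xs \<subseteq> S}"
      proof (rule image_subsetI)
        fix xs assume "xs \<in> {xs. length xs = Suc n \<and> set xs \<subseteq> S}"
        then show "(hd xs, tl xs) \<in> S \<times> {xs. length xs = n \<and> set xs \<subseteq> S}" by (cases xs) simp_all
      qed
    qed
    also have "\<dots> \<lesssim> ?U \<times> ?U" by (rule times_lepoll_mono[OF assms(2) Suc])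
    finally show ?case using sq lepoll_trans by blast
  qed
  \<comment> \<open>A finite set is recovered from any enumeration of it. The lists are then grouped
    by length; those of a fixed length embed because an infinite set absorbs its square.\<close>
  have "Fpow S \<lesssim> lists S"
    unfolding lepoll_def
  proof (rule exI, rule conjI)
    let ?f = "\<lambda>F. SOME xs. set xs = F"
    have f: "set (?f F) = F" if "F \<in> Fpow S" for F
      by (rule someI_ex) (use that finite_list in \<open>auto simp: Fpow_def\<close>)
    show "inj_on ?f (Fpow S)" by (rule inj_onI) (metis f)
    show "?f ` Fpow S \<subseteq> lists S" using f by (auto simp: Fpow_def lists_eq_set)
  qed
  also have "lists S \<lesssim> (UNIV :: nat set) \<times> ?U"
  proof -
    obtain g :: "nat \<Rightarrow> 'a list \<Rightarrow> 'm" where g: "\<And>n. inj_on (g n) {xs. length xs = n \<and> set xs \<subseteq> S}"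
      using len unfolding lepoll_def by metis
    show ?thesis
      unfolding lepoll_def
      by (rule exI[of _ "\<lambda>xs. (length xs, g (length xs) xs)"])
        (auto simp: inj_on_def lists_eq_set intro!: inj_onD[OF g])
  qed
  also have "\<dots> \<lesssim> ?U \<times> ?U" using assms(1) by (intro times_lepoll_mono) (auto simp: infinite_le_lepoll)
  also have "\<dots> \<lesssim> ?U" by (rule sq)
  finally show ?thesis .
qed

lemma times_lepoll_UNIV:
  assumes "infinite (UNIV :: 'm set)" "S \<lesssim> (UNIV :: 'm set)" "S' \<lesssim> (UNIV :: 'm set)"
  shows "S \<times> S' \<lesssim> (UNIV :: 'm set)"
  using card_of_Times_same_infinite[OF assms(1)] times_lepoll_mono[OF assms(2,3)]
  by (metis eqpoll_iff_card_of_ordIso eqpoll_imp_lepoll lepoll_trans)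

text \<open>A finitely supported family is determined by its graph over the support, which is a
  finite subset of \<open>J \<times> carrier A\<close>.\<close>

lemma attach_lepoll:
  fixes A :: "('k, 'a) dg" and J :: "'j set"
  assumes inf: "infinite (UNIV :: 'm set)" and N: "carrier N \<lesssim> (UNIV :: 'm set)"
    and J: "J \<lesssim> (UNIV :: 'm set)" and A: "carrier A \<lesssim> (UNIV :: 'm set)"
  shows "carrier (attach A N J \<delta> t) \<lesssim> (UNIV :: 'm set)"
proof -
  have "fsupp A J \<lesssim> Fpow (J \<times> carrier A)"
    unfolding lepoll_def
  proof (rule exI, rule conjI)
    let ?f = "\<lambda>a :: 'j \<Rightarrow> 'a. (\<lambda>j. (j, a j)) ` {j. a j \<noteq> \<zero>\<^bsub>A\<^esub>}"
    show "inj_on ?f (fsupp A J)"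
    proof (rule inj_onI)
      fix a b assume eq: "?f a = ?f b"
      show "a = b"
      proof
        fix j
        have "(j, x) \<in> ?f c \<longleftrightarrow> x = c j \<and> c j \<noteq> \<zero>\<^bsub>A\<^esub>" for c x by auto
        then show "a j = b j" using eq by (metis (no_types, lifting))
      qed
    qed
    show "?f ` fsupp A J \<subseteq> Fpow (J \<times> carrier A)"
      using fsupp_finite fsupp_subset fsupp_closed by (fastforce simp: Fpow_def)
  qed
  also have "\<dots> \<lesssim> (UNIV :: 'm set)"
    by (intro Fpow_lepoll times_lepoll_UNIV inf J A)
  finally show ?thesis
    unfolding attach_simps by (intro times_lepoll_UNIV inf N)
qed

section \<open>Localisation\<close>

lemma (in graded_ring) even_central:
  assumes "graded_commutative R" "s \<in> gr R k" "even k" "r \<in> carrier R"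
  shows "s \<otimes> r = r \<otimes> s"
  using assms(4)
proof (induction r rule: graded_induct)
  case (homogeneous i r)
  then have "s \<otimes> r = koszul R (k * i) (r \<otimes> s)" using assms unfolding graded_commutative_def by blast
  then show ?case using assms by (simp add: koszul_even)
next
  case (add x y)
  then show ?case using gr_carrier[OF assms(2)] by (simp add: l_distr r_distr)
qed

section \<open>Fractions with respect to a multiplicative set of even elements\<close>

locale mult_set = graded_ring R for R :: "('k, 'r) graded" (structure) +
  fixes S :: "'r set"
  assumes gc: "graded_commutative R"
    and S_even: "s \<in> S \<Longrightarrow> \<exists>l. even l \<and> s \<in> gr R l"
    and S_one: "\<one> \<in> S"
    and S_mult: "\<lbrakk>s \<in> S; t \<in> S\<rbrakk> \<Longrightarrow> s \<otimes> t \<in> S"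
begin

lemma S_carrier: "s \<in> S \<Longrightarrow> s \<in> carrier R"
  using S_even gr_carrier by blast

lemma S_central: "\<lbrakk>s \<in> S; r \<in> carrier R\<rbrakk> \<Longrightarrow> s \<otimes> r = r \<otimes> s"
  using S_even even_central[OF gc] by blast

lemma ract_swap:
  assumes "graded_module R M" "x \<in> carrier M" "s \<in> S" "r \<in> carrier R"
  shows "(x \<cdot>\<^bsub>M\<^esub> s) \<cdot>\<^bsub>M\<^esub> r = (x \<cdot>\<^bsub>M\<^esub> r) \<cdot>\<^bsub>M\<^esub> s"
  using assms S_carrier S_central[of s r] graded_module.ract_mult[OF assms(1,2)] by metis

end

locale fractions = mult_set R S + M: graded_module R M
  for R :: "('k, 'r) graded" and S :: "'r set" and M :: "('r, 'm) graded"
begin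

lemmas swap = ract_swap[OF M.graded_module_axioms]

lemma act_S: "\<lbrakk>x \<in> carrier M; s \<in> S\<rbrakk> \<Longrightarrow> x \<cdot>\<^bsub>M\<^esub> s \<in> carrier M"
  using S_carrier M.ract_closed by blast

lemma act_ST: "\<lbrakk>x \<in> carrier M; s \<in> S; t \<in> S\<rbrakk> \<Longrightarrow> x \<cdot>\<^bsub>M\<^esub> (s \<otimes>\<^bsub>R\<^esub> t) = (x \<cdot>\<^bsub>M\<^esub> s) \<cdot>\<^bsub>M\<^esub> t"
  using S_carrier M.ract_mult by blast

lemma swap_S: "\<lbrakk>x \<in> carrier M; s \<in> S; t \<in> S\<rbrakk> \<Longrightarrow> (x \<cdot>\<^bsub>M\<^esub> s) \<cdot>\<^bsub>M\<^esub> t = (x \<cdot>\<^bsub>M\<^esub> t) \<cdot>\<^bsub>M\<^esub> s"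
  using swap S_carrier by blast

lemma swap_R: "\<lbrakk>x \<in> carrier M; s \<in> S; r \<in> carrier R\<rbrakk> \<Longrightarrow> (x \<cdot>\<^bsub>M\<^esub> r) \<cdot>\<^bsub>M\<^esub> s = (x \<cdot>\<^bsub>M\<^esub> s) \<cdot>\<^bsub>M\<^esub> r"
  by (rule swap[symmetric])

lemma act_add: "\<lbrakk>x \<in> carrier M; y \<in> carrier M; s \<in> S\<rbrakk> \<Longrightarrow> (x \<oplus>\<^bsub>M\<^esub> y) \<cdot>\<^bsub>M\<^esub> s = (x \<cdot>\<^bsub>M\<^esub> s) \<oplus>\<^bsub>M\<^esub> (y \<cdot>\<^bsub>M\<^esub> s)"
  using S_carrier M.ract_add_left by blast

lemma frac_sym:
  assumes "(y, t) \<in> fraction M S x s" "x \<in> carrier M" "s \<in> S"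
  shows "(x, s) \<in> fraction M S y t"
  using assms by (force simp: fraction_def)

text \<open>The denominator \<open>t\<close> of the middle fraction joins the two given witnesses
  \<open>u\<close> and \<open>v\<close>: their product witnesses the new equality.\<close>

lemma frac_trans:
  assumes "(y, t) \<in> fraction M S x s" "(z, w) \<in> fraction M S y t" "x \<in> carrier M" "s \<in> S"
  shows "(z, w) \<in> fraction M S x s"
proof -
  obtain u where u: "u \<in> S" "(x \<cdot>\<^bsub>M\<^esub> t) \<cdot>\<^bsub>M\<^esub> u = (y \<cdot>\<^bsub>M\<^esub> s) \<cdot>\<^bsub>M\<^esub> u" and y: "y \<in> carrier M" "t \<in> S"
    using assms by (auto simp: fraction_def)
  obtain v where v: "v \<in> S" "(y \<cdot>\<^bsub>M\<^esub> w) \<cdot>\<^bsub>M\<^esub> v = (z \<cdot>\<^bsub>M\<^esub> t) \<cdot>\<^bsub>M\<^esub> v" and z: "z \<in> carrier M" "w \<in> S"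
    using assms by (auto simp: fraction_def)
  note c = assms(3,4) u(1) v(1) y z
  have "(((x \<cdot>\<^bsub>M\<^esub> w) \<cdot>\<^bsub>M\<^esub> t) \<cdot>\<^bsub>M\<^esub> u) \<cdot>\<^bsub>M\<^esub> v = (((x \<cdot>\<^bsub>M\<^esub> t) \<cdot>\<^bsub>M\<^esub> u) \<cdot>\<^bsub>M\<^esub> w) \<cdot>\<^bsub>M\<^esub> v"
    using c by (simp add: swap_S act_S)
  also have "\<dots> = (((y \<cdot>\<^bsub>M\<^esub> w) \<cdot>\<^bsub>M\<^esub> v) \<cdot>\<^bsub>M\<^esub> s) \<cdot>\<^bsub>M\<^esub> u"
    unfolding u(2) using c by (simp add: swap_S act_S)
  also have "\<dots> = (((z \<cdot>\<^bsub>M\<^esub> s) \<cdot>\<^bsub>M\<^esub> t) \<cdot>\<^bsub>M\<^esub> u) \<cdot>\<^bsub>M\<^esub> v"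
    unfolding v(2) using c by (simp add: swap_S act_S)
  finally have "(x \<cdot>\<^bsub>M\<^esub> w) \<cdot>\<^bsub>M\<^esub> (t \<otimes>\<^bsub>R\<^esub> u \<otimes>\<^bsub>R\<^esub> v) = (z \<cdot>\<^bsub>M\<^esub> s) \<cdot>\<^bsub>M\<^esub> (t \<otimes>\<^bsub>R\<^esub> u \<otimes>\<^bsub>R\<^esub> v)"
    using c by (simp add: act_ST act_S S_mult)
  then show ?thesis using c S_mult by (auto simp: fraction_def)
qed

lemma frac_self: "\<lbrakk>x \<in> carrier M; s \<in> S\<rbrakk> \<Longrightarrow> (x, s) \<in> fraction M S x s"
  by (auto simp: fraction_def)

lemma frac_nonempty: "\<lbrakk>x \<in> carrier M; s \<in> S\<rbrakk> \<Longrightarrow> fraction M S x s \<noteq> {}"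
  using frac_self by blast

lemma frac_eq:
  assumes "(y, t) \<in> fraction M S x s" "x \<in> carrier M" "s \<in> S"
  shows "fraction M S y t = fraction M S x s"
proof -
  have y: "y \<in> carrier M" "t \<in> S" using assms by (auto simp: fraction_def)
  have "p \<in> fraction M S y t \<longleftrightarrow> p \<in> fraction M S x s" for p
    using frac_trans[of y t x s "fst p" "snd p"] frac_trans[of x s y t "fst p" "snd p"]
      frac_sym assms y by auto
  then show ?thesis by blast
qed

lemma frac_eqI:
  assumes "x \<in> carrier M" "s \<in> S" "y \<in> carrier M" "t \<in> S" "u \<in> S"
    and "(x \<cdot>\<^bsub>M\<^esub> t) \<cdot>\<^bsub>M\<^esub> u = (y \<cdot>\<^bsub>M\<^esub> s) \<cdot>\<^bsub>M\<^esub> u"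
  shows "fraction M S x s = fraction M S y t"
  by (rule frac_eq[symmetric]) (use assms in \<open>auto simp: fraction_def\<close>)

lemma frac_eqD:
  assumes "fraction M S x s = fraction M S y t" "y \<in> carrier M" "t \<in> S"
  shows "\<exists>u\<in>S. (x \<cdot>\<^bsub>M\<^esub> t) \<cdot>\<^bsub>M\<^esub> u = (y \<cdot>\<^bsub>M\<^esub> s) \<cdot>\<^bsub>M\<^esub> u"
  using frac_self[OF assms(2,3)] unfolding assms(1)[symmetric] by (auto simp: fraction_def)

lemma frac_add_wd:
  assumes "(x', s') \<in> fraction M S x s" "(y', t') \<in> fraction M S y t"
    and c: "x \<in> carrier M" "s \<in> S" "y \<in> carrier M" "t \<in> S"
  shows "fraction M S ((x' \<cdot>\<^bsub>M\<^esub> t') \<oplus>\<^bsub>M\<^esub> (y' \<cdot>\<^bsub>M\<^esub> s')) (s' \<otimes>\<^bsub>R\<^esub> t') =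
    fraction M S ((x \<cdot>\<^bsub>M\<^esub> t) \<oplus>\<^bsub>M\<^esub> (y \<cdot>\<^bsub>M\<^esub> s)) (s \<otimes>\<^bsub>R\<^esub> t)"
proof -
  obtain u where u: "u \<in> S" "(x \<cdot>\<^bsub>M\<^esub> s') \<cdot>\<^bsub>M\<^esub> u = (x' \<cdot>\<^bsub>M\<^esub> s) \<cdot>\<^bsub>M\<^esub> u" and x': "x' \<in> carrier M" "s' \<in> S"
    using assms by (auto simp: fraction_def)
  obtain v where v: "v \<in> S" "(y \<cdot>\<^bsub>M\<^esub> t') \<cdot>\<^bsub>M\<^esub> v = (y' \<cdot>\<^bsub>M\<^esub> t) \<cdot>\<^bsub>M\<^esub> v" and y': "y' \<in> carrier M" "t' \<in> S"
    using assms by (auto simp: fraction_def)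
  note c = c u(1) v(1) x' y'
  have 1: "((((x' \<cdot>\<^bsub>M\<^esub> t') \<cdot>\<^bsub>M\<^esub> s) \<cdot>\<^bsub>M\<^esub> t) \<cdot>\<^bsub>M\<^esub> u) \<cdot>\<^bsub>M\<^esub> v
      = ((((x \<cdot>\<^bsub>M\<^esub> t) \<cdot>\<^bsub>M\<^esub> s') \<cdot>\<^bsub>M\<^esub> t') \<cdot>\<^bsub>M\<^esub> u) \<cdot>\<^bsub>M\<^esub> v"
  proof -
    have "((((x' \<cdot>\<^bsub>M\<^esub> t') \<cdot>\<^bsub>M\<^esub> s) \<cdot>\<^bsub>M\<^esub> t) \<cdot>\<^bsub>M\<^esub> u) \<cdot>\<^bsub>M\<^esub> v = ((((x' \<cdot>\<^bsub>M\<^esub> s) \<cdot>\<^bsub>M\<^esub> u) \<cdot>\<^bsub>M\<^esub> t') \<cdot>\<^bsub>M\<^esub> t) \<cdot>\<^bsub>M\<^esub> v"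
      using c by (simp add: swap_S act_S)
    also have "\<dots> = ((((x \<cdot>\<^bsub>M\<^esub> t) \<cdot>\<^bsub>M\<^esub> s') \<cdot>\<^bsub>M\<^esub> t') \<cdot>\<^bsub>M\<^esub> u) \<cdot>\<^bsub>M\<^esub> v"
      unfolding u(2)[symmetric] using c by (simp add: swap_S act_S)
    finally show ?thesis .
  qed
  have 2: "((((y' \<cdot>\<^bsub>M\<^esub> s') \<cdot>\<^bsub>M\<^esub> s) \<cdot>\<^bsub>M\<^esub> t) \<cdot>\<^bsub>M\<^esub> u) \<cdot>\<^bsub>M\<^esub> v
      = ((((y \<cdot>\<^bsub>M\<^esub> s) \<cdot>\<^bsub>M\<^esub> s') \<cdot>\<^bsub>M\<^esub> t') \<cdot>\<^bsub>M\<^esub> u) \<cdot>\<^bsub>M\<^esub> v"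
  proof -
    have "((((y' \<cdot>\<^bsub>M\<^esub> s') \<cdot>\<^bsub>M\<^esub> s) \<cdot>\<^bsub>M\<^esub> t) \<cdot>\<^bsub>M\<^esub> u) \<cdot>\<^bsub>M\<^esub> v = ((((y' \<cdot>\<^bsub>M\<^esub> t) \<cdot>\<^bsub>M\<^esub> v) \<cdot>\<^bsub>M\<^esub> s) \<cdot>\<^bsub>M\<^esub> s') \<cdot>\<^bsub>M\<^esub> u"
      using c by (simp add: swap_S act_S)
    also have "\<dots> = ((((y \<cdot>\<^bsub>M\<^esub> s) \<cdot>\<^bsub>M\<^esub> s') \<cdot>\<^bsub>M\<^esub> t') \<cdot>\<^bsub>M\<^esub> u) \<cdot>\<^bsub>M\<^esub> v"
      unfolding v(2)[symmetric] using c by (simp add: swap_S act_S)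
    finally show ?thesis .
  qed
  show ?thesis
    by (rule frac_eqI[where u = "u \<otimes>\<^bsub>R\<^esub> v"])
      (use c 1 2 in \<open>simp_all add: S_mult act_S act_ST act_add\<close>)
qed

lemma frac_act_wd:
  assumes "(x', s') \<in> fraction M S x s" and c: "x \<in> carrier M" "s \<in> S" "r \<in> carrier R"
  shows "fraction M S (x' \<cdot>\<^bsub>M\<^esub> r) s' = fraction M S (x \<cdot>\<^bsub>M\<^esub> r) s"
proof -
  obtain u where u: "u \<in> S" "(x \<cdot>\<^bsub>M\<^esub> s') \<cdot>\<^bsub>M\<^esub> u = (x' \<cdot>\<^bsub>M\<^esub> s) \<cdot>\<^bsub>M\<^esub> u" and x': "x' \<in> carrier M" "s' \<in> S"
    using assms by (auto simp: fraction_def)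
  show ?thesis
    by (rule frac_eqI[OF _ _ _ _ u(1)])
      (use c x' u in \<open>simp_all add: swap_R act_S M.ract_closed\<close>)
qed

end

locale localised = fractions R "even_denoms R p" M
  for R :: "('k, 'r) graded" and p :: "'r set" and M :: "('r, 'm) graded"
begin

abbreviation "S \<equiv> even_denoms R p"
abbreviation "L \<equiv> localisation R p M"

lemma loc_carrier: "carrier L = {fraction M S x s |x s. x \<in> carrier M \<and> s \<in> S}"
  by (simp add: localisation_def Let_def)

lemma loc_frac: "\<lbrakk>x \<in> carrier M; s \<in> S\<rbrakk> \<Longrightarrow> fraction M S x s \<in> carrier L"
  by (auto simp: loc_carrier)

lemma loc_gr:
  "gr L j = {fraction M S x s |x s i l. x \<in> gr M i \<and> s \<in> S \<inter> gr R l \<and> j = i - l}"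
  by (simp add: localisation_def Let_def)

text \<open>By \<open>frac_add_wd\<close> all representatives give the same fraction, so a union
  over a nonempty family of equal sets collapses.\<close>

lemma loc_add:
  assumes "x \<in> carrier M" "s \<in> S" "y \<in> carrier M" "t \<in> S"
  shows "fraction M S x s \<oplus>\<^bsub>L\<^esub> fraction M S y t =
    fraction M S ((x \<cdot>\<^bsub>M\<^esub> t) \<oplus>\<^bsub>M\<^esub> (y \<cdot>\<^bsub>M\<^esub> s)) (s \<otimes>\<^bsub>R\<^esub> t)"
proof -
  let ?F = "fraction M S ((x \<cdot>\<^bsub>M\<^esub> t) \<oplus>\<^bsub>M\<^esub> (y \<cdot>\<^bsub>M\<^esub> s)) (s \<otimes>\<^bsub>R\<^esub> t)"
  have inner: "(\<Union>(y', t')\<in>fraction M S y t.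
      fraction M S ((x' \<cdot>\<^bsub>M\<^esub> t') \<oplus>\<^bsub>M\<^esub> (y' \<cdot>\<^bsub>M\<^esub> s')) (s' \<otimes>\<^bsub>R\<^esub> t')) = ?F"
    if "(x', s') \<in> fraction M S x s" for x' s'
  proof -
    have "(\<Union>(y', t')\<in>fraction M S y t.
        fraction M S ((x' \<cdot>\<^bsub>M\<^esub> t') \<oplus>\<^bsub>M\<^esub> (y' \<cdot>\<^bsub>M\<^esub> s')) (s' \<otimes>\<^bsub>R\<^esub> t')) = (\<Union>b\<in>fraction M S y t. ?F)"
      by (rule SUP_cong[OF refl]) (auto simp: frac_add_wd[OF that _ assms])
    then show ?thesis using frac_nonempty assms by simp
  qed
  have "add L = (\<lambda>\<xi> \<eta>. \<Union>(x, s)\<in>\<xi>. \<Union>(y, t)\<in>\<eta>.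
      fraction M S ((x \<cdot>\<^bsub>M\<^esub> t) \<oplus>\<^bsub>M\<^esub> (y \<cdot>\<^bsub>M\<^esub> s)) (s \<otimes>\<^bsub>R\<^esub> t))"
    by (simp add: localisation_def Let_def)
  then have "fraction M S x s \<oplus>\<^bsub>L\<^esub> fraction M S y t = (\<Union>(x', s')\<in>fraction M S x s.
      \<Union>(y', t')\<in>fraction M S y t. fraction M S ((x' \<cdot>\<^bsub>M\<^esub> t') \<oplus>\<^bsub>M\<^esub> (y' \<cdot>\<^bsub>M\<^esub> s')) (s' \<otimes>\<^bsub>R\<^esub> t'))"
    by (rule fun_cong[OF fun_cong])
  also have "\<dots> = (\<Union>a\<in>fraction M S x s. ?F)"
  proof (rule SUP_cong[OF refl])
    fix a assume "a \<in> fraction M S x s"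
    then show "(case a of (x', s') \<Rightarrow> \<Union>(y', t')\<in>fraction M S y t.
        fraction M S ((x' \<cdot>\<^bsub>M\<^esub> t') \<oplus>\<^bsub>M\<^esub> (y' \<cdot>\<^bsub>M\<^esub> s')) (s' \<otimes>\<^bsub>R\<^esub> t')) = ?F"
      by (cases a) (simp only: prod.case inner)
  qed
  finally show ?thesis using frac_nonempty assms by simp
qed

lemma loc_act:
  assumes "x \<in> carrier M" "s \<in> S" "r \<in> carrier R"
  shows "fraction M S x s \<cdot>\<^bsub>L\<^esub> r = fraction M S (x \<cdot>\<^bsub>M\<^esub> r) s"
proof -
  have "smult L = (\<lambda>r \<xi>. \<Union>(x, s)\<in>\<xi>. fraction M S (x \<cdot>\<^bsub>M\<^esub> r) s)"
    by (simp add: localisation_def Let_def)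
  then have "fraction M S x s \<cdot>\<^bsub>L\<^esub> r = (\<Union>(x', s')\<in>fraction M S x s. fraction M S (x' \<cdot>\<^bsub>M\<^esub> r) s')"
    by (rule fun_cong[OF fun_cong])
  also have "\<dots> = (\<Union>a\<in>fraction M S x s. fraction M S (x \<cdot>\<^bsub>M\<^esub> r) s)"
    by (rule SUP_cong[OF refl]) (auto simp: frac_act_wd[OF _ assms])
  finally show ?thesis using frac_nonempty assms by simp
qed

text \<open>One of the two closure properties that \<open>realisableD\<close> asks of a
  localisation; the other is \<open>loc_act_closed\<close>.\<close>

lemma loc_add_closed: "\<lbrakk>\<xi> \<in> carrier L; \<eta> \<in> carrier L\<rbrakk> \<Longrightarrow> \<xi> \<oplus>\<^bsub>L\<^esub> \<eta> \<in> carrier L"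
proof -
  assume "\<xi> \<in> carrier L" "\<eta> \<in> carrier L"
  then obtain x s y t where "x \<in> carrier M" "s \<in> S" "\<xi> = fraction M S x s"
      "y \<in> carrier M" "t \<in> S" "\<eta> = fraction M S y t"
    by (auto simp: loc_carrier)
  then show ?thesis by (auto simp: loc_add S_mult act_S intro!: loc_frac)
qed

lemma loc_act_closed: "\<lbrakk>\<xi> \<in> carrier L; r \<in> carrier R\<rbrakk> \<Longrightarrow> \<xi> \<cdot>\<^bsub>L\<^esub> r \<in> carrier L"
  by (auto simp: loc_carrier[of] loc_act) (metis M.ract_closed)

lemma loc_gr_carrier: "gr L j \<subseteq> carrier L"
  using M.M.gr_carrier by (auto simp: loc_gr loc_carrier)

lemma loc_map: "(\<lambda>x. fraction M S x \<one>\<^bsub>R\<^esub>) \<in> graded_hom R M L"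
  unfolding graded_hom_iff
proof (intro conjI allI ballI)
  show "mod_hom R M L (\<lambda>x. fraction M S x \<one>\<^bsub>R\<^esub>)"
    by (rule mod_homI) (simp_all add: loc_frac loc_add loc_act S_one M.ract_one)
  show "fraction M S x \<one>\<^bsub>R\<^esub> \<in> gr L i" if "x \<in> gr M i" for x i
    using that S_one gr_one by (fastforce simp: loc_gr)
qed

end

text \<open>
  None of the modules need have \<open>S\<close> acting invertibly: the image of \<open>H0\<close> in \<open>H1\<close> is divisible by
  \<open>S\<close>, the quotients by \<open>s\<close> are unique up to \<open>S\<close>-torsion, and \<open>H1 \<rightarrow> H2\<close> kills the latter.
\<close>

lemma localised_split:
  fixes H0 :: "('r, 'h0) graded" and H1 :: "('r, 'h1) graded" and H2 :: "('r, 'h2) graded"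
  assumes loc: "localised R p X" and H0: "graded_module R H0" and H1: "graded_module R H1"
    and H2: "graded_module R H2"
    and i: "i \<in> graded_hom R X H0" and q: "q \<in> graded_hom R H0 X"
    and qi: "\<And>x. x \<in> carrier X \<Longrightarrow> q (i x) = x"
    and k1: "k1 \<in> graded_hom R H0 H1" and k2: "k2 \<in> graded_hom R H1 H2"
    and ker1: "\<And>\<xi>. \<lbrakk>\<xi> \<in> carrier H0; k1 \<xi> = \<zero>\<^bsub>H1\<^esub>\<rbrakk> \<Longrightarrow> \<exists>s\<in>even_denoms R p. \<xi> \<cdot>\<^bsub>H0\<^esub> s = \<zero>\<^bsub>H0\<^esub>"
    and ker2: "\<And>\<xi>. \<lbrakk>\<xi> \<in> carrier H1; k2 \<xi> = \<zero>\<^bsub>H2\<^esub>\<rbrakk> \<Longrightarrow> \<exists>s\<in>even_denoms R p. \<xi> \<cdot>\<^bsub>H1\<^esub> s = \<zero>\<^bsub>H1\<^esub>"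
    and coker1: "\<And>\<eta>. \<eta> \<in> carrier H1 \<Longrightarrow> \<exists>s\<in>even_denoms R p. \<exists>\<xi>\<in>carrier H0. \<eta> \<cdot>\<^bsub>H1\<^esub> s = k1 \<xi>"
    and coker2: "\<And>\<eta>. \<eta> \<in> carrier H2 \<Longrightarrow> \<exists>s\<in>even_denoms R p. \<exists>\<xi>\<in>carrier H1. \<eta> \<cdot>\<^bsub>H2\<^esub> s = k2 \<xi>"
    and div1: "\<And>\<xi> n s l. \<lbrakk>\<xi> \<in> gr H0 n; s \<in> even_denoms R p; s \<in> gr R l; even l\<rbrakk> \<Longrightarrow>
      \<exists>\<eta>\<in>gr H1 (n - l). \<eta> \<cdot>\<^bsub>H1\<^esub> s = k1 \<xi>"
    and tors2: "\<And>\<xi> n s. \<lbrakk>\<xi> \<in> gr H1 n; s \<in> even_denoms R p; \<xi> \<cdot>\<^bsub>H1\<^esub> s = \<zero>\<^bsub>H1\<^esub>\<rbrakk> \<Longrightarrow> k2 \<xi> = \<zero>\<^bsub>H2\<^esub>"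
  shows "\<exists>i' q'. i' \<in> graded_hom R (localisation R p X) H2 \<and> q' \<in> graded_hom R H2 (localisation R p X) \<and>
    (\<forall>\<xi>\<in>carrier (localisation R p X). q' (i' \<xi>) = \<xi>)"
proof -
  interpret X: localised R p X by (rule loc)
  let ?S = "even_denoms R p" and ?L = "localisation R p X"
  interpret H0: fractions R ?S H0 using X.mult_set_axioms H0 by (rule fractions.intro)
  interpret H1: fractions R ?S H1 using X.mult_set_axioms H1 by (rule fractions.intro)
  interpret H2: fractions R ?S H2 using X.mult_set_axioms H2 by (rule fractions.intro)
  note k1h = graded_hom_mod_hom[OF k1] and k2h = graded_hom_mod_hom[OF k2]
    and ih = graded_hom_mod_hom[OF i] and qh = graded_hom_mod_hom[OF q]
  note cl = mod_hom_closed[OF k1h] mod_hom_closed[OF k2h] mod_hom_closed[OF ih] mod_hom_closed[OF qh]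
  note acts = mod_hom_ract[OF k1h _ X.S_carrier] mod_hom_ract[OF k2h _ X.S_carrier]
    mod_hom_ract[OF ih _ X.S_carrier] mod_hom_ract[OF qh _ X.S_carrier]
  note adds = mod_hom_add[OF k1h] mod_hom_add[OF k2h] mod_hom_add[OF ih] mod_hom_add[OF qh]
  define k where "k \<xi> = k2 (k1 \<xi>)" for \<xi>
  have kg: "k \<in> graded_hom R H0 H2" unfolding k_def by (rule graded_hom_comp[OF k1 k2])
  note kh = graded_hom_mod_hom[OF kg]
  \<comment> \<open>Torsion kernel and torsion cokernel pass from \<open>k1\<close> and
    \<open>k2\<close> to the composite, with the product of the two elements of \<open>S\<close> as
    annihilator.\<close>
  have ker: "\<exists>s\<in>?S. \<xi> \<cdot>\<^bsub>H0\<^esub> s = \<zero>\<^bsub>H0\<^esub>" if \<xi>: "\<xi> \<in> carrier H0" "k \<xi> = \<zero>\<^bsub>H2\<^esub>" for \<xi>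
  proof -
    obtain s where s: "s \<in> ?S" "k1 \<xi> \<cdot>\<^bsub>H1\<^esub> s = \<zero>\<^bsub>H1\<^esub>" using ker2[of "k1 \<xi>"] \<xi> cl by (auto simp: k_def)
    then have "k1 (\<xi> \<cdot>\<^bsub>H0\<^esub> s) = \<zero>\<^bsub>H1\<^esub>" using \<xi> acts by simp
    then obtain t where t: "t \<in> ?S" "(\<xi> \<cdot>\<^bsub>H0\<^esub> s) \<cdot>\<^bsub>H0\<^esub> t = \<zero>\<^bsub>H0\<^esub>" using ker1 \<xi> s H0.act_S by blast
    then have "\<xi> \<cdot>\<^bsub>H0\<^esub> (s \<otimes>\<^bsub>R\<^esub> t) = \<zero>\<^bsub>H0\<^esub>" using s \<xi> by (simp add: H0.act_ST)
    then show ?thesis using s t X.S_mult by blast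
  qed
  have coker: "\<exists>s\<in>?S. \<exists>\<xi>\<in>carrier H0. \<eta> \<cdot>\<^bsub>H2\<^esub> s = k \<xi>" if \<eta>: "\<eta> \<in> carrier H2" for \<eta>
  proof -
    obtain s \<mu> where s: "s \<in> ?S" "\<mu> \<in> carrier H1" "\<eta> \<cdot>\<^bsub>H2\<^esub> s = k2 \<mu>" using coker2[OF \<eta>] by blast
    obtain t \<xi> where t: "t \<in> ?S" "\<xi> \<in> carrier H0" "\<mu> \<cdot>\<^bsub>H1\<^esub> t = k1 \<xi>" using coker1[OF s(2)] by blast
    have "\<eta> \<cdot>\<^bsub>H2\<^esub> (s \<otimes>\<^bsub>R\<^esub> t) = k \<xi>"
      using s t \<eta> acts(2)[of \<mu> t] by (simp add: H2.act_ST k_def)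
    then show ?thesis using s t X.S_mult by blast
  qed
  \<comment> \<open>Divisibility and the death of torsion are given for homogeneous classes, because
    cells have degrees. Divisibility extends by sums; the statement on torsion is checked on
    components.\<close>
  have div: "\<exists>\<eta>\<in>carrier H1. \<eta> \<cdot>\<^bsub>H1\<^esub> s = k1 \<xi>" if \<xi>: "\<xi> \<in> carrier H0" and s: "s \<in> ?S" for \<xi> s
    using \<xi>
  proof (induction \<xi> rule: H0.M.M.graded_induct)
    case (homogeneous n \<xi>)
    then show ?case using div1 X.S_even[OF s] s H1.M.M.gr_carrier by meson
  next
    case (add \<xi> \<mu>)
    then obtain \<eta> \<nu> where "\<eta> \<in> carrier H1" "\<eta> \<cdot>\<^bsub>H1\<^esub> s = k1 \<xi>" "\<nu> \<in> carrier H1" "\<nu> \<cdot>\<^bsub>H1\<^esub> s = k1 \<mu>" by blast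
    then show ?case
      using add.hyps s by (intro bexI[of _ "\<eta> \<oplus>\<^bsub>H1\<^esub> \<nu>"]) (simp_all add: H1.act_add adds)
  qed
  have tors: "k2 \<xi> = \<zero>\<^bsub>H2\<^esub>" if \<xi>: "\<xi> \<in> carrier H1" and s: "s \<in> ?S" "\<xi> \<cdot>\<^bsub>H1\<^esub> s = \<zero>\<^bsub>H1\<^esub>" for \<xi> s
  proof (rule H2.M.M.eqI_gcomp)
    show "k2 \<xi> \<in> carrier H2" "\<zero>\<^bsub>H2\<^esub> \<in> carrier H2" using cl \<xi> by auto
    fix n
    obtain l where l: "s \<in> gr R l" using X.S_even[OF s(1)] by blast
    have "gcomp H1 \<xi> n \<cdot>\<^bsub>H1\<^esub> s = \<zero>\<^bsub>H1\<^esub>"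
      using H1.M.gcomp_ract[OF \<xi> l, of n] s by (simp add: H1.M.M.gcomp_zero)
    then have "k2 (gcomp H1 \<xi> n) = \<zero>\<^bsub>H2\<^esub>" using tors2[OF H1.M.M.gcomp_props(1)[OF \<xi>] s(1)] by blast
    then show "gcomp H2 (k2 \<xi>) n = gcomp H2 \<zero>\<^bsub>H2\<^esub> n"
      using gcomp_graded_hom[OF H1 H2 k2 \<xi>] by (simp add: H2.M.M.gcomp_zero)
  qed
  \<comment> \<open>\<open>x / s\<close> goes to the image in \<open>H2\<close> of a quotient of
    \<open>k1 (i x)\<close> by \<open>s\<close>. Such a quotient exists in \<open>H1\<close>, but it
    is unique only after applying \<open>k2\<close>.\<close>
  define i' where "i' \<xi> = (SOME \<zeta>. \<exists>x s \<eta>. x \<in> carrier X \<and> s \<in> ?S \<and> \<xi> = fraction X ?S x s \<and>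
    \<eta> \<in> carrier H1 \<and> \<eta> \<cdot>\<^bsub>H1\<^esub> s = k1 (i x) \<and> \<zeta> = k2 \<eta>)" for \<xi>
  have i': "i' (fraction X ?S x s) = k2 \<eta>"
    if h: "x \<in> carrier X" "s \<in> ?S" "\<eta> \<in> carrier H1" "\<eta> \<cdot>\<^bsub>H1\<^esub> s = k1 (i x)" for x s \<eta>
    unfolding i'_def
  proof (rule some_equality)
    show "\<exists>y t \<theta>. y \<in> carrier X \<and> t \<in> ?S \<and> fraction X ?S x s = fraction X ?S y t \<and>
        \<theta> \<in> carrier H1 \<and> \<theta> \<cdot>\<^bsub>H1\<^esub> t = k1 (i y) \<and> k2 \<eta> = k2 \<theta>" using h by blast
    fix \<zeta> assume "\<exists>y t \<theta>. y \<in> carrier X \<and> t \<in> ?S \<and> fraction X ?S x s = fraction X ?S y t \<and>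
        \<theta> \<in> carrier H1 \<and> \<theta> \<cdot>\<^bsub>H1\<^esub> t = k1 (i y) \<and> \<zeta> = k2 \<theta>"
    then obtain y t \<theta> where g: "y \<in> carrier X" "t \<in> ?S" "fraction X ?S x s = fraction X ?S y t"
        "\<theta> \<in> carrier H1" "\<theta> \<cdot>\<^bsub>H1\<^esub> t = k1 (i y)" "\<zeta> = k2 \<theta>" by blast
    obtain u where u: "u \<in> ?S" "(x \<cdot>\<^bsub>X\<^esub> t) \<cdot>\<^bsub>X\<^esub> u = (y \<cdot>\<^bsub>X\<^esub> s) \<cdot>\<^bsub>X\<^esub> u"
      using X.frac_eqD[OF g(3,1,2)] by blast
    have "((\<eta> \<cdot>\<^bsub>H1\<^esub> s) \<cdot>\<^bsub>H1\<^esub> t) \<cdot>\<^bsub>H1\<^esub> u = k1 (i ((x \<cdot>\<^bsub>X\<^esub> t) \<cdot>\<^bsub>X\<^esub> u))"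
      using h g(1,2) u(1) by (simp add: acts cl X.act_S H0.act_S)
    also have "\<dots> = ((\<theta> \<cdot>\<^bsub>H1\<^esub> t) \<cdot>\<^bsub>H1\<^esub> s) \<cdot>\<^bsub>H1\<^esub> u"
      unfolding u(2) using h(1-3) g(1,2,4) g(5)[symmetric] u(1) by (simp add: acts cl X.act_S H0.act_S)
    also have "\<dots> = ((\<theta> \<cdot>\<^bsub>H1\<^esub> s) \<cdot>\<^bsub>H1\<^esub> t) \<cdot>\<^bsub>H1\<^esub> u"
      using h(1-3) g(1,2,4) u(1) by (simp add: H1.swap_S)
    \<comment> \<open>The two candidates for the quotient differ by an element killed by
      \<open>s t u\<close>, hence by something that \<open>k2\<close> kills.\<close>
    finally have "(\<eta> \<ominus>\<^bsub>H1\<^esub> \<theta>) \<cdot>\<^bsub>H1\<^esub> (s \<otimes>\<^bsub>R\<^esub> t \<otimes>\<^bsub>R\<^esub> u) = \<zero>\<^bsub>H1\<^esub>"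
      using h g u by (simp add: H1.M.ract_minus_left X.S_carrier X.S_mult H1.act_ST H1.M.M.minus_eq_zero_iff
          H1.act_S)
    then have "k2 (\<eta> \<ominus>\<^bsub>H1\<^esub> \<theta>) = \<zero>\<^bsub>H2\<^esub>"
      using h g u X.S_mult by (intro tors[of _ "s \<otimes>\<^bsub>R\<^esub> t \<otimes>\<^bsub>R\<^esub> u"]) auto
    then show "\<zeta> = k2 \<eta>"
      using h g cl by (simp add: mod_hom_minus[OF k2h H1 H2] H2.M.M.minus_eq_zero_iff)
  qed
  \<comment> \<open>Up to a factor \<open>s\<close> a class of \<open>H2\<close> comes from some
    \<open>\<mu>\<close> in \<open>H0\<close>, and it is sent to \<open>q \<mu>\<close> divided by
    \<open>s\<close>. Two choices of \<open>\<mu>\<close> over a common factor differ by an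
    \<open>S\<close>-torsion class of \<open>H0\<close>, which fractions do not see.\<close>
  define q' where "q' \<eta> = (SOME \<zeta>. \<exists>\<mu> s. \<mu> \<in> carrier H0 \<and> s \<in> ?S \<and> \<eta> \<cdot>\<^bsub>H2\<^esub> s = k \<mu> \<and>
    \<zeta> = fraction X ?S (q \<mu>) s)" for \<eta>
  have q': "q' \<eta> = fraction X ?S (q \<mu>) s"
    if h: "\<eta> \<in> carrier H2" "\<mu> \<in> carrier H0" "s \<in> ?S" "\<eta> \<cdot>\<^bsub>H2\<^esub> s = k \<mu>" for \<eta> \<mu> s
    unfolding q'_def
  proof (rule some_equality)
    show "\<exists>\<nu> t. \<nu> \<in> carrier H0 \<and> t \<in> ?S \<and> \<eta> \<cdot>\<^bsub>H2\<^esub> t = k \<nu> \<and>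
        fraction X ?S (q \<mu>) s = fraction X ?S (q \<nu>) t" using h by blast
    fix \<zeta> assume "\<exists>\<nu> t. \<nu> \<in> carrier H0 \<and> t \<in> ?S \<and> \<eta> \<cdot>\<^bsub>H2\<^esub> t = k \<nu> \<and> \<zeta> = fraction X ?S (q \<nu>) t"
    then obtain \<nu> t where g: "\<nu> \<in> carrier H0" "t \<in> ?S" "\<eta> \<cdot>\<^bsub>H2\<^esub> t = k \<nu>" "\<zeta> = fraction X ?S (q \<nu>) t" by blast
    have "k (\<mu> \<cdot>\<^bsub>H0\<^esub> t) = k (\<nu> \<cdot>\<^bsub>H0\<^esub> s)"
      using h g H2.swap_S[of \<eta> s t] by (simp add: mod_hom_ract[OF kh] X.S_carrier)
    then have "k ((\<mu> \<cdot>\<^bsub>H0\<^esub> t) \<ominus>\<^bsub>H0\<^esub> (\<nu> \<cdot>\<^bsub>H0\<^esub> s)) = \<zero>\<^bsub>H2\<^esub>"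
      using h g by (simp add: mod_hom_minus[OF kh H0 H2] H0.act_S H2.M.M.minus_eq_zero_iff mod_hom_closed[OF kh])
    then obtain u where u: "u \<in> ?S" "((\<mu> \<cdot>\<^bsub>H0\<^esub> t) \<ominus>\<^bsub>H0\<^esub> (\<nu> \<cdot>\<^bsub>H0\<^esub> s)) \<cdot>\<^bsub>H0\<^esub> u = \<zero>\<^bsub>H0\<^esub>"
      using ker h g H0.act_S by blast
    then have "(\<mu> \<cdot>\<^bsub>H0\<^esub> t) \<cdot>\<^bsub>H0\<^esub> u = (\<nu> \<cdot>\<^bsub>H0\<^esub> s) \<cdot>\<^bsub>H0\<^esub> u"
      using h g by (simp add: H0.M.ract_minus_left X.S_carrier H0.act_S H0.M.M.minus_eq_zero_iff)
    then have "q ((\<mu> \<cdot>\<^bsub>H0\<^esub> t) \<cdot>\<^bsub>H0\<^esub> u) = q ((\<nu> \<cdot>\<^bsub>H0\<^esub> s) \<cdot>\<^bsub>H0\<^esub> u)" by simp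
    then have "(q \<mu> \<cdot>\<^bsub>X\<^esub> t) \<cdot>\<^bsub>X\<^esub> u = (q \<nu> \<cdot>\<^bsub>X\<^esub> s) \<cdot>\<^bsub>X\<^esub> u"
      using h g u by (simp add: acts H0.act_S)
    then show "\<zeta> = fraction X ?S (q \<mu>) s"
      using X.frac_eqI[OF _ _ _ _ u(1)] h g cl by metis
  qed
  have 1: "i' \<in> graded_hom R ?L H2"
    unfolding graded_hom_iff
  proof (intro conjI allI ballI)
    show "mod_hom R ?L H2 i'"
    proof (rule mod_homI)
      fix \<xi> assume "\<xi> \<in> carrier ?L"
      then obtain x s where x: "x \<in> carrier X" "s \<in> ?S" "\<xi> = fraction X ?S x s" by (auto simp: X.loc_carrier)
      obtain \<eta> where \<eta>: "\<eta> \<in> carrier H1" "\<eta> \<cdot>\<^bsub>H1\<^esub> s = k1 (i x)" using div[of "i x" s] x cl by blast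
      show "i' \<xi> \<in> carrier H2" using i'[OF x(1,2) \<eta>] x cl \<eta> by simp
      show "i' (\<xi> \<oplus>\<^bsub>?L\<^esub> \<zeta>) = i' \<xi> \<oplus>\<^bsub>H2\<^esub> i' \<zeta>" if z: "\<zeta> \<in> carrier ?L" for \<zeta>
      proof -
        obtain y t where y: "y \<in> carrier X" "t \<in> ?S" "\<zeta> = fraction X ?S y t"
          using z by (auto simp: X.loc_carrier)
        obtain \<theta> where \<theta>: "\<theta> \<in> carrier H1" "\<theta> \<cdot>\<^bsub>H1\<^esub> t = k1 (i y)" using div[of "i y" t] y cl by blast
        have "(\<eta> \<oplus>\<^bsub>H1\<^esub> \<theta>) \<cdot>\<^bsub>H1\<^esub> (s \<otimes>\<^bsub>R\<^esub> t) = ((\<eta> \<cdot>\<^bsub>H1\<^esub> s) \<cdot>\<^bsub>H1\<^esub> t) \<oplus>\<^bsub>H1\<^esub> ((\<theta> \<cdot>\<^bsub>H1\<^esub> t) \<cdot>\<^bsub>H1\<^esub> s)"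
          using x y \<eta>(1) \<theta>(1) H1.swap_S[of \<theta> s t] by (simp add: H1.act_ST H1.act_add H1.act_S)
        also have "\<dots> = k1 (i ((x \<cdot>\<^bsub>X\<^esub> t) \<oplus>\<^bsub>X\<^esub> (y \<cdot>\<^bsub>X\<^esub> s)))"
          using x y \<eta> \<theta> by (simp add: adds acts cl X.act_S H0.act_S)
        finally show ?thesis
          using x y \<eta> \<theta> i'[of x s \<eta>] i'[of y t \<theta>]
            i'[of "(x \<cdot>\<^bsub>X\<^esub> t) \<oplus>\<^bsub>X\<^esub> (y \<cdot>\<^bsub>X\<^esub> s)" "s \<otimes>\<^bsub>R\<^esub> t" "\<eta> \<oplus>\<^bsub>H1\<^esub> \<theta>"]
          by (simp add: X.loc_add X.act_S X.S_mult adds)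
      qed
      show "i' (\<xi> \<cdot>\<^bsub>?L\<^esub> r) = i' \<xi> \<cdot>\<^bsub>H2\<^esub> r" if r: "r \<in> carrier R" for r
      proof -
        have "(\<eta> \<cdot>\<^bsub>H1\<^esub> r) \<cdot>\<^bsub>H1\<^esub> s = k1 (i (x \<cdot>\<^bsub>X\<^esub> r))"
          using x r \<eta> H1.swap_R[of \<eta> s r] by (simp add: mod_hom_ract[OF k1h] mod_hom_ract[OF ih] cl)
        then show ?thesis
          using x r \<eta> i'[of x s \<eta>] i'[of "x \<cdot>\<^bsub>X\<^esub> r" s "\<eta> \<cdot>\<^bsub>H1\<^esub> r"]
          by (simp add: X.loc_act X.M.ract_closed H1.M.ract_closed mod_hom_ract[OF k2h])
      qed
    qed
    fix j \<xi> assume "\<xi> \<in> gr ?L j"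
    then obtain x s m l where x: "x \<in> gr X m" "s \<in> ?S" "s \<in> gr R l" "j = m - l" "\<xi> = fraction X ?S x s"
      by (auto simp: X.loc_gr)
    obtain l' where l': "even l'" "s \<in> gr R l'" using X.S_even[OF x(2)] by blast
    have xc: "x \<in> carrier X" using x X.M.M.gr_carrier by blast
    show "i' \<xi> \<in> gr H2 j"
    \<comment> \<open>In \<open>loc_gr\<close> the degree \<open>l\<close> of \<open>s\<close> is
      arbitrary. If it is odd then \<open>s\<close>, being of even degree as well, is zero; for a
      general \<open>p\<close> this may happen. Then \<open>k1 (i x)\<close> vanishes because it is
      divisible by \<open>s\<close>.\<close>
    proof (cases "even l")
      case True
      then obtain \<eta> where \<eta>: "\<eta> \<in> gr H1 j" "\<eta> \<cdot>\<^bsub>H1\<^esub> s = k1 (i x)"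
        using div1[OF graded_hom_gr[OF i x(1)] x(2,3)] x(4) by blast
      then show ?thesis
        using i'[OF xc x(2) H1.M.M.gr_carrier[OF \<eta>(1)] \<eta>(2)] x(5) graded_hom_gr[OF k2 \<eta>(1)] by simp
    next
      case False
      then have "s = \<zero>\<^bsub>R\<^esub>" using X.gr_disjoint[OF x(3) l'(2)] l'(1) by blast
      then have "k1 (i x) = \<zero>\<^bsub>H1\<^esub> \<cdot>\<^bsub>H1\<^esub> s \<and> \<zero>\<^bsub>H1\<^esub> \<cdot>\<^bsub>H1\<^esub> s = \<zero>\<^bsub>H1\<^esub>" if "k1 (i x) = \<zero>\<^bsub>H1\<^esub>"
        using that by (simp add: H1.M.ract_zero_right)
      moreover have "k1 (i x) = \<zero>\<^bsub>H1\<^esub>"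
        using div[of "i x" s] x(2) xc cl \<open>s = \<zero>\<^bsub>R\<^esub>\<close> H1.M.ract_zero_right by metis
      ultimately have "i' \<xi> = k2 \<zero>\<^bsub>H1\<^esub>" using i'[OF xc x(2), of "\<zero>\<^bsub>H1\<^esub>"] x(5) by simp
      then show ?thesis by (simp add: mod_hom_zero[OF k2h H1 H2] H2.M.M.gr_zero)
    qed
  qed
  have 2: "q' \<in> graded_hom R H2 ?L"
    unfolding graded_hom_iff
  proof (intro conjI allI ballI)
    show "mod_hom R H2 ?L q'"
    proof (rule mod_homI)
      fix \<eta> assume e: "\<eta> \<in> carrier H2"
      then obtain s \<mu> where s: "s \<in> ?S" "\<mu> \<in> carrier H0" "\<eta> \<cdot>\<^bsub>H2\<^esub> s = k \<mu>" using coker by blast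
      show "q' \<eta> \<in> carrier ?L" using q'[OF e s(2,1,3)] s cl X.loc_frac by simp
      show "q' (\<eta> \<oplus>\<^bsub>H2\<^esub> \<theta>) = q' \<eta> \<oplus>\<^bsub>?L\<^esub> q' \<theta>" if f: "\<theta> \<in> carrier H2" for \<theta>
      proof -
        obtain t \<nu> where t: "t \<in> ?S" "\<nu> \<in> carrier H0" "\<theta> \<cdot>\<^bsub>H2\<^esub> t = k \<nu>" using coker f by blast
        have "(\<eta> \<oplus>\<^bsub>H2\<^esub> \<theta>) \<cdot>\<^bsub>H2\<^esub> (s \<otimes>\<^bsub>R\<^esub> t) = ((\<eta> \<cdot>\<^bsub>H2\<^esub> s) \<cdot>\<^bsub>H2\<^esub> t) \<oplus>\<^bsub>H2\<^esub> ((\<theta> \<cdot>\<^bsub>H2\<^esub> t) \<cdot>\<^bsub>H2\<^esub> s)"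
          using e f s(1) t(1) H2.swap_S[of \<theta> s t] by (simp add: H2.act_ST H2.act_add H2.act_S)
        also have "\<dots> = k ((\<mu> \<cdot>\<^bsub>H0\<^esub> t) \<oplus>\<^bsub>H0\<^esub> (\<nu> \<cdot>\<^bsub>H0\<^esub> s))"
          using s t by (simp add: mod_hom_add[OF kh] mod_hom_ract[OF kh] X.S_carrier H0.act_S)
        finally show ?thesis
          using e f s t q'[of \<eta> \<mu> s] q'[of \<theta> \<nu> t]
            q'[of "\<eta> \<oplus>\<^bsub>H2\<^esub> \<theta>" "(\<mu> \<cdot>\<^bsub>H0\<^esub> t) \<oplus>\<^bsub>H0\<^esub> (\<nu> \<cdot>\<^bsub>H0\<^esub> s)" "s \<otimes>\<^bsub>R\<^esub> t"]
          by (simp add: X.loc_add cl H0.act_S X.S_mult adds acts)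
      qed
      show "q' (\<eta> \<cdot>\<^bsub>H2\<^esub> r) = q' \<eta> \<cdot>\<^bsub>?L\<^esub> r" if r: "r \<in> carrier R" for r
      proof -
        have "(\<eta> \<cdot>\<^bsub>H2\<^esub> r) \<cdot>\<^bsub>H2\<^esub> s = k (\<mu> \<cdot>\<^bsub>H0\<^esub> r)"
          using e s r H2.swap_R[of \<eta> s r] by (simp add: mod_hom_ract[OF kh])
        then show ?thesis
          using e s r q'[of \<eta> \<mu> s] q'[of "\<eta> \<cdot>\<^bsub>H2\<^esub> r" "\<mu> \<cdot>\<^bsub>H0\<^esub> r" s]
          by (simp add: X.loc_act cl H2.M.ract_closed H0.M.ract_closed mod_hom_ract[OF qh])
      qed
    qed
    fix j \<eta> assume e: "\<eta> \<in> gr H2 j"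
    have ec: "\<eta> \<in> carrier H2" using e H2.M.M.gr_carrier by blast
    then obtain s \<mu> where s: "s \<in> ?S" "\<mu> \<in> carrier H0" "\<eta> \<cdot>\<^bsub>H2\<^esub> s = k \<mu>" using coker by blast
    obtain l where l: "even l" "s \<in> gr R l" using X.S_even[OF s(1)] by blast
    \<comment> \<open>Replacing \<open>\<mu>\<close> by its component of degree \<open>j + l\<close>
      does not change its image, as the product of \<open>\<eta>\<close> and \<open>s\<close> is
      homogeneous of that degree. Now the fraction is visibly of degree \<open>j\<close>.\<close>
    have "k (gcomp H0 \<mu> (j + l)) = gcomp H2 (\<eta> \<cdot>\<^bsub>H2\<^esub> s) (j + l)"
      unfolding s(3) by (rule gcomp_graded_hom[OF H0 H2 kg s(2), symmetric])
    also have "\<dots> = \<eta> \<cdot>\<^bsub>H2\<^esub> s"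
      using H2.M.M.gcomp_homogeneous[OF H2.M.gr_ract[OF e l(2)], of "j + l"] by simp
    finally have "q' \<eta> = fraction X ?S (q (gcomp H0 \<mu> (j + l))) s"
      using q'[OF ec H0.M.M.gcomp_closed[OF s(2)] s(1)] by simp
    moreover have "q (gcomp H0 \<mu> (j + l)) \<in> gr X (j + l)"
      by (rule graded_hom_gr[OF q H0.M.M.gcomp_props(1)[OF s(2)]])
    moreover have "j = (j + l) - l" by simp
    ultimately show "q' \<eta> \<in> gr ?L j" unfolding X.loc_gr using s(1) l(2) by blast
  qed
  have 3: "q' (i' \<xi>) = \<xi>" if "\<xi> \<in> carrier ?L" for \<xi>
  proof -
    obtain x s where x: "x \<in> carrier X" "s \<in> ?S" "\<xi> = fraction X ?S x s"
      using \<open>\<xi> \<in> carrier ?L\<close> by (auto simp: X.loc_carrier)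
    obtain \<eta> where \<eta>: "\<eta> \<in> carrier H1" "\<eta> \<cdot>\<^bsub>H1\<^esub> s = k1 (i x)" using div[of "i x" s] x cl by blast
    \<comment> \<open>Hence \<open>i x\<close> and \<open>s\<close> are admissible choices in the
      definition of \<open>q'\<close> at \<open>k2 \<eta>\<close>, and the value is
      \<open>q (i x)\<close> divided by \<open>s\<close>.\<close>
    have "k2 \<eta> \<cdot>\<^bsub>H2\<^esub> s = k (i x)" using \<eta> x acts(2)[of \<eta> s] by (simp add: k_def)
    then show ?thesis
      using i'[OF x(1,2) \<eta>] q'[of "k2 \<eta>" "i x" s] x \<eta> cl qi by simp
  qed
  show ?thesis using 1 2 3 by blast
qed

section \<open>Inverting cohomology classes up to torsion\<close>

context cells
begin

definition cell :: "'j \<Rightarrow> 'n \<times> ('j \<Rightarrow> 'a)"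
  where "cell j = (\<zero>\<^bsub>N\<^esub>, single A j \<one>\<^bsub>A\<^esub>)"

lemma cell_closed: "j \<in> J \<Longrightarrow> cell j \<in> carrier T"
  by (simp add: cell_def attach_simps A.A.single_fsupp)

lemma cell_gr: "j \<in> J \<Longrightarrow> cell j \<in> gr T (\<delta> j)"
  using A.A.gr_one A.A.gr_zero M.M.gr_zero
  by (auto simp: cell_def attach_simps A.A.single_fsupp) (auto simp: single_def)

lemma cell_ract: "\<lbrakk>j \<in> J; a \<in> carrier A\<rbrakk> \<Longrightarrow> cell j \<cdot>\<^bsub>T\<^esub> a = (\<zero>\<^bsub>N\<^esub>, single A j a)"
  by (auto simp: cell_def attach_simps single_def M.ract_zero_left)

lemma cell_diff: "j \<in> J \<Longrightarrow> diff T (cell j) = (t j, \<lambda>j. \<zero>\<^bsub>A\<^esub>)"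
proof -
  assume j: "j \<in> J"
  have "diff A (single A j \<one>\<^bsub>A\<^esub> i) = \<zero>\<^bsub>A\<^esub>" for i
    using A.cyclesD(2)[OF A.one_cycle] by (simp add: single_def A.d_zero)
  then show ?thesis
    using t_closed[OF j]
    by (simp add: cell_def attach_simps M.wsum_single M.d_zero M.ract_one koszul_zero
        A.A.abelian_group_axioms)
qed

text \<open>Covers the two families met below whose members involve a single coordinate: the cells
  themselves, where \<open>c\<close> is \<open>\<one>\<close>, and the boundaries of the cells
  \<open>f\<close> in \<open>step\<close>, where \<open>c\<close> is the negative of
  \<open>z\<close>.\<close>

lemma wsum_single_snd:
  assumes y: "\<And>j. j \<in> J \<Longrightarrow> y j = (m j, single A j (c j))" "\<And>j. j \<in> J \<Longrightarrow> y j \<in> carrier T"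
    and b: "b \<in> fsupp A J" and i: "i \<in> J"
  shows "snd (wsum A T y b) i = c i \<otimes>\<^bsub>A\<^esub> b i"
proof -
  interpret T: dgm A T by (rule T_dgm)
  let ?F = "{j. b j \<noteq> \<zero>\<^bsub>A\<^esub>}"
  have F: "finite ?F" "?F \<subseteq> J" using fsupp_finite[OF b] fsupp_subset[OF b] .
  note bc = fsupp_closed[OF b]
  have cc: "c j \<in> carrier A" if "j \<in> J" for j
  proof -
    have "single A j (c j) \<in> fsupp A J" using y[OF that] by (simp add: attach_simps)
    then have "single A j (c j) j \<in> carrier A" by (rule fsupp_closed)
    then show ?thesis by (simp add: single_def)
  qed
  have "snd (wsum A T y b) i = (\<Oplus>\<^bsub>A\<^esub>j\<in>?F. snd (y j \<cdot>\<^bsub>T\<^esub> b j) i)"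
    unfolding wsum_def
    by (rule add_hom_finsum[OF T_snd T_abelian_group A.A.abelian_group_axioms])
      (use F y bc T.M.ract_closed in auto)
  also have "\<dots> = (\<Oplus>\<^bsub>A\<^esub>j\<in>?F. if i = j then c j \<otimes>\<^bsub>A\<^esub> b j else \<zero>\<^bsub>A\<^esub>)"
    by (rule A.A.finsum_cong') (use F y bc cc in \<open>auto simp: attach_simps single_def subset_iff\<close>)
  also have "\<dots> = c i \<otimes>\<^bsub>A\<^esub> b i"
  proof (cases "i \<in> ?F")
    case True
    have "(\<Oplus>\<^bsub>A\<^esub>j\<in>?F. if i = j then (\<lambda>j. c j \<otimes>\<^bsub>A\<^esub> b j) j else \<zero>\<^bsub>A\<^esub>) = (\<lambda>j. c j \<otimes>\<^bsub>A\<^esub> b j) i"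
      by (rule A.A.finsum_singleton[OF True F(1)]) (use F bc cc in \<open>auto simp: subset_iff\<close>)
    then show ?thesis by simp
  next
    case False
    then have "(\<Oplus>\<^bsub>A\<^esub>j\<in>?F. if i = j then c j \<otimes>\<^bsub>A\<^esub> b j else \<zero>\<^bsub>A\<^esub>) = \<zero>\<^bsub>A\<^esub>"
      by (intro A.A.add.finprod_one_eqI) auto
    then show ?thesis using False cc[OF i] by simp
  qed
  finally show ?thesis .
qed

lemma T_decomp:
  assumes n: "n \<in> carrier N" and a: "a \<in> fsupp A J"
  shows "(n, a) = (n, \<lambda>j. \<zero>\<^bsub>A\<^esub>) \<oplus>\<^bsub>T\<^esub> wsum A T cell a"
proof -
  interpret T: dgm A T by (rule T_dgm)
  have wc: "wsum A T cell a \<in> carrier T" by (rule T.M.wsum_closed[OF a cell_closed])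
  let ?F = "{j. a j \<noteq> \<zero>\<^bsub>A\<^esub>}"
  have "fst (wsum A T cell a) = (\<Oplus>\<^bsub>N\<^esub>j\<in>?F. fst (cell j \<cdot>\<^bsub>T\<^esub> a j))"
    unfolding wsum_def
    by (rule add_hom_finsum[OF T_fst T_abelian_group M.M.abelian_group_axioms])
      (intro funcsetI T.M.ract_closed cell_closed, use fsupp_subset[OF a] fsupp_closed[OF a] in auto)
  also have "\<dots> = \<zero>\<^bsub>N\<^esub>"
    by (rule M.M.add.finprod_one_eqI)
      (use fsupp_subset[OF a] fsupp_closed[OF a] cell_ract in auto)
  finally have 1: "fst (wsum A T cell a) = \<zero>\<^bsub>N\<^esub>" .
  have "snd (wsum A T cell a) j = a j" for j
  proof (cases "j \<in> J")
    case True
    then have "snd (wsum A T cell a) j = \<one>\<^bsub>A\<^esub> \<otimes>\<^bsub>A\<^esub> a j"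
      by (intro wsum_single_snd[of cell "\<lambda>j. \<zero>\<^bsub>N\<^esub>" "\<lambda>j. \<one>\<^bsub>A\<^esub>", OF _ cell_closed a]) (auto simp: cell_def)
    then show ?thesis using fsupp_closed[OF a] by simp
  next
    case False
    then show ?thesis using wc a by (auto simp: attach_simps fsupp_def)
  qed
  then have "snd (wsum A T cell a) = a" by blast
  then have "wsum A T cell a = (\<zero>\<^bsub>N\<^esub>, a)" using 1 by (metis prod.collapse)
  then show ?thesis using n fsupp_closed[OF a] by (simp add: attach_simps)
qed

end

text \<open>In the application \<open>P\<close> is the copy of \<open>N\<close> in \<open>L\<close>.
  The quotient complex \<open>L / P\<close> is handled through representatives in \<open>L\<close>:
  \<open>Bd\<close> consists of the relative boundaries, and \<open>Good\<close> of the relative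
  cycles whose class is \<open>S\<close>-torsion, \<open>Zs\<close> being the cycles that represent
  elements of \<open>S\<close>.\<close>

locale relative = dgm A L + R: mult_set "cohomology_ring A" S
  for A :: "('k, 'a) dg" and L :: "('a, 'l) dg" and S :: "'a set set" +
  fixes P :: "'l set"
  assumes P_sub: "additive_subgroup P L"
    and P_act: "\<lbrakk>p \<in> P; a \<in> carrier A\<rbrakk> \<Longrightarrow> p \<cdot>\<^bsub>L\<^esub> a \<in> P"
    and P_gcomp: "p \<in> P \<Longrightarrow> gcomp L p i \<in> P"
begin

definition "Zs = {z \<in> cycles A. cls A z \<in> S}"
definition "Bd = {x. \<exists>p\<in>P. \<exists>w\<in>carrier L. x = p \<oplus>\<^bsub>L\<^esub> diff L w}"
definition "Good = {y \<in> carrier L. diff L y \<in> P \<and> (\<exists>z\<in>Zs. y \<cdot>\<^bsub>L\<^esub> z \<in> Bd)}"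

lemma P_carrier: "p \<in> P \<Longrightarrow> p \<in> carrier L"
  using additive_subgroup.a_subset[OF P_sub] by blast

lemma Bd_carrier: "x \<in> Bd \<Longrightarrow> x \<in> carrier L"
  using P_carrier M.d_closed by (auto simp: Bd_def)

lemma Bd_P: "p \<in> P \<Longrightarrow> p \<in> Bd"
proof -
  assume p: "p \<in> P"
  then have "p = p \<oplus>\<^bsub>L\<^esub> diff L \<zero>\<^bsub>L\<^esub>" using P_carrier M.d_zero by simp
  then show ?thesis unfolding Bd_def using p M.M.zero_closed by blast
qed

lemma Bd_d: "w \<in> carrier L \<Longrightarrow> diff L w \<in> Bd"
  unfolding Bd_def using additive_subgroup.zero_closed[OF P_sub] M.d_closed by force

lemma Bd_sub: "additive_subgroup Bd L"
proof (rule additive_subgroup.intro, rule M.M.add.subgroupI)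
  show "Bd \<subseteq> carrier L" using Bd_carrier by blast
  show "Bd \<noteq> {}" using Bd_d by blast
  fix x assume "x \<in> Bd"
  then obtain p w where x: "p \<in> P" "w \<in> carrier L" "x = p \<oplus>\<^bsub>L\<^esub> diff L w" by (auto simp: Bd_def)
  then have "\<ominus>\<^bsub>L\<^esub> x = (\<ominus>\<^bsub>L\<^esub> p) \<oplus>\<^bsub>L\<^esub> diff L (\<ominus>\<^bsub>L\<^esub> w)"
    using P_carrier M.d_closed by (simp add: M.M.minus_add M.d_neg)
  then show "\<ominus>\<^bsub>L\<^esub> x \<in> Bd"
    unfolding Bd_def using x additive_subgroup.a_inv_closed[OF P_sub] by blast
  fix y assume "y \<in> Bd"
  then obtain p' w' where y: "p' \<in> P" "w' \<in> carrier L" "y = p' \<oplus>\<^bsub>L\<^esub> diff L w'" by (auto simp: Bd_def)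
  have "x \<oplus>\<^bsub>L\<^esub> y = (p \<oplus>\<^bsub>L\<^esub> p') \<oplus>\<^bsub>L\<^esub> diff L (w \<oplus>\<^bsub>L\<^esub> w')"
    using x y P_carrier M.d_closed by (simp add: M.d_add M.M.a_ac)
  then show "x \<oplus>\<^bsub>L\<^esub> y \<in> Bd"
    unfolding Bd_def using x y additive_subgroup.a_closed[OF P_sub] by blast
qed

lemmas Bd_add = additive_subgroup.a_closed[OF Bd_sub]
  and Bd_neg = additive_subgroup.a_inv_closed[OF Bd_sub]

lemma Bd_minus: "\<lbrakk>x \<in> Bd; y \<in> Bd\<rbrakk> \<Longrightarrow> x \<ominus>\<^bsub>L\<^esub> y \<in> Bd"
  by (simp add: a_minus_def Bd_add Bd_neg)

lemma Bd_cong: "\<lbrakk>x \<ominus>\<^bsub>L\<^esub> y \<in> Bd; y \<in> Bd; x \<in> carrier L\<rbrakk> \<Longrightarrow> x \<in> Bd"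
  using Bd_add[of "x \<ominus>\<^bsub>L\<^esub> y" y] Bd_carrier M.M.minus_add_cancel(1)[of x y] by simp

lemma Bd_ract: "\<lbrakk>x \<in> Bd; z \<in> cycles A\<rbrakk> \<Longrightarrow> x \<cdot>\<^bsub>L\<^esub> z \<in> Bd"
proof -
  assume "x \<in> Bd" and z: "z \<in> cycles A"
  then obtain p w where x: "p \<in> P" "w \<in> carrier L" "x = p \<oplus>\<^bsub>L\<^esub> diff L w" by (auto simp: Bd_def)
  then have "x \<cdot>\<^bsub>L\<^esub> z = (p \<cdot>\<^bsub>L\<^esub> z) \<oplus>\<^bsub>L\<^esub> diff L (w \<cdot>\<^bsub>L\<^esub> z)"
    using P_carrier M.d_closed A.cyclesD z by (simp add: M.ract_add_left d_ract_cycle)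
  then show "x \<cdot>\<^bsub>L\<^esub> z \<in> Bd"
    unfolding Bd_def using x z P_act A.cyclesD M.ract_closed by blast
qed

text \<open>By the Leibniz rule a relative cycle times a boundary of \<open>A\<close> is a relative
  boundary. With \<open>Zs_comm\<close> it follows that acting by a product with a factor in
  \<open>Zs\<close> does not depend on the order of the factors, modulo \<open>Bd\<close>.\<close>

lemma Bd_ract_diff:
  assumes y: "y \<in> carrier L" "diff L y \<in> P" and g: "g \<in> carrier A"
  shows "y \<cdot>\<^bsub>L\<^esub> diff A g \<in> Bd"
proof -
  have *: "x \<cdot>\<^bsub>L\<^esub> diff A g \<in> Bd" if x: "x \<in> gr L i" "diff L x \<in> P" for x i
  proof -
    have xc: "x \<in> carrier L" using x M.M.gr_carrier by blast
    have c: "x \<cdot>\<^bsub>L\<^esub> diff A g \<in> carrier L" "x \<cdot>\<^bsub>L\<^esub> g \<in> carrier L" "diff L x \<cdot>\<^bsub>L\<^esub> g \<in> carrier L"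
      using xc g A.d_closed M.d_closed M.ract_closed by auto
    have kc: "koszul L i (x \<cdot>\<^bsub>L\<^esub> diff A g) \<in> carrier L" using c by (simp add: koszul_closed M.M.abelian_group_axioms)
    have "koszul L i (x \<cdot>\<^bsub>L\<^esub> diff A g) = diff L (x \<cdot>\<^bsub>L\<^esub> g) \<ominus>\<^bsub>L\<^esub> (diff L x \<cdot>\<^bsub>L\<^esub> g)"
      using M.mleibniz[OF x(1) g] c kc
      by (simp add: M.M.add_minus_cancel_left)
    also have "\<dots> \<in> Bd" using x g c P_act by (intro Bd_minus Bd_d Bd_P) auto
    finally have "koszul L i (koszul L i (x \<cdot>\<^bsub>L\<^esub> diff A g)) \<in> Bd"
      by (rule koszul_in_subgroup[OF Bd_sub M.M.abelian_group_axioms])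
    then show ?thesis using c by (simp add: koszul_koszul M.M.abelian_group_axioms koszul_even)
  qed
  have "y \<cdot>\<^bsub>L\<^esub> diff A g = (\<Oplus>\<^bsub>L\<^esub>i\<in>{i. gcomp L y i \<noteq> \<zero>\<^bsub>L\<^esub>}. gcomp L y i \<cdot>\<^bsub>L\<^esub> diff A g)"
    using M.ract_finsum_left[OF A.d_closed[OF g], of "gcomp L y" "{i. gcomp L y i \<noteq> \<zero>\<^bsub>L\<^esub>}"]
      M.M.gcomp_props(3)[OF y(1)] M.M.gcomp_closed[OF y(1)] by auto
  also have "\<dots> \<in> Bd"
  proof (rule additive_subgroup_finsum[OF M.M.abelian_group_axioms Bd_sub], rule funcsetI)
    fix i
    have "diff L (gcomp L y i) \<in> P" using M.gcomp_diff[OF y(1), of i] P_gcomp[OF y(2), of "i + 1"] by simp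
    then show "gcomp L y i \<cdot>\<^bsub>L\<^esub> diff A g \<in> Bd" using *[OF M.M.gcomp_props(1)[OF y(1)]] by blast
  qed
  finally show ?thesis .
qed

lemma Zs_cycle: "z \<in> Zs \<Longrightarrow> z \<in> cycles A"
  by (simp add: Zs_def)

lemma Zs_mult: "\<lbrakk>z \<in> Zs; z' \<in> Zs\<rbrakk> \<Longrightarrow> z \<otimes>\<^bsub>A\<^esub> z' \<in> Zs"
  using R.S_mult A.mult_cycles by (auto simp: Zs_def A.coh_ring_mult[symmetric])

lemma Zs_comm:
  assumes "z \<in> Zs" "a \<in> cycles A"
  obtains g where "g \<in> carrier A" "(a \<otimes>\<^bsub>A\<^esub> z) \<ominus>\<^bsub>A\<^esub> (z \<otimes>\<^bsub>A\<^esub> a) = diff A g"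
proof -
  have c: "z \<in> cycles A" "cls A z \<in> S" using assms by (auto simp: Zs_def)
  have "cls A (z \<otimes>\<^bsub>A\<^esub> a) = cls A (a \<otimes>\<^bsub>A\<^esub> z)"
    using R.S_central[OF c(2), of "cls A a"] c assms A.coh_ring_mult A.coh_ring_simps(1) by auto
  then have "(a \<otimes>\<^bsub>A\<^esub> z) \<ominus>\<^bsub>A\<^esub> (z \<otimes>\<^bsub>A\<^esub> a) \<in> boundaries A"
    using A.cls_eq_iff c assms A.cyclesD by (metis A.A.m_closed)
  then show thesis using that by (elim A.boundariesE)
qed

text \<open>If \<open>z\<close> kills \<open>x\<close> and \<open>w\<close> kills \<open>y\<close>,
  then the product of \<open>z\<close> and \<open>w\<close> kills both: for \<open>x\<close> at
  once, for \<open>y\<close> after exchanging the factors modulo \<open>Bd\<close>.\<close>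

lemma Good_sub: "additive_subgroup Good L"
proof (rule additive_subgroup.intro, rule M.M.add.subgroupI)
  show "Good \<subseteq> carrier L" by (auto simp: Good_def)
  have "\<one>\<^bsub>A\<^esub> \<in> Zs" using R.S_one A.one_cycle by (simp add: Zs_def A.coh_ring_simps)
  then have "\<zero>\<^bsub>L\<^esub> \<in> Good"
    using additive_subgroup.zero_closed[OF P_sub] additive_subgroup.zero_closed[OF Bd_sub]
    by (auto simp: Good_def M.d_zero M.ract_one intro!: bexI[of _ "\<one>\<^bsub>A\<^esub>"])
  then show "Good \<noteq> {}" by blast
  fix x assume x: "x \<in> Good"
  then obtain z where z: "z \<in> Zs" "x \<cdot>\<^bsub>L\<^esub> z \<in> Bd" "x \<in> carrier L" "diff L x \<in> P" by (auto simp: Good_def)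
  note zc = Zs_cycle[OF z(1)] A.cyclesD(1)[OF Zs_cycle[OF z(1)]]
  show "\<ominus>\<^bsub>L\<^esub> x \<in> Good"
    using z zc additive_subgroup.a_inv_closed[OF P_sub] Bd_neg
    by (auto simp: Good_def M.d_neg M.ract_neg_left intro!: bexI[of _ z])
  fix y assume y: "y \<in> Good"
  then obtain w where w: "w \<in> Zs" "y \<cdot>\<^bsub>L\<^esub> w \<in> Bd" "y \<in> carrier L" "diff L y \<in> P" by (auto simp: Good_def)
  note wc = Zs_cycle[OF w(1)] A.cyclesD(1)[OF Zs_cycle[OF w(1)]]
  obtain g where g: "g \<in> carrier A" "(z \<otimes>\<^bsub>A\<^esub> w) \<ominus>\<^bsub>A\<^esub> (w \<otimes>\<^bsub>A\<^esub> z) = diff A g"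
    using Zs_comm[OF w(1) zc(1)] .
  have "x \<cdot>\<^bsub>L\<^esub> (z \<otimes>\<^bsub>A\<^esub> w) \<in> Bd" using Bd_ract[OF z(2) wc(1)] z zc wc by (simp add: M.ract_mult)
  moreover have "y \<cdot>\<^bsub>L\<^esub> (z \<otimes>\<^bsub>A\<^esub> w) \<in> Bd"
  proof (rule Bd_cong)
    show "y \<cdot>\<^bsub>L\<^esub> (w \<otimes>\<^bsub>A\<^esub> z) \<in> Bd" using Bd_ract[OF w(2) zc(1)] w zc wc by (simp add: M.ract_mult)
    show "(y \<cdot>\<^bsub>L\<^esub> (z \<otimes>\<^bsub>A\<^esub> w)) \<ominus>\<^bsub>L\<^esub> (y \<cdot>\<^bsub>L\<^esub> (w \<otimes>\<^bsub>A\<^esub> z)) \<in> Bd"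
      using Bd_ract_diff[OF w(3,4) g(1)] g w zc wc by (simp add: M.ract_minus_right[symmetric])
    show "y \<cdot>\<^bsub>L\<^esub> (z \<otimes>\<^bsub>A\<^esub> w) \<in> carrier L" using w zc wc by (simp add: M.ract_closed)
  qed
  ultimately have "(x \<oplus>\<^bsub>L\<^esub> y) \<cdot>\<^bsub>L\<^esub> (z \<otimes>\<^bsub>A\<^esub> w) \<in> Bd"
    using z w zc wc Bd_add by (simp add: M.ract_add_left)
  then show "x \<oplus>\<^bsub>L\<^esub> y \<in> Good"
    using z w Zs_mult additive_subgroup.a_closed[OF P_sub] by (auto simp: Good_def M.d_add)
qed

text \<open>The pair \<open>e\<close>, \<open>f\<close> spans the cone of left multiplication by
  \<open>z\<close>. Its cohomology is an extension of a kernel by a cokernel of multiplication by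
  the class of \<open>z\<close>; on each of the two this class acts as zero, so its square kills the
  extension. In terms of elements: multiplying once by \<open>z\<close> turns a relative cycle into
  one supported on \<open>e\<close>, and multiplying once more makes that one bound.\<close>

lemma Good_cell:
  assumes e: "e \<in> gr L k" "diff L e \<in> P" and f: "f \<in> gr L (k + l - 1)" and l: "even l"
    and z: "z \<in> Zs" "z \<in> gr A l" and v: "v \<in> P" and df: "diff L f = v \<ominus>\<^bsub>L\<^esub> (e \<cdot>\<^bsub>L\<^esub> z)"
    and a: "a \<in> carrier A" and b: "b \<in> cycles A" and zb: "koszul A k (diff A a) = z \<otimes>\<^bsub>A\<^esub> b"
  shows "(e \<cdot>\<^bsub>L\<^esub> a) \<oplus>\<^bsub>L\<^esub> (f \<cdot>\<^bsub>L\<^esub> b) \<in> Good"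
proof -
  let ?m = "k + l - 1"
  note abA = A.A.abelian_group_axioms and abL = M.M.abelian_group_axioms
  have ec: "e \<in> carrier L" and fc: "f \<in> carrier L" and vc: "v \<in> carrier L"
    using e f v M.M.gr_carrier P_carrier by auto
  have zc: "z \<in> cycles A" "z \<in> carrier A" "diff A z = \<zero>\<^bsub>A\<^esub>" using Zs_cycle[OF z(1)] A.cyclesD by auto
  have bc: "b \<in> carrier A" using b A.cyclesD by auto
  have dac: "diff A a \<in> carrier A" using a A.d_closed by auto
  note cl = ec fc vc zc(2) bc a dac M.ract_closed A.A.m_closed M.d_closed A.d_closed
  let ?y = "(e \<cdot>\<^bsub>L\<^esub> a) \<oplus>\<^bsub>L\<^esub> (f \<cdot>\<^bsub>L\<^esub> b)"
  have yc: "?y \<in> carrier L" using cl by simp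
  have d1: "diff L (e \<cdot>\<^bsub>L\<^esub> a) = (diff L e \<cdot>\<^bsub>L\<^esub> a) \<oplus>\<^bsub>L\<^esub> (e \<cdot>\<^bsub>L\<^esub> (z \<otimes>\<^bsub>A\<^esub> b))"
    using M.mleibniz[OF e(1) a] koszul_ract[OF ec dac, of k] zb by simp
  have d2: "diff L (f \<cdot>\<^bsub>L\<^esub> b) = (v \<cdot>\<^bsub>L\<^esub> b) \<ominus>\<^bsub>L\<^esub> (e \<cdot>\<^bsub>L\<^esub> (z \<otimes>\<^bsub>A\<^esub> b))"
    using cl by (simp add: d_ract_cycle[OF fc b] df M.ract_minus_left M.ract_mult)
  have "diff L ?y = (diff L e \<cdot>\<^bsub>L\<^esub> a) \<oplus>\<^bsub>L\<^esub> (v \<cdot>\<^bsub>L\<^esub> b)"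
  proof -
    have "diff L ?y = ((diff L e \<cdot>\<^bsub>L\<^esub> a) \<oplus>\<^bsub>L\<^esub> (e \<cdot>\<^bsub>L\<^esub> (z \<otimes>\<^bsub>A\<^esub> b))) \<oplus>\<^bsub>L\<^esub> ((v \<cdot>\<^bsub>L\<^esub> b) \<ominus>\<^bsub>L\<^esub> (e \<cdot>\<^bsub>L\<^esub> (z \<otimes>\<^bsub>A\<^esub> b)))"
      using cl by (simp only: M.d_add d1 d2)
    also have "\<dots> = (diff L e \<cdot>\<^bsub>L\<^esub> a) \<oplus>\<^bsub>L\<^esub> (((v \<cdot>\<^bsub>L\<^esub> b) \<ominus>\<^bsub>L\<^esub> (e \<cdot>\<^bsub>L\<^esub> (z \<otimes>\<^bsub>A\<^esub> b))) \<oplus>\<^bsub>L\<^esub> (e \<cdot>\<^bsub>L\<^esub> (z \<otimes>\<^bsub>A\<^esub> b)))"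
      using cl by (simp add: M.M.a_ac)
    finally show ?thesis using cl by (simp add: M.M.minus_add_cancel(1))
  qed
  then have dy: "diff L ?y \<in> P"
    using P_act[OF e(2) a] P_act[OF v bc] additive_subgroup.a_closed[OF P_sub] by simp
  obtain g0 where g0: "g0 \<in> carrier A" "(b \<otimes>\<^bsub>A\<^esub> z) \<ominus>\<^bsub>A\<^esub> (z \<otimes>\<^bsub>A\<^esub> b) = diff A g0"
    using Zs_comm[OF z(1) b] .
  \<comment> \<open>\<open>b z\<close> differs from \<open>z b\<close> by the boundary of
    \<open>g0\<close>, and \<open>z b\<close> is up to sign the boundary of \<open>a\<close> by
    assumption. So \<open>b z\<close> is the boundary of \<open>c\<close>.\<close>
  define c where "c = g0 \<oplus>\<^bsub>A\<^esub> koszul A k a"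
  have cc: "c \<in> carrier A" using g0 a by (simp add: c_def koszul_closed abA)
  have bz: "b \<otimes>\<^bsub>A\<^esub> z = diff A c"
  proof -
    have "diff A c = diff A g0 \<oplus>\<^bsub>A\<^esub> (z \<otimes>\<^bsub>A\<^esub> b)"
      using g0 a zb koszul_hom[OF A.add_hom_diff abA abA a, of k]
      by (simp add: c_def A.d_add koszul_closed abA)
    also have "\<dots> = b \<otimes>\<^bsub>A\<^esub> z" using g0(2)[symmetric] cl by (simp add: A.A.minus_add_cancel(1))
    finally show ?thesis ..
  qed
  note cl = cl cc
  \<comment> \<open>The coefficient of \<open>e\<close> after the term
    \<open>f (b z) = f (d c)\<close> has been traded for one in \<open>e (z c)\<close>;
    \<open>?m\<close> is the degree of \<open>f\<close>, whence the sign. It is a cycle because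
    \<open>l\<close> is even, which makes the signs of \<open>k\<close> and \<open>?m\<close>
    opposite.\<close>
  define a' where "a' = (a \<otimes>\<^bsub>A\<^esub> z) \<oplus>\<^bsub>A\<^esub> koszul A ?m (z \<otimes>\<^bsub>A\<^esub> c)"
  have a'c: "a' \<in> carrier A" using cl by (simp add: a'_def koszul_closed abA)
  have a'z: "a' \<in> cycles A"
  proof (rule A.cyclesI[OF a'c])
    have "diff A (z \<otimes>\<^bsub>A\<^esub> c) = z \<otimes>\<^bsub>A\<^esub> diff A c"
      using A.d_leibniz[OF z(2), of c] cl zc(3) l by (simp add: koszul_even)
    also have "\<dots> = koszul A k (diff A a) \<otimes>\<^bsub>A\<^esub> z"
      unfolding bz[symmetric] zb using cl by (simp add: A.A.m_assoc)
    also have "\<dots> = koszul A k (diff A a \<otimes>\<^bsub>A\<^esub> z)"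
      using cl by (simp add: koszul_def A.A.l_minus)
    finally have "koszul A ?m (diff A (z \<otimes>\<^bsub>A\<^esub> c)) = \<ominus>\<^bsub>A\<^esub> (diff A a \<otimes>\<^bsub>A\<^esub> z)"
      using cl l by (simp add: koszul_koszul abA) (simp add: koszul_def)
    moreover have "diff A (koszul A ?m (z \<otimes>\<^bsub>A\<^esub> c)) = koszul A ?m (diff A (z \<otimes>\<^bsub>A\<^esub> c))"
      using koszul_hom[OF A.add_hom_diff abA abA] cl by simp
    moreover have "diff A (a \<otimes>\<^bsub>A\<^esub> z) = diff A a \<otimes>\<^bsub>A\<^esub> z" using A.d_mult_cycle[OF a zc(1)] .
    ultimately show "diff A a' = \<zero>\<^bsub>A\<^esub>"
      using cl by (simp add: a'_def A.d_add koszul_closed abA A.A.r_neg)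
  qed
  note cl = cl a'c
  \<comment> \<open>The trade is made by the boundary of \<open>f c\<close>, which is
    \<open>(v - e z) c\<close> plus the signed term \<open>f (d c)\<close>; here \<open>v c\<close>
    lies in \<open>P\<close>.\<close>
  have "(?y \<cdot>\<^bsub>L\<^esub> z) \<ominus>\<^bsub>L\<^esub> (e \<cdot>\<^bsub>L\<^esub> a') \<in> Bd"
  proof -
    let ?w = "f \<cdot>\<^bsub>L\<^esub> diff A c" and ?x = "e \<cdot>\<^bsub>L\<^esub> (z \<otimes>\<^bsub>A\<^esub> c)"
    have wc: "?w \<in> carrier L" "?x \<in> carrier L" using cl by auto
    have "diff L (f \<cdot>\<^bsub>L\<^esub> c) = ((v \<cdot>\<^bsub>L\<^esub> c) \<ominus>\<^bsub>L\<^esub> ?x) \<oplus>\<^bsub>L\<^esub> koszul L ?m ?w"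
      using M.mleibniz[OF f, of c] cl by (simp add: df M.ract_minus_left M.ract_mult)
    then have "koszul L ?m ?w = diff L (f \<cdot>\<^bsub>L\<^esub> c) \<ominus>\<^bsub>L\<^esub> ((v \<cdot>\<^bsub>L\<^esub> c) \<ominus>\<^bsub>L\<^esub> ?x)"
      using cl wc by (simp add: M.M.add_minus_cancel_left koszul_closed abL)
    then have "koszul L ?m ?w \<ominus>\<^bsub>L\<^esub> ?x = diff L (f \<cdot>\<^bsub>L\<^esub> c) \<ominus>\<^bsub>L\<^esub> (v \<cdot>\<^bsub>L\<^esub> c)"
      using cl wc by (simp add: a_minus_def M.M.minus_add M.M.minus_minus M.M.a_assoc M.M.l_neg M.M.r_neg)
    also have "\<dots> \<in> Bd" using cl P_act[OF v cc] by (intro Bd_minus Bd_d Bd_P) auto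
    finally have "koszul L ?m (koszul L ?m ?w \<ominus>\<^bsub>L\<^esub> ?x) \<in> Bd"
      by (rule koszul_in_subgroup[OF Bd_sub abL])
    then have 1: "?w \<ominus>\<^bsub>L\<^esub> koszul L ?m ?x \<in> Bd"
      using wc add_hom_minus[OF add_hom_koszul[OF abL] abL abL, of "koszul L ?m ?w" ?x]
      by (simp add: koszul_koszul abL koszul_closed koszul_even)
    have "?y \<cdot>\<^bsub>L\<^esub> z = (e \<cdot>\<^bsub>L\<^esub> (a \<otimes>\<^bsub>A\<^esub> z)) \<oplus>\<^bsub>L\<^esub> ?w"
      using cl by (simp add: M.ract_add_left M.ract_mult[symmetric] bz)
    moreover have "e \<cdot>\<^bsub>L\<^esub> a' = (e \<cdot>\<^bsub>L\<^esub> (a \<otimes>\<^bsub>A\<^esub> z)) \<oplus>\<^bsub>L\<^esub> koszul L ?m ?x"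
      using cl by (simp add: a'_def M.ract_add_right koszul_closed abA koszul_ract)
    moreover have "((e \<cdot>\<^bsub>L\<^esub> (a \<otimes>\<^bsub>A\<^esub> z)) \<oplus>\<^bsub>L\<^esub> ?w) \<ominus>\<^bsub>L\<^esub> ((e \<cdot>\<^bsub>L\<^esub> (a \<otimes>\<^bsub>A\<^esub> z)) \<oplus>\<^bsub>L\<^esub> koszul L ?m ?x)
        = ?w \<ominus>\<^bsub>L\<^esub> koszul L ?m ?x"
    proof -
      have "p \<in> carrier L \<Longrightarrow> q \<in> carrier L \<Longrightarrow> r \<in> carrier L \<Longrightarrow>
          (p \<oplus>\<^bsub>L\<^esub> q) \<ominus>\<^bsub>L\<^esub> (p \<oplus>\<^bsub>L\<^esub> r) = q \<ominus>\<^bsub>L\<^esub> r" for p q r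
        by (rule M.M.add_eq_add_imp_minus_eq[symmetric, of q "p \<oplus>\<^bsub>L\<^esub> r" "r"]) (auto simp: M.M.a_ac)
      then show ?thesis using cl wc by (simp add: koszul_closed abL)
    qed
    ultimately show ?thesis using 1 by simp
  qed
  then have 2: "((?y \<cdot>\<^bsub>L\<^esub> z) \<cdot>\<^bsub>L\<^esub> z) \<ominus>\<^bsub>L\<^esub> ((e \<cdot>\<^bsub>L\<^esub> a') \<cdot>\<^bsub>L\<^esub> z) \<in> Bd"
    using Bd_ract[OF _ zc(1)] yc cl by (simp add: M.ract_minus_left[symmetric])
  obtain g1 where g1: "g1 \<in> carrier A" "(a' \<otimes>\<^bsub>A\<^esub> z) \<ominus>\<^bsub>A\<^esub> (z \<otimes>\<^bsub>A\<^esub> a') = diff A g1"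
    using Zs_comm[OF z(1) a'z] .
  \<comment> \<open>\<open>e z\<close> is \<open>v\<close> minus the boundary of \<open>f\<close>.
    Multiplying by the cycle \<open>a'\<close> commutes with the differential.\<close>
  have 3: "e \<cdot>\<^bsub>L\<^esub> (z \<otimes>\<^bsub>A\<^esub> a') \<in> Bd"
  proof -
    have "diff L (f \<cdot>\<^bsub>L\<^esub> a') = (v \<cdot>\<^bsub>L\<^esub> a') \<ominus>\<^bsub>L\<^esub> (e \<cdot>\<^bsub>L\<^esub> (z \<otimes>\<^bsub>A\<^esub> a'))"
      using cl by (simp add: d_ract_cycle[OF fc a'z] df M.ract_minus_left M.ract_mult)
    then have "e \<cdot>\<^bsub>L\<^esub> (z \<otimes>\<^bsub>A\<^esub> a') = (v \<cdot>\<^bsub>L\<^esub> a') \<ominus>\<^bsub>L\<^esub> diff L (f \<cdot>\<^bsub>L\<^esub> a')"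
      using cl by (simp add: a_minus_def M.M.minus_add M.M.minus_minus M.M.r_neg1 M.M.a_assoc[symmetric] M.M.r_neg)
    also have "\<dots> \<in> Bd" using cl P_act[OF v a'c] by (intro Bd_minus Bd_d Bd_P) auto
    finally show ?thesis .
  qed
  \<comment> \<open>Here \<open>z\<close> stands on the other side of \<open>a'\<close>. As
    \<open>a'\<close> is a cycle, exchanging them costs a boundary of \<open>A\<close>, which
    \<open>Bd_ract_diff\<close> absorbs.\<close>
  have "(e \<cdot>\<^bsub>L\<^esub> a') \<cdot>\<^bsub>L\<^esub> z \<in> Bd"
  proof (rule Bd_cong[OF _ 3])
    show "((e \<cdot>\<^bsub>L\<^esub> a') \<cdot>\<^bsub>L\<^esub> z) \<ominus>\<^bsub>L\<^esub> (e \<cdot>\<^bsub>L\<^esub> (z \<otimes>\<^bsub>A\<^esub> a')) \<in> Bd"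
      using Bd_ract_diff[OF ec e(2) g1(1)] g1(2)[symmetric] cl by (simp add: M.ract_minus_right M.ract_mult)
  qed (use cl in simp)
  then have "(?y \<cdot>\<^bsub>L\<^esub> z) \<cdot>\<^bsub>L\<^esub> z \<in> Bd" by (rule Bd_cong[OF 2]) (use yc cl in simp)
  then have "?y \<cdot>\<^bsub>L\<^esub> (z \<otimes>\<^bsub>A\<^esub> z) \<in> Bd" using yc cl by (simp add: M.ract_mult)
  then show ?thesis using yc dy Zs_mult[OF z(1) z(1)] by (auto simp: Good_def)
qed

end

section \<open>Cones attached along all maps at once\<close>

type_synonym ('a, 'n) step_index = "'n \<times> 'n \<times> 'a \<times> int \<times> int"

text \<open>An index amounts to a dg map into \<open>N\<close> from a shift of the cone of left
  multiplication by \<open>z\<close>: one generator goes to the cycle \<open>u\<close>, the other to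
  \<open>v\<close>, whose boundary must be \<open>u z\<close>. Two special cases matter:
  \<open>u = 0\<close> makes the class of a cycle \<open>v\<close> divisible, and a cycle
  \<open>u\<close> whose product with \<open>z\<close> bounds \<open>v\<close> is made a
  boundary.\<close>

definition step_index ::
    "('k, 'a) dg \<Rightarrow> 'a set set \<Rightarrow> ('a, 'n) dg \<Rightarrow> ('a, 'n) step_index set"
  where "step_index A S N = {(u, v, z, k, l). u \<in> cycles N \<inter> gr N (k + 1) \<and> v \<in> gr N (k + l) \<and>
    even l \<and> z \<in> cycles A \<inter> gr A l \<and> cls A z \<in> S \<and> diff N v = u \<cdot>\<^bsub>N\<^esub> z}"

text \<open>
  Attaching the cone of left multiplication by \<open>z\<close> along the map given by \<open>u\<close> and \<open>v\<close>, for all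
  \<open>z\<close> representing an element of \<open>S\<close>: cells \<open>e\<close> and \<open>f\<close> with \<open>d e = u\<close> and \<open>d f = v - e z\<close>.
\<close>

definition step_half ::
    "('k, 'a) dg \<Rightarrow> 'a set set \<Rightarrow> ('a, 'n) dg \<Rightarrow> ('a, 'n \<times> (('a, 'n) step_index \<Rightarrow> 'a)) dg"
  where "step_half A S N = attach A N (step_index A S N) (\<lambda>(u, v, z, k, l). k) (\<lambda>(u, v, z, k, l). u)"

definition step :: "('k, 'a) dg \<Rightarrow> 'a set set \<Rightarrow> ('a, 'n) dg
    \<Rightarrow> ('a, ('n \<times> (('a, 'n) step_index \<Rightarrow> 'a)) \<times> (('a, 'n) step_index \<Rightarrow> 'a)) dg"
  where "step A S N = attach A (step_half A S N) (step_index A S N)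
    (\<lambda>(u, v, z, k, l). k + l - 1) (\<lambda>j. case j of (u, v, z, k, l) \<Rightarrow> (v, single A j (\<ominus>\<^bsub>A\<^esub> z)))"

definition step_incl :: "('k, 'a) dg \<Rightarrow> 'n \<Rightarrow> ('n \<times> ('j \<Rightarrow> 'a)) \<times> ('j \<Rightarrow> 'a)"
  where "step_incl A n = ((n, \<lambda>j. \<zero>\<^bsub>A\<^esub>), \<lambda>j. \<zero>\<^bsub>A\<^esub>)"

locale step_locale = dgm A N + R: mult_set "cohomology_ring A" S
  for A :: "('k, 'a) dg" and N :: "('a, 'n) dg" and S :: "'a set set"
begin

abbreviation "I \<equiv> step_index A S N"
abbreviation "E \<equiv> step_half A S N"
abbreviation "L \<equiv> step A S N"
abbreviation "degE \<equiv> \<lambda>(u, v, z, k, l). k :: int"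
abbreviation "bdE \<equiv> \<lambda>(u, v, z, k, l). u"
abbreviation "degF \<equiv> \<lambda>(u, v, z, k, l). k + l - 1 :: int"
abbreviation "bdF \<equiv> \<lambda>j. case j of (u, v, z, k, l) \<Rightarrow> (v, single A j (\<ominus>\<^bsub>A\<^esub> z))"
abbreviation incl :: "'n \<Rightarrow> ('n \<times> (('a, 'n) step_index \<Rightarrow> 'a)) \<times> (('a, 'n) step_index \<Rightarrow> 'a)"
  where "incl \<equiv> step_incl A"

sublocale E: cells A N I degE bdE
  rewrites "attach A N I degE bdE = E"
proof -
  show "cells A N I degE bdE"
    by unfold_locales (auto simp: step_index_def)
qed (simp add: step_half_def)

sublocale E': dgm A E by (rule E.T_dgm)

lemma cellE_ract:
  assumes "j \<in> I" "a \<in> carrier A"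
  shows "E.cell j \<cdot>\<^bsub>E\<^esub> a = (\<zero>\<^bsub>N\<^esub>, single A j a)"
  by (rule E.cell_ract[OF assms])

lemma E_simps:
  "carrier E = carrier N \<times> fsupp A I"
  "\<zero>\<^bsub>E\<^esub> = (\<zero>\<^bsub>N\<^esub>, \<lambda>j. \<zero>\<^bsub>A\<^esub>)"
  "(n, a) \<oplus>\<^bsub>E\<^esub> (m, b) = (n \<oplus>\<^bsub>N\<^esub> m, \<lambda>j. a j \<oplus>\<^bsub>A\<^esub> b j)"
  "(n, a) \<cdot>\<^bsub>E\<^esub> r = (n \<cdot>\<^bsub>N\<^esub> r, \<lambda>j. a j \<otimes>\<^bsub>A\<^esub> r)"
  "gr E k = gr N k \<times> {a \<in> fsupp A I. \<forall>j\<in>I. a j \<in> gr A (k - degE j)}"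
  "diff E (n, a) = (diff N n \<oplus>\<^bsub>N\<^esub> wsum A N bdE a, \<lambda>j. koszul A (degE j) (diff A (a j)))"
  unfolding step_half_def attach_simps by (simp_all add: case_prod_unfold)

lemma bdF_eq:
  assumes j: "j \<in> I" "j = (u, v, z, k, l)"
  shows "bdF j = (v, \<lambda>i. \<zero>\<^bsub>A\<^esub>) \<ominus>\<^bsub>E\<^esub> (E.cell j \<cdot>\<^bsub>E\<^esub> z)"
proof -
  have c: "v \<in> carrier N" "z \<in> carrier A"
    using j A.cyclesD M.M.gr_carrier by (auto simp: step_index_def)
  have 1: "\<ominus>\<^bsub>E\<^esub> (E.cell j \<cdot>\<^bsub>E\<^esub> z) = (\<zero>\<^bsub>N\<^esub>, single A j (\<ominus>\<^bsub>A\<^esub> z))"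
  proof (rule E'.M.M.minus_equality)
    show "(\<zero>\<^bsub>N\<^esub>, single A j (\<ominus>\<^bsub>A\<^esub> z)) \<oplus>\<^bsub>E\<^esub> (E.cell j \<cdot>\<^bsub>E\<^esub> z) = \<zero>\<^bsub>E\<^esub>"
      using c j by (auto simp: cellE_ract E_simps single_def A.A.l_neg)
  qed (use c j in \<open>simp_all add: cellE_ract E_simps A.A.single_fsupp\<close>)
  show ?thesis
    using c j unfolding a_minus_def 1 by (auto simp: E_simps single_def)
qed

text \<open>The boundary of \<open>v - e z\<close> is \<open>u z - u z\<close>, since
  \<open>z\<close> is a cycle. This is where the condition on \<open>diff N v\<close> in
  \<open>step_index\<close> enters.\<close>

lemma bdF:
  assumes j: "j \<in> I"
  shows "bdF j \<in> gr E (degF j + 1)" "bdF j \<in> cycles E"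
proof -
  obtain u v z k l where j': "j = (u, v, z, k, l)" by (cases j) auto
  have h: "u \<in> cycles N" "v \<in> gr N (k + l)" "z \<in> cycles A" "z \<in> gr A l" "diff N v = u \<cdot>\<^bsub>N\<^esub> z"
    using j j' by (auto simp: step_index_def)
  have c: "v \<in> carrier N" "z \<in> carrier A" "u \<in> carrier N" using h A.cyclesD M.cyclesD M.M.gr_carrier by auto
  note ig = dg_hom_gr[OF E.attach_incl] and id = dg_hom_diff[OF E.attach_incl]
  have g: "E.cell j \<in> gr E k" using E.cell_gr[OF j] j' by simp
  then have ec: "E.cell j \<in> carrier E" using E'.M.M.gr_carrier by blast
  have vc: "(v, \<lambda>i. \<zero>\<^bsub>A\<^esub>) \<in> carrier E" using c by (simp add: E_simps A.A.fsupp_zero)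
  have "bdF j \<in> gr E (k + l)"
    unfolding bdF_eq[OF j j'] by (intro E'.M.M.gr_minus E'.M.gr_ract ig h g)
  then show "bdF j \<in> gr E (degF j + 1)" by (simp add: j')
  have "diff E (bdF j) = diff E (v, \<lambda>i. \<zero>\<^bsub>A\<^esub>) \<ominus>\<^bsub>E\<^esub> (diff E (E.cell j) \<cdot>\<^bsub>E\<^esub> z)"
    unfolding bdF_eq[OF j j'] using vc ec c
    by (simp add: E'.M.d_minus E'.M.ract_closed E'.d_ract_cycle[OF ec h(3)])
  also have "diff E (v, \<lambda>i. \<zero>\<^bsub>A\<^esub>) = (u \<cdot>\<^bsub>N\<^esub> z, \<lambda>i. \<zero>\<^bsub>A\<^esub>)" using id[OF c(1)] h by simp
  also have "diff E (E.cell j) \<cdot>\<^bsub>E\<^esub> z = (u \<cdot>\<^bsub>N\<^esub> z, \<lambda>i. \<zero>\<^bsub>A\<^esub>)"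
    using E.cell_diff[OF j] j' c by (simp add: E_simps)
  also have "(u \<cdot>\<^bsub>N\<^esub> z, \<lambda>i. \<zero>\<^bsub>A\<^esub>) \<ominus>\<^bsub>E\<^esub> (u \<cdot>\<^bsub>N\<^esub> z, \<lambda>i. \<zero>\<^bsub>A\<^esub>) = \<zero>\<^bsub>E\<^esub>"
    by (rule E'.M.M.minus_eq_zero_iff[THEN iffD2])
      (use c in \<open>simp_all add: E_simps M.ract_closed A.A.fsupp_zero\<close>)
  finally have "diff E (bdF j) = \<zero>\<^bsub>E\<^esub>" .
  moreover have "bdF j \<in> carrier E"
    using \<open>bdF j \<in> gr E (k + l)\<close> E'.M.M.gr_carrier by blast
  ultimately show "bdF j \<in> cycles E" by (rule E'.M.cyclesI[rotated])
qed

sublocale F: cells A E I degF bdF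
  rewrites "attach A E I degF bdF = L"
proof -
  show "cells A E I degF bdF" by unfold_locales (use bdF in blast)+
qed (simp add: step_def)

sublocale F': dgm A L by (rule F.T_dgm)

lemma L_simps:
  "carrier L = carrier E \<times> fsupp A I"
  "\<zero>\<^bsub>L\<^esub> = (\<zero>\<^bsub>E\<^esub>, \<lambda>j. \<zero>\<^bsub>A\<^esub>)"
  "(n, a) \<oplus>\<^bsub>L\<^esub> (m, b) = (n \<oplus>\<^bsub>E\<^esub> m, \<lambda>j. a j \<oplus>\<^bsub>A\<^esub> b j)"
  "(n, a) \<cdot>\<^bsub>L\<^esub> r = (n \<cdot>\<^bsub>E\<^esub> r, \<lambda>j. a j \<otimes>\<^bsub>A\<^esub> r)"
  "diff L (n, a) = (diff E n \<oplus>\<^bsub>E\<^esub> wsum A E bdF a, \<lambda>j. koszul A (degF j) (diff A (a j)))"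
  unfolding step_def attach_simps by (simp_all add: case_prod_unfold)

lemma incl_eq: "incl n = ((n, \<lambda>j. \<zero>\<^bsub>A\<^esub>), \<lambda>j. \<zero>\<^bsub>A\<^esub>)"
  by (simp add: step_incl_def)

lemma incl_dg_hom: "dg_hom A N L incl"
  unfolding step_incl_def[abs_def] by (rule dg_hom_comp[OF E.attach_incl F.attach_incl])

lemmas incl_mod = dg_hom_mod_hom[OF incl_dg_hom]
  and incl_d = dg_hom_diff[OF incl_dg_hom]

lemma incl_inj: "incl n = incl m \<Longrightarrow> n = m"
  by (simp add: incl_eq)

definition "eL j = (E.cell j, \<lambda>i. \<zero>\<^bsub>A\<^esub>)"
definition "fL j = F.cell j"

lemma cells_L:
  assumes j: "j \<in> I" "j = (u, v, z, k, l)"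
  shows "eL j \<in> gr L k" "diff L (eL j) = incl u" "fL j \<in> gr L (k + l - 1)"
    "diff L (fL j) = incl v \<ominus>\<^bsub>L\<^esub> (eL j \<cdot>\<^bsub>L\<^esub> z)" "incl u \<in> carrier L" "incl v \<in> carrier L"
proof -
  note hE = E.attach_incl and hF = F.attach_incl
  have h: "v \<in> carrier N" "u \<in> carrier N" "z \<in> carrier A"
    using j A.cyclesD M.cyclesD M.M.gr_carrier by (auto simp: step_index_def)
  have ec: "E.cell j \<in> carrier E" by (rule E.cell_closed[OF j(1)])
  show "eL j \<in> gr L k" unfolding eL_def
    by (rule dg_hom_gr[OF hF]) (use E.cell_gr[OF j(1)] j in simp)
  show "diff L (eL j) = incl u"
    using dg_hom_diff[OF hF ec] E.cell_diff[OF j(1)] j by (simp add: eL_def incl_eq)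
  show "fL j \<in> gr L (k + l - 1)" using F.cell_gr[OF j(1)] j by (simp add: fL_def)
  have vc: "(v, \<lambda>i. \<zero>\<^bsub>A\<^esub>) \<in> carrier E" using h by (simp add: E_simps A.A.fsupp_zero)
  note m = dg_hom_mod_hom[OF hF]
  have "diff L (fL j) = ((v, \<lambda>i. \<zero>\<^bsub>A\<^esub>) \<ominus>\<^bsub>E\<^esub> (E.cell j \<cdot>\<^bsub>E\<^esub> z), \<lambda>i. \<zero>\<^bsub>A\<^esub>)"
    using F.cell_diff[OF j(1)] bdF_eq[OF j] by (simp add: fL_def)
  also have "\<dots> = incl v \<ominus>\<^bsub>L\<^esub> (eL j \<cdot>\<^bsub>L\<^esub> z)"
    using mod_hom_minus[OF m E'.M.is_graded_module F'.M.is_graded_module vc E'.M.ract_closed[OF ec h(3)]]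
      mod_hom_ract[OF m ec h(3)] by (simp add: incl_eq eL_def)
  finally show "diff L (fL j) = incl v \<ominus>\<^bsub>L\<^esub> (eL j \<cdot>\<^bsub>L\<^esub> z)" .
  show "incl u \<in> carrier L" "incl v \<in> carrier L" using mod_hom_closed[OF incl_mod] h by auto
qed

sublocale rel: relative A L S "incl ` carrier N"
proof (intro relative.intro relative_axioms.intro F'.dgm_axioms R.mult_set_axioms)
  show "additive_subgroup (incl ` carrier N) L"
  proof (rule additive_subgroup.intro, rule F'.M.M.add.subgroupI)
    show "incl ` carrier N \<subseteq> carrier L" using mod_hom_closed[OF incl_mod] by blast
    show "incl ` carrier N \<noteq> {}" using M.M.zero_closed by blast
    fix x assume x: "x \<in> incl ` carrier N"
    then show "\<ominus>\<^bsub>L\<^esub> x \<in> incl ` carrier N"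
      using mod_hom_neg[OF incl_mod M.is_graded_module F'.M.is_graded_module, symmetric] by auto
    fix y assume "y \<in> incl ` carrier N"
    then show "x \<oplus>\<^bsub>L\<^esub> y \<in> incl ` carrier N"
      using x mod_hom_add[OF incl_mod, symmetric] by auto
  qed
  show "p \<cdot>\<^bsub>L\<^esub> a \<in> incl ` carrier N" if "p \<in> incl ` carrier N" "a \<in> carrier A" for p a
    using that mod_hom_ract[OF incl_mod, symmetric] M.ract_closed by auto
  show "gcomp L p i \<in> incl ` carrier N" if "p \<in> incl ` carrier N" for p i
    using that gcomp_graded_hom[OF M.is_graded_module F'.M.is_graded_module] incl_dg_hom
      M.M.gcomp_closed by (auto simp: dg_hom_def)
qed

text \<open>Relative to \<open>N\<close>, the module \<open>L\<close> is a direct sum of cones. An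
  element splits into a part from \<open>N\<close> and contributions of finitely many pairs
  \<open>e\<close>, \<open>f\<close>; being a relative cycle is a condition on each pair separately,
  namely that required by \<open>Good_cell\<close>.\<close>

lemma Good_if_diff:
  assumes y: "y \<in> carrier L" and dy: "diff L y \<in> incl ` carrier N"
  shows "y \<in> rel.Good"
proof -
  obtain n a b where y': "y = ((n, a), b)" "n \<in> carrier N" "a \<in> fsupp A I" "b \<in> fsupp A I"
    using y by (auto simp: L_simps E_simps)
  have na: "(n, a) \<in> carrier E" using y' by (simp add: E_simps)
  note ac = fsupp_closed[OF y'(3)] and bc = fsupp_closed[OF y'(4)]
  have F_c: "bdF j \<in> carrier E" if "j \<in> I" for j using bdF(2)[OF that] E'.M.cyclesD by blast
  have wc: "wsum A E bdF b \<in> carrier E" by (rule E'.M.wsum_closed[OF y'(4) F_c])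
  obtain m where m: "diff L y = incl m" using dy by blast
  \<comment> \<open>The boundary comes from \<open>N\<close>, so its coordinates at the cells
    \<open>e\<close> and at the cells \<open>f\<close> vanish. The latter show that
    \<open>b j\<close> is a cycle, the former relate the differential of \<open>a j\<close> to
    \<open>z\<close> times \<open>b j\<close>.\<close>
  then have 1: "snd (diff E (n, a) \<oplus>\<^bsub>E\<^esub> wsum A E bdF b) = (\<lambda>j. \<zero>\<^bsub>A\<^esub>)"
    and 2: "(\<lambda>j. koszul A (degF j) (diff A (b j))) = (\<lambda>j. \<zero>\<^bsub>A\<^esub>)"
    by (simp_all add: y' L_simps(5) incl_eq del: E_simps)
  have kz: "x = \<zero>\<^bsub>A\<^esub>" if "koszul A i x = \<zero>\<^bsub>A\<^esub>" "x \<in> carrier A" for i x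
    using that koszul_koszul[OF A.A.abelian_group_axioms that(2), of i i]
    by (simp add: koszul_zero A.A.abelian_group_axioms koszul_even)
  have bcyc: "b j \<in> cycles A" for j
    using fun_cong[OF 2, of j] kz A.d_closed[OF bc] bc by (intro A.cyclesI) auto
  have zb: "koszul A k (diff A (a j)) = z \<otimes>\<^bsub>A\<^esub> b j" if j: "j \<in> I" "j = (u, v, z, k, l)" for j u v z k l
  proof -
    have zc: "z \<in> carrier A" using j A.cyclesD by (auto simp: step_index_def)
    obtain p w where pw: "wsum A E bdF b = (p, w)" by (cases "wsum A E bdF b")
    have "w j = (\<ominus>\<^bsub>A\<^esub> z) \<otimes>\<^bsub>A\<^esub> b j"
      using E.wsum_single_snd[of bdF "\<lambda>(u, v, z, k, l). v" "\<lambda>(u, v, z, k, l). \<ominus>\<^bsub>A\<^esub> z", OF _ F_c y'(4) j(1)] pw j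
      by (auto split: prod.splits)
    moreover have "koszul A (degE j) (diff A (a j)) \<oplus>\<^bsub>A\<^esub> w j = \<zero>\<^bsub>A\<^esub>"
      using fun_cong[OF 1, of j] pw by (simp add: E_simps)
    ultimately have "koszul A k (diff A (a j)) \<ominus>\<^bsub>A\<^esub> (z \<otimes>\<^bsub>A\<^esub> b j) = \<zero>\<^bsub>A\<^esub>"
      using zc bc[of j] j by (simp add: a_minus_def A.A.l_minus)
    then show ?thesis
      using zc bc[of j] A.d_closed[OF ac[of j]]
      by (simp add: A.A.minus_eq_zero_iff koszul_closed A.A.abelian_group_axioms)
  qed
  let ?F = "{j. a j \<noteq> \<zero>\<^bsub>A\<^esub>} \<union> {j. b j \<noteq> \<zero>\<^bsub>A\<^esub>}"
  have F: "finite ?F" "?F \<subseteq> I" using fsupp_finite fsupp_subset y' by (fast, fast)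
  note m2 = dg_hom_mod_hom[OF F.attach_incl]
  have ec: "eL j \<in> carrier L" "fL j \<in> carrier L" if "j \<in> I" for j
  proof -
    obtain u v z k l where "j = (u, v, z, k, l)" by (cases j) auto
    then show "eL j \<in> carrier L" "fL j \<in> carrier L"
      using cells_L(1,3)[OF that] F'.M.M.gr_carrier by blast+
  qed
  have "(n, a) = (n, \<lambda>j. \<zero>\<^bsub>A\<^esub>) \<oplus>\<^bsub>E\<^esub> wsum A E E.cell a" by (rule E.T_decomp[OF y'(2,3)])
  then have "((n, a), \<lambda>j. \<zero>\<^bsub>A\<^esub>) = incl n \<oplus>\<^bsub>L\<^esub> wsum A L eL a"
    using mod_hom_add[OF m2, of "(n, \<lambda>j. \<zero>\<^bsub>A\<^esub>)" "wsum A E E.cell a"]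
      E'.M.wsum_hom[OF F'.M.is_graded_module m2 y'(3) E.cell_closed]
      E'.M.wsum_closed[OF y'(3) E.cell_closed] y'(2)
    by (simp add: incl_eq eL_def[abs_def] E_simps(1) A.A.fsupp_zero)
  moreover have "y = ((n, a), \<lambda>j. \<zero>\<^bsub>A\<^esub>) \<oplus>\<^bsub>L\<^esub> wsum A L fL b"
    unfolding y' fL_def[abs_def] by (rule F.T_decomp[OF na y'(4)])
  ultimately have "y = (incl n \<oplus>\<^bsub>L\<^esub> wsum A L eL a) \<oplus>\<^bsub>L\<^esub> wsum A L fL b" by simp
  also have "wsum A L eL a = (\<Oplus>\<^bsub>L\<^esub>j\<in>?F. eL j \<cdot>\<^bsub>L\<^esub> a j)"
    by (rule F'.M.wsum_eq[OF y'(3) ec(1) F(1) _ F(2)]) auto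
  also have "wsum A L fL b = (\<Oplus>\<^bsub>L\<^esub>j\<in>?F. fL j \<cdot>\<^bsub>L\<^esub> b j)"
    by (rule F'.M.wsum_eq[OF y'(4) ec(2) F(1) _ F(2)]) auto
  also have "(incl n \<oplus>\<^bsub>L\<^esub> (\<Oplus>\<^bsub>L\<^esub>j\<in>?F. eL j \<cdot>\<^bsub>L\<^esub> a j)) \<oplus>\<^bsub>L\<^esub> (\<Oplus>\<^bsub>L\<^esub>j\<in>?F. fL j \<cdot>\<^bsub>L\<^esub> b j)
      = incl n \<oplus>\<^bsub>L\<^esub> (\<Oplus>\<^bsub>L\<^esub>j\<in>?F. (eL j \<cdot>\<^bsub>L\<^esub> a j) \<oplus>\<^bsub>L\<^esub> (fL j \<cdot>\<^bsub>L\<^esub> b j))"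
  proof -
    have 1: "(\<lambda>j. eL j \<cdot>\<^bsub>L\<^esub> a j) \<in> ?F \<rightarrow> carrier L" "(\<lambda>j. fL j \<cdot>\<^bsub>L\<^esub> b j) \<in> ?F \<rightarrow> carrier L"
      using F ec ac bc F'.M.ract_closed by blast+
    then have "(\<Oplus>\<^bsub>L\<^esub>j\<in>?F. eL j \<cdot>\<^bsub>L\<^esub> a j) \<in> carrier L" "(\<Oplus>\<^bsub>L\<^esub>j\<in>?F. fL j \<cdot>\<^bsub>L\<^esub> b j) \<in> carrier L"
      by (simp_all only: F'.M.M.finsum_closed)
    then show ?thesis
      using mod_hom_closed[OF incl_mod y'(2)] by (simp only: F'.M.M.finsum_addf[OF 1] F'.M.M.a_assoc)
  qed
  also have "\<dots> \<in> rel.Good"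
  proof (rule additive_subgroup.a_closed[OF rel.Good_sub])
    \<comment> \<open>The part coming from \<open>N\<close> is zero in the relative complex, so
      multiplication by \<open>\<one>\<close> is enough.\<close>
    have "\<one>\<^bsub>A\<^esub> \<in> rel.Zs" using R.S_one A.one_cycle by (simp add: rel.Zs_def A.coh_ring_simps)
    moreover have "diff L (incl n) \<in> incl ` carrier N"
      unfolding incl_d[OF y'(2), symmetric] using M.d_closed[OF y'(2)] by (rule imageI)
    moreover have "incl n \<in> rel.Bd" by (rule rel.Bd_P[OF imageI[OF y'(2)]])
    ultimately show "incl n \<in> rel.Good"
      using mod_hom_closed[OF incl_mod y'(2)]
      by (auto simp: rel.Good_def F'.M.ract_one intro!: bexI[of _ "\<one>\<^bsub>A\<^esub>"])
    show "(\<Oplus>\<^bsub>L\<^esub>j\<in>?F. (eL j \<cdot>\<^bsub>L\<^esub> a j) \<oplus>\<^bsub>L\<^esub> (fL j \<cdot>\<^bsub>L\<^esub> b j)) \<in> rel.Good"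
    proof (rule additive_subgroup_finsum[OF F'.M.M.abelian_group_axioms rel.Good_sub], rule funcsetI)
      fix j assume "j \<in> ?F"
      then have j: "j \<in> I" using F by blast
      obtain u v z k l where j': "j = (u, v, z, k, l)" by (cases j) auto
      have h: "u \<in> carrier N" "v \<in> carrier N" "even l" "z \<in> gr A l" "z \<in> rel.Zs"
        using j j' M.cyclesD M.M.gr_carrier by (auto simp: step_index_def rel.Zs_def)
      show "(eL j \<cdot>\<^bsub>L\<^esub> a j) \<oplus>\<^bsub>L\<^esub> (fL j \<cdot>\<^bsub>L\<^esub> b j) \<in> rel.Good"
        by (rule rel.Good_cell[OF cells_L(1)[OF j j'] _ cells_L(3)[OF j j'] h(3,5,4) _ cells_L(4)[OF j j']
            ac bcyc zb[OF j j']]) (use h cells_L(2)[OF j j'] in auto)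
    qed
  qed
  finally show ?thesis .
qed

text \<open>The cohomology of the cokernel of \<open>incl\<close> is \<open>S\<close>-torsion. It is
  kept in terms of elements, which replaces a long exact sequence: kernel and cokernel of the
  induced map are obtained by suitable choices of \<open>y\<close>.\<close>

lemma step_relative:
  assumes y: "y \<in> carrier L" "diff L y \<in> incl ` carrier N"
  obtains z n w where "z \<in> cycles A" "cls A z \<in> S" "n \<in> carrier N" "w \<in> carrier L"
    "y \<cdot>\<^bsub>L\<^esub> z = incl n \<oplus>\<^bsub>L\<^esub> diff L w"
  using Good_if_diff[OF y] that by (auto simp: rel.Good_def rel.Zs_def rel.Bd_def)

section \<open>The map that one step induces in cohomology\<close>

abbreviation "\<kappa> \<equiv> hmap L incl"

lemma kappa_hom: "\<kappa> \<in> graded_hom (cohomology_ring A) (cohomology_module N) (cohomology_module L)"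
  by (rule hmap_graded_hom[OF dgm_axioms F'.dgm_axioms incl_dg_hom])

lemma kappa_cls: "z \<in> cycles N \<Longrightarrow> \<kappa> (cls N z) = cls L (incl z)"
  by (rule hmap_cls[OF dgm_axioms F'.dgm_axioms incl_dg_hom])

text \<open>An element \<open>y\<close> bounding \<open>incl c\<close> is a relative cycle. Taking
  boundaries in \<open>y z = incl n + d w\<close> gives \<open>incl (c z) = incl (d n)\<close>, and
  \<open>incl\<close> is injective.\<close>

lemma kappa_ker:
  assumes x: "\<xi> \<in> carrier (cohomology_module N)" and k: "\<kappa> \<xi> = \<zero>\<^bsub>cohomology_module L\<^esub>"
  shows "\<exists>s\<in>S. \<xi> \<cdot>\<^bsub>cohomology_module N\<^esub> s = \<zero>\<^bsub>cohomology_module N\<^esub>"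
proof -
  obtain c where c: "c \<in> cycles N" "\<xi> = cls N c" using x by (auto simp: coh_simps)
  have cc: "c \<in> carrier N" "incl c \<in> carrier L"
    using c M.cyclesD mod_hom_closed[OF incl_mod] by auto
  have "incl c \<in> boundaries L"
    using k c cc by (simp add: kappa_cls F'.coh_simps F'.M.cls_zero F'.M.cls_zero_iff)
  then obtain y where y: "y \<in> carrier L" "incl c = diff L y" by (rule F'.M.boundariesE)
  obtain z n w where z: "z \<in> cycles A" "cls A z \<in> S" "n \<in> carrier N" "w \<in> carrier L"
      "y \<cdot>\<^bsub>L\<^esub> z = incl n \<oplus>\<^bsub>L\<^esub> diff L w"
    using step_relative[OF y(1)] y(2) cc by (metis image_eqI)
  have zc: "z \<in> carrier A" using z A.cyclesD by blast
  have "incl (c \<cdot>\<^bsub>N\<^esub> z) = incl c \<cdot>\<^bsub>L\<^esub> z" by (rule mod_hom_ract[OF incl_mod cc(1) zc])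
  also have "\<dots> = diff L (y \<cdot>\<^bsub>L\<^esub> z)" by (simp add: F'.d_ract_cycle[OF y(1) z(1)] y(2))
  also have "\<dots> = incl (diff N n)"
    unfolding z(5) using z mod_hom_closed[OF incl_mod] M.d_closed
    by (simp add: F'.M.d_add F'.M.d_closed F'.M.d_d incl_d)
  finally have "c \<cdot>\<^bsub>N\<^esub> z = diff N n" by (rule incl_inj)
  then have "\<xi> \<cdot>\<^bsub>cohomology_module N\<^esub> cls A z = \<zero>\<^bsub>cohomology_module N\<^esub>"
    using c z M.boundariesI[OF z(3)] M.d_closed[OF z(3)]
    by (simp add: coh_ract coh_simps M.cls_zero M.cls_zero_iff)
  then show ?thesis using z(2) by blast
qed

text \<open>A cycle of \<open>L\<close> is in particular a relative cycle, so its product with a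
  suitable \<open>z\<close> is homologous to an element of \<open>N\<close>, which is a cycle
  because \<open>incl\<close> is injective.\<close>

lemma kappa_coker:
  assumes h: "\<eta> \<in> carrier (cohomology_module L)"
  shows "\<exists>s\<in>S. \<exists>\<xi>\<in>carrier (cohomology_module N). \<eta> \<cdot>\<^bsub>cohomology_module L\<^esub> s = \<kappa> \<xi>"
proof -
  obtain y where y: "y \<in> cycles L" "\<eta> = cls L y" using h by (auto simp: F'.coh_simps)
  have yc: "y \<in> carrier L" "diff L y = incl \<zero>\<^bsub>N\<^esub>"
    using y F'.M.cyclesD mod_hom_zero[OF incl_mod M.is_graded_module F'.M.is_graded_module] by auto
  obtain z n w where z: "z \<in> cycles A" "cls A z \<in> S" "n \<in> carrier N" "w \<in> carrier L"
      "y \<cdot>\<^bsub>L\<^esub> z = incl n \<oplus>\<^bsub>L\<^esub> diff L w"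
    using step_relative[OF yc(1)] yc(2) M.M.zero_closed by (metis image_eqI)
  have nc: "incl n \<in> carrier L" using mod_hom_closed[OF incl_mod z(3)] .
  have yz: "y \<cdot>\<^bsub>L\<^esub> z \<in> cycles L" by (rule F'.ract_cycles[OF y(1) z(1)])
  have "incl (diff N n) = diff L (incl n)" by (rule incl_d[OF z(3)])
  also have "\<dots> = diff L (y \<cdot>\<^bsub>L\<^esub> z)"
    unfolding z(5) using z nc by (simp add: F'.M.d_add F'.M.d_closed F'.M.d_d)
  also have "\<dots> = incl \<zero>\<^bsub>N\<^esub>"
    using F'.M.cyclesD(2)[OF yz] mod_hom_zero[OF incl_mod M.is_graded_module F'.M.is_graded_module] by simp
  finally have n: "n \<in> cycles N" using z(3) by (intro M.cyclesI) (auto dest: incl_inj)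
  have "\<eta> \<cdot>\<^bsub>cohomology_module L\<^esub> cls A z = cls L (y \<cdot>\<^bsub>L\<^esub> z)" using y z by (simp add: F'.coh_ract)
  also have "\<dots> = cls L (incl n)"
    using z(5) F'.M.cyclesD(1)[OF yz] nc F'.M.boundariesI[OF z(4)] F'.M.d_closed[OF z(4)]
    by (simp add: F'.M.cls_eq_iff F'.M.M.add_minus_cancel_left)
  also have "\<dots> = \<kappa> (cls N n)" using n by (simp add: kappa_cls)
  finally show ?thesis using z(2) n by (auto simp: coh_simps)
qed

lemma S_cycle:
  assumes "s \<in> S"
  obtains z l where "z \<in> cycles A" "z \<in> gr A l" "even l" "s = cls A z"
  using R.S_even[OF assms] by (auto simp: A.coh_ring_simps)

text \<open>If \<open>u z\<close> bounds \<open>v\<close>, the cell \<open>e\<close> belonging to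
  these data has boundary \<open>u\<close>. The cell has degree \<open>n - 1\<close>, one less than
  \<open>u\<close>.\<close>

lemma kappa_tors:
  assumes x: "\<xi> \<in> gr (cohomology_module N) n" and s: "s \<in> S"
    and xs: "\<xi> \<cdot>\<^bsub>cohomology_module N\<^esub> s = \<zero>\<^bsub>cohomology_module N\<^esub>"
  shows "\<kappa> \<xi> = \<zero>\<^bsub>cohomology_module L\<^esub>"
proof -
  obtain u where u: "u \<in> cycles N" "u \<in> gr N n" "\<xi> = cls N u" using x by (auto simp: coh_simps)
  obtain z l where z: "z \<in> cycles A" "z \<in> gr A l" "even l" "s = cls A z" using S_cycle[OF s] .
  have uz: "u \<cdot>\<^bsub>N\<^esub> z \<in> gr N (n + l)" using u z M.gr_ract by blast
  have "u \<cdot>\<^bsub>N\<^esub> z \<in> boundaries N"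
    using xs u z M.M.gr_carrier[OF uz] by (simp add: coh_ract coh_simps M.cls_zero M.cls_zero_iff)
  then obtain v where v: "v \<in> gr N (n + l - 1)" "u \<cdot>\<^bsub>N\<^esub> z = diff N v"
    using M.boundary_homogeneous uz by blast
  define j where "j = (u, v, z, n - 1, l)"
  have vg: "v \<in> gr N ((n - 1) + l)" using v by (simp add: algebra_simps)
  have j: "j \<in> I" using u v z s vg by (auto simp: j_def step_index_def)
  note cl = cells_L[OF j j_def]
  have "eL j \<in> carrier L" using cl(1) F'.M.M.gr_carrier by blast
  then have "incl u \<in> boundaries L" unfolding cl(2)[symmetric] by (rule F'.M.boundariesI)
  then show ?thesis using u cl(5) by (simp add: kappa_cls F'.coh_simps F'.M.cls_zero F'.M.cls_zero_iff)
qed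

text \<open>With \<open>u = 0\<close> the cell \<open>e\<close> is a cycle, and the cell
  \<open>f\<close> shows that \<open>e z\<close> is homologous to \<open>v\<close>. Since
  \<open>v\<close> has degree \<open>n\<close> and \<open>z\<close> has degree \<open>l\<close>, the
  cell \<open>e\<close> must have degree \<open>n - l\<close>.\<close>

lemma kappa_div:
  assumes x: "\<xi> \<in> gr (cohomology_module N) n" and s: "s \<in> S" "s \<in> gr (cohomology_ring A) l" "even l"
  shows "\<exists>\<eta>\<in>gr (cohomology_module L) (n - l). \<eta> \<cdot>\<^bsub>cohomology_module L\<^esub> s = \<kappa> \<xi>"
proof -
  obtain v where v: "v \<in> cycles N" "v \<in> gr N n" "\<xi> = cls N v" using x by (auto simp: coh_simps)
  obtain z where z: "z \<in> cycles A" "z \<in> gr A l" "s = cls A z" using s by (auto simp: A.coh_ring_simps)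
  define j where "j = (\<zero>\<^bsub>N\<^esub>, v, z, n - l, l)"
  have "\<zero>\<^bsub>N\<^esub> \<in> cycles N" using M.d_zero by (intro M.cyclesI) auto
  then have j: "j \<in> I"
    using v z s A.cyclesD M.cyclesD by (auto simp: j_def step_index_def M.M.gr_zero M.ract_zero_left)
  note cl = cells_L[OF j j_def]
  have ec: "eL j \<in> carrier L" "fL j \<in> carrier L" using cl(1,3) F'.M.M.gr_carrier by blast+
  have e: "eL j \<in> cycles L"
    using cl(2) mod_hom_zero[OF incl_mod M.is_graded_module F'.M.is_graded_module] ec
    by (intro F'.M.cyclesI) auto
  have "incl v \<ominus>\<^bsub>L\<^esub> (eL j \<cdot>\<^bsub>L\<^esub> z) \<in> boundaries L"
    unfolding cl(4)[symmetric] by (rule F'.M.boundariesI[OF ec(2)])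
  then have "cls L (incl v) = cls L (eL j \<cdot>\<^bsub>L\<^esub> z)"
    using cl(6) F'.M.cyclesD(1)[OF F'.ract_cycles[OF e z(1)]] by (simp add: F'.M.cls_eq_iff)
  then have "cls L (eL j) \<cdot>\<^bsub>cohomology_module L\<^esub> s = \<kappa> \<xi>"
    using v z e by (simp add: kappa_cls F'.coh_ract)
  then show ?thesis using e cl(1) by (auto simp: F'.coh_simps)
qed

text \<open>An index consists of two elements of \<open>N\<close>, one of \<open>A\<close> and two
  integers, so the number of cells stays within the cardinality of the type.\<close>

lemma step_lepoll:
  assumes inf: "infinite (UNIV :: 'm set)" and N: "carrier N \<lesssim> (UNIV :: 'm set)"
    and A: "carrier A \<lesssim> (UNIV :: 'm set)"
  shows "carrier L \<lesssim> (UNIV :: 'm set)"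
proof -
  have int: "(UNIV :: int set) \<lesssim> (UNIV :: 'm set)"
  proof -
    have "(UNIV :: int set) \<lesssim> (UNIV :: nat set)" unfolding lepoll_def by (rule exI[of _ to_nat]) auto
    then show ?thesis using inf unfolding infinite_le_lepoll by (rule lepoll_trans)
  qed
  have "I \<subseteq> carrier N \<times> carrier N \<times> carrier A \<times> UNIV \<times> UNIV"
    using M.cyclesD A.cyclesD M.M.gr_carrier by (auto simp: step_index_def)
  moreover have "carrier N \<times> carrier N \<times> carrier A \<times> (UNIV :: int set) \<times> (UNIV :: int set) \<lesssim> (UNIV :: 'm set)"
    by (intro times_lepoll_UNIV inf N A int)
  ultimately have I: "I \<lesssim> (UNIV :: 'm set)" by (meson lepoll_trans subset_imp_lepoll)
  show ?thesis
    unfolding step_def step_half_def by (intro attach_lepoll inf N A I)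
qed

end

lemma realisable_localisation:
  fixes A :: "('k, 'a) dg" and X :: "('a set, 'x) graded"
  assumes A: "dg_ring A" and X: "graded_module (cohomology_ring A) X"
    and loc: "localised (cohomology_ring A) p X"
    and inf: "infinite (UNIV :: 'm set)" and small: "carrier A \<lesssim> (UNIV :: 'm set)"
    and real: "realisable TYPE('m) A X"
  shows "realisable TYPE('m) A (localisation (cohomology_ring A) p X)"
proof -
  let ?R = "cohomology_ring A" and ?S = "even_denoms (cohomology_ring A) p"
  interpret X: graded_module ?R X by fact
  interpret loc: localised ?R p X by fact
  obtain M :: "('a, 'm) dg" and i q where M: "dgm A M" and i: "i \<in> graded_hom ?R X (cohomology_module M)"
    and q: "mod_hom ?R (cohomology_module M) X q" and qi: "\<forall>x\<in>carrier X. q (i x) = x"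
    using realisableD[OF A real] X.M.a_closed X.ract_closed by blast
  interpret M: step_locale A M ?S
    using M loc.mult_set_axioms by (rule step_locale.intro)
  interpret M1: step_locale A "step A ?S M" ?S
    using M.F'.dgm_axioms loc.mult_set_axioms by (rule step_locale.intro)
  \<comment> \<open>The projection obtained from a direct summand is only linear, whereas
    \<open>localised_split\<close> reads off degrees of numerators.\<close>
  obtain q0 where q0: "q0 \<in> graded_hom ?R (cohomology_module M) X" "\<forall>x\<in>carrier X. q0 (i x) = x"
    using graded_retraction[OF X M.coh_graded_module i q] qi by blast
  have M_small: "carrier M \<lesssim> (UNIV :: 'm set)" by (rule subset_imp_lepoll) simp
  have "\<exists>i' q'. i' \<in> graded_hom ?R (localisation ?R p X) (cohomology_module M1.L) \<and>
      q' \<in> graded_hom ?R (cohomology_module M1.L) (localisation ?R p X) \<and>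
      (\<forall>\<xi>\<in>carrier (localisation ?R p X). q' (i' \<xi>) = \<xi>)"
    by (rule localised_split[OF loc M.coh_graded_module M.F'.coh_graded_module M1.F'.coh_graded_module
        i q0(1) _ M.kappa_hom M1.kappa_hom])
      (use q0(2) in blast, erule (1) M.kappa_ker, erule (1) M1.kappa_ker, erule M.kappa_coker,
        erule M1.kappa_coker, erule (3) M.kappa_div, erule (2) M1.kappa_tors)
  then obtain i' q' where iq: "i' \<in> graded_hom ?R (localisation ?R p X) (cohomology_module M1.L)"
    "q' \<in> graded_hom ?R (cohomology_module M1.L) (localisation ?R p X)"
    "\<forall>\<xi>\<in>carrier (localisation ?R p X). q' (i' \<xi>) = \<xi>"
    by blast
  show ?thesis
    by (rule realisableI[OF M1.F'.dgm_axioms _ iq(1,2)])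
      (use iq(3) loc.loc_gr_carrier M1.step_lepoll[OF inf M.step_lepoll[OF inf M_small small] small] in auto)
qed

section \<open>Free modules and coherence\<close>

lemma free_simps:
  "carrier (free_graded R ds) = {..<length ds} \<rightarrow>\<^sub>E carrier R"
  "\<zero>\<^bsub>free_graded R ds\<^esub> = (\<lambda>k\<in>{..<length ds}. \<zero>\<^bsub>R\<^esub>)"
  "f \<oplus>\<^bsub>free_graded R ds\<^esub> g = (\<lambda>k\<in>{..<length ds}. f k \<oplus>\<^bsub>R\<^esub> g k)"
  "f \<cdot>\<^bsub>free_graded R ds\<^esub> r = (\<lambda>k\<in>{..<length ds}. f k \<otimes>\<^bsub>R\<^esub> r)"
  "gr (free_graded R ds) j = (\<Pi>\<^sub>E k\<in>{..<length ds}. gr R (j - ds ! k))"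
  by (simp_all add: free_graded_def)

definition fbasis :: "('r, 'z) ring_scheme \<Rightarrow> int list \<Rightarrow> nat \<Rightarrow> nat \<Rightarrow> 'r"
  where "fbasis R ds k = (\<lambda>j\<in>{..<length ds}. if j = k then \<one>\<^bsub>R\<^esub> else \<zero>\<^bsub>R\<^esub>)"

context graded_ring
begin

lemma free_abelian_group: "abelian_group (free_graded R ds)"
proof (rule abelian_groupI)
  fix x assume x: "x \<in> carrier (free_graded R ds)"
  show "\<exists>y\<in>carrier (free_graded R ds). y \<oplus>\<^bsub>free_graded R ds\<^esub> x = \<zero>\<^bsub>free_graded R ds\<^esub>"
    by (rule bexI[of _ "\<lambda>k\<in>{..<length ds}. \<ominus> x k"])
      (use x in \<open>auto simp: free_simps PiE_iff l_neg intro!: restrict_ext\<close>)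
qed (auto simp: free_simps PiE_iff a_ac extensional_def restrict_def fun_eq_iff)

lemma free_eval: "i < length ds \<Longrightarrow> add_hom (free_graded R ds) R (\<lambda>f. f i)"
  by (auto simp: add_hom_def free_simps)

lemma free_graded_module: "graded_module R (free_graded R ds)"
proof -
  let ?F = "free_graded R ds" and ?n = "length ds"
  interpret F: abelian_group ?F by (rule free_abelian_group)
  define c where "c f k = (\<lambda>i\<in>{..<?n}. gcomp R (f i) (k - ds ! i))" for f k
  have fc: "f i \<in> carrier R" if "f \<in> carrier ?F" "i < ?n" for f i using that by (auto simp: free_simps)
  have "graded_group ?F"
  proof (rule graded_groupI[where c = c])
    show "abelian_group ?F" by (rule free_abelian_group)
    show "additive_subgroup (gr ?F j) ?F" for j
    proof (rule additive_subgroup.intro, rule F.add.subgroupI)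
      show "gr ?F j \<subseteq> carrier ?F" using gr_carrier by (fastforce simp: free_simps PiE_iff)
      have "\<zero>\<^bsub>?F\<^esub> \<in> gr ?F j" using gr_zero by (auto simp: free_simps)
      then show "gr ?F j \<noteq> {}" by blast
      fix x assume x: "x \<in> gr ?F j"
      have xc: "x \<in> carrier ?F" using x gr_carrier by (fastforce simp: free_simps PiE_iff)
      have "(\<lambda>k\<in>{..<?n}. \<ominus> x k) \<oplus>\<^bsub>?F\<^esub> x = \<zero>\<^bsub>?F\<^esub>"
        using fc[OF xc] by (auto simp: free_simps l_neg intro!: restrict_ext)
      then have "\<ominus>\<^bsub>?F\<^esub> x = (\<lambda>k\<in>{..<?n}. \<ominus> x k)"
        using xc fc[OF xc] by (intro F.minus_equality) (auto simp: free_simps)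
      then show "\<ominus>\<^bsub>?F\<^esub> x \<in> gr ?F j" using x by (auto simp: free_simps PiE_iff gr_neg)
      fix y assume "y \<in> gr ?F j"
      then show "x \<oplus>\<^bsub>?F\<^esub> y \<in> gr ?F j" using x by (auto simp: free_simps PiE_iff gr_add)
    qed
    fix f k assume f: "f \<in> carrier ?F"
    have cc: "c f k \<in> carrier ?F" for k using gcomp_closed fc[OF f] by (auto simp: c_def free_simps)
    show "c f k \<in> gr ?F k" using gcomp_props(1) fc[OF f] by (auto simp: c_def free_simps)
    define D where "D = (\<Union>i\<in>{..<?n}. (\<lambda>j. j + ds ! i) ` {j. gcomp R (f i) j \<noteq> \<zero>})"
    have D: "finite D" unfolding D_def using gcomp_props(2)[OF fc[OF f]] by auto
    have aD: "k \<in> D" if "gcomp R (f i) (k - ds ! i) \<noteq> \<zero>" "i < ?n" for i k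
      unfolding D_def using that by (auto intro!: bexI[of _ i] rev_image_eqI[of "k - ds ! i"])
    have sub: "{k. c f k \<noteq> \<zero>\<^bsub>?F\<^esub>} \<subseteq> D"
    proof
      fix k assume k: "k \<in> {k. c f k \<noteq> \<zero>\<^bsub>?F\<^esub>}"
      have "\<exists>i<?n. gcomp R (f i) (k - ds ! i) \<noteq> \<zero>"
      proof (rule ccontr)
        assume "\<not> (\<exists>i<?n. gcomp R (f i) (k - ds ! i) \<noteq> \<zero>)"
        then have "c f k = \<zero>\<^bsub>?F\<^esub>" by (auto simp: c_def free_simps intro!: restrict_ext)
        then show False using k by simp
      qed
      then show "k \<in> D" using aD by blast
    qed
    then show "finite {k. c f k \<noteq> \<zero>\<^bsub>?F\<^esub>}" using D finite_subset by blast
    have "finsum ?F (c f) {k. c f k \<noteq> \<zero>\<^bsub>?F\<^esub>} = finsum ?F (c f) D"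
      by (rule F.finsum_support[symmetric]) (use D sub cc in auto)
    also have "\<dots> = f"
    proof (rule PiE_ext[where k = "{..<?n}" and s = "\<lambda>_. carrier R"])
      show "finsum ?F (c f) D \<in> {..<?n} \<rightarrow>\<^sub>E carrier R"
        using F.finsum_closed[of "c f" D] cc by (simp add: free_simps Pi_iff)
      show "f \<in> {..<?n} \<rightarrow>\<^sub>E carrier R" using f by (simp add: free_simps)
      fix i assume "i \<in> {..<?n}"
      then have i: "i < ?n" by simp
      have "finsum ?F (c f) D i = finsum R (\<lambda>k. c f k i) D"
        by (rule add_hom_finsum[OF free_eval[OF i] free_abelian_group abelian_group_axioms]) (use cc in auto)
      also have "\<dots> = finsum R (\<lambda>k. gcomp R (f i) (k - ds ! i)) D" using i by (simp add: c_def)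
      also have "\<dots> = finsum R (gcomp R (f i)) ((\<lambda>k. k - ds ! i) ` D)"
        by (rule finsum_reindex[symmetric]) (use gcomp_closed[OF fc[OF f i]] in \<open>auto simp: inj_on_def\<close>)
      also have "\<dots> = f i"
      proof (rule gcomp_sum[OF fc[OF f i]])
        show "finite ((\<lambda>k. k - ds ! i) ` D)" using D by simp
        show "{j. gcomp R (f i) j \<noteq> \<zero>} \<subseteq> (\<lambda>k. k - ds ! i) ` D"
        proof
          fix j assume "j \<in> {j. gcomp R (f i) j \<noteq> \<zero>}"
          then have "j + ds ! i \<in> D" using aD[of i "j + ds ! i"] i by simp
          then show "j \<in> (\<lambda>k. k - ds ! i) ` D" by (rule rev_image_eqI) simp
        qed
      qed
      finally show "finsum ?F (c f) D i = f i" .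
    qed
    finally show "finsum ?F (c f) {k. c f k \<noteq> \<zero>\<^bsub>?F\<^esub>} = f" .
    fix g assume g: "g \<in> carrier ?F"
    show "c (f \<oplus>\<^bsub>?F\<^esub> g) k = c f k \<oplus>\<^bsub>?F\<^esub> c g k"
      unfolding c_def free_simps by (rule restrict_ext) (use fc[OF f] fc[OF g] in \<open>simp add: gcomp_add\<close>)
  next
    fix f k j assume f: "f \<in> gr ?F j"
    have *: "gcomp R (f i) (k - ds ! i) = (if k = j then f i else \<zero>)" if "i < ?n" for i
      using gcomp_homogeneous[of "f i" "j - ds ! i" "k - ds ! i"] f that by (auto simp: free_simps PiE_iff)
    have fe: "f \<in> extensional {..<?n}" using f by (simp add: free_simps PiE_def)
    show "c f k = (if k = j then f else \<zero>\<^bsub>?F\<^esub>)"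
      unfolding c_def using * fe by (auto simp: free_simps extensional_def restrict_def fun_eq_iff)
  qed
  moreover have "graded_module_axioms R ?F"
  proof
    fix x i r j assume x: "x \<in> gr ?F i" and r: "r \<in> gr R j"
    have "x k \<otimes> r \<in> gr R (i + j - ds ! k)" if "k < ?n" for k
      using gr_mult[of "x k" "i - ds ! k" r j] x r that by (simp add: free_simps PiE_iff algebra_simps)
    then show "x \<cdot>\<^bsub>?F\<^esub> r \<in> gr ?F (i + j)" by (auto simp: free_simps)
  qed (auto simp: free_simps PiE_iff l_distr r_distr m_assoc extensional_def restrict_def)
  ultimately show ?thesis using graded_ring_axioms by (simp add: graded_module_def)
qed

lemma fbasis_closed: "fbasis R ds k \<in> carrier (free_graded R ds)"
  by (auto simp: fbasis_def free_simps)

lemma fbasis_gr: "k < length ds \<Longrightarrow> fbasis R ds k \<in> gr (free_graded R ds) (ds ! k)"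
  using gr_one gr_zero by (auto simp: fbasis_def free_simps)

lemma free_expand:
  assumes f: "f \<in> carrier (free_graded R ds)"
  shows "f = (\<Oplus>\<^bsub>free_graded R ds\<^esub>k\<in>{..<length ds}. fbasis R ds k \<cdot>\<^bsub>free_graded R ds\<^esub> f k)"
proof -
  let ?F = "free_graded R ds" and ?n = "length ds"
  interpret F: graded_module R ?F by (rule free_graded_module)
  let ?g = "\<lambda>k. fbasis R ds k \<cdot>\<^bsub>?F\<^esub> f k"
  have fc: "f i \<in> carrier R" if "i < ?n" for i using that f by (auto simp: free_simps)
  have gc: "?g \<in> {..<?n} \<rightarrow> carrier ?F" using fc F.ract_closed[OF fbasis_closed] by auto
  show ?thesis
  proof (rule PiE_ext[where k = "{..<?n}" and s = "\<lambda>_. carrier R"])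
    show "f \<in> {..<?n} \<rightarrow>\<^sub>E carrier R" using f by (simp add: free_simps)
    show "finsum ?F ?g {..<?n} \<in> {..<?n} \<rightarrow>\<^sub>E carrier R"
      using F.M.finsum_closed[OF gc] by (simp add: free_simps)
    fix i assume "i \<in> {..<?n}"
    then have i: "i < ?n" by simp
    have "finsum ?F ?g {..<?n} i = finsum R (\<lambda>k. ?g k i) {..<?n}"
      by (rule add_hom_finsum[OF free_eval[OF i] free_abelian_group abelian_group_axioms gc])
    also have "\<dots> = finsum R (\<lambda>k. if i = k then f k else \<zero>) {..<?n}"
      by (rule finsum_cong') (use fc i in \<open>auto simp: free_simps fbasis_def\<close>)
    also have "\<dots> = f i" by (rule finsum_singleton) (use i fc in auto)
    finally show "f i = finsum ?F ?g {..<?n} i" ..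
  qed
qed

lemma free_induct [consumes 1, case_names zero basis add]:
  assumes f: "f \<in> carrier (free_graded R ds)" and "P \<zero>\<^bsub>free_graded R ds\<^esub>"
    and "\<And>k a. \<lbrakk>k < length ds; a \<in> carrier R\<rbrakk> \<Longrightarrow> P (fbasis R ds k \<cdot>\<^bsub>free_graded R ds\<^esub> a)"
    and "\<And>g h. \<lbrakk>g \<in> carrier (free_graded R ds); h \<in> carrier (free_graded R ds); P g; P h\<rbrakk>
      \<Longrightarrow> P (g \<oplus>\<^bsub>free_graded R ds\<^esub> h)"
  shows "P f"
proof -
  let ?F = "free_graded R ds"
  interpret F: graded_module R ?F by (rule free_graded_module)
  let ?g = "\<lambda>k. fbasis R ds k \<cdot>\<^bsub>?F\<^esub> f k"
  have fc: "f i \<in> carrier R" if "i < length ds" for i using that f by (auto simp: free_simps)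
  have gc: "?g k \<in> carrier ?F" if "k < length ds" for k using fc[OF that] F.ract_closed[OF fbasis_closed] by auto
  have "P (finsum ?F ?g K)" if "K \<subseteq> {..<length ds}" for K
    using finite_subset[OF that finite_lessThan] that
  proof (induction K rule: finite_induct)
    case (insert k K)
    then have "?g \<in> K \<rightarrow> carrier ?F" "?g k \<in> carrier ?F" using gc by auto
    then show ?case using insert assms(3)[of k "f k"] fc by (simp add: assms(4) F.M.finsum_closed)
  qed (simp add: assms(2))
  then have "P (finsum ?F ?g {..<length ds})" by blast
  then show ?thesis using free_expand[OF f] by simp
qed

end

section \<open>Homomorphisms out of free modules\<close>

definition free_lift :: "int list \<Rightarrow> ('r, 'm, 'y) graded_scheme \<Rightarrow> (nat \<Rightarrow> 'm) \<Rightarrow> (nat \<Rightarrow> 'r) \<Rightarrow> 'm"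
  where "free_lift ds M y f = (\<Oplus>\<^bsub>M\<^esub>k\<in>{..<length ds}. y k \<cdot>\<^bsub>M\<^esub> f k)"

lemma free_lift_hom:
  assumes M: "graded_module R M" and y: "\<And>k. k < length ds \<Longrightarrow> y k \<in> carrier M"
  shows "mod_hom R (free_graded R ds) M (free_lift ds M y)"
    and "k < length ds \<Longrightarrow> free_lift ds M y (fbasis R ds k) = y k"
proof -
  interpret M: graded_module R M by fact
  have fc: "f i \<in> carrier R" if "f \<in> carrier (free_graded R ds)" "i < length ds" for f i
    using that by (auto simp: free_simps)
  have tc: "(\<lambda>k. y k \<cdot>\<^bsub>M\<^esub> f k) \<in> {..<length ds} \<rightarrow> carrier M" if "f \<in> carrier (free_graded R ds)" for f
    using y fc[OF that] M.ract_closed by auto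
  show "mod_hom R (free_graded R ds) M (free_lift ds M y)"
  proof (rule mod_homI)
    fix f assume f: "f \<in> carrier (free_graded R ds)"
    show "free_lift ds M y f \<in> carrier M" unfolding free_lift_def using tc[OF f] by (rule M.M.finsum_closed)
    show "free_lift ds M y (f \<oplus>\<^bsub>free_graded R ds\<^esub> g) = free_lift ds M y f \<oplus>\<^bsub>M\<^esub> free_lift ds M y g"
      if g: "g \<in> carrier (free_graded R ds)" for g
    proof -
      have "free_lift ds M y (f \<oplus>\<^bsub>free_graded R ds\<^esub> g) =
          (\<Oplus>\<^bsub>M\<^esub>k\<in>{..<length ds}. (y k \<cdot>\<^bsub>M\<^esub> f k) \<oplus>\<^bsub>M\<^esub> (y k \<cdot>\<^bsub>M\<^esub> g k))"
        unfolding free_lift_def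
        by (rule M.M.finsum_cong')
          (use y fc[OF f] fc[OF g] in \<open>auto simp: free_simps M.ract_add_right M.ract_closed\<close>)
      also have "\<dots> = free_lift ds M y f \<oplus>\<^bsub>M\<^esub> free_lift ds M y g"
        unfolding free_lift_def by (rule M.M.finsum_addf[OF tc[OF f] tc[OF g]])
      finally show ?thesis .
    qed
    show "free_lift ds M y (f \<cdot>\<^bsub>free_graded R ds\<^esub> r) = free_lift ds M y f \<cdot>\<^bsub>M\<^esub> r" if r: "r \<in> carrier R" for r
    proof -
      have "free_lift ds M y (f \<cdot>\<^bsub>free_graded R ds\<^esub> r) = (\<Oplus>\<^bsub>M\<^esub>k\<in>{..<length ds}. (y k \<cdot>\<^bsub>M\<^esub> f k) \<cdot>\<^bsub>M\<^esub> r)"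
        unfolding free_lift_def
        by (rule M.M.finsum_cong')
          (use y fc[OF f] r in \<open>auto simp: free_simps M.ract_mult M.ract_closed\<close>)
      also have "\<dots> = free_lift ds M y f \<cdot>\<^bsub>M\<^esub> r"
        unfolding free_lift_def by (rule M.ract_finsum_left[OF r tc[OF f], symmetric])
      finally show ?thesis .
    qed
  qed
  show "free_lift ds M y (fbasis R ds k) = y k" if k: "k < length ds"
  proof -
    have "free_lift ds M y (fbasis R ds k) = (\<Oplus>\<^bsub>M\<^esub>j\<in>{..<length ds}. if k = j then y j else \<zero>\<^bsub>M\<^esub>)"
      unfolding free_lift_def
      by (rule M.M.finsum_cong') (use y in \<open>auto simp: fbasis_def M.ract_one M.ract_zero_right\<close>)
    also have "\<dots> = y k" by (rule M.M.finsum_singleton) (use k y in auto)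
    finally show ?thesis .
  qed
qed

lemma free_hom_eqI:
  assumes M: "graded_module R M" and \<phi>: "mod_hom R (free_graded R ds) M \<phi>"
    and \<psi>: "mod_hom R (free_graded R ds) M \<psi>"
    and eq: "\<And>k. k < length ds \<Longrightarrow> \<phi> (fbasis R ds k) = \<psi> (fbasis R ds k)"
    and f: "f \<in> carrier (free_graded R ds)"
  shows "\<phi> f = \<psi> f"
proof -
  interpret M: graded_module R M by fact
  interpret F: graded_module R "free_graded R ds" by (rule M.R.free_graded_module)
  show ?thesis
    using f
  proof (induction f rule: M.R.free_induct)
    case zero
    then show ?case
      using mod_hom_zero[OF \<phi> F.is_graded_module M] mod_hom_zero[OF \<psi> F.is_graded_module M] by simp
  next
    case (basis k a)
    then show ?case using eq M.R.fbasis_closed by (simp add: mod_hom_ract[OF \<phi>] mod_hom_ract[OF \<psi>])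
  next
    case (add g h)
    then show ?case by (simp add: mod_hom_add[OF \<phi>] mod_hom_add[OF \<psi>])
  qed
qed

subsection \<open>Generated submodules\<close>

lemma submodule_gen_least:
  assumes "additive_subgroup N M" "\<And>x r. \<lbrakk>x \<in> N; r \<in> carrier R\<rbrakk> \<Longrightarrow> x \<cdot>\<^bsub>M\<^esub> r \<in> N" "S \<subseteq> N"
  shows "submodule_gen R M S \<subseteq> N"
  using assms unfolding submodule_gen_def by blast

lemma submodule_gen_props:
  assumes M: "graded_module R M" and S: "S \<subseteq> carrier M"
  shows "additive_subgroup (submodule_gen R M S) M"
    and "\<And>x r. \<lbrakk>x \<in> submodule_gen R M S; r \<in> carrier R\<rbrakk> \<Longrightarrow> x \<cdot>\<^bsub>M\<^esub> r \<in> submodule_gen R M S"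
    and "S \<subseteq> submodule_gen R M S" and "submodule_gen R M S \<subseteq> carrier M"
proof -
  interpret M: graded_module R M by fact
  have car: "additive_subgroup (carrier M) M"
    by (rule additive_subgroup.intro, rule M.M.add.subgroupI) auto
  show sub: "submodule_gen R M S \<subseteq> carrier M"
    by (rule submodule_gen_least[OF car]) (use S M.ract_closed in auto)
  show "S \<subseteq> submodule_gen R M S" by (auto simp: submodule_gen_def)
  show "x \<cdot>\<^bsub>M\<^esub> r \<in> submodule_gen R M S" if "x \<in> submodule_gen R M S" "r \<in> carrier R" for x r
    using that by (auto simp: submodule_gen_def)
  show "additive_subgroup (submodule_gen R M S) M"
  proof (rule additive_subgroup.intro, rule M.M.add.subgroupI)
    show "submodule_gen R M S \<subseteq> carrier M" by (rule sub)
    have "\<zero>\<^bsub>M\<^esub> \<in> submodule_gen R M S"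
      by (auto simp: submodule_gen_def additive_subgroup.zero_closed)
    then show "submodule_gen R M S \<noteq> {}" by blast
    fix x assume x: "x \<in> submodule_gen R M S"
    then show "\<ominus>\<^bsub>M\<^esub> x \<in> submodule_gen R M S"
      by (auto simp: submodule_gen_def additive_subgroup.a_inv_closed)
    fix y assume "y \<in> submodule_gen R M S"
    then show "x \<oplus>\<^bsub>M\<^esub> y \<in> submodule_gen R M S"
      using x by (auto simp: submodule_gen_def additive_subgroup.a_closed)
  qed
qed

text \<open>Together with \<open>submodule_gen_least\<close> this reduces the equality of two linear
  maps on a generated submodule to an equality on generators.\<close>

lemma equaliser_subgroup:
  assumes "add_hom M N \<phi>" "add_hom M N \<psi>" "abelian_group M" "abelian_group N"
  shows "additive_subgroup {x \<in> carrier M. \<phi> x = \<psi> x} M"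
proof -
  interpret M: abelian_group M by fact
  have "\<zero>\<^bsub>M\<^esub> \<in> {x \<in> carrier M. \<phi> x = \<psi> x}"
    using add_hom_zero[OF assms(1,3,4)] add_hom_zero[OF assms(2,3,4)] by simp
  then show ?thesis
    by (intro additive_subgroup.intro M.add.subgroupI)
      (auto simp: add_hom_add[OF assms(1)] add_hom_add[OF assms(2)] add_hom_neg[OF assms(1,3,4)]
        add_hom_neg[OF assms(2,3,4)])
qed

lemma kernel_graded_submodule:
  assumes M: "graded_module R M" and N: "graded_module R N" and \<phi>: "\<phi> \<in> graded_hom R M N"
  shows "graded_submodule R M {f \<in> carrier M. \<phi> f = \<zero>\<^bsub>N\<^esub>}"
proof -
  interpret M: graded_module R M by fact
  interpret N: graded_module R N by fact
  note h = graded_hom_mod_hom[OF \<phi>]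
  show ?thesis
    by (rule graded_submoduleI[OF M])
      (auto simp: mod_hom_zero[OF h M N] mod_hom_add[OF h] mod_hom_neg[OF h M N] mod_hom_ract[OF h]
        M.ract_closed N.ract_zero_left N.M.neg_zero M.M.gcomp_closed gcomp_graded_hom[OF M N \<phi>, symmetric]
        N.M.gcomp_zero)
qed

text \<open>
  The definition of coherence only speaks about modules whose elements are sets; here the free
  module is replaced by the isomorphic module of singletons.
\<close>

lemma coherent_free:
  fixes R :: "('k, 'r) graded"
  assumes R: "graded_ring R" and coh: "coherent R"
    and U: "graded_submodule R (free_graded R ds) U" and fg: "fin_gen R (free_graded R ds) U"
  shows "\<exists>ds' \<psi>. \<psi> \<in> graded_hom R (free_graded R ds') (free_graded R ds) \<and>
    \<psi> ` carrier (free_graded R ds') = U \<and>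
    fin_gen R (free_graded R ds') {f \<in> carrier (free_graded R ds'). \<psi> f = \<zero>\<^bsub>free_graded R ds\<^esub>}"
proof -
  interpret R: graded_ring R by fact
  let ?F = "free_graded R ds"
  interpret F: graded_module R ?F by (rule R.free_graded_module)
  define w where "w = (\<lambda>x :: nat \<Rightarrow> 'r. {x})"
  have winj: "w x = w y \<longleftrightarrow> x = y" for x y by (simp add: w_def)
  define P :: "('r, (nat \<Rightarrow> 'r) set) graded" where "P = \<lparr>carrier = w ` carrier ?F, mult = undefined,
    one = undefined, zero = w \<zero>\<^bsub>?F\<^esub>, add = (\<lambda>x y. w (the_elem x \<oplus>\<^bsub>?F\<^esub> the_elem y)),
    smult = (\<lambda>r x. w (the_elem x \<cdot>\<^bsub>?F\<^esub> r)), gr = (\<lambda>i. w ` gr ?F i)\<rparr>"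
  have P: "carrier P = w ` carrier ?F" "\<zero>\<^bsub>P\<^esub> = w \<zero>\<^bsub>?F\<^esub>" "gr P i = w ` gr ?F i"
    "w x \<oplus>\<^bsub>P\<^esub> w y = w (x \<oplus>\<^bsub>?F\<^esub> y)" "w x \<cdot>\<^bsub>P\<^esub> r = w (x \<cdot>\<^bsub>?F\<^esub> r)" for x y r i
    by (simp_all add: P_def w_def)
  have Pm: "graded_module R P"
    by (rule graded_module_iso[OF F.is_graded_module, of w]) (auto simp: P inj_on_def winj)
  interpret P: graded_module R P by (rule Pm)
  have wh: "w \<in> graded_hom R ?F P"
    by (auto simp: graded_hom_iff P intro!: mod_homI)
  note wm = graded_hom_mod_hom[OF wh]
  \<comment> \<open>\<open>w\<close> is an isomorphism from a free module, so the module of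
    relations is zero and is generated by the empty set.\<close>
  have "finitely_presented R P"
    unfolding finitely_presented_def
  proof (intro conjI Pm exI bexI)
    show "w ` carrier ?F = carrier P" by (simp add: P)
    have zsub: "additive_subgroup {\<zero>\<^bsub>?F\<^esub>} ?F"
      by (rule additive_subgroup.intro, rule F.M.add.subgroupI) (auto simp: F.M.neg_zero)
    have "submodule_gen R ?F {} = {\<zero>\<^bsub>?F\<^esub>}"
    proof
      show "submodule_gen R ?F {} \<subseteq> {\<zero>\<^bsub>?F\<^esub>}"
        by (rule submodule_gen_least[OF zsub]) (auto simp: F.ract_zero_left)
      show "{\<zero>\<^bsub>?F\<^esub>} \<subseteq> submodule_gen R ?F {}"
        using additive_subgroup.zero_closed[OF submodule_gen_props(1)[OF F.is_graded_module, of "{}"]] by simp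
    qed
    moreover have "{f \<in> carrier ?F. w f = \<zero>\<^bsub>P\<^esub>} = {\<zero>\<^bsub>?F\<^esub>}" by (auto simp: P winj)
    ultimately show "fin_gen R ?F {f \<in> carrier ?F. w f = \<zero>\<^bsub>P\<^esub>}"
      by (auto simp: fin_gen_def intro!: exI[of _ "{}"])
  qed (rule wh)
  moreover have "graded_submodule R P (w ` U)"
  proof -
    note Ud = graded_submoduleD[OF F.is_graded_module U]
    have Uc: "x \<in> carrier ?F" if "x \<in> U" for x using that Ud(1) by blast
    show ?thesis
      by (rule graded_submoduleI[OF Pm])
        (auto simp: P Ud Uc mod_hom_neg[OF wm F.is_graded_module Pm, symmetric]
          gcomp_graded_hom[OF F.is_graded_module Pm wh] intro: imageI)
  qed
  moreover have "fin_gen R P (w ` U)"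
  proof -
    obtain S where S: "finite S" "S \<subseteq> U" "submodule_gen R ?F S = U" using fg by (auto simp: fin_gen_def)
    have Sc: "S \<subseteq> carrier ?F" using S U by (auto simp: graded_submodule_def)
    note Up = submodule_gen_props[OF F.is_graded_module Sc, unfolded S(3)]
    have "submodule_gen R P (w ` S) = w ` U"
    proof
      have "additive_subgroup (w ` U) P"
      proof (rule additive_subgroup.intro, rule P.M.add.subgroupI)
        show "w ` U \<subseteq> carrier P" using Up(4) by (auto simp: P)
        show "w ` U \<noteq> {}" using additive_subgroup.zero_closed[OF Up(1)] by blast
        fix x assume "x \<in> w ` U"
        then obtain u where u: "u \<in> U" "x = w u" by blast
        then show "\<ominus>\<^bsub>P\<^esub> x \<in> w ` U"
          using mod_hom_neg[OF wm F.is_graded_module Pm, of u] Up(4) additive_subgroup.a_inv_closed[OF Up(1)] by force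
        fix y assume "y \<in> w ` U"
        then show "x \<oplus>\<^bsub>P\<^esub> y \<in> w ` U" using u additive_subgroup.a_closed[OF Up(1)] by (auto simp: P)
      qed
      then show "submodule_gen R P (w ` S) \<subseteq> w ` U"
        by (rule submodule_gen_least) (use Up S in \<open>auto simp: P\<close>)
      have wSc: "w ` S \<subseteq> carrier P" using Sc by (auto simp: P)
      note Gp = submodule_gen_props[OF Pm wSc]
      have "additive_subgroup {x \<in> carrier ?F. w x \<in> submodule_gen R P (w ` S)} ?F"
      proof (rule additive_subgroup.intro, rule F.M.add.subgroupI)
        have "\<zero>\<^bsub>?F\<^esub> \<in> {x \<in> carrier ?F. w x \<in> submodule_gen R P (w ` S)}"
          using additive_subgroup.zero_closed[OF Gp(1)] by (simp add: P)
        then show "{x \<in> carrier ?F. w x \<in> submodule_gen R P (w ` S)} \<noteq> {}" by blast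
      qed (use additive_subgroup.a_inv_closed[OF Gp(1)] additive_subgroup.a_closed[OF Gp(1)]
          in \<open>auto simp: mod_hom_neg[OF wm F.is_graded_module Pm] mod_hom_add[OF wm]\<close>)
      then have "submodule_gen R ?F S \<subseteq> {x \<in> carrier ?F. w x \<in> submodule_gen R P (w ` S)}"
        by (rule submodule_gen_least) (use Gp Sc in \<open>auto simp: mod_hom_ract[OF wm] F.ract_closed\<close>)
      then show "w ` U \<subseteq> submodule_gen R P (w ` S)" using S(3) by blast
    qed
    then show ?thesis using S by (auto simp: fin_gen_def intro!: exI[of _ "w ` S"])
  qed
  ultimately have "finitely_presented R (restr P (w ` U))" using coh by (auto simp: coherent_def)
  then obtain ds' \<phi> where \<phi>: "\<phi> \<in> graded_hom R (free_graded R ds') (restr P (w ` U))"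
    and im: "\<phi> ` carrier (free_graded R ds') = w ` U"
    and ker: "fin_gen R (free_graded R ds') {f \<in> carrier (free_graded R ds'). \<phi> f = w \<zero>\<^bsub>?F\<^esub>}"
    by (auto simp: finitely_presented_def P)
  define \<psi> where "\<psi> f = the_elem (\<phi> f)" for f
  have \<psi>: "\<phi> f = w (\<psi> f) \<and> \<psi> f \<in> U" if "f \<in> carrier (free_graded R ds')" for f
  proof -
    have "\<phi> f \<in> w ` U" using imageI[OF that, of \<phi>] unfolding im .
    then obtain u where "u \<in> U" "\<phi> f = w u" by blast
    then show ?thesis by (simp add: \<psi>_def w_def)
  qed
  note h = graded_hom_mod_hom[OF \<phi>]
  interpret F': graded_module R "free_graded R ds'" by (rule R.free_graded_module)
  have Uc: "u \<in> carrier ?F" if "u \<in> U" for u using that U by (auto simp: graded_submodule_def)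
  have "\<psi> \<in> graded_hom R (free_graded R ds') ?F"
    unfolding graded_hom_iff
  proof (intro conjI allI ballI)
    show "mod_hom R (free_graded R ds') ?F \<psi>"
    proof (rule mod_homI)
      fix f assume f: "f \<in> carrier (free_graded R ds')"
      show "\<psi> f \<in> carrier ?F" using \<psi>[OF f] Uc by blast
      show "\<psi> (f \<oplus>\<^bsub>free_graded R ds'\<^esub> g) = \<psi> f \<oplus>\<^bsub>?F\<^esub> \<psi> g" if g: "g \<in> carrier (free_graded R ds')" for g
        using mod_hom_add[OF h f g] \<psi>[OF f] \<psi>[OF g] \<psi>[OF F'.M.a_closed[OF f g]] by (simp add: P winj)
      show "\<psi> (f \<cdot>\<^bsub>free_graded R ds'\<^esub> r) = \<psi> f \<cdot>\<^bsub>?F\<^esub> r" if r: "r \<in> carrier R" for r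
        using mod_hom_ract[OF h f r] \<psi>[OF f] \<psi>[OF F'.ract_closed[OF f r]] by (simp add: P winj)
    qed
    fix i f assume f: "f \<in> gr (free_graded R ds') i"
    then have "\<phi> f \<in> w ` gr ?F i" using graded_hom_gr[OF \<phi> f] by (simp add: P)
    then show "\<psi> f \<in> gr ?F i" by (auto simp: \<psi>_def w_def)
  qed
  moreover have "\<psi> ` carrier (free_graded R ds') = U"
  proof -
    have "(\<lambda>f. w (\<psi> f)) ` carrier (free_graded R ds') = w ` U"
      unfolding im[symmetric] by (rule image_cong[OF refl]) (rule \<psi>[THEN conjunct1, symmetric])
    then have "w ` (\<psi> ` carrier (free_graded R ds')) = w ` U" by (simp only: image_image)
    moreover have "inj w" by (simp add: inj_on_def winj)
    ultimately show ?thesis by (simp only: inj_image_eq_iff)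
  qed
  moreover have "{f \<in> carrier (free_graded R ds'). \<phi> f = w \<zero>\<^bsub>?F\<^esub>} =
      {f \<in> carrier (free_graded R ds'). \<psi> f = \<zero>\<^bsub>?F\<^esub>}"
  proof (rule Collect_cong, rule conj_cong[OF refl])
    fix f assume "f \<in> carrier (free_graded R ds')"
    then show "\<phi> f = w \<zero>\<^bsub>?F\<^esub> \<longleftrightarrow> \<psi> f = \<zero>\<^bsub>?F\<^esub>" using \<psi>[THEN conjunct1] winj by metis
  qed
  ultimately show ?thesis using ker by auto
qed

section \<open>Graded ideals\<close>

lemma (in graded_ring) gcomp_mult_left:
  assumes "a \<in> gr R k" "x \<in> carrier R"
  shows "gcomp R (a \<otimes> x) (i + k) = a \<otimes> gcomp R x i"
proof (rule gcomp_shift[OF graded_group_axioms graded_group_axioms])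
  show "add_hom R R ((\<otimes>) a)" using gr_carrier[OF assms(1)] by (simp add: add_hom_def r_distr)
  show "a \<otimes> y \<in> gr R (j + k)" if "y \<in> gr R j" for y j
    using gr_mult[OF assms(1) that] by (simp add: add.commute)
qed (rule assms)

lemma (in graded_ring) gcomp_mult_right:
  assumes "a \<in> gr R k" "x \<in> carrier R"
  shows "gcomp R (x \<otimes> a) (i + k) = gcomp R x i \<otimes> a"
proof (rule gcomp_shift[OF graded_group_axioms graded_group_axioms])
  show "add_hom R R (\<lambda>y. y \<otimes> a)" using gr_carrier[OF assms(1)] by (simp add: add_hom_def l_distr)
  show "y \<otimes> a \<in> gr R (j + k)" if "y \<in> gr R j" for y j
    using gr_mult[OF that assms(1)] .
qed (rule assms)

lemma ideal_sub: "ideal I R \<Longrightarrow> additive_subgroup I R"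
  by (simp add: ideal_def)

context graded_ring
begin

text \<open>Ideals are two-sided and closed under inhomogeneous multipliers. The multiplier is split
  into homogeneous parts, each of which only shifts the components of \<open>a\<close>.\<close>

lemma gcomp_mult_in:
  assumes I: "ideal I R" and comp: "\<And>i. gcomp R a i \<in> I" and a: "a \<in> carrier R" and x: "x \<in> carrier R"
  shows "gcomp R (x \<otimes> a) i \<in> I" "gcomp R (a \<otimes> x) i \<in> I"
proof -
  interpret I: ideal I R by fact
  show "gcomp R (x \<otimes> a) i \<in> I"
    using x
  proof (induction x rule: graded_induct)
    case (homogeneous k x)
    have "gcomp R (x \<otimes> a) ((i - k) + k) = x \<otimes> gcomp R a (i - k)" by (rule gcomp_mult_left[OF homogeneous a])
    then show ?case using I.I_l_closed[OF comp gr_carrier[OF homogeneous]] by simp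
  next
    case (add x y)
    then show ?case using a by (simp add: l_distr gcomp_add)
  qed
  show "gcomp R (a \<otimes> x) i \<in> I"
    using x
  proof (induction x rule: graded_induct)
    case (homogeneous k x)
    have "gcomp R (a \<otimes> x) ((i - k) + k) = gcomp R a (i - k) \<otimes> x" by (rule gcomp_mult_right[OF homogeneous a])
    then show ?case using I.I_r_closed[OF comp gr_carrier[OF homogeneous]] by simp
  next
    case (add x y)
    then show ?case using a by (simp add: r_distr gcomp_add)
  qed
qed

lemma ideal_of_closed:
  assumes "additive_subgroup I R"
    and "\<And>a x. \<lbrakk>a \<in> I; x \<in> carrier R\<rbrakk> \<Longrightarrow> x \<otimes> a \<in> I" "\<And>a x. \<lbrakk>a \<in> I; x \<in> carrier R\<rbrakk> \<Longrightarrow> a \<otimes> x \<in> I"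
  shows "ideal I R"
  by (rule idealI[OF ring_axioms additive_subgroup.a_subgroup[OF assms(1)]]) (use assms in auto)

text \<open>Forwards, the elements all of whose components lie in \<open>I\<close> form an ideal,
  and it contains the homogeneous generators. Backwards, an ideal that contains the components of
  its elements is generated by its homogeneous elements.\<close>

lemma graded_ideal_iff:
  "graded_ideal R I \<longleftrightarrow> ideal I R \<and> (\<forall>a\<in>I. \<forall>i. gcomp R a i \<in> I)"
proof
  assume "graded_ideal R I"
  then obtain T where T: "T \<subseteq> homogeneous R" "I = Idl T" by (auto simp: graded_ideal_def)
  have Tc: "T \<subseteq> carrier R" using T gr_carrier by (auto simp: homogeneous_def)
  have I: "ideal I R" unfolding T by (rule genideal_ideal[OF Tc])
  interpret I: ideal I R by (rule I)
  let ?D = "{a \<in> carrier R. \<forall>i. gcomp R a i \<in> I}"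
  have "ideal ?D R"
  proof (rule ideal_of_closed)
    show "additive_subgroup ?D R"
    proof (rule additive_subgroup.intro, rule add.subgroupI)
      have "\<zero> \<in> ?D" by (simp add: gcomp_zero)
      then show "?D \<noteq> {}" by blast
      fix a assume a: "a \<in> ?D"
      have hom: "add_hom R R (\<lambda>x. gcomp R x i)" for i by (simp add: add_hom_def gcomp_closed gcomp_add)
      have "gcomp R (\<ominus> a) i = \<ominus> gcomp R a i" for i
        using add_hom_neg[OF hom[of i] abelian_group_axioms abelian_group_axioms] a by simp
      then show "\<ominus> a \<in> ?D" using a by simp
    qed (auto simp: gcomp_add)
  qed (use gcomp_mult_in[OF I] in auto)
  moreover have "T \<subseteq> ?D"
  proof
    fix t assume t: "t \<in> T"
    then obtain k where k: "t \<in> gr R k" using T by (auto simp: homogeneous_def)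
    have "t \<in> I" unfolding T using genideal_self[OF Tc] t by blast
    then show "t \<in> ?D" using gr_carrier[OF k] by (auto simp: gcomp_homogeneous[OF k])
  qed
  ultimately have "Idl T \<subseteq> ?D" by (rule genideal_minimal)
  then show "ideal I R \<and> (\<forall>a\<in>I. \<forall>i. gcomp R a i \<in> I)" using I T by blast
next
  assume I: "ideal I R \<and> (\<forall>a\<in>I. \<forall>i. gcomp R a i \<in> I)"
  then interpret I: ideal I R by blast
  let ?T = "I \<inter> homogeneous R"
  have Tc: "?T \<subseteq> carrier R" using I.a_subset by blast
  have id: "ideal (Idl ?T) R" by (rule genideal_ideal[OF Tc])
  have "Idl ?T = I"
  proof
    show "Idl ?T \<subseteq> I" by (rule genideal_minimal[OF I.is_ideal]) blast
    show "I \<subseteq> Idl ?T"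
    proof
      fix a assume a: "a \<in> I"
      then have ac: "a \<in> carrier R" using I.a_subset by blast
      have "gcomp R a i \<in> Idl ?T" for i
        using I a gcomp_props(1)[OF ac] genideal_self[OF Tc] by (auto simp: homogeneous_def)
      then have "finsum R (gcomp R a) {i. gcomp R a i \<noteq> \<zero>} \<in> Idl ?T"
        by (intro additive_subgroup_finsum[OF abelian_group_axioms ideal_sub[OF id]]) auto
      then show "a \<in> Idl ?T" using gcomp_props(3)[OF ac] by simp
    qed
  qed
  then show "graded_ideal R I" by (auto simp: graded_ideal_def)
qed

section \<open>Graded maximal ideals: existence and primeness\<close>

lemma ideal_proper_iff: "ideal I R \<Longrightarrow> I \<noteq> carrier R \<longleftrightarrow> \<one> \<notin> I"
  using ideal.one_imp_carrier[of I R] by auto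

text \<open>By Zorn's lemma. Properness means that \<open>\<one>\<close> is missing; this survives
  unions of chains, and so does closure under components.\<close>

lemma graded_maximal_exists:
  assumes J: "graded_ideal R J" "J \<noteq> carrier R"
  shows "\<exists>m. graded_maximal R m \<and> J \<subseteq> m"
proof -
  let ?A = "{I. graded_ideal R I \<and> \<one> \<notin> I \<and> J \<subseteq> I}"
  have idl: "ideal I R" if "graded_ideal R I" for I using that graded_ideal_iff by blast
  have "\<exists>m\<in>?A. \<forall>I\<in>?A. m \<subseteq> I \<longrightarrow> I = m"
  proof (rule subset_Zorn_nonempty)
    show "?A \<noteq> {}" using J ideal_proper_iff idl by blast
    fix C assume C: "C \<noteq> {}" "subset.chain ?A C"
    have CA: "I \<in> C \<Longrightarrow> graded_ideal R I \<and> \<one> \<notin> I \<and> J \<subseteq> I" for I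
      using C(2) by (auto simp: subset.chain_def)
    have Ci: "I \<in> C \<Longrightarrow> ideal I R" for I using CA idl by blast
    have lin: "I \<in> C \<Longrightarrow> I' \<in> C \<Longrightarrow> I \<subseteq> I' \<or> I' \<subseteq> I" for I I'
      using C(2) by (auto simp: subset_chain_def)
    have "ideal (\<Union>C) R"
    proof (rule ideal_of_closed)
      show "additive_subgroup (\<Union>C) R"
      proof (rule additive_subgroup.intro, rule add.subgroupI)
        show "\<Union>C \<subseteq> carrier R"
          using additive_subgroup.a_subset[OF ideal_sub[OF Ci]] by blast
        obtain I where "I \<in> C" using C(1) by blast
        then show "\<Union>C \<noteq> {}" using additive_subgroup.zero_closed[OF ideal_sub[OF Ci]] by blast
        fix a assume "a \<in> \<Union>C"
        then obtain I where I: "I \<in> C" "a \<in> I" by blast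
        then show "\<ominus> a \<in> \<Union>C" using additive_subgroup.a_inv_closed[OF ideal_sub[OF Ci]] by blast
        fix b assume "b \<in> \<Union>C"
        then obtain I' where I': "I' \<in> C" "b \<in> I'" by blast
        from lin[OF I(1) I'(1)] obtain K where "K \<in> C" "a \<in> K" "b \<in> K" using I I' by blast
        then show "a \<oplus> b \<in> \<Union>C" using additive_subgroup.a_closed[OF ideal_sub[OF Ci]] by blast
      qed
    qed (use ideal.I_l_closed[OF Ci] ideal.I_r_closed[OF Ci] in blast)+
    moreover have "\<forall>a\<in>\<Union>C. \<forall>i. gcomp R a i \<in> \<Union>C" using CA graded_ideal_iff by blast
    ultimately have "graded_ideal R (\<Union>C)" using graded_ideal_iff by blast
    then show "\<Union>C \<in> ?A" using CA C(1) by blast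
  qed
  then obtain m where mA: "m \<in> ?A" and mmax: "\<forall>I\<in>?A. m \<subseteq> I \<longrightarrow> I = m" by (rule bexE)
  from mA have m: "graded_ideal R m" "\<one> \<notin> m" "J \<subseteq> m" by simp_all
  have max: "I = m" if "graded_ideal R I" "\<one> \<notin> I" "J \<subseteq> I" "m \<subseteq> I" for I
    using mmax that by simp
  have "graded_maximal R m"
    unfolding graded_maximal_def
  proof (intro conjI allI impI)
    show "m \<noteq> carrier R" using m(2) by auto
    fix I assume I: "graded_ideal R I \<and> I \<noteq> carrier R \<and> m \<subseteq> I"
    then have "\<one> \<notin> I" using ideal_proper_iff[OF idl] by blast
    then show "I = m" using I m(3) by (intro max) auto
  qed (rule m)
  then show ?thesis using m(3) by blast
qed

text \<open>\<open>y\<close> arises from \<open>x\<close> by changing the signs of some components.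
  It follows that the right ideal generated by a homogeneous element is two-sided.\<close>

lemma homogeneous_commute:
  assumes gc: "graded_commutative R" and a: "a \<in> gr R k" and x: "x \<in> carrier R"
  shows "\<exists>y\<in>carrier R. x \<otimes> a = a \<otimes> y"
  using x
proof (induction x rule: graded_induct)
  case (homogeneous i x)
  have "x \<otimes> a = koszul R (i * k) (a \<otimes> x)"
    using gc[unfolded graded_commutative_def, rule_format, OF homogeneous a] .
  then show ?case
    using gr_carrier[OF a] gr_carrier[OF homogeneous]
    by (intro bexI[of _ "koszul R (i * k) x"]) (auto simp: koszul_def r_minus)
next
  case (add x y)
  then obtain u v where "u \<in> carrier R" "x \<otimes> a = a \<otimes> u" "v \<in> carrier R" "y \<otimes> a = a \<otimes> v" by blast
  then show ?case using add.hyps gr_carrier[OF a] by (intro bexI[of _ "u \<oplus> v"]) (auto simp: l_distr r_distr)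
qed

text \<open>The set \<open>m + a R\<close> is a graded ideal because \<open>a\<close> is
  homogeneous, see \<open>homogeneous_commute\<close>. It is strictly larger than \<open>m\<close>,
  so it contains \<open>\<one>\<close>.\<close>

lemma graded_maximal_inverse:
  assumes gc: "graded_commutative R" and m: "graded_maximal R m" and a: "a \<in> gr R i" "a \<notin> m"
  shows "\<exists>r\<in>carrier R. \<one> \<ominus> a \<otimes> r \<in> m"
proof -
  have mg: "graded_ideal R m" using m by (simp add: graded_maximal_def)
  then have mi: "ideal m R" and mc: "\<And>x i. x \<in> m \<Longrightarrow> gcomp R x i \<in> m" by (auto simp: graded_ideal_iff)
  interpret m: ideal m R by (rule mi)
  have ac: "a \<in> carrier R" using a gr_carrier by blast
  let ?J = "{x. \<exists>p\<in>m. \<exists>r\<in>carrier R. x = p \<oplus> a \<otimes> r}"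
  have "ideal ?J R"
  proof (rule ideal_of_closed)
    show "additive_subgroup ?J R"
    proof (rule additive_subgroup.intro, rule add.subgroupI)
      show "?J \<subseteq> carrier R" using ac m.Icarr by auto
      show "?J \<noteq> {}" using m.zero_closed by blast
      fix x assume "x \<in> ?J"
      then obtain p r where x: "p \<in> m" "r \<in> carrier R" "x = p \<oplus> a \<otimes> r" by blast
      have "\<ominus> x = \<ominus> p \<oplus> a \<otimes> (\<ominus> r)" using x ac m.Icarr by (simp add: minus_add r_minus)
      then show "\<ominus> x \<in> ?J" using x m.a_inv_closed by blast
      fix y assume "y \<in> ?J"
      then obtain p' r' where y: "p' \<in> m" "r' \<in> carrier R" "y = p' \<oplus> a \<otimes> r'" by blast
      have "x \<oplus> y = (p \<oplus> p') \<oplus> a \<otimes> (r \<oplus> r')" using x y ac m.Icarr by (simp add: r_distr a_ac)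
      then show "x \<oplus> y \<in> ?J" using x y m.a_closed by blast
    qed
    fix x s assume "x \<in> ?J" and s: "s \<in> carrier R"
    then obtain p r where x: "p \<in> m" "r \<in> carrier R" "x = p \<oplus> a \<otimes> r" by blast
    have "x \<otimes> s = p \<otimes> s \<oplus> a \<otimes> (r \<otimes> s)" using x s ac m.Icarr by (simp add: l_distr m_assoc)
    then show "x \<otimes> s \<in> ?J" using m.I_r_closed[OF x(1) s] x s by blast
    obtain s' where s': "s' \<in> carrier R" "s \<otimes> a = a \<otimes> s'" using homogeneous_commute[OF gc a(1) s] by blast
    have "s \<otimes> x = s \<otimes> p \<oplus> (s \<otimes> a) \<otimes> r" using x s ac m.Icarr by (simp add: r_distr m_assoc)
    also have "\<dots> = s \<otimes> p \<oplus> a \<otimes> (s' \<otimes> r)" using x s' ac by (simp add: m_assoc)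
    finally show "s \<otimes> x \<in> ?J" using m.I_l_closed[OF x(1) s] x s' by blast
  qed
  moreover have "\<forall>x\<in>?J. \<forall>k. gcomp R x k \<in> ?J"
  proof (intro ballI allI)
    fix x k assume "x \<in> ?J"
    then obtain p r where x: "p \<in> m" "r \<in> carrier R" "x = p \<oplus> a \<otimes> r" by blast
    have "gcomp R x k = gcomp R p k \<oplus> a \<otimes> gcomp R r (k - i)"
      using gcomp_mult_left[OF a(1) x(2), of "k - i"] x ac m.Icarr by (simp add: gcomp_add)
    then show "gcomp R x k \<in> ?J" using mc[OF x(1)] gcomp_closed[OF x(2)] by blast
  qed
  ultimately have "graded_ideal R ?J" by (simp add: graded_ideal_iff)
  moreover have "m \<subseteq> ?J"
  proof
    fix p assume "p \<in> m"
    moreover have "p = p \<oplus> a \<otimes> \<zero>" using ac m.Icarr[OF \<open>p \<in> m\<close>] by simp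
    ultimately show "p \<in> ?J" by blast
  qed
  moreover have "a \<in> ?J"
  proof -
    have "a = \<zero> \<oplus> a \<otimes> \<one>" using ac by simp
    then show ?thesis using m.zero_closed by blast
  qed
  ultimately have "?J = carrier R" using m a(2) unfolding graded_maximal_def by blast
  then have "\<one> \<in> ?J" by simp
  then obtain p r where p: "p \<in> m" "r \<in> carrier R" "\<one> = p \<oplus> a \<otimes> r" by blast
  have "\<one> \<ominus> a \<otimes> r = p"
    unfolding p(3) by (rule minus_add_cancel(2)) (use p ac m.Icarr in auto)
  then show ?thesis using p(1,2) by (intro bexI[of _ r]) simp_all
qed

text \<open>Write \<open>b = (1 - a r) b + a r b\<close> with \<open>1 - a r\<close> in
  \<open>m\<close>. Moving \<open>r\<close> past the homogeneous element \<open>b\<close> turns the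
  last summand into a multiple of \<open>a b\<close>.\<close>

lemma graded_maximal_homogeneous_prime:
  assumes gc: "graded_commutative R" and m: "graded_maximal R m"
    and a: "a \<in> gr R i" and b: "b \<in> gr R j" and ab: "a \<otimes> b \<in> m" and am: "a \<notin> m"
  shows "b \<in> m"
proof -
  have "ideal m R" using m by (simp add: graded_maximal_def graded_ideal_iff)
  then interpret m: ideal m R .
  have c: "a \<in> carrier R" "b \<in> carrier R" using a b gr_carrier by auto
  obtain r where r: "r \<in> carrier R" "\<one> \<ominus> a \<otimes> r \<in> m" using graded_maximal_inverse[OF gc m a am] by blast
  obtain r' where r': "r' \<in> carrier R" "r \<otimes> b = b \<otimes> r'" using homogeneous_commute[OF gc b r(1)] by blast
  have "(\<one> \<ominus> a \<otimes> r) \<otimes> b \<oplus> (a \<otimes> b) \<otimes> r' = b"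
  proof -
    have "(\<one> \<ominus> a \<otimes> r) \<otimes> b = b \<ominus> a \<otimes> (r \<otimes> b)" using c r by (simp add: a_minus_def l_distr l_minus m_assoc)
    also have "a \<otimes> (r \<otimes> b) = (a \<otimes> b) \<otimes> r'" using c r r' by (simp add: m_assoc)
    finally show ?thesis using c r' by (simp add: minus_add_cancel(1))
  qed
  then show ?thesis using m.a_closed[OF m.I_r_closed[OF r(2) c(2)] m.I_r_closed[OF ab r'(1)]] by simp
qed

text \<open>Primeness is demanded of inhomogeneous elements as well. The argument is that of leading
  coefficients, with components counted modulo \<open>m\<close>: the product of the leading
  components would be a component of \<open>a b\<close> modulo \<open>m\<close>.\<close>

lemma graded_maximal_prime:
  assumes gc: "graded_commutative R" and m: "graded_maximal R m"
  shows "graded_prime R m"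
  unfolding graded_prime_def
proof (intro conjI ballI impI)
  show "graded_ideal R m" "m \<noteq> carrier R" using m by (auto simp: graded_maximal_def)
  then have mi: "ideal m R" and mc: "\<And>x i. x \<in> m \<Longrightarrow> gcomp R x i \<in> m" by (auto simp: graded_ideal_iff)
  interpret m: ideal m R by (rule mi)
  fix a b assume a: "a \<in> carrier R" and b: "b \<in> carrier R" and ab: "a \<otimes> b \<in> m"
  show "a \<in> m \<or> b \<in> m"
  proof (rule ccontr)
    assume n: "\<not> (a \<in> m \<or> b \<in> m)"
    have ex: "finite {i. gcomp R x i \<notin> m} \<and> {i. gcomp R x i \<notin> m} \<noteq> {}"
      if x: "x \<in> carrier R" "x \<notin> m" for x
    proof
      have "{i. gcomp R x i \<notin> m} \<subseteq> {i. gcomp R x i \<noteq> \<zero>}" using m.zero_closed by auto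
      then show "finite {i. gcomp R x i \<notin> m}" using gcomp_props(2)[OF x(1)] finite_subset by blast
      show "{i. gcomp R x i \<notin> m} \<noteq> {}"
      proof
        assume "{i. gcomp R x i \<notin> m} = {}"
        then have "finsum R (gcomp R x) {i. gcomp R x i \<noteq> \<zero>} \<in> m"
          by (intro additive_subgroup_finsum[OF abelian_group_axioms ideal_sub[OF mi]]) auto
        then show False using gcomp_props(3)[OF x(1)] x(2) by simp
      qed
    qed
    have top: "gcomp R x (Max {i. gcomp R x i \<notin> m}) \<notin> m"
        "\<And>i. i > Max {i. gcomp R x i \<notin> m} \<Longrightarrow> gcomp R x i \<in> m"
      if x: "x \<in> carrier R" "x \<notin> m" for x
    proof -
      note e = ex[OF x]
      show "gcomp R x (Max {i. gcomp R x i \<notin> m}) \<notin> m"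
        using Max_in[OF e[THEN conjunct1] e[THEN conjunct2]] by simp
      show "gcomp R x i \<in> m" if "i > Max {i. gcomp R x i \<notin> m}" for i
        using Max_ge[OF e[THEN conjunct1], of i] that by (cases "gcomp R x i \<in> m") auto
    qed
    \<comment> \<open>The highest degree whose component is not in \<open>m\<close>. Nonzero
      components of higher degree may exist, but they lie in \<open>m\<close>.\<close>
    define i0 where "i0 = Max {i. gcomp R a i \<notin> m}"
    define j0 where "j0 = Max {i. gcomp R b i \<notin> m}"
    have i0: "gcomp R a i0 \<notin> m" "\<And>i. i > i0 \<Longrightarrow> gcomp R a i \<in> m"
      using top[OF a] n unfolding i0_def by blast+
    have j0: "gcomp R b j0 \<notin> m" "\<And>i. i > j0 \<Longrightarrow> gcomp R b i \<in> m"
      using top[OF b] n unfolding j0_def by blast+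
    let ?n = "i0 + j0" and ?F = "{i. gcomp R a i \<noteq> \<zero>}"
    have i0F: "i0 \<in> ?F" using i0(1) m.zero_closed by auto
    have F: "finite ?F" by (rule gcomp_props(2)[OF a])
    note ac = gcomp_closed[OF a] and bc = gcomp_closed[OF b]
    have hom: "add_hom R R (\<lambda>x. gcomp R (x \<otimes> b) ?n)"
      using b by (simp add: add_hom_def l_distr gcomp_add gcomp_closed)
    have "gcomp R (a \<otimes> b) ?n = (\<Oplus>i\<in>?F. gcomp R (gcomp R a i \<otimes> b) ?n)"
      using add_hom_finsum[OF hom abelian_group_axioms abelian_group_axioms, of "gcomp R a" ?F]
        gcomp_props(3)[OF a] ac by auto
    also have "\<dots> = (\<Oplus>i\<in>?F. gcomp R a i \<otimes> gcomp R b (?n - i))"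
    proof (rule finsum_cong')
      fix i
      show "gcomp R (gcomp R a i \<otimes> b) ?n = gcomp R a i \<otimes> gcomp R b (?n - i)"
        using gcomp_mult_left[OF gcomp_props(1)[OF a, of i] b, of "?n - i"] by simp
    qed (use ac bc in auto)
    also have "\<dots> = (\<Oplus>i\<in>insert i0 (?F - {i0}). gcomp R a i \<otimes> gcomp R b (?n - i))"
      using i0F by (simp add: insert_absorb)
    also have "\<dots> = gcomp R a i0 \<otimes> gcomp R b j0 \<oplus> (\<Oplus>i\<in>?F - {i0}. gcomp R a i \<otimes> gcomp R b (?n - i))"
      using F ac bc by (subst finsum_insert) auto
    finally have eq: "gcomp R (a \<otimes> b) ?n =
      gcomp R a i0 \<otimes> gcomp R b j0 \<oplus> (\<Oplus>i\<in>?F - {i0}. gcomp R a i \<otimes> gcomp R b (?n - i))" .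
    \<comment> \<open>For \<open>i\<close> different from \<open>i0\<close>, either \<open>i\<close>
      exceeds \<open>i0\<close> or the complementary degree exceeds \<open>j0\<close>; one of the
      factors is in \<open>m\<close>.\<close>
    have rest: "(\<Oplus>i\<in>?F - {i0}. gcomp R a i \<otimes> gcomp R b (?n - i)) \<in> m"
    proof (rule additive_subgroup_finsum[OF abelian_group_axioms ideal_sub[OF mi]], rule funcsetI)
      fix i assume "i \<in> ?F - {i0}"
      then have "i > i0 \<or> ?n - i > j0" by auto
      then show "gcomp R a i \<otimes> gcomp R b (?n - i) \<in> m"
        using i0(2) j0(2) m.I_l_closed m.I_r_closed ac bc by blast
    qed
    have "gcomp R a i0 \<otimes> gcomp R b j0 =
        gcomp R (a \<otimes> b) ?n \<ominus> (\<Oplus>i\<in>?F - {i0}. gcomp R a i \<otimes> gcomp R b (?n - i))"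
      unfolding eq using m.Icarr[OF rest] ac bc by (simp add: minus_add_cancel(2))
    also have "\<dots> \<in> m" using mc[OF ab] rest m.a_closed m.a_inv_closed by (simp add: a_minus_def)
    finally have "gcomp R b j0 \<in> m"
      using graded_maximal_homogeneous_prime[OF gc m gcomp_props(1)[OF a] gcomp_props(1)[OF b]] i0(1) by blast
    then show False using j0(1) by blast
  qed
qed

lemma prime_mult_set:
  assumes gc: "graded_commutative R" and p: "graded_prime R p"
  shows "\<one> \<in> even_denoms R p"
    and "\<lbrakk>s \<in> even_denoms R p; t \<in> even_denoms R p\<rbrakk> \<Longrightarrow> s \<otimes> t \<in> even_denoms R p"
    and "s \<in> even_denoms R p \<Longrightarrow> \<exists>l. even l \<and> s \<in> gr R l"
proof -
  have "ideal p R" using p by (simp add: graded_prime_def graded_ideal_iff)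
  then have "\<one> \<notin> p" using p ideal_proper_iff by (auto simp: graded_prime_def)
  moreover have "\<one> \<in> (\<Union>i\<in>{i. even i}. gr R i)" by (rule UN_I[of 0]) (use gr_one in auto)
  ultimately show "\<one> \<in> even_denoms R p" by (simp add: even_denoms_def)
  show "s \<otimes> t \<in> even_denoms R p" if s: "s \<in> even_denoms R p" and t: "t \<in> even_denoms R p"
  proof -
    obtain i j where h: "even i" "s \<in> gr R i" "s \<notin> p" "even j" "t \<in> gr R j" "t \<notin> p"
      using s t by (auto simp: even_denoms_def)
    then have "s \<otimes> t \<in> gr R (i + j)" "even (i + j)" using gr_mult by auto
    moreover have "s \<otimes> t \<notin> p"
      using p h gr_carrier[OF h(2)] gr_carrier[OF h(5)] unfolding graded_prime_def by blast
    ultimately show ?thesis unfolding even_denoms_def by blast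
  qed
  show "\<exists>l. even l \<and> s \<in> gr R l" if "s \<in> even_denoms R p"
    using that by (auto simp: even_denoms_def)
qed

end

lemma prime_localised:
  assumes R: "graded_ring R" and gc: "graded_commutative R" and p: "graded_prime R p" and M: "graded_module R M"
  shows "localised R p M"
proof -
  interpret R: graded_ring R by fact
  have "mult_set R (even_denoms R p)"
    by (intro mult_set.intro mult_set_axioms.intro R.graded_ring_axioms gc R.prime_mult_set[OF gc p])
  then show ?thesis using M by (intro localised.intro fractions.intro)
qed

section \<open>Local-global principle for retractions\<close>

context localised
begin

lemma common_denominator:
  assumes "finite K" "\<And>k. k \<in> K \<Longrightarrow> \<xi> k \<in> carrier L"
  shows "\<exists>s\<in>S. \<forall>k\<in>K. \<exists>x\<in>carrier M. \<xi> k = fraction M S x s"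
  using assms
proof (induction K rule: finite_induct)
  case empty
  then show ?case using S_one by blast
next
  case (insert k K)
  then obtain s where s: "s \<in> S" "\<forall>k\<in>K. \<exists>x\<in>carrier M. \<xi> k = fraction M S x s" by auto
  obtain y t where y: "y \<in> carrier M" "t \<in> S" "\<xi> k = fraction M S y t"
    using insert(4)[of k] by (auto simp: loc_carrier)
  have *: "fraction M S x u = fraction M S (x \<cdot>\<^bsub>M\<^esub> v) (u \<otimes>\<^bsub>R\<^esub> v)" if "x \<in> carrier M" "u \<in> S" "v \<in> S" for x u v
    by (rule frac_eqI[where u = "\<one>\<^bsub>R\<^esub>"])
      (use that S_one S_mult in \<open>simp_all add: act_S act_ST swap_S\<close>)
  have "s \<otimes>\<^bsub>R\<^esub> t = t \<otimes>\<^bsub>R\<^esub> s" using S_central[OF s(1) S_carrier[OF y(2)]] .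
  then have "\<xi> k = fraction M S (y \<cdot>\<^bsub>M\<^esub> s) (s \<otimes>\<^bsub>R\<^esub> t)" using *[OF y(1,2) s(1)] y(3) by simp
  moreover have "\<exists>x\<in>carrier M. \<xi> j = fraction M S x (s \<otimes>\<^bsub>R\<^esub> t)" if j: "j \<in> K" for j
  proof -
    obtain x where "x \<in> carrier M" "\<xi> j = fraction M S x s" using s(2) j by blast
    then show ?thesis using *[of x s t] s(1) y(2) act_S by auto
  qed
  ultimately have "\<forall>j\<in>insert k K. \<exists>x\<in>carrier M. \<xi> j = fraction M S x (s \<otimes>\<^bsub>R\<^esub> t)"
    using act_S[OF y(1) s(1)] by auto
  then show ?case using S_mult[OF s(1) y(2)] by blast
qed

lemma common_annihilator:
  assumes "finite K" "\<And>k. k \<in> K \<Longrightarrow> x k \<in> carrier M \<and> y k \<in> carrier M"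
    and "\<And>k. k \<in> K \<Longrightarrow> \<exists>u\<in>S. x k \<cdot>\<^bsub>M\<^esub> u = y k \<cdot>\<^bsub>M\<^esub> u"
  shows "\<exists>u\<in>S. \<forall>k\<in>K. x k \<cdot>\<^bsub>M\<^esub> u = y k \<cdot>\<^bsub>M\<^esub> u"
  using assms
proof (induction K rule: finite_induct)
  case empty
  then show ?case using S_one by blast
next
  case (insert k K)
  then obtain u where u: "u \<in> S" "\<forall>k\<in>K. x k \<cdot>\<^bsub>M\<^esub> u = y k \<cdot>\<^bsub>M\<^esub> u" by auto
  obtain v where v: "v \<in> S" "x k \<cdot>\<^bsub>M\<^esub> v = y k \<cdot>\<^bsub>M\<^esub> v" using insert(5)[of k] by auto
  have "x j \<cdot>\<^bsub>M\<^esub> (u \<otimes>\<^bsub>R\<^esub> v) = y j \<cdot>\<^bsub>M\<^esub> (u \<otimes>\<^bsub>R\<^esub> v)" if j: "j \<in> insert k K" for j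
  proof (cases "j = k")
    case True
    have "x k \<in> carrier M" "y k \<in> carrier M" using insert(4)[of k] by auto
    then show ?thesis
      unfolding True act_ST[OF \<open>x k \<in> carrier M\<close> u(1) v(1)] act_ST[OF \<open>y k \<in> carrier M\<close> u(1) v(1)]
      using swap_S[of "x k" u v] swap_S[of "y k" u v] u(1) v by simp
  next
    case False
    then have "x j \<in> carrier M" "y j \<in> carrier M" "x j \<cdot>\<^bsub>M\<^esub> u = y j \<cdot>\<^bsub>M\<^esub> u"
      using j insert(4)[of j] u(2) by auto
    then show ?thesis using act_ST u(1) v(1) by simp
  qed
  then show ?case using S_mult[OF u(1) v(1)] by blast
qed

end

text \<open>
  The set of those \<open>c\<close> for which \<open>\<gamma> \<cdot> c\<close> can be corrected along \<open>\<iota>\<close> contains an element outside each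
  graded maximal ideal, hence contains \<open>\<one>\<close>.
\<close>

lemma local_global_retraction:
  fixes R :: "('k, 'r) graded" and X :: "('r, 'x) graded" and Y :: "('r, 'y) graded"
  assumes gc: "graded_commutative R" and X: "graded_module R X" and Y: "graded_module R Y"
    and i: "i \<in> graded_hom R X Y" and inj: "inj_on i (carrier X)"
    and \<gamma>: "mod_hom R (free_graded R ds) Y \<gamma>"
    and gen: "\<And>y. y \<in> carrier Y \<Longrightarrow> \<exists>x\<in>carrier X. \<exists>r\<in>carrier (free_graded R ds). y = i x \<oplus>\<^bsub>Y\<^esub> \<gamma> r"
    and fg: "fin_gen R (free_graded R ds) {r \<in> carrier (free_graded R ds). \<gamma> r \<in> i ` carrier X}"
    and loc: "\<And>m. graded_maximal R m \<Longrightarrow> \<exists>\<rho>. mod_hom R Y (localisation R m X) \<rho> \<and>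
      (\<forall>x\<in>carrier X. \<rho> (i x) = fraction X (even_denoms R m) x \<one>\<^bsub>R\<^esub>)"
  shows "\<exists>\<rho>. mod_hom R Y X \<rho> \<and> (\<forall>x\<in>carrier X. \<rho> (i x) = x)"
proof -
  interpret X: graded_module R X by fact
  interpret Y: graded_module R Y by fact
  let ?F = "free_graded R ds"
  have Fm: "graded_module R ?F" by (rule X.R.free_graded_module)
  interpret F: graded_module R ?F by (rule Fm)
  note ih = graded_hom_mod_hom[OF i]
  note ic = mod_hom_closed[OF ih] and gc' = mod_hom_closed[OF \<gamma>]
  \<comment> \<open>\<open>Y\<close> is generated by the images of \<open>X\<close> and
    \<open>?F\<close>, and \<open>Lr\<close> records the overlap. A retraction of \<open>i\<close>
    amounts to a linear \<open>g\<close> on \<open>?F\<close> with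
    \<open>i (g r) = \<gamma> r\<close> on \<open>Lr\<close>; \<open>solv c\<close> asks for the
    same with \<open>\<gamma>\<close> multiplied by \<open>c\<close>.\<close>
  define Lr where "Lr = {r \<in> carrier ?F. \<gamma> r \<in> i ` carrier X}"
  define solv where "solv c \<longleftrightarrow> c \<in> carrier R \<and>
    (\<exists>g. mod_hom R ?F X g \<and> (\<forall>r\<in>Lr. i (g r) = \<gamma> r \<cdot>\<^bsub>Y\<^esub> c))" for c
  have Lc: "r \<in> carrier ?F" if "r \<in> Lr" for r using that by (simp add: Lr_def)
  \<comment> \<open>Elements of even degree are central, so acting by them is linear.\<close>
  have act_hom: "mod_hom R M N (\<lambda>r. g r \<cdot>\<^bsub>N\<^esub> c)"
    if g: "mod_hom R M N g" and N: "graded_module R N" and c: "c \<in> gr R k" "even k"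
    for M :: "('r, 'm) graded" and N :: "('r, 'n) graded" and g c k
  proof -
    interpret N: graded_module R N by (rule N)
    have cc: "c \<in> carrier R" using c X.R.gr_carrier by blast
    have sw: "(x \<cdot>\<^bsub>N\<^esub> r) \<cdot>\<^bsub>N\<^esub> c = (x \<cdot>\<^bsub>N\<^esub> c) \<cdot>\<^bsub>N\<^esub> r" if "x \<in> carrier N" "r \<in> carrier R" for x r
      using that cc X.R.even_central[OF gc c that(2)] N.ract_mult by metis
    show ?thesis
      by (rule mod_homI)
        (use mod_hom_closed[OF g] cc sw in \<open>simp_all add: mod_hom_add[OF g] mod_hom_ract[OF g]
          N.ract_closed N.ract_add_left\<close>)
  qed
  have solv_add: "solv (c \<oplus>\<^bsub>R\<^esub> d)" if "solv c" "solv d" for c d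
  proof -
    obtain g h where g: "mod_hom R ?F X g" "\<forall>r\<in>Lr. i (g r) = \<gamma> r \<cdot>\<^bsub>Y\<^esub> c" "c \<in> carrier R"
      and h: "mod_hom R ?F X h" "\<forall>r\<in>Lr. i (h r) = \<gamma> r \<cdot>\<^bsub>Y\<^esub> d" "d \<in> carrier R"
      using \<open>solv c\<close> \<open>solv d\<close> by (auto simp: solv_def)
    note gcl = mod_hom_closed[OF g(1)] and hcl = mod_hom_closed[OF h(1)]
    have "mod_hom R ?F X (\<lambda>r. g r \<oplus>\<^bsub>X\<^esub> h r)"
      by (rule mod_homI)
        (simp_all add: gcl hcl mod_hom_add[OF g(1)] mod_hom_add[OF h(1)] mod_hom_ract[OF g(1)]
          mod_hom_ract[OF h(1)] X.ract_add_left X.M.a_ac)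
    moreover have "\<forall>r\<in>Lr. i (g r \<oplus>\<^bsub>X\<^esub> h r) = \<gamma> r \<cdot>\<^bsub>Y\<^esub> (c \<oplus>\<^bsub>R\<^esub> d)"
      using g(2,3) h(2,3) Lc by (simp add: mod_hom_add[OF ih] gcl hcl Y.ract_add_right gc')
    ultimately show ?thesis using g(3) h(3) by (auto simp: solv_def)
  qed
  have solv_mult: "solv (s \<otimes>\<^bsub>R\<^esub> a)" if s: "solv s" and a: "a \<in> gr R k" "even k" for s a k
  proof -
    obtain g where g: "mod_hom R ?F X g" "\<forall>r\<in>Lr. i (g r) = \<gamma> r \<cdot>\<^bsub>Y\<^esub> s" "s \<in> carrier R"
      using s by (auto simp: solv_def)
    have ac: "a \<in> carrier R" using a X.R.gr_carrier by blast
    have "\<forall>r\<in>Lr. i (g r \<cdot>\<^bsub>X\<^esub> a) = \<gamma> r \<cdot>\<^bsub>Y\<^esub> (s \<otimes>\<^bsub>R\<^esub> a)"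
      using g(2,3) ac Lc mod_hom_closed[OF g(1)] by (simp add: mod_hom_ract[OF ih] Y.ract_mult gc')
    then show ?thesis
      using act_hom[OF g(1) X a] g(3) ac unfolding solv_def by blast
  qed
  have zero_hom: "mod_hom R ?F X (\<lambda>r. \<zero>\<^bsub>X\<^esub>)"
    by (rule mod_homI) (simp_all add: X.ract_zero_left)
  have solv_zero: "solv \<zero>\<^bsub>R\<^esub>"
    unfolding solv_def using zero_hom Lc
    by (auto simp: Y.ract_zero_right gc' mod_hom_zero[OF ih X Y])
  have solv_neg: "solv (\<ominus>\<^bsub>R\<^esub> c)" if "solv c" for c
  proof -
    have c: "c \<in> carrier R" using that by (simp add: solv_def)
    have "\<ominus>\<^bsub>R\<^esub> \<one>\<^bsub>R\<^esub> \<in> gr R 0" by (rule X.R.gr_neg[OF X.R.gr_one])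
    then have "solv (c \<otimes>\<^bsub>R\<^esub> (\<ominus>\<^bsub>R\<^esub> \<one>\<^bsub>R\<^esub>))" using solv_mult[OF that] by simp
    then show ?thesis using c by (simp add: X.R.r_minus)
  qed
  define T where "T = {s \<in> (\<Union>k\<in>{k. even k}. gr R k). solv s}"
  have Tc: "T \<subseteq> carrier R" using X.R.gr_carrier by (auto simp: T_def)
  \<comment> \<open>\<open>solv\<close> is preserved only by multipliers of even degree, while the
    ideal generated by \<open>T\<close> involves all of them. Quantifying over \<open>a\<close> and
    \<open>b\<close> makes \<open>E\<close> a two-sided ideal. It contains \<open>T\<close>: for
    \<open>s\<close> of even degree \<open>k\<close>, the component of degree zero of a multiple of
    \<open>s\<close> is \<open>s\<close> times a component of degree \<open>- k\<close>, which is
    again even. For \<open>r = \<one>\<close> and \<open>a = b = \<one>\<close> the condition says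
    that \<open>\<one>\<close> is solvable.\<close>
  define E where "E = {r \<in> carrier R. \<forall>a\<in>carrier R. \<forall>b\<in>carrier R. solv (gcomp R ((a \<otimes>\<^bsub>R\<^esub> r) \<otimes>\<^bsub>R\<^esub> b) 0)}"
  have "ideal E R"
  proof (rule X.R.ideal_of_closed)
    show "additive_subgroup E R"
    proof (rule additive_subgroup.intro, rule X.R.add.subgroupI)
      show "E \<subseteq> carrier R" by (auto simp: E_def)
      have "\<zero>\<^bsub>R\<^esub> \<in> E" by (auto simp: E_def X.R.gcomp_zero solv_zero)
      then show "E \<noteq> {}" by blast
      fix r assume r: "r \<in> E"
      then have rc: "r \<in> carrier R" by (simp add: E_def)
      have hom: "add_hom R R (\<lambda>x. gcomp R x 0)" by (simp add: add_hom_def X.R.gcomp_closed X.R.gcomp_add)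
      have "gcomp R ((a \<otimes>\<^bsub>R\<^esub> (\<ominus>\<^bsub>R\<^esub> r)) \<otimes>\<^bsub>R\<^esub> b) 0 = \<ominus>\<^bsub>R\<^esub> gcomp R ((a \<otimes>\<^bsub>R\<^esub> r) \<otimes>\<^bsub>R\<^esub> b) 0"
        if "a \<in> carrier R" "b \<in> carrier R" for a b
        using that rc add_hom_neg[OF hom X.R.abelian_group_axioms X.R.abelian_group_axioms, of "(a \<otimes>\<^bsub>R\<^esub> r) \<otimes>\<^bsub>R\<^esub> b"]
        by (simp add: X.R.r_minus X.R.l_minus)
      then show "\<ominus>\<^bsub>R\<^esub> r \<in> E" using r solv_neg by (simp add: E_def)
      fix t assume "t \<in> E"
      then show "r \<oplus>\<^bsub>R\<^esub> t \<in> E"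
        using r solv_add by (simp add: E_def X.R.r_distr X.R.l_distr X.R.gcomp_add)
    qed
    fix r x assume r: "r \<in> E" and x: "x \<in> carrier R"
    then have rc: "r \<in> carrier R" by (simp add: E_def)
    have "solv (gcomp R ((a \<otimes>\<^bsub>R\<^esub> (x \<otimes>\<^bsub>R\<^esub> r)) \<otimes>\<^bsub>R\<^esub> b) 0)"
      "solv (gcomp R ((a \<otimes>\<^bsub>R\<^esub> (r \<otimes>\<^bsub>R\<^esub> x)) \<otimes>\<^bsub>R\<^esub> b) 0)" if "a \<in> carrier R" "b \<in> carrier R" for a b
    proof -
      have E: "solv (gcomp R ((c \<otimes>\<^bsub>R\<^esub> r) \<otimes>\<^bsub>R\<^esub> d) 0)" if "c \<in> carrier R" "d \<in> carrier R" for c d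
        using r that by (simp add: E_def)
      show "solv (gcomp R ((a \<otimes>\<^bsub>R\<^esub> (x \<otimes>\<^bsub>R\<^esub> r)) \<otimes>\<^bsub>R\<^esub> b) 0)"
        using E[of "a \<otimes>\<^bsub>R\<^esub> x" b] that x rc by (simp add: X.R.m_assoc)
      show "solv (gcomp R ((a \<otimes>\<^bsub>R\<^esub> (r \<otimes>\<^bsub>R\<^esub> x)) \<otimes>\<^bsub>R\<^esub> b) 0)"
        using E[of a "x \<otimes>\<^bsub>R\<^esub> b"] that x rc by (simp add: X.R.m_assoc)
    qed
    then show "x \<otimes>\<^bsub>R\<^esub> r \<in> E" "r \<otimes>\<^bsub>R\<^esub> x \<in> E" using rc x by (auto simp: E_def)
  qed
  moreover have "T \<subseteq> E"
  proof
    fix s assume "s \<in> T"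
    then obtain k where s: "s \<in> gr R k" "even k" "solv s" by (auto simp: T_def)
    have sc: "s \<in> carrier R" using s X.R.gr_carrier by blast
    have "solv (gcomp R ((a \<otimes>\<^bsub>R\<^esub> s) \<otimes>\<^bsub>R\<^esub> b) 0)" if ab: "a \<in> carrier R" "b \<in> carrier R" for a b
    proof -
      have "(a \<otimes>\<^bsub>R\<^esub> s) \<otimes>\<^bsub>R\<^esub> b = s \<otimes>\<^bsub>R\<^esub> (a \<otimes>\<^bsub>R\<^esub> b)"
        using ab sc X.R.even_central[OF gc s(1,2) ab(1)] by (simp add: X.R.m_assoc[symmetric])
      moreover have "gcomp R (s \<otimes>\<^bsub>R\<^esub> (a \<otimes>\<^bsub>R\<^esub> b)) (- k + k) = s \<otimes>\<^bsub>R\<^esub> gcomp R (a \<otimes>\<^bsub>R\<^esub> b) (- k)"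
        by (rule X.R.gcomp_mult_left[OF s(1)]) (use ab in simp)
      ultimately show ?thesis
        using solv_mult[OF s(3) X.R.gcomp_props(1)[of "a \<otimes>\<^bsub>R\<^esub> b" "- k"]] ab s(2) by simp
    qed
    then show "s \<in> E" using sc by (simp add: E_def)
  qed
  ultimately have TE: "Idl\<^bsub>R\<^esub> T \<subseteq> E" by (rule X.R.genideal_minimal)
  \<comment> \<open>On the basis of \<open>?F\<close> the map \<open>\<rho> \<gamma>\<close> is
    given by fractions with a common denominator \<open>s\<close>, and the numerators define
    \<open>g\<close>. On \<open>Lr\<close> the fractions \<open>g r / s\<close> and
    \<open>x r / 1\<close> agree, where \<open>i (x r) = \<gamma> r\<close>. For the finitely many
    generators of \<open>Lr\<close> a single \<open>u\<close> turns this into equations in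
    \<open>X\<close>, so that \<open>c = s u\<close> is solved by the product of \<open>g\<close>
    with \<open>u\<close>.\<close>
  have loc_solv: "\<exists>s\<in>even_denoms R m. solv s" if m: "graded_maximal R m" for m
  proof -
    interpret L: localised R m X
      by (rule prime_localised[OF X.R.graded_ring_axioms gc X.R.graded_maximal_prime[OF gc m] X])
    let ?S = "even_denoms R m"
    obtain \<rho> where \<rho>: "mod_hom R Y L.L \<rho>" "\<forall>x\<in>carrier X. \<rho> (i x) = fraction X ?S x \<one>\<^bsub>R\<^esub>"
      using loc[OF m] by blast
    have "\<exists>s\<in>?S. \<forall>k\<in>{..<length ds}. \<exists>x\<in>carrier X. \<rho> (\<gamma> (fbasis R ds k)) = fraction X ?S x s"
      by (rule L.common_denominator) (use mod_hom_closed[OF \<rho>(1)] gc' X.R.fbasis_closed in auto)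
    then obtain s y where s: "s \<in> ?S" and y: "\<And>k. k < length ds \<Longrightarrow> y k \<in> carrier X"
        "\<And>k. k < length ds \<Longrightarrow> \<rho> (\<gamma> (fbasis R ds k)) = fraction X ?S (y k) s"
      by (metis lessThan_iff)
    define g where "g = free_lift ds X y"
    have g: "mod_hom R ?F X g" and gb: "\<And>k. k < length ds \<Longrightarrow> g (fbasis R ds k) = y k"
      unfolding g_def using free_lift_hom[OF X] y(1) by blast+
    note gcl = mod_hom_closed[OF g]
    have \<rho>g: "\<rho> (\<gamma> r) = fraction X ?S (g r) s" if "r \<in> carrier ?F" for r
      using that
    proof (induction r rule: X.R.free_induct)
      case zero
      have "\<rho> (\<gamma> \<zero>\<^bsub>?F\<^esub>) = \<rho> (i \<zero>\<^bsub>X\<^esub>)"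
        using mod_hom_zero[OF \<gamma> Fm Y] mod_hom_zero[OF ih X Y] by simp
      also have "\<dots> = fraction X ?S \<zero>\<^bsub>X\<^esub> \<one>\<^bsub>R\<^esub>" using \<rho>(2) by simp
      also have "\<dots> = fraction X ?S \<zero>\<^bsub>X\<^esub> s"
        by (rule L.frac_eqI[OF _ _ _ _ L.S_one]) (use s L.S_one L.S_carrier in \<open>simp_all add: X.ract_zero_left\<close>)
      finally show ?case using mod_hom_zero[OF g Fm X] by simp
    next
      case (basis k a)
      then show ?case
        using y s gb X.R.fbasis_closed gc'
        by (simp add: mod_hom_ract[OF \<gamma>] mod_hom_ract[OF \<rho>(1)] mod_hom_ract[OF g] L.loc_act)
    next
      case (add p q)
      have "fraction X ?S ((g p \<cdot>\<^bsub>X\<^esub> s) \<oplus>\<^bsub>X\<^esub> (g q \<cdot>\<^bsub>X\<^esub> s)) (s \<otimes>\<^bsub>R\<^esub> s) = fraction X ?S (g p \<oplus>\<^bsub>X\<^esub> g q) s"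
        by (rule L.frac_eqI[OF _ _ _ _ L.S_one])
          (use add.hyps s gcl L.S_one L.S_mult in \<open>simp_all add: L.act_S L.act_add[symmetric] L.act_ST\<close>)
      then show ?case
        using add gcl s gc' by (simp add: mod_hom_add[OF \<gamma>] mod_hom_add[OF \<rho>(1)] mod_hom_add[OF g] L.loc_add)
    qed
    obtain K where K: "finite K" "K \<subseteq> Lr" "submodule_gen R ?F K = Lr"
      using fg by (auto simp: fin_gen_def Lr_def)
    have "\<exists>x. x \<in> carrier X \<and> \<gamma> r = i x" if "r \<in> Lr" for r using that by (auto simp: Lr_def)
    then obtain x where x: "\<And>r. r \<in> Lr \<Longrightarrow> x r \<in> carrier X \<and> \<gamma> r = i (x r)" by metis
    have "\<exists>u\<in>?S. \<forall>r\<in>K. g r \<cdot>\<^bsub>X\<^esub> u = (x r \<cdot>\<^bsub>X\<^esub> s) \<cdot>\<^bsub>X\<^esub> u"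
    proof (rule L.common_annihilator[OF K(1)])
      fix r assume "r \<in> K"
      then have r: "r \<in> Lr" "r \<in> carrier ?F" using K Lc by auto
      show "g r \<in> carrier X \<and> x r \<cdot>\<^bsub>X\<^esub> s \<in> carrier X" using gcl[OF r(2)] x[OF r(1)] s L.act_S by blast
      have "fraction X ?S (g r) s = fraction X ?S (x r) \<one>\<^bsub>R\<^esub>"
        using \<rho>g[OF r(2)] \<rho>(2) x[OF r(1)] by simp
      then show "\<exists>u\<in>?S. g r \<cdot>\<^bsub>X\<^esub> u = (x r \<cdot>\<^bsub>X\<^esub> s) \<cdot>\<^bsub>X\<^esub> u"
        using L.frac_eqD x[OF r(1)] L.S_one gcl[OF r(2)] by (metis X.ract_one)
    qed
    then obtain u where u: "u \<in> ?S" "\<forall>r\<in>K. g r \<cdot>\<^bsub>X\<^esub> u = (x r \<cdot>\<^bsub>X\<^esub> s) \<cdot>\<^bsub>X\<^esub> u" by blast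
    define c where "c = s \<otimes>\<^bsub>R\<^esub> u"
    have c: "c \<in> ?S" "c \<in> carrier R" using s u(1) L.S_mult L.S_carrier by (auto simp: c_def)
    obtain k l where kl: "u \<in> gr R k" "even k" "c \<in> gr R l" "even l"
      using L.S_even[OF u(1)] L.S_even[OF c(1)] by blast
    have h1: "mod_hom R ?F Y (\<lambda>r. i (g r \<cdot>\<^bsub>X\<^esub> u))" by (rule mod_hom_comp[OF act_hom[OF g X kl(1,2)] ih])
    have h2: "mod_hom R ?F Y (\<lambda>r. \<gamma> r \<cdot>\<^bsub>Y\<^esub> c)" by (rule act_hom[OF \<gamma> Y kl(3,4)])
    have "submodule_gen R ?F K \<subseteq> {r \<in> carrier ?F. i (g r \<cdot>\<^bsub>X\<^esub> u) = \<gamma> r \<cdot>\<^bsub>Y\<^esub> c}"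
    proof (rule submodule_gen_least)
      show "additive_subgroup {r \<in> carrier ?F. i (g r \<cdot>\<^bsub>X\<^esub> u) = \<gamma> r \<cdot>\<^bsub>Y\<^esub> c} ?F"
        by (rule equaliser_subgroup[OF mod_hom_add_hom[OF h1] mod_hom_add_hom[OF h2]
            F.M.abelian_group_axioms Y.M.abelian_group_axioms])
      show "r \<cdot>\<^bsub>?F\<^esub> a \<in> {r \<in> carrier ?F. i (g r \<cdot>\<^bsub>X\<^esub> u) = \<gamma> r \<cdot>\<^bsub>Y\<^esub> c}"
        if "r \<in> {r \<in> carrier ?F. i (g r \<cdot>\<^bsub>X\<^esub> u) = \<gamma> r \<cdot>\<^bsub>Y\<^esub> c}" "a \<in> carrier R" for r a
        using that mod_hom_ract[OF h1] mod_hom_ract[OF h2] F.ract_closed by simp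
      show "K \<subseteq> {r \<in> carrier ?F. i (g r \<cdot>\<^bsub>X\<^esub> u) = \<gamma> r \<cdot>\<^bsub>Y\<^esub> c}"
      proof
        fix r assume rK: "r \<in> K"
        then have r: "r \<in> Lr" "r \<in> carrier ?F" using K Lc by auto
        have "i (g r \<cdot>\<^bsub>X\<^esub> u) = i ((x r \<cdot>\<^bsub>X\<^esub> s) \<cdot>\<^bsub>X\<^esub> u)" using u(2) rK by simp
        also have "\<dots> = i (x r) \<cdot>\<^bsub>Y\<^esub> c"
          using x[OF r(1)] s u(1) L.S_carrier ic
          by (simp add: c_def mod_hom_ract[OF ih] X.ract_closed Y.ract_mult)
        finally show "r \<in> {r \<in> carrier ?F. i (g r \<cdot>\<^bsub>X\<^esub> u) = \<gamma> r \<cdot>\<^bsub>Y\<^esub> c}"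
          using x[OF r(1)] r(2) by simp
      qed
    qed
    then have "\<forall>r\<in>Lr. i (g r \<cdot>\<^bsub>X\<^esub> u) = \<gamma> r \<cdot>\<^bsub>Y\<^esub> c" using K(3) by blast
    then have "solv c" using act_hom[OF g X kl(1,2)] c(2) unfolding solv_def by blast
    then show ?thesis using c(1) by blast
  qed
  have "Idl\<^bsub>R\<^esub> T = carrier R"
  proof (rule ccontr)
    assume "Idl\<^bsub>R\<^esub> T \<noteq> carrier R"
    moreover have "graded_ideal R (Idl\<^bsub>R\<^esub> T)"
      unfolding graded_ideal_def homogeneous_def by (rule exI[of _ T]) (auto simp: T_def)
    ultimately obtain m where m: "graded_maximal R m" "Idl\<^bsub>R\<^esub> T \<subseteq> m"
      using X.R.graded_maximal_exists by blast
    obtain s where "s \<in> even_denoms R m" "solv s" using loc_solv[OF m(1)] by blast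
    then have "s \<in> T" "s \<notin> m" by (auto simp: T_def even_denoms_def)
    then show False using m(2) X.R.genideal_self[OF Tc] by blast
  qed
  then have "\<one>\<^bsub>R\<^esub> \<in> E" using TE by blast
  then have "solv (gcomp R ((\<one>\<^bsub>R\<^esub> \<otimes>\<^bsub>R\<^esub> \<one>\<^bsub>R\<^esub>) \<otimes>\<^bsub>R\<^esub> \<one>\<^bsub>R\<^esub>) 0)"
    unfolding E_def using X.R.one_closed by blast
  then have "solv \<one>\<^bsub>R\<^esub>" using X.R.gcomp_homogeneous[OF X.R.gr_one, of 0] by simp
  then obtain g where g: "mod_hom R ?F X g" and g1: "\<And>r. r \<in> Lr \<Longrightarrow> i (g r) = \<gamma> r"
    using gc' Lc by (auto simp: solv_def Y.ract_one)
  note gcl = mod_hom_closed[OF g]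
  \<comment> \<open>Two presentations of the same \<open>y\<close> differ by an element of
    \<open>Lr\<close>. There \<open>i g = \<gamma>\<close>, and \<open>i\<close> is injective, so
    the value does not depend on the presentation.\<close>
  define \<rho> where "\<rho> y = (SOME z. \<exists>x\<in>carrier X. \<exists>r\<in>carrier ?F. y = i x \<oplus>\<^bsub>Y\<^esub> \<gamma> r \<and> z = x \<oplus>\<^bsub>X\<^esub> g r)" for y
  have \<rho>: "\<rho> (i x \<oplus>\<^bsub>Y\<^esub> \<gamma> r) = x \<oplus>\<^bsub>X\<^esub> g r" if x: "x \<in> carrier X" and r: "r \<in> carrier ?F" for x r
    unfolding \<rho>_def
  proof (rule some_equality)
    show "\<exists>x'\<in>carrier X. \<exists>r'\<in>carrier ?F. i x \<oplus>\<^bsub>Y\<^esub> \<gamma> r = i x' \<oplus>\<^bsub>Y\<^esub> \<gamma> r' \<and> x \<oplus>\<^bsub>X\<^esub> g r = x' \<oplus>\<^bsub>X\<^esub> g r'"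
      using x r by blast
    fix z assume "\<exists>x'\<in>carrier X. \<exists>r'\<in>carrier ?F. i x \<oplus>\<^bsub>Y\<^esub> \<gamma> r = i x' \<oplus>\<^bsub>Y\<^esub> \<gamma> r' \<and> z = x' \<oplus>\<^bsub>X\<^esub> g r'"
    then obtain x' r' where h: "x' \<in> carrier X" "r' \<in> carrier ?F"
        "i x \<oplus>\<^bsub>Y\<^esub> \<gamma> r = i x' \<oplus>\<^bsub>Y\<^esub> \<gamma> r'" "z = x' \<oplus>\<^bsub>X\<^esub> g r'" by blast
    have "i x \<ominus>\<^bsub>Y\<^esub> i x' = \<gamma> r' \<ominus>\<^bsub>Y\<^esub> \<gamma> r"
      by (rule Y.M.add_eq_add_imp_minus_eq[OF h(3)]) (use x r h ic gc' in auto)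
    then have e: "i (x \<ominus>\<^bsub>X\<^esub> x') = \<gamma> (r' \<ominus>\<^bsub>?F\<^esub> r)"
      using x r h by (simp add: mod_hom_minus[OF ih X Y] mod_hom_minus[OF \<gamma> Fm Y])
    have xc: "x \<ominus>\<^bsub>X\<^esub> x' \<in> carrier X" and rc: "r' \<ominus>\<^bsub>?F\<^esub> r \<in> carrier ?F"
      using x h(1) r h(2) by (blast intro: X.M.minus_closed F.M.minus_closed)+
    have "\<gamma> (r' \<ominus>\<^bsub>?F\<^esub> r) \<in> i ` carrier X" unfolding e[symmetric] by (rule imageI[OF xc])
    then have "r' \<ominus>\<^bsub>?F\<^esub> r \<in> Lr" using rc by (simp add: Lr_def)
    then have "i (g (r' \<ominus>\<^bsub>?F\<^esub> r)) = i (x \<ominus>\<^bsub>X\<^esub> x')" using g1 e by simp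
    then have "g (r' \<ominus>\<^bsub>?F\<^esub> r) = x \<ominus>\<^bsub>X\<^esub> x'" using inj_onD[OF inj] gcl[OF rc] xc by blast
    then have "g r' \<ominus>\<^bsub>X\<^esub> g r = x \<ominus>\<^bsub>X\<^esub> x'" using r h by (simp add: mod_hom_minus[OF g Fm X])
    then have "(g r' \<ominus>\<^bsub>X\<^esub> g r) \<oplus>\<^bsub>X\<^esub> (x' \<oplus>\<^bsub>X\<^esub> g r) = (x \<ominus>\<^bsub>X\<^esub> x') \<oplus>\<^bsub>X\<^esub> (x' \<oplus>\<^bsub>X\<^esub> g r)" by simp
    moreover have "(g r' \<ominus>\<^bsub>X\<^esub> g r) \<oplus>\<^bsub>X\<^esub> (x' \<oplus>\<^bsub>X\<^esub> g r) = x' \<oplus>\<^bsub>X\<^esub> ((g r' \<ominus>\<^bsub>X\<^esub> g r) \<oplus>\<^bsub>X\<^esub> g r)"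
      using gcl r h by (simp add: X.M.a_ac)
    moreover have "(x \<ominus>\<^bsub>X\<^esub> x') \<oplus>\<^bsub>X\<^esub> (x' \<oplus>\<^bsub>X\<^esub> g r) = ((x \<ominus>\<^bsub>X\<^esub> x') \<oplus>\<^bsub>X\<^esub> x') \<oplus>\<^bsub>X\<^esub> g r"
      using gcl r h x by (simp add: X.M.a_assoc)
    ultimately show "z = x \<oplus>\<^bsub>X\<^esub> g r"
      using gcl r h x by (simp add: X.M.minus_add_cancel(1))
  qed
  have "mod_hom R Y X \<rho>"
  proof (rule mod_homI)
    fix y assume "y \<in> carrier Y"
    then obtain x r where y: "x \<in> carrier X" "r \<in> carrier ?F" "y = i x \<oplus>\<^bsub>Y\<^esub> \<gamma> r" using gen by blast
    show "\<rho> y \<in> carrier X" using y gcl by (simp add: \<rho>)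
    show "\<rho> (y \<oplus>\<^bsub>Y\<^esub> z) = \<rho> y \<oplus>\<^bsub>X\<^esub> \<rho> z" if zc: "z \<in> carrier Y" for z
    proof -
      obtain x' r' where z: "x' \<in> carrier X" "r' \<in> carrier ?F" "z = i x' \<oplus>\<^bsub>Y\<^esub> \<gamma> r'" using gen[OF zc] by blast
      have "y \<oplus>\<^bsub>Y\<^esub> z = i (x \<oplus>\<^bsub>X\<^esub> x') \<oplus>\<^bsub>Y\<^esub> \<gamma> (r \<oplus>\<^bsub>?F\<^esub> r')"
        using y z ic gc' by (simp add: mod_hom_add[OF ih] mod_hom_add[OF \<gamma>] Y.M.a_ac)
      then show ?thesis
        using y z gcl \<rho>[of "x \<oplus>\<^bsub>X\<^esub> x'" "r \<oplus>\<^bsub>?F\<^esub> r'"] by (simp add: \<rho> mod_hom_add[OF g] X.M.a_ac)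
    qed
    show "\<rho> (y \<cdot>\<^bsub>Y\<^esub> a) = \<rho> y \<cdot>\<^bsub>X\<^esub> a" if a: "a \<in> carrier R" for a
    proof -
      have "y \<cdot>\<^bsub>Y\<^esub> a = i (x \<cdot>\<^bsub>X\<^esub> a) \<oplus>\<^bsub>Y\<^esub> \<gamma> (r \<cdot>\<^bsub>?F\<^esub> a)"
        using y a ic gc' by (simp add: mod_hom_ract[OF ih] mod_hom_ract[OF \<gamma>] Y.ract_add_left)
      then show ?thesis
        using y a gcl \<rho>[of "x \<cdot>\<^bsub>X\<^esub> a" "r \<cdot>\<^bsub>?F\<^esub> a"]
        by (simp add: \<rho> mod_hom_ract[OF g] X.ract_add_left X.ract_closed F.ract_closed)
    qed
  qed
  moreover have "\<rho> (i x) = x" if x: "x \<in> carrier X" for x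
    using \<rho>[OF x F.M.zero_closed] x ic
    by (simp add: mod_hom_zero[OF \<gamma> Fm Y] mod_hom_zero[OF g Fm X])
  ultimately show ?thesis by blast
qed

section \<open>The cone of a presentation\<close>

text \<open>Additivity and vanishing on boundaries make \<open>Q\<close> depend on the class only.
  It serves for the maps of the cone that read off coordinates of cycles.\<close>

lemma (in dgm) coh_factor:
  assumes W: "graded_module (cohomology_ring A) W"
    and c: "\<And>z. z \<in> cycles M \<Longrightarrow> Q z \<in> carrier W"
    and add: "\<And>z w. \<lbrakk>z \<in> cycles M; w \<in> cycles M\<rbrakk> \<Longrightarrow> Q (z \<oplus>\<^bsub>M\<^esub> w) = Q z \<oplus>\<^bsub>W\<^esub> Q w"
    and act: "\<And>z a. \<lbrakk>z \<in> cycles M; a \<in> cycles A\<rbrakk> \<Longrightarrow> Q (z \<cdot>\<^bsub>M\<^esub> a) = Q z \<cdot>\<^bsub>W\<^esub> cls A a"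
    and bd: "\<And>x. x \<in> carrier M \<Longrightarrow> Q (diff M x) = \<zero>\<^bsub>W\<^esub>"
  shows "\<exists>q. mod_hom (cohomology_ring A) (cohomology_module M) W q \<and> (\<forall>z\<in>cycles M. q (cls M z) = Q z)"
proof -
  interpret W: graded_module "cohomology_ring A" W by (rule W)
  note za = additive_subgroup.a_closed[OF M.cycles_subgroup]
  have wd: "Q w = Q z" if z: "z \<in> cycles M" and w: "w \<in> cycles M" and eq: "cls M w = cls M z" for z w
  proof -
    have c': "w \<in> carrier M" "z \<in> carrier M" using z w M.cyclesD by auto
    obtain x where x: "x \<in> carrier M" "w \<ominus>\<^bsub>M\<^esub> z = diff M x"
      using M.cls_eq_iff[OF c'] eq by (auto elim: M.boundariesE)
    have dz: "diff M x \<in> cycles M" using M.boundariesI[OF x(1)] M.boundaries_cycles by blast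
    have "w = diff M x \<oplus>\<^bsub>M\<^esub> z" unfolding x(2)[symmetric] using c' by (simp add: M.M.minus_add_cancel(1))
    then have "Q w = \<zero>\<^bsub>W\<^esub> \<oplus>\<^bsub>W\<^esub> Q z" using add[OF dz z] bd[OF x(1)] by simp
    then show ?thesis using c[OF z] by simp
  qed
  define q where "q \<xi> = Q (SOME z. z \<in> cycles M \<and> cls M z = \<xi>)" for \<xi>
  have q: "q (cls M z) = Q z" if z: "z \<in> cycles M" for z
  proof -
    have "(SOME w. w \<in> cycles M \<and> cls M w = cls M z) \<in> cycles M \<and>
        cls M (SOME w. w \<in> cycles M \<and> cls M w = cls M z) = cls M z"
      by (rule someI[of _ z]) (use z in simp)
    then show ?thesis unfolding q_def using wd[OF z] by blast
  qed
  have "mod_hom (cohomology_ring A) (cohomology_module M) W q"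
  proof (rule mod_homI)
    fix x assume "x \<in> carrier (cohomology_module M)"
    then obtain z where z: "z \<in> cycles M" "x = cls M z" by (auto simp: coh_simps)
    show "q x \<in> carrier W" using z q c by simp
    show "q (x \<oplus>\<^bsub>cohomology_module M\<^esub> y) = q x \<oplus>\<^bsub>W\<^esub> q y" if y: "y \<in> carrier (cohomology_module M)" for y
    proof -
      obtain w where "w \<in> cycles M" "y = cls M w" using y by (auto simp: coh_simps)
      then show ?thesis using z by (simp add: coh_add q za add)
    qed
    show "q (x \<cdot>\<^bsub>cohomology_module M\<^esub> r) = q x \<cdot>\<^bsub>W\<^esub> r" if r: "r \<in> carrier (cohomology_ring A)" for r
    proof -
      obtain a where "a \<in> cycles A" "r = cls A a" using r by (auto simp: A.coh_ring_simps)
      then show ?thesis using z by (simp add: coh_ract q ract_cycles act)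
    qed
  qed
  then show ?thesis using q by blast
qed

section \<open>Vectors of cycles and their classes\<close>

definition vcyc :: "('k, 'a) dg \<Rightarrow> nat \<Rightarrow> (nat \<Rightarrow> 'a) set"
  where "vcyc A n = {a \<in> fsupp A {..<n}. \<forall>i. a i \<in> cycles A}"

text \<open>Besides taking classes this changes the encoding: elements of \<open>fsupp\<close> are
  functions on all natural numbers that vanish off the index set, elements of
  \<open>free_graded\<close> are restricted functions.\<close>

definition vcls :: "('k, 'a) dg \<Rightarrow> nat \<Rightarrow> (nat \<Rightarrow> 'a) \<Rightarrow> nat \<Rightarrow> 'a set"
  where "vcls A n a = (\<lambda>i\<in>{..<n}. cls A (a i))"

context dg_ring
begin

abbreviation "H \<equiv> cohomology_ring A"

lemma vcyc_fsupp: "a \<in> vcyc A n \<Longrightarrow> a \<in> fsupp A {..<n}"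
  by (simp add: vcyc_def)

lemma vcyc_cycle: "a \<in> vcyc A n \<Longrightarrow> a i \<in> cycles A"
  by (simp add: vcyc_def)

lemma vcls_closed: "a \<in> vcyc A (length ds) \<Longrightarrow> vcls A (length ds) a \<in> carrier (free_graded H ds)"
  by (auto simp: vcls_def free_simps coh_ring_simps vcyc_def)

lemma vcls_add:
  "\<lbrakk>a \<in> vcyc A (length ds); b \<in> vcyc A (length ds)\<rbrakk> \<Longrightarrow>
    vcls A (length ds) (\<lambda>i. a i \<oplus> b i) =
      vcls A (length ds) a \<oplus>\<^bsub>free_graded H ds\<^esub> vcls A (length ds) b"
  by (auto simp: vcls_def free_simps coh_ring_add vcyc_def intro!: restrict_ext)

lemma vcls_act:
  "\<lbrakk>a \<in> vcyc A (length ds); z \<in> cycles A\<rbrakk> \<Longrightarrow>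
    vcls A (length ds) (\<lambda>i. a i \<otimes> z) = vcls A (length ds) a \<cdot>\<^bsub>free_graded H ds\<^esub> cls A z"
  by (auto simp: vcls_def free_simps coh_ring_mult vcyc_def intro!: restrict_ext)

lemma vcls_bd:
  assumes "a \<in> fsupp A {..<length ds}"
  shows "(\<lambda>j. koszul A (\<delta> j) (diff A (a j))) \<in> vcyc A (length ds)"
    "vcls A (length ds) (\<lambda>j. koszul A (\<delta> j) (diff A (a j))) = \<zero>\<^bsub>free_graded H ds\<^esub>"
proof -
  have b: "koszul A (\<delta> j) (diff A (a j)) \<in> boundaries A" for j
    by (rule koszul_in_subgroup[OF boundaries_subgroup abelian_group_axioms boundariesI])
      (rule fsupp_closed[OF assms])
  then show "(\<lambda>j. koszul A (\<delta> j) (diff A (a j))) \<in> vcyc A (length ds)"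
    using fsupp_kd[OF assms] boundaries_cycles by (auto simp: vcyc_def)
  show "vcls A (length ds) (\<lambda>j. koszul A (\<delta> j) (diff A (a j))) = \<zero>\<^bsub>free_graded H ds\<^esub>"
  proof -
    have "cls A (koszul A (\<delta> j) (diff A (a j))) = boundaries A" for j
      using cls_zero_iff b boundaries_carrier by blast
    then show ?thesis by (simp add: vcls_def free_simps coh_ring_simps cls_zero)
  qed
qed

lemma vcls_surj:
  assumes r: "r \<in> carrier (free_graded H ds)"
  shows "\<exists>a\<in>vcyc A (length ds). vcls A (length ds) a = r"
proof -
  have "\<exists>z\<in>cycles A. cls A z = r i" if "i < length ds" for i
  proof -
    have "r i \<in> cls A ` cycles A" using r that by (simp add: free_simps coh_ring_simps PiE_iff)
    then obtain z where "r i = cls A z" "z \<in> cycles A" by (rule imageE)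
    then show ?thesis by auto
  qed
  then obtain f where f: "\<And>i. i < length ds \<Longrightarrow> f i \<in> cycles A \<and> cls A (f i) = r i" by metis
  define a where "a i = (if i < length ds then f i else \<zero>)" for i
  have z: "\<zero> \<in> cycles A" using additive_subgroup.zero_closed[OF cycles_subgroup] .
  have "finite {i. a i \<noteq> \<zero>}" by (rule finite_subset[of _ "{..<length ds}"]) (auto simp: a_def)
  then have "a \<in> vcyc A (length ds)" using f z cyclesD by (auto simp: vcyc_def fsupp_def a_def)
  moreover have "vcls A (length ds) a = r"
    using f r by (auto simp: vcls_def a_def free_simps PiE_iff extensional_def fun_eq_iff)
  ultimately show ?thesis by blast
qed

lemma vcls_homogeneous:
  assumes r: "r \<in> gr (free_graded H ds) k"
  shows "\<exists>a\<in>vcyc A (length ds). vcls A (length ds) a = r \<and> (\<forall>i<length ds. a i \<in> gr A (k - ds ! i))"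
proof -
  have "\<exists>z\<in>cycles A. cls A z = r i \<and> z \<in> gr A (k - ds ! i)" if "i < length ds" for i
  proof -
    have "r i \<in> cls A ` (cycles A \<inter> gr A (k - ds ! i))"
      using r that by (simp add: free_simps coh_ring_simps PiE_iff)
    then obtain z where "r i = cls A z" "z \<in> cycles A \<inter> gr A (k - ds ! i)" by (rule imageE)
    then show ?thesis by auto
  qed
  then obtain f where f: "\<And>i. i < length ds \<Longrightarrow> f i \<in> cycles A \<and> cls A (f i) = r i \<and> f i \<in> gr A (k - ds ! i)"
    by metis
  define a where "a i = (if i < length ds then f i else \<zero>)" for i
  have z: "\<zero> \<in> cycles A" using additive_subgroup.zero_closed[OF cycles_subgroup] .
  have "finite {i. a i \<noteq> \<zero>}" by (rule finite_subset[of _ "{..<length ds}"]) (auto simp: a_def)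
  then have "a \<in> vcyc A (length ds)" using f z cyclesD by (auto simp: vcyc_def fsupp_def a_def)
  moreover have "vcls A (length ds) a = r"
    using f r by (auto simp: vcls_def a_def free_simps PiE_iff extensional_def fun_eq_iff)
  ultimately show ?thesis using f by (auto simp: a_def intro!: bexI[of _ a])
qed

text \<open>Each coordinate is the boundary of some \<open>f i\<close>; multiplying
  \<open>f i\<close> by the sign of \<open>\<delta> i\<close> compensates the sign in the
  differential of a free dg module. The degrees \<open>\<delta>\<close> are left open since both the
  cells of \<open>P\<close> and those of \<open>C\<close> are met.\<close>

lemma vcls_zeroD:
  assumes a: "a \<in> vcyc A (length ds)" and z: "vcls A (length ds) a = \<zero>\<^bsub>free_graded H ds\<^esub>"
  shows "\<exists>b\<in>fsupp A {..<length ds}. a = (\<lambda>j. koszul A (\<delta> j) (diff A (b j)))"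
proof -
  have "\<exists>x\<in>carrier A. a i = diff A x" if i: "i < length ds" for i
  proof -
    have "cls A (a i) = boundaries A"
      using fun_cong[OF z, of i] i by (simp add: vcls_def free_simps coh_ring_simps cls_zero)
    then show ?thesis
      using cls_zero_iff[of "a i"] vcyc_cycle[OF a, of i] cyclesD by (auto elim: boundariesE)
  qed
  then obtain f where f: "\<And>i. i < length ds \<Longrightarrow> f i \<in> carrier A \<and> a i = diff A (f i)" by metis
  define b where "b i = (if i < length ds then koszul A (\<delta> i) (f i) else \<zero>)" for i
  have "finite {i. b i \<noteq> \<zero>}" by (rule finite_subset[of _ "{..<length ds}"]) (auto simp: b_def)
  then have "b \<in> fsupp A {..<length ds}"
    using f by (auto simp: fsupp_def b_def koszul_closed abelian_group_axioms)
  moreover have "a = (\<lambda>j. koszul A (\<delta> j) (diff A (b j)))"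
  proof
    fix j
    show "a j = koszul A (\<delta> j) (diff A (b j))"
    proof (cases "j < length ds")
      case True
      then have "diff A (b j) = koszul A (\<delta> j) (diff A (f j))"
        using f[OF True] koszul_hom[OF add_hom_diff abelian_group_axioms abelian_group_axioms, of "f j"]
        by (simp add: b_def)
      then show ?thesis
        using f[OF True] d_closed by (simp add: koszul_koszul abelian_group_axioms koszul_even)
    next
      case False
      then have "a j = \<zero>" using vcyc_fsupp[OF a] by (simp add: fsupp_def)
      then show ?thesis using False by (simp add: b_def d_zero koszul_zero abelian_group_axioms)
    qed
  qed
  ultimately show ?thesis by blast
qed

lemma koszul_diff_cycle:
  assumes "a \<in> fsupp A {..<n}" "(\<lambda>j. koszul A (\<delta> j) (diff A (a j))) = (\<lambda>j. \<zero>)"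
  shows "a \<in> vcyc A n"
proof -
  have "diff A (a j) = \<zero>" for j
  proof -
    have "diff A (a j) \<in> carrier A" by (rule d_closed[OF fsupp_closed[OF assms(1)]])
    then have "diff A (a j) = koszul A (\<delta> j) (koszul A (\<delta> j) (diff A (a j)))"
      by (simp add: koszul_koszul abelian_group_axioms koszul_even)
    also have "\<dots> = \<zero>" using fun_cong[OF assms(2), of j] by (simp add: koszul_zero abelian_group_axioms)
    finally show ?thesis .
  qed
  then show ?thesis using assms(1) fsupp_closed[OF assms(1)] by (simp add: vcyc_def cyclesI)
qed

end

text \<open>Identifies what a map out of a free dg module, given by cycles \<open>y i\<close>, does
  in cohomology. It is applied to the attaching map of the cone and to maps from \<open>P\<close> to
  a dg module.\<close>

lemma (in dgm) cls_wsum: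
  assumes a: "a \<in> vcyc A (length ds)" and y: "\<And>i. i < length ds \<Longrightarrow> y i \<in> cycles M"
  shows "wsum A M y a \<in> cycles M"
    "cls M (wsum A M y a) = free_lift ds (cohomology_module M) (\<lambda>i. cls M (y i)) (vcls A (length ds) a)"
proof -
  let ?I = "{..<length ds}"
  have tc: "(\<lambda>i. y i \<cdot>\<^bsub>M\<^esub> a i) \<in> ?I \<rightarrow> cycles M"
    using y A.vcyc_cycle[OF a] ract_cycles by auto
  have eq: "wsum A M y a = (\<Oplus>\<^bsub>M\<^esub>i\<in>?I. y i \<cdot>\<^bsub>M\<^esub> a i)"
    by (rule M.wsum_eq[OF A.vcyc_fsupp[OF a]])
      (use y M.cyclesD fsupp_subset[OF A.vcyc_fsupp[OF a]] in auto)
  show "wsum A M y a \<in> cycles M"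
    unfolding eq by (rule additive_subgroup_finsum[OF M.M.abelian_group_axioms M.cycles_subgroup tc])
  interpret H: graded_module "cohomology_ring A" "cohomology_module M" by (rule coh_graded_module)
  have "cls M (wsum A M y a) = (\<Oplus>\<^bsub>cohomology_module M\<^esub>i\<in>?I. cls M (y i \<cdot>\<^bsub>M\<^esub> a i))"
    unfolding eq cohomology_module_def by (rule M.coh_finsum[OF tc, symmetric])
  also have "\<dots> = (\<Oplus>\<^bsub>cohomology_module M\<^esub>i\<in>?I. cls M (y i) \<cdot>\<^bsub>cohomology_module M\<^esub> vcls A (length ds) a i)"
  proof (rule H.M.finsum_cong')
    have "cls M (y i) \<cdot>\<^bsub>cohomology_module M\<^esub> vcls A (length ds) a i = cls M (y i \<cdot>\<^bsub>M\<^esub> a i)" if "i \<in> ?I" for i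
      using that y A.vcyc_cycle[OF a] by (simp add: vcls_def coh_ract)
    then show "(\<lambda>i. cls M (y i) \<cdot>\<^bsub>cohomology_module M\<^esub> vcls A (length ds) a i) \<in> ?I \<rightarrow> carrier (cohomology_module M)"
      "\<And>i. i \<in> ?I \<Longrightarrow> cls M (y i \<cdot>\<^bsub>M\<^esub> a i) = cls M (y i) \<cdot>\<^bsub>cohomology_module M\<^esub> vcls A (length ds) a i"
      using tc by (auto simp: coh_simps)
  qed simp
  finally show "cls M (wsum A M y a) = free_lift ds (cohomology_module M) (\<lambda>i. cls M (y i)) (vcls A (length ds) a)"
    by (simp add: free_lift_def)
qed

text \<open>Cells attached to the zero module with zero boundaries span a free dg module. Thus free
  modules and cones both come from \<open>attach\<close>.\<close>

definition zero_dg :: "('a, unit) dg"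
  where "zero_dg = \<lparr>carrier = {()}, mult = undefined, one = undefined, zero = (), add = (\<lambda>x y. ()),
    smult = (\<lambda>r x. ()), gr = (\<lambda>i. {()}), diff = (\<lambda>x. ())\<rparr>"

lemma zero_dgm:
  assumes A: "dg_ring A"
  shows "dgm A (zero_dg :: ('a, unit) dg)"
proof -
  interpret A: dg_ring A by fact
  let ?Z = "zero_dg :: ('a, unit) dg"
  have ab: "abelian_group ?Z"
    by (rule abelian_groupI) (simp_all add: zero_dg_def)
  interpret Z: abelian_group ?Z by (rule ab)
  have "graded_group ?Z"
  proof (rule graded_groupI[where c = "\<lambda>x i. ()"])
    show "additive_subgroup (gr ?Z i) ?Z" for i
      by (rule additive_subgroup.intro, rule Z.add.subgroupI) (simp_all add: zero_dg_def)
  qed (use ab in \<open>simp_all add: zero_dg_def\<close>)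
  then have "graded_module A ?Z"
    by (intro graded_module.intro graded_module_axioms.intro A.A.graded_ring_axioms) (simp_all add: zero_dg_def)
  then show ?thesis by (rule dg_moduleI[OF A]) (simp_all add: zero_dg_def)
qed

text \<open>\<open>P\<close> is the free dg module with cohomology \<open>F0\<close>, and
  \<open>t\<close> lifts the columns of \<open>\<psi>\<close> to homogeneous vectors of cycles. The
  cells of \<open>C\<close> with boundary \<open>t j\<close> have degree \<open>ds1 ! j - 1\<close>,
  one less than the generators of \<open>F1\<close>.\<close>

locale cone = dg_ring A for A :: "('k, 'a) dg" (structure) +
  fixes ds0 ds1 :: "int list" and \<psi> :: "(nat \<Rightarrow> 'a set) \<Rightarrow> (nat \<Rightarrow> 'a set)"
  assumes psi: "\<psi> \<in> graded_hom (cohomology_ring A) (free_graded (cohomology_ring A) ds1)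
    (free_graded (cohomology_ring A) ds0)"
begin

abbreviation "n0 \<equiv> length ds0"
abbreviation "n1 \<equiv> length ds1"
abbreviation "F0 \<equiv> free_graded H ds0"
abbreviation "F1 \<equiv> free_graded H ds1"

definition "P = attach A zero_dg {..<n0} ((!) ds0) (\<lambda>i. ())"

definition "t = (SOME t. \<forall>j<n1. t j \<in> vcyc A n0 \<and> vcls A n0 (t j) = \<psi> (fbasis H ds1 j) \<and>
  (\<forall>i<n0. t j i \<in> gr A (ds1 ! j - ds0 ! i)))"

definition "C = attach A P {..<n1} (\<lambda>j. ds1 ! j - 1) (\<lambda>j. ((), t j))"

lemma HR: "graded_ring H"
  by (rule coh_graded_ring)

interpretation HR: graded_ring H by (rule HR)

lemma F0m: "graded_module H F0" and F1m: "graded_module H F1"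
  by (rule HR.free_graded_module)+

lemma t:
  assumes j: "j < n1"
  shows "t j \<in> vcyc A n0" "vcls A n0 (t j) = \<psi> (fbasis H ds1 j)" "\<And>i. i < n0 \<Longrightarrow> t j i \<in> gr A (ds1 ! j - ds0 ! i)"
proof -
  have "\<exists>a. a \<in> vcyc A n0 \<and> vcls A n0 a = \<psi> (fbasis H ds1 j) \<and> (\<forall>i<n0. a i \<in> gr A (ds1 ! j - ds0 ! i))"
    if "j < n1" for j
    using vcls_homogeneous[OF graded_hom_gr[OF psi HR.fbasis_gr[OF that]]] by blast
  then have "\<exists>t. \<forall>j<n1. t j \<in> vcyc A n0 \<and> vcls A n0 (t j) = \<psi> (fbasis H ds1 j) \<and>
      (\<forall>i<n0. t j i \<in> gr A (ds1 ! j - ds0 ! i))" by metis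
  then have "\<forall>j<n1. t j \<in> vcyc A n0 \<and> vcls A n0 (t j) = \<psi> (fbasis H ds1 j) \<and>
      (\<forall>i<n0. t j i \<in> gr A (ds1 ! j - ds0 ! i))" unfolding t_def by (rule someI_ex)
  then show "t j \<in> vcyc A n0" "vcls A n0 (t j) = \<psi> (fbasis H ds1 j)" "\<And>i. i < n0 \<Longrightarrow> t j i \<in> gr A (ds1 ! j - ds0 ! i)"
    using j by auto
qed

sublocale Z: dgm A zero_dg
  by (rule zero_dgm[OF dg_ring_axioms])

sublocale P: cells A zero_dg "{..<n0}" "(!) ds0" "\<lambda>i. ()"
  rewrites "attach A zero_dg {..<n0} ((!) ds0) (\<lambda>i. ()) = P"
proof -
  show "cells A zero_dg {..<n0} ((!) ds0) (\<lambda>i. ())"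
    by unfold_locales (simp_all add: zero_dg_def cycles_def)
qed (simp add: P_def)

sublocale P': dgm A P by (rule P.T_dgm)

lemma P_simps:
  "carrier P = UNIV \<times> fsupp A {..<n0}"
  "\<zero>\<^bsub>P\<^esub> = ((), \<lambda>j. \<zero>)"
  "(u, a) \<oplus>\<^bsub>P\<^esub> (v, b) = ((), \<lambda>j. a j \<oplus> b j)"
  "(u, a) \<cdot>\<^bsub>P\<^esub> r = ((), \<lambda>j. a j \<otimes> r)"
  "gr P k = UNIV \<times> {a \<in> fsupp A {..<n0}. \<forall>j\<in>{..<n0}. a j \<in> gr A (k - ds0 ! j)}"
  "diff P (u, a) = ((), \<lambda>j. koszul A (ds0 ! j) (diff A (a j)))"
  unfolding P_def attach_simps by (auto simp: zero_dg_def)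

lemma P_cycles: "cycles P = UNIV \<times> vcyc A n0"
proof -
  have k: "koszul A n (diff A x) = \<zero>" if "x \<in> cycles A" for n x
    using cyclesD(2)[OF that] by (simp add: koszul_zero abelian_group_axioms)
  have "(u, a) \<in> cycles P \<longleftrightarrow> a \<in> vcyc A n0" for u a
  proof
    assume "(u, a) \<in> cycles P"
    then have "a \<in> fsupp A {..<n0}" "(\<lambda>j. koszul A (ds0 ! j) (diff A (a j))) = (\<lambda>j. \<zero>)"
      by (simp_all add: cycles_def P_simps)
    then show "a \<in> vcyc A n0" by (rule koszul_diff_cycle)
  next
    assume a: "a \<in> vcyc A n0"
    then show "(u, a) \<in> cycles P"
      using vcyc_fsupp[OF a] k[OF vcyc_cycle[OF a]] by (simp add: cycles_def P_simps)
  qed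
  then show ?thesis by auto
qed

sublocale C: cells A P "{..<n1}" "\<lambda>j. ds1 ! j - 1" "\<lambda>j. ((), t j)"
  rewrites "attach A P {..<n1} (\<lambda>j. ds1 ! j - 1) (\<lambda>j. ((), t j)) = C"
proof -
  show "cells A P {..<n1} (\<lambda>j. ds1 ! j - 1) (\<lambda>j. ((), t j))"
    by unfold_locales (use t vcyc_fsupp in \<open>auto simp: P_cycles P_simps\<close>)
qed (simp add: C_def)

sublocale C': dgm A C by (rule C.T_dgm)

lemma C_simps:
  "carrier C = carrier P \<times> fsupp A {..<n1}"
  "\<zero>\<^bsub>C\<^esub> = (\<zero>\<^bsub>P\<^esub>, \<lambda>j. \<zero>)"
  "(p, a) \<oplus>\<^bsub>C\<^esub> (q, b) = (p \<oplus>\<^bsub>P\<^esub> q, \<lambda>j. a j \<oplus> b j)"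
  "(p, a) \<cdot>\<^bsub>C\<^esub> r = (p \<cdot>\<^bsub>P\<^esub> r, \<lambda>j. a j \<otimes> r)"
  "diff C (p, a) = (diff P p \<oplus>\<^bsub>P\<^esub> wsum A P (\<lambda>j. ((), t j)) a,
    \<lambda>j. koszul A (ds1 ! j - 1) (diff A (a j)))"
  unfolding C_def attach_simps by simp_all

text \<open>A cycle of \<open>P\<close> is a vector of cycles of \<open>A\<close>, because the
  attaching cycles are zero; its coordinates give the identification of the cohomology of
  \<open>P\<close> with \<open>F0\<close>. Bijectivity is expressed by \<open>theta_surj\<close> and
  \<open>theta_zero\<close>.\<close>

lemma theta_ex: "\<exists>\<theta>. mod_hom H (cohomology_module P) F0 \<theta> \<and> (\<forall>z\<in>cycles P. \<theta> (cls P z) = vcls A n0 (snd z))"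
proof (rule P'.coh_factor[OF F0m])
  fix x assume "x \<in> carrier P"
  then obtain a where "x = ((), a)" "a \<in> fsupp A {..<n0}" by (auto simp: P_simps)
  then show "vcls A n0 (snd (diff P x)) = \<zero>\<^bsub>F0\<^esub>" by (simp add: P_simps vcls_bd)
qed (auto simp: P_cycles P_simps vcls_closed vcls_add vcls_act)

definition "\<theta> = (SOME \<theta>. mod_hom H (cohomology_module P) F0 \<theta> \<and> (\<forall>z\<in>cycles P. \<theta> (cls P z) = vcls A n0 (snd z)))"

lemma theta: "mod_hom H (cohomology_module P) F0 \<theta>" "z \<in> cycles P \<Longrightarrow> \<theta> (cls P z) = vcls A n0 (snd z)"
  using someI_ex[OF theta_ex, folded \<theta>_def] by blast+

lemma theta_graded: "\<theta> \<in> graded_hom H (cohomology_module P) F0"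
  unfolding graded_hom_iff
proof (intro conjI allI ballI theta(1))
  fix k \<xi> assume "\<xi> \<in> gr (cohomology_module P) k"
  then obtain z where z: "z \<in> cycles P" "z \<in> gr P k" "\<xi> = cls P z" by (auto simp: P'.coh_simps)
  then show "\<theta> \<xi> \<in> gr F0 k"
    by (auto simp: theta(2) vcls_def free_simps P_simps coh_ring_simps P_cycles vcyc_def)
qed

lemma theta_surj: "r \<in> carrier F0 \<Longrightarrow> \<exists>\<xi>\<in>carrier (cohomology_module P). \<theta> \<xi> = r"
proof -
  assume "r \<in> carrier F0"
  then obtain a where a: "a \<in> vcyc A n0" "vcls A n0 a = r" using vcls_surj by blast
  then have "((), a) \<in> cycles P" by (simp add: P_cycles)
  then show ?thesis using theta(2)[of "((), a)"] a by (auto simp: P'.coh_simps)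
qed

lemma theta_zero:
  assumes "\<xi> \<in> carrier (cohomology_module P)" "\<theta> \<xi> = \<zero>\<^bsub>F0\<^esub>"
  shows "\<xi> = \<zero>\<^bsub>cohomology_module P\<^esub>"
proof -
  obtain a where a: "a \<in> vcyc A n0" "\<xi> = cls P ((), a)" using assms(1) by (auto simp: P'.coh_simps P_cycles)
  have za: "((), a) \<in> cycles P" using a by (simp add: P_cycles)
  then have "vcls A n0 a = \<zero>\<^bsub>F0\<^esub>" using theta(2)[OF za] a(2) assms(2) by simp
  from vcls_zeroD[OF a(1) this, of "(!) ds0"]
  obtain b where b: "b \<in> fsupp A {..<n0}" "a = (\<lambda>j. koszul A (ds0 ! j) (diff A (b j)))"
    by (rule bexE)
  have "((), a) = diff P ((), b)" using b(2) by (simp add: P_simps)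
  then have "((), a) \<in> boundaries P" using P'.M.boundariesI[of "((), b)"] b(1) by (simp add: P_simps)
  then show ?thesis
    using a(2) P'.M.cls_zero_iff[OF P'.M.cyclesD(1)[OF za]] by (simp add: P'.coh_simps P'.M.cls_zero)
qed

lemma t_cycle: "j < n1 \<Longrightarrow> ((), t j) \<in> cycles P"
  using t(1) by (simp add: P_cycles)

text \<open>Both sides of the second claim are linear in the class of \<open>b\<close>, and they
  agree on the basis of \<open>F1\<close>, where \<open>t\<close> was chosen to lift the columns of
  \<open>\<psi>\<close>.\<close>

lemma wsum_t:
  assumes b: "b \<in> vcyc A n1"
  shows "wsum A P (\<lambda>j. ((), t j)) b \<in> cycles P"
    "\<theta> (cls P (wsum A P (\<lambda>j. ((), t j)) b)) = \<psi> (vcls A n1 b)"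
proof -
  show "wsum A P (\<lambda>j. ((), t j)) b \<in> cycles P" by (rule P'.cls_wsum(1)[OF b t_cycle])
  have w: "cls P (wsum A P (\<lambda>j. ((), t j)) b) =
      free_lift ds1 (cohomology_module P) (\<lambda>j. cls P ((), t j)) (vcls A n1 b)"
    by (rule P'.cls_wsum(2)[OF b t_cycle])
  have y: "cls P ((), t j) \<in> carrier (cohomology_module P)" if "j < n1" for j
    using t_cycle[OF that] by (auto simp: P'.coh_simps)
  note fl = free_lift_hom[OF P'.coh_graded_module, of ds1 "\<lambda>j. cls P ((), t j)", OF y]
  have eq: "\<theta> (free_lift ds1 (cohomology_module P) (\<lambda>j. cls P ((), t j)) r) = \<psi> r" if r: "r \<in> carrier F1" for r
    by (rule free_hom_eqI[OF F0m mod_hom_comp[OF fl(1) theta(1)] graded_hom_mod_hom[OF psi] _ r])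
      (use fl(2) theta(2)[OF t_cycle] t(2) in simp_all)
  show "\<theta> (cls P (wsum A P (\<lambda>j. ((), t j)) b)) = \<psi> (vcls A n1 b)"
    unfolding w by (rule eq[OF vcls_closed[OF b]])
qed

lemma wsum_t_closed: "b \<in> fsupp A {..<n1} \<Longrightarrow> wsum A P (\<lambda>j. ((), t j)) b \<in> carrier P"
  by (rule P'.M.wsum_closed) (use t_cycle P'.M.cyclesD in auto)

lemma C_cyclesD:
  assumes "(p, b) \<in> cycles C"
  shows "p \<in> carrier P" "b \<in> vcyc A n1" "diff P p \<oplus>\<^bsub>P\<^esub> wsum A P (\<lambda>j. ((), t j)) b = \<zero>\<^bsub>P\<^esub>"
proof -
  have c: "p \<in> carrier P" "b \<in> fsupp A {..<n1}" using C'.M.cyclesD(1)[OF assms] by (auto simp: C_simps)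
  have d: "diff C (p, b) = \<zero>\<^bsub>C\<^esub>" using C'.M.cyclesD(2)[OF assms] .
  show "p \<in> carrier P" by (rule c)
  show "b \<in> vcyc A n1"
    by (rule koszul_diff_cycle[OF c(2), of "\<lambda>j. ds1 ! j - 1"]) (use d in \<open>simp add: C_simps\<close>)
  show "diff P p \<oplus>\<^bsub>P\<^esub> wsum A P (\<lambda>j. ((), t j)) b = \<zero>\<^bsub>P\<^esub>" using d by (simp add: C_simps)
qed

text \<open>The connecting map of the cone, given by the coordinates at the upper cells. Because of
  the degrees of these cells it raises degrees by one, so it is treated as a merely linear
  map.\<close>

lemma del_ex: "\<exists>\<beta>. mod_hom H (cohomology_module C) F1 \<beta> \<and> (\<forall>z\<in>cycles C. \<beta> (cls C z) = vcls A n1 (snd z))"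
proof (rule C'.coh_factor[OF F1m])
  fix x assume "x \<in> carrier C"
  then obtain p b where "x = (p, b)" "b \<in> fsupp A {..<n1}" by (auto simp: C_simps)
  then show "vcls A n1 (snd (diff C x)) = \<zero>\<^bsub>F1\<^esub>" by (simp add: C_simps vcls_bd)
next
  fix z assume "z \<in> cycles C"
  then obtain p b where z: "z = (p, b)" "b \<in> vcyc A n1" using C_cyclesD(2) by (cases z) auto
  then show "vcls A n1 (snd z) \<in> carrier F1" by (simp add: vcls_closed)
  show "vcls A n1 (snd (z \<cdot>\<^bsub>C\<^esub> a)) = vcls A n1 (snd z) \<cdot>\<^bsub>F1\<^esub> cls A a" if "a \<in> cycles A" for a
    using z that by (simp add: C_simps vcls_act)
  fix w assume "w \<in> cycles C"
  then obtain q c where w: "w = (q, c)" "c \<in> vcyc A n1" using C_cyclesD(2) by (cases w) auto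
  then show "vcls A n1 (snd (z \<oplus>\<^bsub>C\<^esub> w)) = vcls A n1 (snd z) \<oplus>\<^bsub>F1\<^esub> vcls A n1 (snd w)"
    using z by (simp add: C_simps vcls_add)
qed

definition "\<beta> = (SOME \<beta>. mod_hom H (cohomology_module C) F1 \<beta> \<and> (\<forall>z\<in>cycles C. \<beta> (cls C z) = vcls A n1 (snd z)))"

lemma del: "mod_hom H (cohomology_module C) F1 \<beta>" "z \<in> cycles C \<Longrightarrow> \<beta> (cls C z) = vcls A n1 (snd z)"
  using someI_ex[OF del_ex, folded \<beta>_def] by blast+

abbreviation inc :: "unit \<times> (nat \<Rightarrow> 'a) \<Rightarrow> (unit \<times> (nat \<Rightarrow> 'a)) \<times> (nat \<Rightarrow> 'a)"
  where "inc \<equiv> (\<lambda>p. (p, \<lambda>j. \<zero>))"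
abbreviation "\<kappa> \<equiv> hmap C inc"

lemma kappa: "\<kappa> \<in> graded_hom H (cohomology_module P) (cohomology_module C)"
  "z \<in> cycles P \<Longrightarrow> \<kappa> (cls P z) = cls C (z, \<lambda>j. \<zero>)"
  using hmap_graded_hom[OF P'.dgm_axioms C'.dgm_axioms C.attach_incl]
    hmap_cls[OF P'.dgm_axioms C'.dgm_axioms C.attach_incl] by auto

text \<open>Exactness of the long exact sequence of the cone at the cohomology of \<open>P\<close>:
  a cycle of \<open>P\<close> bounds in \<open>C\<close> exactly if it is homologous in
  \<open>P\<close> to an image under the attaching map, which is \<open>\<psi>\<close> in
  cohomology.\<close>

lemma kappa_zero_iff:
  assumes x: "\<xi> \<in> carrier (cohomology_module P)"
  shows "\<kappa> \<xi> = \<zero>\<^bsub>cohomology_module C\<^esub> \<longleftrightarrow> \<theta> \<xi> \<in> \<psi> ` carrier F1"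
proof -
  obtain p where p: "p \<in> cycles P" "\<xi> = cls P p" using x by (auto simp: P'.coh_simps)
  have pc: "p \<in> carrier P" using p P'.M.cyclesD by blast
  have pC: "(p, \<lambda>j. \<zero>) \<in> carrier C" using pc by (simp add: C_simps fsupp_zero)
  show ?thesis
  proof
    assume "\<kappa> \<xi> = \<zero>\<^bsub>cohomology_module C\<^esub>"
    then have "(p, \<lambda>j. \<zero>) \<in> boundaries C"
      using kappa(2)[OF p(1)] p(2) C'.M.cls_zero_iff[OF pC] by (simp add: C'.coh_simps C'.M.cls_zero)
    then obtain x where xc: "x \<in> carrier C" "(p, \<lambda>j. \<zero>) = diff C x" by (rule C'.M.boundariesE)
    then obtain q b where q: "q \<in> carrier P" "b \<in> fsupp A {..<n1}" "x = (q, b)" by (auto simp: C_simps)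
    have e: "p = diff P q \<oplus>\<^bsub>P\<^esub> wsum A P (\<lambda>j. ((), t j)) b"
        "(\<lambda>j. \<zero>) = (\<lambda>j. koszul A (ds1 ! j - 1) (diff A (b j)))"
      using xc(2) q(3) by (simp_all add: C_simps)
    have b: "b \<in> vcyc A n1" by (rule koszul_diff_cycle[OF q(2) e(2)[symmetric]])
    have w: "wsum A P (\<lambda>j. ((), t j)) b \<in> cycles P" by (rule wsum_t(1)[OF b])
    have "cls P p = cls P (wsum A P (\<lambda>j. ((), t j)) b)"
      using P'.M.cls_eq_iff[OF pc P'.M.cyclesD(1)[OF w]] P'.M.boundariesI[OF q(1)] P'.M.d_closed[OF q(1)]
        P'.M.cyclesD(1)[OF w] unfolding e(1) by (simp add: P'.M.M.minus_add_cancel(2))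
    then have "\<theta> \<xi> = \<psi> (vcls A n1 b)" using wsum_t(2)[OF b] p(2) by simp
    then show "\<theta> \<xi> \<in> \<psi> ` carrier F1" using vcls_closed[OF b] by blast
  next
    assume "\<theta> \<xi> \<in> \<psi> ` carrier F1"
    then obtain b where b: "b \<in> vcyc A n1" "\<theta> \<xi> = \<psi> (vcls A n1 b)" using vcls_surj by blast
    note w = wsum_t[OF b(1)]
    let ?w = "wsum A P (\<lambda>j. ((), t j)) b"
    interpret HP: graded_module H "cohomology_module P" by (rule P'.coh_graded_module)
    interpret F0: graded_module H F0 by (rule F0m)
    have wH: "cls P ?w \<in> carrier (cohomology_module P)" using w(1) by (auto simp: P'.coh_simps)
    have "\<theta> (\<xi> \<ominus>\<^bsub>cohomology_module P\<^esub> cls P ?w) = \<theta> \<xi> \<ominus>\<^bsub>F0\<^esub> \<theta> (cls P ?w)"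
      by (rule mod_hom_minus[OF theta(1) P'.coh_graded_module F0m x wH])
    also have "\<dots> = \<zero>\<^bsub>F0\<^esub>"
      using b(2) w(2) mod_hom_closed[OF theta(1) x] mod_hom_closed[OF theta(1) wH]
      by (simp add: F0.M.minus_eq_zero_iff)
    finally have "\<xi> = cls P ?w"
      using theta_zero[of "\<xi> \<ominus>\<^bsub>cohomology_module P\<^esub> cls P ?w"] x wH by (simp add: HP.M.minus_eq_zero_iff)
    then have "\<kappa> \<xi> = cls C (?w, \<lambda>j. \<zero>)" using kappa(2)[OF w(1)] by simp
    also have "(?w, \<lambda>j. \<zero>) = diff C (\<zero>\<^bsub>P\<^esub>, b)"
    proof -
      have "koszul A n (diff A (b j)) = \<zero>" for n j
        using cyclesD(2)[OF vcyc_cycle[OF b(1)]] by (simp add: koszul_zero abelian_group_axioms)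
      then show ?thesis using P'.M.cyclesD(1)[OF w(1)] by (simp add: C_simps(5) P'.M.d_zero)
    qed
    also have "cls C (diff C (\<zero>\<^bsub>P\<^esub>, b)) = \<zero>\<^bsub>cohomology_module C\<^esub>"
    proof -
      have c: "(\<zero>\<^bsub>P\<^esub>, b) \<in> carrier C" using vcyc_fsupp[OF b(1)] by (simp add: C_simps(1))
      show ?thesis
        using C'.M.cls_zero_iff[OF C'.M.d_closed[OF c]] C'.M.boundariesI[OF c]
        by (simp add: C'.coh_simps C'.M.cls_zero)
    qed
    finally show "\<kappa> \<xi> = \<zero>\<^bsub>cohomology_module C\<^esub>" .
  qed
qed

text \<open>Exactness of the same sequence at the cohomology of \<open>C\<close>.\<close>

lemma del_zero_iff:
  assumes h: "\<eta> \<in> carrier (cohomology_module C)"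
  shows "\<beta> \<eta> = \<zero>\<^bsub>F1\<^esub> \<longleftrightarrow> \<eta> \<in> \<kappa> ` carrier (cohomology_module P)"
proof
  assume d: "\<beta> \<eta> = \<zero>\<^bsub>F1\<^esub>"
  obtain p b where pb: "(p, b) \<in> cycles C" "\<eta> = cls C (p, b)" using h by (auto simp: C'.coh_simps)
  note cd = C_cyclesD[OF pb(1)]
  have "vcls A n1 b = \<zero>\<^bsub>F1\<^esub>" using d del(2)[OF pb(1)] pb(2) by simp
  from vcls_zeroD[OF cd(2) this, of "\<lambda>j. ds1 ! j - 1"]
  obtain c where c: "c \<in> fsupp A {..<n1}" "b = (\<lambda>j. koszul A (ds1 ! j - 1) (diff A (c j)))"
    by (rule bexE)
  \<comment> \<open>\<open>b\<close> is the signed boundary of \<open>c\<close>, so subtracting the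
    boundary of \<open>(0, c)\<close> from \<open>(p, b)\<close> removes the upper coordinates and
    leaves a cycle of \<open>P\<close>.\<close>
  let ?w = "wsum A P (\<lambda>j. ((), t j)) c"
  have wc: "?w \<in> carrier P" by (rule wsum_t_closed[OF c(1)])
  have c0: "(\<zero>\<^bsub>P\<^esub>, c) \<in> carrier C" using c(1) by (simp add: C_simps(1))
  have dc: "diff C (\<zero>\<^bsub>P\<^esub>, c) = (?w, b)" using wc c(2) by (simp add: C_simps(5) P'.M.d_zero)
  let ?p = "p \<ominus>\<^bsub>P\<^esub> ?w"
  have pc: "?p \<in> carrier P" using cd(1) wc by simp
  have eq: "(p, b) = (?p, \<lambda>j. \<zero>) \<oplus>\<^bsub>C\<^esub> diff C (\<zero>\<^bsub>P\<^esub>, c)"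
    using cd(1) wc fsupp_closed[OF vcyc_fsupp[OF cd(2)]]
    by (simp only: dc C_simps(3) P'.M.M.minus_add_cancel(1)) simp
  have ic: "(?p, \<lambda>j. \<zero>) \<in> carrier C" using pc by (simp add: C_simps(1) fsupp_zero)
  have "diff C (?p, \<lambda>j. \<zero>) = diff C (p, b)"
    unfolding eq using ic C'.M.d_closed[OF c0] by (simp add: C'.M.d_add C'.M.d_d[OF c0] C'.M.d_closed)
  then have "(diff P ?p, \<lambda>j. \<zero>) = \<zero>\<^bsub>C\<^esub>"
    using C'.M.cyclesD(2)[OF pb(1)] dg_hom_diff[OF C.attach_incl pc] by simp
  then have pz: "?p \<in> cycles P" using pc by (intro P'.M.cyclesI) (simp_all add: C_simps(2))
  have "cls C (p, b) = cls C (?p, \<lambda>j. \<zero>)"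
    using C'.M.cls_eq_iff[OF C'.M.cyclesD(1)[OF pb(1)] ic] C'.M.boundariesI[OF c0]
      C'.M.M.add_minus_cancel_left[OF ic C'.M.d_closed[OF c0]] unfolding eq by simp
  then have "\<eta> = \<kappa> (cls P ?p)" using pb(2) kappa(2)[OF pz] by simp
  then show "\<eta> \<in> \<kappa> ` carrier (cohomology_module P)" using pz by (auto simp: P'.coh_simps)
next
  assume "\<eta> \<in> \<kappa> ` carrier (cohomology_module P)"
  then obtain p where p: "p \<in> cycles P" "\<eta> = cls C (p, \<lambda>j. \<zero>)"
    using kappa(2) by (auto simp: P'.coh_simps)
  have "(p, \<lambda>j. \<zero>) \<in> cycles C" using dg_hom_cycles[OF P'.dgm_axioms C'.dgm_axioms C.attach_incl p(1)] .
  then show "\<beta> \<eta> = \<zero>\<^bsub>F1\<^esub>"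
    using p(2) del(2) by (auto simp: vcls_def free_simps coh_ring_simps)
qed

text \<open>Exactness at \<open>F1\<close>: a vector \<open>b\<close> of cycles is the upper part of
  a cycle \<open>(p, b)\<close> of \<open>C\<close> exactly if its image under the attaching map
  bounds, namely \<open>- p\<close>.\<close>

lemma del_image: "\<beta> ` carrier (cohomology_module C) = {r \<in> carrier F1. \<psi> r = \<zero>\<^bsub>F0\<^esub>}"
proof
  show "\<beta> ` carrier (cohomology_module C) \<subseteq> {r \<in> carrier F1. \<psi> r = \<zero>\<^bsub>F0\<^esub>}"
  proof (rule image_subsetI)
    fix \<eta> assume "\<eta> \<in> carrier (cohomology_module C)"
    then obtain p b where pb: "(p, b) \<in> cycles C" "\<eta> = cls C (p, b)" by (auto simp: C'.coh_simps)
    note cd = C_cyclesD[OF pb(1)]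
    let ?w = "wsum A P (\<lambda>j. ((), t j)) b"
    have w: "?w \<in> cycles P" by (rule wsum_t(1)[OF cd(2)])
    have wc: "?w \<in> carrier P" using w P'.M.cyclesD by blast
    have "?w = diff P (\<ominus>\<^bsub>P\<^esub> p)"
      using cd(1,3) wc P'.M.d_closed[OF cd(1)] P'.M.d_neg[OF cd(1)]
      by (metis P'.M.M.a_comm P'.M.M.minus_equality)
    then have "?w \<in> boundaries P" using P'.M.boundariesI[of "\<ominus>\<^bsub>P\<^esub> p"] cd(1) by simp
    then have "cls P ?w = \<zero>\<^bsub>cohomology_module P\<^esub>"
      using P'.M.cls_zero_iff[OF wc] by (simp add: P'.coh_simps P'.M.cls_zero)
    then have "\<psi> (vcls A n1 b) = \<zero>\<^bsub>F0\<^esub>"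
      using wsum_t(2)[OF cd(2)] mod_hom_zero[OF theta(1) P'.coh_graded_module F0m] by simp
    then show "\<beta> \<eta> \<in> {r \<in> carrier F1. \<psi> r = \<zero>\<^bsub>F0\<^esub>}"
      using del(2)[OF pb(1)] pb(2) vcls_closed[OF cd(2)] by simp
  qed
  show "{r \<in> carrier F1. \<psi> r = \<zero>\<^bsub>F0\<^esub>} \<subseteq> \<beta> ` carrier (cohomology_module C)"
  proof
    fix r assume "r \<in> {r \<in> carrier F1. \<psi> r = \<zero>\<^bsub>F0\<^esub>}"
    then obtain b where b: "b \<in> vcyc A n1" "vcls A n1 b = r" "\<psi> r = \<zero>\<^bsub>F0\<^esub>" using vcls_surj by blast
    let ?w = "wsum A P (\<lambda>j. ((), t j)) b"
    note w = wsum_t[OF b(1)]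
    have wc: "?w \<in> carrier P" using w P'.M.cyclesD by blast
    have "cls P ?w = \<zero>\<^bsub>cohomology_module P\<^esub>"
      using theta_zero[of "cls P ?w"] w b by (auto simp: P'.coh_simps(1))
    then have "?w \<in> boundaries P" using P'.M.cls_zero_iff[OF wc] by (simp add: P'.coh_simps P'.M.cls_zero)
    then obtain p where p: "p \<in> carrier P" "?w = diff P p" by (rule P'.M.boundariesE)
    have dk: "koszul A n (diff A (b j)) = \<zero>" for n j
      using cyclesD(2)[OF vcyc_cycle[OF b(1)]] by (simp add: koszul_zero abelian_group_axioms)
    have "(\<ominus>\<^bsub>P\<^esub> p, b) \<in> cycles C"
    proof (rule C'.M.cyclesI)
      show "(\<ominus>\<^bsub>P\<^esub> p, b) \<in> carrier C" using p vcyc_fsupp[OF b(1)] by (simp add: C_simps(1))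
      show "diff C (\<ominus>\<^bsub>P\<^esub> p, b) = \<zero>\<^bsub>C\<^esub>"
        using p P'.M.d_closed[OF p(1)] by (simp add: C_simps(2,5) dk P'.M.d_neg P'.M.M.l_neg)
    qed
    then show "r \<in> \<beta> ` carrier (cohomology_module C)"
      using del(2)[of "(\<ominus>\<^bsub>P\<^esub> p, b)"] b(2) by (auto simp: C'.coh_simps intro!: rev_image_eqI)
  qed
qed

lemma C_lepoll:
  assumes "infinite (UNIV :: 'm set)" "carrier A \<lesssim> (UNIV :: 'm set)"
  shows "carrier C \<lesssim> (UNIV :: 'm set)"
  unfolding C_def P_def
  by (intro attach_lepoll assms finite_lepoll_infinite) (simp_all add: zero_dg_def)

text \<open>The basis of \<open>F0\<close> can be sent to homogeneous cycles representing its image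
  under \<open>g\<close>. As \<open>g\<close> kills the image of \<open>\<psi>\<close>, the
  attaching cycles go to boundaries, and homogeneous elements bounding them are the values on the
  upper cells.\<close>

lemma cone_extend:
  assumes M: "dgm A M" and g: "g \<in> graded_hom H F0 (cohomology_module M)"
    and g\<psi>: "\<And>r. r \<in> carrier F1 \<Longrightarrow> g (\<psi> r) = \<zero>\<^bsub>cohomology_module M\<^esub>"
  shows "\<exists>G. dg_hom A C M G \<and> (\<forall>\<xi>\<in>carrier (cohomology_module P). hmap M G (\<kappa> \<xi>) = g (\<theta> \<xi>))"
proof -
  interpret M: dgm A M by (rule M)
  have "\<exists>z\<in>cycles M. z \<in> gr M (ds0 ! i) \<and> cls M z = g (fbasis H ds0 i)" if i: "i < n0" for i
    using graded_hom_gr[OF g HR.fbasis_gr[OF i]] by (auto simp: M.coh_simps)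
  then obtain u where u: "\<And>i. i < n0 \<Longrightarrow> u i \<in> cycles M \<and> u i \<in> gr M (ds0 ! i) \<and> cls M (u i) = g (fbasis H ds0 i)"
    by metis
  have z: "dg_hom A zero_dg M (\<lambda>x. \<zero>\<^bsub>M\<^esub>)"
    by (auto simp: dg_hom_def graded_hom_iff zero_dg_def M.M.M.gr_zero M.M.d_zero M.M.ract_zero_left intro!: mod_homI)
  define g0 where "g0 x = \<zero>\<^bsub>M\<^esub> \<oplus>\<^bsub>M\<^esub> wsum A M u (snd x)" for x :: "unit \<times> (nat \<Rightarrow> 'a)"
  have g0: "dg_hom A P M g0"
    unfolding g0_def[abs_def]
    by (rule P.attach_lift[OF M z]) (use u M.M.cyclesD in auto)
  have h0: "hmap M g0 \<xi> = g (\<theta> \<xi>)" if x: "\<xi> \<in> carrier (cohomology_module P)" for \<xi>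
  proof -
    obtain a where a: "a \<in> vcyc A n0" "\<xi> = cls P ((), a)" using x by (auto simp: P'.coh_simps P_cycles)
    have za: "((), a) \<in> cycles P" using a by (simp add: P_cycles)
    have uc: "i < n0 \<Longrightarrow> u i \<in> cycles M" for i using u by blast
    note w = M.cls_wsum[OF a(1), of u, OF uc]
    have "hmap M g0 \<xi> = cls M (wsum A M u a)"
      unfolding a(2) hmap_cls[OF P'.dgm_axioms M g0 za] using M.M.cyclesD(1)[OF w(1)] by (simp add: g0_def)
    also have "\<dots> = free_lift ds0 (cohomology_module M) (\<lambda>i. cls M (u i)) (vcls A n0 a)" by (rule w(2))
    also have "\<dots> = g (vcls A n0 a)"
    proof (rule free_hom_eqI[OF M.coh_graded_module _ graded_hom_mod_hom[OF g] _ vcls_closed[OF a(1)]])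
      have y: "i < n0 \<Longrightarrow> cls M (u i) \<in> carrier (cohomology_module M)" for i
        using uc by (auto simp: M.coh_simps)
      note fl = free_lift_hom[OF M.coh_graded_module, of ds0 "\<lambda>i. cls M (u i)", OF y]
      show "mod_hom H F0 (cohomology_module M) (free_lift ds0 (cohomology_module M) (\<lambda>i. cls M (u i)))"
        by (rule fl(1))
      show "free_lift ds0 (cohomology_module M) (\<lambda>i. cls M (u i)) (fbasis H ds0 k) = g (fbasis H ds0 k)"
        if "k < n0" for k using fl(2) u that by simp
    qed
    also have "\<dots> = g (\<theta> \<xi>)" using theta(2)[OF za] a(2) by simp
    finally show ?thesis .
  qed
  have "\<exists>n\<in>gr M (ds1 ! j - 1). diff M n = g0 ((), t j)" if j: "j < n1" for j
  proof -
    have tz: "((), t j) \<in> cycles P" by (rule t_cycle[OF j])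
    have "cls M (g0 ((), t j)) = g (\<theta> (cls P ((), t j)))"
      using h0[of "cls P ((), t j)"] hmap_cls[OF P'.dgm_axioms M g0 tz] tz by (auto simp: P'.coh_simps)
    also have "\<dots> = \<zero>\<^bsub>cohomology_module M\<^esub>"
      using theta(2)[OF tz] t(2)[OF j] g\<psi> HR.fbasis_closed by simp
    finally have "g0 ((), t j) \<in> boundaries M"
      using M.M.cls_zero_iff M.M.cyclesD(1)[OF dg_hom_cycles[OF P'.dgm_axioms M g0 tz]]
      by (simp add: M.coh_simps M.M.cls_zero)
    moreover have "((), t j) \<in> gr P (ds1 ! j)" using t[OF j] vcyc_fsupp by (auto simp: P_simps)
    then have "g0 ((), t j) \<in> gr M (ds1 ! j)" by (rule dg_hom_gr[OF g0])
    ultimately show ?thesis using M.M.boundary_homogeneous by metis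
  qed
  then obtain n where n: "\<And>j. j < n1 \<Longrightarrow> n j \<in> gr M (ds1 ! j - 1) \<and> diff M (n j) = g0 ((), t j)" by metis
  define G where "G x = g0 (fst x) \<oplus>\<^bsub>M\<^esub> wsum A M n (snd x)" for x
  have G: "dg_hom A C M G"
    unfolding G_def[abs_def] by (rule C.attach_lift[OF M g0]) (use n in auto)
  have "hmap M G (\<kappa> \<xi>) = g (\<theta> \<xi>)" if x: "\<xi> \<in> carrier (cohomology_module P)" for \<xi>
  proof -
    obtain p where p: "p \<in> cycles P" "\<xi> = cls P p" using x by (auto simp: P'.coh_simps)
    have pC: "(p, \<lambda>j. \<zero>) \<in> cycles C" using dg_hom_cycles[OF P'.dgm_axioms C'.dgm_axioms C.attach_incl p(1)] .
    have "hmap M G (\<kappa> \<xi>) = cls M (G (p, \<lambda>j. \<zero>))"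
      using kappa(2)[OF p(1)] p(2) hmap_cls[OF C'.dgm_axioms M G pC] by simp
    also have "G (p, \<lambda>j. \<zero>) = g0 p"
      using M.M.cyclesD(1)[OF dg_hom_cycles[OF P'.dgm_axioms M g0 p(1)]] by (simp add: G_def M.M.wsum_zero)
    also have "cls M (g0 p) = hmap M g0 \<xi>" using hmap_cls[OF P'.dgm_axioms M g0 p(1)] p(2) by simp
    finally show ?thesis using h0[OF x] by simp
  qed
  then show ?thesis using G by blast
qed

end

section \<open>From local to global realisability\<close>

lemma realisable_of_local:
  fixes A :: "('k, 'a) dg" and X :: "('a set, 'x) graded"
  assumes A: "dg_ring A" and gc: "graded_commutative (cohomology_ring A)"
    and coh: "coherent (cohomology_ring A)" and fp: "finitely_presented (cohomology_ring A) X"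
    and inf: "infinite (UNIV :: 'm set)" and small: "carrier A \<lesssim> (UNIV :: 'm set)"
    and local: "\<And>m. graded_maximal (cohomology_ring A) m \<Longrightarrow>
      realisable TYPE('m) A (localisation (cohomology_ring A) m X)"
  shows "realisable TYPE('m) A X"
proof -
  interpret A: dg_ring A by (rule A)
  let ?R = "cohomology_ring A"
  have R: "graded_ring ?R" by (rule A.coh_graded_ring)
  interpret R: graded_ring ?R by (rule R)
  have X: "graded_module ?R X" using fp by (simp add: finitely_presented_def)
  interpret X: graded_module ?R X by (rule X)
  obtain ds0 \<phi> where phi: "\<phi> \<in> graded_hom ?R (free_graded ?R ds0) X"
    and phi_surj: "\<phi> ` carrier (free_graded ?R ds0) = carrier X"
    and fg0: "fin_gen ?R (free_graded ?R ds0) {f \<in> carrier (free_graded ?R ds0). \<phi> f = \<zero>\<^bsub>X\<^esub>}"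
    using fp by (auto simp: finitely_presented_def)
  note Fm = R.free_graded_module
  \<comment> \<open>The finitely generated kernel of \<open>\<phi>\<close> is finitely presented by
    coherence, so it is covered by a free module \<open>F1\<close> with finitely generated kernel.
    The same is then done for the kernel of \<open>\<psi>\<close>.\<close>
  obtain ds1 \<psi> where psi: "\<psi> \<in> graded_hom ?R (free_graded ?R ds1) (free_graded ?R ds0)"
    and psi_im: "\<psi> ` carrier (free_graded ?R ds1) = {f \<in> carrier (free_graded ?R ds0). \<phi> f = \<zero>\<^bsub>X\<^esub>}"
    and fg1: "fin_gen ?R (free_graded ?R ds1) {f \<in> carrier (free_graded ?R ds1). \<psi> f = \<zero>\<^bsub>free_graded ?R ds0\<^esub>}"
    using coherent_free[OF R coh kernel_graded_submodule[OF Fm X phi] fg0] by blast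
  obtain ds2 \<psi>2 where psi2: "\<psi>2 \<in> graded_hom ?R (free_graded ?R ds2) (free_graded ?R ds1)"
    and psi2_im: "\<psi>2 ` carrier (free_graded ?R ds2) =
      {f \<in> carrier (free_graded ?R ds1). \<psi> f = \<zero>\<^bsub>free_graded ?R ds0\<^esub>}"
    and fg2: "fin_gen ?R (free_graded ?R ds2) {f \<in> carrier (free_graded ?R ds2). \<psi>2 f = \<zero>\<^bsub>free_graded ?R ds1\<^esub>}"
    using coherent_free[OF R coh kernel_graded_submodule[OF Fm Fm psi] fg1] by blast
  interpret K: cone A ds0 ds1 \<psi> by unfold_locales (rule psi)
  let ?F0 = "free_graded ?R ds0" and ?F1 = "free_graded ?R ds1" and ?F2 = "free_graded ?R ds2"
  let ?HP = "cohomology_module K.P" and ?HC = "cohomology_module K.C"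
  have HC: "graded_module ?R ?HC" by (rule K.C'.coh_graded_module)
  have HP: "graded_module ?R ?HP" by (rule K.P'.coh_graded_module)
  interpret HC: graded_module ?R ?HC by (rule HC)
  interpret HP: graded_module ?R ?HP by (rule HP)
  interpret F1: graded_module ?R ?F1 by (rule Fm)
  define \<epsilon> where "\<epsilon> \<xi> = \<phi> (K.\<theta> \<xi>)" for \<xi>
  have eps: "\<epsilon> \<in> graded_hom ?R ?HP X" unfolding \<epsilon>_def by (rule graded_hom_comp[OF K.theta_graded phi])
  note epsh = graded_hom_mod_hom[OF eps] and kh = graded_hom_mod_hom[OF K.kappa(1)]
  have eps_surj: "\<exists>\<xi>\<in>carrier ?HP. \<epsilon> \<xi> = x" if "x \<in> carrier X" for x
  proof -
    have "x \<in> \<phi> ` carrier ?F0" unfolding phi_surj by (rule that)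
    then show ?thesis using K.theta_surj by (auto simp: \<epsilon>_def)
  qed
  have ker: "K.\<kappa> \<xi> = \<zero>\<^bsub>?HC\<^esub> \<longleftrightarrow> \<epsilon> \<xi> = \<zero>\<^bsub>X\<^esub>" if "\<xi> \<in> carrier ?HP" for \<xi>
    unfolding K.kappa_zero_iff[OF that] psi_im \<epsilon>_def using mod_hom_closed[OF K.theta(1) that] by simp
  have eq_iff: "K.\<kappa> \<xi> = K.\<kappa> \<zeta> \<longleftrightarrow> \<epsilon> \<xi> = \<epsilon> \<zeta>" if "\<xi> \<in> carrier ?HP" "\<zeta> \<in> carrier ?HP" for \<xi> \<zeta>
    using ker[of "\<xi> \<ominus>\<^bsub>?HP\<^esub> \<zeta>"] that mod_hom_closed[OF kh] mod_hom_closed[OF epsh]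
    by (simp add: mod_hom_minus[OF kh HP HC] mod_hom_minus[OF epsh HP X] HC.M.minus_eq_zero_iff X.M.minus_eq_zero_iff)
  \<comment> \<open>\<open>\<epsilon>\<close> is surjective and has the same kernel as
    \<open>K.\<kappa>\<close>, because the image of \<open>\<psi>\<close> is the kernel of
    \<open>\<phi>\<close>. So \<open>K.\<kappa>\<close> factors through \<open>X\<close> by an
    injective map.\<close>
  define \<iota> where "\<iota> x = K.\<kappa> (SOME \<xi>. \<xi> \<in> carrier ?HP \<and> \<epsilon> \<xi> = x)" for x
  have iota: "\<iota> (\<epsilon> \<xi>) = K.\<kappa> \<xi>" if x: "\<xi> \<in> carrier ?HP" for \<xi>
  proof -
    have "(SOME \<zeta>. \<zeta> \<in> carrier ?HP \<and> \<epsilon> \<zeta> = \<epsilon> \<xi>) \<in> carrier ?HP \<and>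
        \<epsilon> (SOME \<zeta>. \<zeta> \<in> carrier ?HP \<and> \<epsilon> \<zeta> = \<epsilon> \<xi>) = \<epsilon> \<xi>"
      by (rule someI[of _ \<xi>]) (use x in simp)
    then show ?thesis unfolding \<iota>_def using eq_iff x by blast
  qed
  have iota_hom: "\<iota> \<in> graded_hom ?R X ?HC"
    unfolding graded_hom_iff
  proof (intro conjI allI ballI)
    show "mod_hom ?R X ?HC \<iota>"
    proof (rule mod_homI)
      fix x assume "x \<in> carrier X"
      then obtain \<xi> where x: "\<xi> \<in> carrier ?HP" "x = \<epsilon> \<xi>" using eps_surj by blast
      show "\<iota> x \<in> carrier ?HC" using x iota mod_hom_closed[OF kh] by simp
      show "\<iota> (x \<oplus>\<^bsub>X\<^esub> y) = \<iota> x \<oplus>\<^bsub>?HC\<^esub> \<iota> y" if yc: "y \<in> carrier X" for y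
      proof -
        obtain \<zeta> where y: "\<zeta> \<in> carrier ?HP" "y = \<epsilon> \<zeta>" using eps_surj[OF yc] by blast
        then show ?thesis
          using x iota[of "\<xi> \<oplus>\<^bsub>?HP\<^esub> \<zeta>"] by (simp add: iota mod_hom_add[OF epsh] mod_hom_add[OF kh])
      qed
      show "\<iota> (x \<cdot>\<^bsub>X\<^esub> r) = \<iota> x \<cdot>\<^bsub>?HC\<^esub> r" if "r \<in> carrier ?R" for r
        using x that iota[of "\<xi> \<cdot>\<^bsub>?HP\<^esub> r"] HP.ract_closed
        by (simp add: iota mod_hom_ract[OF epsh] mod_hom_ract[OF kh])
    qed
    fix k x assume x: "x \<in> gr X k"
    then obtain \<xi> where xi: "\<xi> \<in> carrier ?HP" "\<epsilon> \<xi> = x" using eps_surj X.M.gr_carrier by blast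
    have "\<epsilon> (gcomp ?HP \<xi> k) = x"
      using gcomp_graded_hom[OF HP X eps xi(1), of k] xi(2) X.M.gcomp_homogeneous[OF x, of k] by simp
    then have "\<iota> x = K.\<kappa> (gcomp ?HP \<xi> k)" using iota[OF HP.M.gcomp_closed[OF xi(1)], of k] by simp
    then show "\<iota> x \<in> gr ?HC k" using graded_hom_gr[OF K.kappa(1) HP.M.gcomp_props(1)[OF xi(1)]] by simp
  qed
  have iota_inj: "inj_on \<iota> (carrier X)"
  proof (rule inj_onI)
    fix x y assume "x \<in> carrier X" "y \<in> carrier X" and e: "\<iota> x = \<iota> y"
    then obtain \<xi> \<zeta> where "\<xi> \<in> carrier ?HP" "x = \<epsilon> \<xi>" "\<zeta> \<in> carrier ?HP" "y = \<epsilon> \<zeta>" using eps_surj by metis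
    then show "x = y" using e iota eq_iff by simp
  qed
  have iota_im: "\<iota> ` carrier X = K.\<kappa> ` carrier ?HP"
  proof
    show "\<iota> ` carrier X \<subseteq> K.\<kappa> ` carrier ?HP"
    proof (rule image_subsetI)
      fix x assume "x \<in> carrier X"
      then obtain \<xi> where "\<xi> \<in> carrier ?HP" "x = \<epsilon> \<xi>" using eps_surj by blast
      then show "\<iota> x \<in> K.\<kappa> ` carrier ?HP" using iota by simp
    qed
    show "K.\<kappa> ` carrier ?HP \<subseteq> \<iota> ` carrier X"
      using iota[symmetric] mod_hom_closed[OF epsh] by blast
  qed
  have ker_del: "K.\<beta> \<eta> = \<zero>\<^bsub>?F1\<^esub> \<longleftrightarrow> \<eta> \<in> \<iota> ` carrier X" if "\<eta> \<in> carrier ?HC" for \<eta>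
    unfolding iota_im by (rule K.del_zero_iff[OF that])
  \<comment> \<open>The images of the basis of \<open>F2\<close> generate the kernel of
    \<open>\<psi>\<close>, which is the image of \<open>K.\<beta>\<close>. Lifting them along
    \<open>K.\<beta>\<close> yields finitely many generators of the cohomology of \<open>C\<close>
    modulo \<open>X\<close>.\<close>
  have "\<exists>\<eta>\<in>carrier ?HC. K.\<beta> \<eta> = \<psi>2 (fbasis ?R ds2 l)" if "l < length ds2" for l
  proof -
    have "\<psi>2 (fbasis ?R ds2 l) \<in> K.\<beta> ` carrier ?HC"
      unfolding K.del_image psi2_im[symmetric] by (rule imageI[OF R.fbasis_closed])
    then show ?thesis by force
  qed
  then obtain y where y: "\<And>l. l < length ds2 \<Longrightarrow> y l \<in> carrier ?HC \<and> K.\<beta> (y l) = \<psi>2 (fbasis ?R ds2 l)"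
    by metis
  define \<gamma> where "\<gamma> = free_lift ds2 ?HC y"
  have gam: "mod_hom ?R ?F2 ?HC \<gamma>" and gamb: "\<And>l. l < length ds2 \<Longrightarrow> \<gamma> (fbasis ?R ds2 l) = y l"
    unfolding \<gamma>_def using free_lift_hom[OF HC] y by blast+
  have del_gam: "K.\<beta> (\<gamma> r) = \<psi>2 r" if "r \<in> carrier ?F2" for r
    by (rule free_hom_eqI[OF Fm mod_hom_comp[OF gam K.del(1)] graded_hom_mod_hom[OF psi2] _ that])
      (simp add: gamb y)
  have gen: "\<exists>x\<in>carrier X. \<exists>r\<in>carrier ?F2. \<eta> = \<iota> x \<oplus>\<^bsub>?HC\<^esub> \<gamma> r" if h: "\<eta> \<in> carrier ?HC" for \<eta>
  proof -
    have "K.\<beta> \<eta> \<in> \<psi>2 ` carrier ?F2" unfolding psi2_im K.del_image[symmetric] by (rule imageI[OF h])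
    then obtain r where r: "r \<in> carrier ?F2" "K.\<beta> \<eta> = \<psi>2 r" by blast
    have gr: "\<gamma> r \<in> carrier ?HC" by (rule mod_hom_closed[OF gam r(1)])
    have "K.\<beta> (\<eta> \<ominus>\<^bsub>?HC\<^esub> \<gamma> r) = \<zero>\<^bsub>?F1\<^esub>"
      using r del_gam[OF r(1)] mod_hom_closed[OF K.del(1) gr]
      by (simp add: mod_hom_minus[OF K.del(1) HC Fm h gr] F1.M.minus_eq_zero_iff)
    then obtain x where x: "x \<in> carrier X" "\<eta> \<ominus>\<^bsub>?HC\<^esub> \<gamma> r = \<iota> x" using ker_del h gr by blast
    then have "\<eta> = \<iota> x \<oplus>\<^bsub>?HC\<^esub> \<gamma> r" using HC.M.minus_add_cancel(1)[OF h gr] by simp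
    then show ?thesis using x r by blast
  qed
  \<comment> \<open>The relations among these generators modulo \<open>X\<close> form the kernel of
    \<open>F2 -> F1\<close>, which the second use of coherence made finitely generated.\<close>
  have "{r \<in> carrier ?F2. \<gamma> r \<in> \<iota> ` carrier X} = {f \<in> carrier ?F2. \<psi>2 f = \<zero>\<^bsub>?F1\<^esub>}"
  proof (rule Collect_cong, rule conj_cong[OF refl])
    fix r assume r: "r \<in> carrier ?F2"
    show "\<gamma> r \<in> \<iota> ` carrier X \<longleftrightarrow> \<psi>2 r = \<zero>\<^bsub>?F1\<^esub>"
      using ker_del[OF mod_hom_closed[OF gam r]] del_gam[OF r] by simp
  qed
  then have fg: "fin_gen ?R ?F2 {r \<in> carrier ?F2. \<gamma> r \<in> \<iota> ` carrier X}" using fg2 by simp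
  have loc: "\<exists>\<rho>. mod_hom ?R ?HC (localisation ?R m X) \<rho> \<and>
      (\<forall>x\<in>carrier X. \<rho> (\<iota> x) = fraction X (even_denoms ?R m) x \<one>\<^bsub>?R\<^esub>)"
    if m: "graded_maximal ?R m" for m
  proof -
    interpret L: localised ?R m X
      by (rule prime_localised[OF R gc R.graded_maximal_prime[OF gc m] X])
    obtain M :: "('a, 'm) dg" and i q where M: "dgm A M"
      and i: "i \<in> graded_hom ?R L.L (cohomology_module M)"
      and q: "mod_hom ?R (cohomology_module M) L.L q" and qi: "\<forall>x\<in>carrier L.L. q (i x) = x"
      using realisableD[OF A local[OF m] L.loc_add_closed L.loc_act_closed] by blast
    interpret M: dgm A M by (rule M)
    define g where "g r = i (fraction X (even_denoms ?R m) (\<phi> r) \<one>\<^bsub>?R\<^esub>)" for r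
    have g: "g \<in> graded_hom ?R ?F0 (cohomology_module M)"
      unfolding g_def by (rule graded_hom_comp[OF graded_hom_comp[OF phi L.loc_map] i])
    have g\<psi>: "g (\<psi> r) = \<zero>\<^bsub>cohomology_module M\<^esub>" if r: "r \<in> carrier ?F1" for r
    proof -
      have "\<psi> r \<in> {f \<in> carrier ?F0. \<phi> f = \<zero>\<^bsub>X\<^esub>}" unfolding psi_im[symmetric] by (rule imageI[OF r])
      then have "\<phi> (\<psi> r) = \<phi> \<zero>\<^bsub>?F0\<^esub>" using mod_hom_zero[OF graded_hom_mod_hom[OF phi] Fm X] by simp
      then have "g (\<psi> r) = g \<zero>\<^bsub>?F0\<^esub>" by (simp add: g_def)
      then show ?thesis using mod_hom_zero[OF graded_hom_mod_hom[OF g] Fm M.coh_graded_module] by simp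
    qed
    obtain G where G: "dg_hom A K.C M G" "\<forall>\<xi>\<in>carrier ?HP. hmap M G (K.\<kappa> \<xi>) = g (K.\<theta> \<xi>)"
      using K.cone_extend[OF M g g\<psi>] by blast
    have "mod_hom ?R ?HC L.L (\<lambda>\<eta>. q (hmap M G \<eta>))"
      by (rule mod_hom_comp[OF graded_hom_mod_hom[OF hmap_graded_hom[OF K.C'.dgm_axioms M G(1)]] q])
    moreover have "q (hmap M G (\<iota> x)) = fraction X (even_denoms ?R m) x \<one>\<^bsub>?R\<^esub>" if xc: "x \<in> carrier X" for x
    proof -
      obtain \<xi> where x: "\<xi> \<in> carrier ?HP" "\<epsilon> \<xi> = x" using eps_surj[OF xc] by blast
      have "q (hmap M G (\<iota> x)) = q (i (fraction X (even_denoms ?R m) x \<one>\<^bsub>?R\<^esub>))"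
        using G(2) x iota[OF x(1)] by (simp add: g_def \<epsilon>_def)
      then show ?thesis using qi L.loc_frac[OF xc L.S_one] by simp
    qed
    ultimately show ?thesis by blast
  qed
  \<comment> \<open>The retraction is merely linear, since \<open>K.\<beta>\<close> shifts degrees
    and the denominators have various degrees. Its part of degree zero is taken next.\<close>
  obtain \<rho> where "mod_hom ?R ?HC X \<rho>" "\<forall>x\<in>carrier X. \<rho> (\<iota> x) = x"
    using local_global_retraction[OF gc X HC iota_hom iota_inj gam gen fg loc] by blast
  then obtain p where "p \<in> graded_hom ?R ?HC X" "\<forall>x\<in>carrier X. p (\<iota> x) = x"
    using graded_retraction[OF X HC iota_hom] by blast
  then show ?thesis
    using realisableI[OF K.C'.dgm_axioms K.C_lepoll[OF inf small] iota_hom, of p] X.M.gr_sub by blast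
qed

theorem theorem1p1:
  fixes K :: "('k, 'y) ring_scheme"
    and A :: "('k, 'a) dg"
    and X :: "('a set, 'x) graded"
  assumes "dg_algebra K A"
    and "graded_commutative (cohomology_ring A)"
    and "coherent (cohomology_ring A)"
    and "finitely_presented (cohomology_ring A) X"
    and "infinite (UNIV :: 'm set)"
    and "carrier A \<lesssim> (UNIV :: 'm set)"
  shows "(realisable TYPE('m) A X \<longleftrightarrow>
           (\<forall>p. graded_prime (cohomology_ring A) p \<longrightarrow>
             realisable TYPE('m) A (localisation (cohomology_ring A) p X))) \<and>
         (realisable TYPE('m) A X \<longleftrightarrow>
           (\<forall>m. graded_maximal (cohomology_ring A) m \<longrightarrow>
             realisable TYPE('m) A (localisation (cohomology_ring A) m X)))"
proof -
  let ?R = "cohomology_ring A"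
  have A: "dg_ring A" by (rule dg_algebra_ring[OF assms(1)])
  interpret A: dg_ring A by (rule A)
  have R: "graded_ring ?R" by (rule A.coh_graded_ring)
  have X: "graded_module ?R X" using assms(4) by (simp add: finitely_presented_def)
  have prime: "graded_prime ?R m" if "graded_maximal ?R m" for m
    by (rule graded_ring.graded_maximal_prime[OF R assms(2) that])
  have 1: "realisable TYPE('m) A (localisation ?R p X)" if "realisable TYPE('m) A X" "graded_prime ?R p" for p
    by (rule realisable_localisation[OF A X prime_localised[OF R assms(2) that(2) X] assms(5,6) that(1)])
  have 2: "realisable TYPE('m) A X"
    if "\<forall>m. graded_maximal ?R m \<longrightarrow> realisable TYPE('m) A (localisation ?R m X)"
    using realisable_of_local[OF A assms(2-6)] that by blast
  \<comment> \<open>Fact \<open>1\<close> leads from (1) to (2), primeness of graded maximal ideals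
    from (2) to (3), and fact \<open>2\<close> from (3) back to (1).\<close>
  show ?thesis using 1 2 prime by blast
qed

end
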